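(* Let $\mathbb{G}=[G_1\rightrightarrows G_0]$ be a Lie 2-group and $\pi:\mathbb{E}\to\mathbb{X}$ a principal $\mathbb{G}$-bundle over a Lie groupoid $\mathbb{X}$. Then the gauge 2-group $\mathcal{G}(\mathbb{E})$ acts on the category $\Omega^{\mathrm{semi}}_{\mathbb{E}}$ of semi-strict connection 1-forms by $$(F,\omega)\mapsto\omega\circ F_*^{-1}:T\mathbb{E}\to L(\mathbb{G}),$$ $$(\Psi:F\Rightarrow F',\ \zeta:\omega\Rightarrow\omega')\mapsto\zeta\circ_H\Psi_*^{-1}:\ \omega\circ F_*^{-1}\Rightarrow\omega'\circ F_*'^{-1},$$ where $\circ_H$ denotes horizontal composition of natural transformations. Moreover, the action restricts to $\Omega^{\mathrm{strict}}_{\mathbb{E}}\subset\Omega^{\mathrm{semi}}_{\mathbb{E}}$.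
   Context: **Basics.** A Lie groupoid has submersive source/target and smooth structure maps. A Lie 2-group is a Lie groupoid $\mathbb{G}=[G_1\rightrightarrows G_0]$ with Lie group structures on $G_1,G_0$ whose multiplication is a smooth functor. A principal $\mathbb{G}$-bundle over $\mathbb{X}=[X_1\rightrightarrows X_0]$ is a morphism of Lie groupoids $\pi:\mathbb{E}=[E_1\rightrightarrows E_0]\to\mathbb{X}$ with a right action of $\mathbb{G}$ (a smooth functor $\mathbb{E}\times\mathbb{G}\to\mathbb{E}$, Lie group action on objects and on morphisms) such that $\pi_i:E_i\to X_i$ is a principal $G_i$-bundle, $i=0,1$. **Gauge 2-group $\mathcal{G}(\mathbb{E})$.** The strict 2-group (group object in categories) whose objects are $\mathbb{G}$-equivariant isomorphisms of Lie groupoids $F:\mathbb{E}\to\mathbb{E}$ with $\pi\circ F=\pi$, and whose morphisms $\Psi:F\Rightarrow F'$ are smooth natural isomorphisms with $\Psi(pg)=\Psi(p)1_g$ and $\pi_1(\Psi(p))=1_{\pi_0(p)}$ for $p\in E_0$, $g\in G_0$. The product of $F$ and $F'$ is $F'\circ F$ and on morphisms it is horizontal composition $\Psi'\circ_H\Psi$ (so acting first by $F$ and then by $F'$ is acting by $F'\circ F$). $F_*:T\mathbb{E}\to T\mathbb{E}$ is the functor given by the differentials of $F_0,F_1$; $\Psi_*:F_*\Rightarrow F'_*$ is the natural isomorphism given by the differential of $\Psi:E_0\to E_1$; $\Psi_*^{-1}:F_*^{-1}\Rightarrow F_*'^{-1}$ is its inverse for horizontal composition. **Connection 1-forms.** $T\mathbb{E}=[TE_1\rightrightarrows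 TE_0]$ and $L(\mathbb{G})=[L(G_1)\rightrightarrows L(G_0)]$ have structure maps obtained by differentiation. $\delta:\mathbb{E}\times L(\mathbb{G})\to T\mathbb{E}$, $(x,A)\mapsto\delta_x(A)$, is the fundamental vector field functor ($\delta_x$ the differential of $g\mapsto xg$ at the identity). A $\mathbb{G}$-equivariant $L(\mathbb{G})$-valued 1-form is a smooth functor $\omega=(\omega_1,\omega_0):T\mathbb{E}\to L(\mathbb{G})$ with $\omega_i$ an $L(G_i)$-valued 1-form and $\omega_i(v\cdot g)=\mathrm{ad}_{g^{-1}}\omega_i(v)$. It is a strict connection 1-form if $\omega\circ\delta=\mathrm{pr}_2$; semi-strict if there is a smooth fibrewise linear natural isomorphism $\kappa:\omega\circ\delta\Rightarrow\mathrm{pr}_2$ with $\kappa(pg,\mathrm{ad}_{g^{-1}}B)=\mathrm{ad}_{1_g^{-1}}\kappa(p,B)$. $\Omega^{\mathrm{strict}}_{\mathbb{E}}$, $\Omega^{\mathrm{semi}}_{\mathbb{E}}$ have these as objects and, as morphisms $\eta:\omega\Rightarrow\omega'$, smooth natural isomorphisms with $\eta:TE_0\to L(G_1)$ fibrewise linear (a 1-form) and $\eta((p,v)\cdot g)=\mathrm{ad}_{1_g^{-1}}\eta(p,v)$ for $(p,v)\in TE_0$, $g\in G_0$. *)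

theory Defs
  imports "HOL-Analysis.Analysis" "HOL-Algebra.Group"
begin

section \<open>Categories, functors and natural transformations\<close>

record ('o, 'm) cat =
  Ob :: "'o set"
  Mor :: "'m set"
  Src :: "'m \<Rightarrow> 'o"
  Tgt :: "'m \<Rightarrow> 'o"
  Idt :: "'o \<Rightarrow> 'm"
  Cmp :: "'m \<Rightarrow> 'm \<Rightarrow> 'm"  \<comment> \<open>\<open>Cmp C g f\<close> is \<open>g\<close> after \<open>f\<close>, meaningful if \<open>Src C g = Tgt C f\<close>\<close>

definition category :: "('o, 'm, 'z) cat_scheme \<Rightarrow> bool" where
  "category C \<longleftrightarrow>
     Src C \<in> Mor C \<rightarrow> Ob C \<and> Tgt C \<in> Mor C \<rightarrow> Ob C \<and> Idt C \<in> Ob C \<rightarrow> Mor C \<and>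
     (\<forall>x\<in>Ob C. Src C (Idt C x) = x \<and> Tgt C (Idt C x) = x) \<and>
     (\<forall>f\<in>Mor C. \<forall>g\<in>Mor C. Src C g = Tgt C f \<longrightarrow>
        Cmp C g f \<in> Mor C \<and> Src C (Cmp C g f) = Src C f \<and> Tgt C (Cmp C g f) = Tgt C g) \<and>
     (\<forall>f\<in>Mor C. Cmp C f (Idt C (Src C f)) = f \<and> Cmp C (Idt C (Tgt C f)) f = f) \<and>
     (\<forall>f\<in>Mor C. \<forall>g\<in>Mor C. \<forall>h\<in>Mor C. Src C g = Tgt C f \<longrightarrow> Src C h = Tgt C g \<longrightarrow>
        Cmp C h (Cmp C g f) = Cmp C (Cmp C h g) f)"

definition composable :: "('o, 'm, 'z) cat_scheme \<Rightarrow> ('m \<times> 'm) set" where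
  "composable C = {(g, f). g \<in> Mor C \<and> f \<in> Mor C \<and> Src C g = Tgt C f}"

definition inverse_mor :: "('o, 'm, 'z) cat_scheme \<Rightarrow> 'm \<Rightarrow> 'm \<Rightarrow> bool" where
  "inverse_mor C f g \<longleftrightarrow> f \<in> Mor C \<and> g \<in> Mor C \<and> Src C g = Tgt C f \<and> Tgt C g = Src C f \<and>
     Cmp C g f = Idt C (Src C f) \<and> Cmp C f g = Idt C (Tgt C f)"

definition iso_mor :: "('o, 'm, 'z) cat_scheme \<Rightarrow> 'm \<Rightarrow> bool" where
  "iso_mor C f \<longleftrightarrow> (\<exists>g. inverse_mor C f g)"

definition mor_inv :: "('o, 'm, 'z) cat_scheme \<Rightarrow> 'm \<Rightarrow> 'm" where
  "mor_inv C f = (THE g. inverse_mor C f g)"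

definition groupoid :: "('o, 'm, 'z) cat_scheme \<Rightarrow> bool" where
  "groupoid C \<longleftrightarrow> category C \<and> (\<forall>f\<in>Mor C. iso_mor C f)"

definition subcategory :: "('o, 'm, 'y) cat_scheme \<Rightarrow> ('o, 'm, 'z) cat_scheme \<Rightarrow> bool" where
  "subcategory D C \<longleftrightarrow> category D \<and> category C \<and> Ob D \<subseteq> Ob C \<and> Mor D \<subseteq> Mor C \<and>
     (\<forall>f\<in>Mor D. Src D f = Src C f \<and> Tgt D f = Tgt C f) \<and>
     (\<forall>x\<in>Ob D. Idt D x = Idt C x) \<and>
     (\<forall>(g, f)\<in>composable D. Cmp D g f = Cmp C g f)"

definition prod_cat ::
  "('o, 'm, 'y) cat_scheme \<Rightarrow> ('p, 'n, 'z) cat_scheme \<Rightarrow> ('o \<times> 'p, 'm \<times> 'n) cat" where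
  "prod_cat C D = \<lparr>Ob = Ob C \<times> Ob D, Mor = Mor C \<times> Mor D,
     Src = map_prod (Src C) (Src D), Tgt = map_prod (Tgt C) (Tgt D),
     Idt = map_prod (Idt C) (Idt D),
     Cmp = (\<lambda>(g, g') (f, f'). (Cmp C g f, Cmp D g' f'))\<rparr>"

type_synonym ('o, 'm, 'p, 'n) ftr = "('o \<Rightarrow> 'p) \<times> ('m \<Rightarrow> 'n)"

definition is_functor ::
  "('o, 'm, 'y) cat_scheme \<Rightarrow> ('p, 'n, 'z) cat_scheme \<Rightarrow> ('o, 'm, 'p, 'n) ftr \<Rightarrow> bool" where
  "is_functor C D F \<longleftrightarrow>
     fst F \<in> Ob C \<rightarrow> Ob D \<and> snd F \<in> Mor C \<rightarrow> Mor D \<and>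
     (\<forall>f\<in>Mor C. Src D (snd F f) = fst F (Src C f) \<and> Tgt D (snd F f) = fst F (Tgt C f)) \<and>
     (\<forall>x\<in>Ob C. snd F (Idt C x) = Idt D (fst F x)) \<and>
     (\<forall>(g, f)\<in>composable C. snd F (Cmp C g f) = Cmp D (snd F g) (snd F f))"

text \<open>Functors that occur as objects of a category, and the components of natural
  transformations, are required to be \<^const>\<open>undefined\<close> off their domain, so that
  equality of functions is equality on the domain.\<close>

definition functor_ext :: "('o, 'm, 'y) cat_scheme \<Rightarrow> ('o, 'm, 'p, 'n) ftr \<Rightarrow> bool" where
  "functor_ext C F \<longleftrightarrow> fst F \<in> extensional (Ob C) \<and> snd F \<in> extensional (Mor C)"

definition fid :: "('o, 'm, 'y) cat_scheme \<Rightarrow> ('o, 'm, 'o, 'm) ftr" where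
  "fid C = (restrict id (Ob C), restrict id (Mor C))"

definition fcomp_on ::
  "('o, 'm, 'y) cat_scheme \<Rightarrow> ('p, 'n, 'q, 'r) ftr \<Rightarrow> ('o, 'm, 'p, 'n) ftr \<Rightarrow> ('o, 'm, 'q, 'r) ftr" where
  "fcomp_on C H F = (restrict (fst H \<circ> fst F) (Ob C), restrict (snd H \<circ> snd F) (Mor C))"

definition finv_on ::
  "('o, 'm, 'y) cat_scheme \<Rightarrow> ('p, 'n, 'z) cat_scheme \<Rightarrow> ('o, 'm, 'p, 'n) ftr \<Rightarrow> ('p, 'n, 'o, 'm) ftr" where
  "finv_on C D F = (restrict (inv_into (Ob C) (fst F)) (Ob D), restrict (inv_into (Mor C) (snd F)) (Mor D))"

definition nat_trans :: "('o, 'm, 'y) cat_scheme \<Rightarrow> ('p, 'n, 'z) cat_scheme \<Rightarrow>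
    ('o, 'm, 'p, 'n) ftr \<Rightarrow> ('o, 'm, 'p, 'n) ftr \<Rightarrow> ('o \<Rightarrow> 'n) \<Rightarrow> bool" where
  "nat_trans C D F F' \<eta> \<longleftrightarrow> is_functor C D F \<and> is_functor C D F' \<and>
     (\<forall>x\<in>Ob C. \<eta> x \<in> Mor D \<and> Src D (\<eta> x) = fst F x \<and> Tgt D (\<eta> x) = fst F' x) \<and>
     (\<forall>f\<in>Mor C. Cmp D (\<eta> (Tgt C f)) (snd F f) = Cmp D (snd F' f) (\<eta> (Src C f)))"

definition nat_iso :: "('o, 'm, 'y) cat_scheme \<Rightarrow> ('p, 'n, 'z) cat_scheme \<Rightarrow>
    ('o, 'm, 'p, 'n) ftr \<Rightarrow> ('o, 'm, 'p, 'n) ftr \<Rightarrow> ('o \<Rightarrow> 'n) \<Rightarrow> bool" where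
  "nat_iso C D F F' \<eta> \<longleftrightarrow> nat_trans C D F F' \<eta> \<and> (\<forall>x\<in>Ob C. iso_mor D (\<eta> x))"

text \<open>A natural transformation bundled with its source and target functor.\<close>

type_synonym ('o, 'm, 'p, 'n) ntr = "('o, 'm, 'p, 'n) ftr \<times> ('o \<Rightarrow> 'n) \<times> ('o, 'm, 'p, 'n) ftr"

abbreviation (input) ntr_src :: "('o, 'm, 'p, 'n) ntr \<Rightarrow> ('o, 'm, 'p, 'n) ftr" where
  "ntr_src t \<equiv> fst t"
abbreviation (input) ntr_map :: "('o, 'm, 'p, 'n) ntr \<Rightarrow> 'o \<Rightarrow> 'n" where
  "ntr_map t \<equiv> fst (snd t)"
abbreviation (input) ntr_tgt :: "('o, 'm, 'p, 'n) ntr \<Rightarrow> ('o, 'm, 'p, 'n) ftr" where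
  "ntr_tgt t \<equiv> snd (snd t)"

definition ntr_id :: "('o, 'm, 'y) cat_scheme \<Rightarrow> ('p, 'n, 'z) cat_scheme \<Rightarrow>
    ('o, 'm, 'p, 'n) ftr \<Rightarrow> ('o, 'm, 'p, 'n) ntr" where
  "ntr_id C D F = (F, restrict (\<lambda>x. Idt D (fst F x)) (Ob C), F)"

definition vcomp :: "('o, 'm, 'y) cat_scheme \<Rightarrow> ('p, 'n, 'z) cat_scheme \<Rightarrow>
    ('o, 'm, 'p, 'n) ntr \<Rightarrow> ('o, 'm, 'p, 'n) ntr \<Rightarrow> ('o, 'm, 'p, 'n) ntr" where
  "vcomp C D t s = (ntr_src s, restrict (\<lambda>x. Cmp D (ntr_map t x) (ntr_map s x)) (Ob C), ntr_tgt t)"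

text \<open>\<open>hcomp C D \<theta> \<eta>\<close> is \<open>\<theta> \<circ>\<^sub>H \<eta> : H \<circ> F \<Rightarrow> H' \<circ> F'\<close> for \<open>\<eta> : F \<Rightarrow> F' : C \<rightarrow> B\<close> and
  \<open>\<theta> : H \<Rightarrow> H' : B \<rightarrow> D\<close>.\<close>

definition hcomp :: "('o, 'm, 'y) cat_scheme \<Rightarrow> ('q, 'r, 'z) cat_scheme \<Rightarrow>
    ('p, 'n, 'q, 'r) ntr \<Rightarrow> ('o, 'm, 'p, 'n) ntr \<Rightarrow> ('o, 'm, 'q, 'r) ntr" where
  "hcomp C D t s =
     (fcomp_on C (ntr_src t) (ntr_src s),
      restrict (\<lambda>x. Cmp D (ntr_map t (fst (ntr_tgt s) x)) (snd (ntr_src t) (ntr_map s x))) (Ob C),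
      fcomp_on C (ntr_tgt t) (ntr_tgt s))"

text \<open>Inverse for horizontal composition of \<open>\<eta> : F \<Rightarrow> F'\<close> between automorphisms of \<open>C\<close>.\<close>

definition hinv :: "('o, 'm, 'y) cat_scheme \<Rightarrow> ('o, 'm, 'o, 'm) ntr \<Rightarrow> ('o, 'm, 'o, 'm) ntr" where
  "hinv C s = (THE t.
     ntr_src t = finv_on C C (ntr_src s) \<and> ntr_tgt t = finv_on C C (ntr_tgt s) \<and>
     nat_trans C C (ntr_src t) (ntr_tgt t) (ntr_map t) \<and> ntr_map t \<in> extensional (Ob C) \<and>
     hcomp C C t s = ntr_id C C (fid C) \<and> hcomp C C s t = ntr_id C C (fid C))"

text \<open>A strict 2-group is a group object in categories; \<open>H0\<close> and \<open>H1\<close> are the groups of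
  objects and of morphisms.\<close>

definition strict_2group :: "('o, 'm, 'y) cat_scheme \<Rightarrow> 'o monoid \<Rightarrow> 'm monoid \<Rightarrow> bool" where
  "strict_2group C H0 H1 \<longleftrightarrow> category C \<and>
     group H0 \<and> carrier H0 = Ob C \<and> group H1 \<and> carrier H1 = Mor C \<and>
     is_functor (prod_cat C C) C (\<lambda>(x, y). x \<otimes>\<^bsub>H0\<^esub> y, \<lambda>(f, g). f \<otimes>\<^bsub>H1\<^esub> g) \<and>
     is_functor C C (m_inv H0, m_inv H1) \<and>
     \<one>\<^bsub>H1\<^esub> = Idt C \<one>\<^bsub>H0\<^esub>"

text \<open>Strict action of a strict 2-group on the category \<open>D\<close>. Acting first by \<open>F\<close> and then
  by \<open>F'\<close> is acting by the product of \<open>F\<close> and \<open>F'\<close> in this order.\<close>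

definition strict_2group_action :: "('o, 'm, 'y) cat_scheme \<Rightarrow> 'o monoid \<Rightarrow> 'm monoid \<Rightarrow>
    ('p, 'n, 'z) cat_scheme \<Rightarrow> ('o \<times> 'p, 'm \<times> 'n, 'p, 'n) ftr \<Rightarrow> bool" where
  "strict_2group_action C H0 H1 D act \<longleftrightarrow>
     strict_2group C H0 H1 \<and> category D \<and> is_functor (prod_cat C D) D act \<and>
     (\<forall>x\<in>Ob D. fst act (\<one>\<^bsub>H0\<^esub>, x) = x) \<and>
     (\<forall>F\<in>Ob C. \<forall>F'\<in>Ob C. \<forall>x\<in>Ob D.
        fst act (F', fst act (F, x)) = fst act (F \<otimes>\<^bsub>H0\<^esub> F', x)) \<and>
     (\<forall>f\<in>Mor D. snd act (\<one>\<^bsub>H1\<^esub>, f) = f) \<and>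
     (\<forall>\<Psi>\<in>Mor C. \<forall>\<Psi>'\<in>Mor C. \<forall>f\<in>Mor D.
        snd act (\<Psi>', snd act (\<Psi>, f)) = snd act (\<Psi> \<otimes>\<^bsub>H1\<^esub> \<Psi>', f))"


section \<open>Smooth manifolds\<close>

primrec Ck_on :: "nat \<Rightarrow> 'e::real_normed_vector set \<Rightarrow> ('e \<Rightarrow> 'f::real_normed_vector) \<Rightarrow> bool" where
  "Ck_on 0 S f \<longleftrightarrow> continuous_on S f"
| "Ck_on (Suc k) S f \<longleftrightarrow> (\<forall>x\<in>S. f differentiable (at x)) \<and>
     (\<forall>v. Ck_on k S (\<lambda>x. frechet_derivative f (at x) v))"

text \<open>Only used for open \<open>S\<close> in a finite-dimensional space, where it is the usual
  \<open>C\<^sup>\<infinity>\<close> condition in terms of iterated directional derivatives.\<close>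

definition smooth_on :: "'e::real_normed_vector set \<Rightarrow> ('e \<Rightarrow> 'f::real_normed_vector) \<Rightarrow> bool" where
  "smooth_on S f \<longleftrightarrow> (\<forall>k. Ck_on k S f)"

text \<open>A chart is a pair of its domain and its coordinate map. The model space is a
  finite-dimensional inner product space; unlike in class \<^class>\<open>euclidean_space\<close>, dimension
  \<open>0\<close> is included.\<close>

type_synonym ('a, 'e) chart = "'a set \<times> ('a \<Rightarrow> 'e)"

record ('a, 'e) mfd =
  pts :: "'a set"
  atlas :: "('a, 'e) chart set"

definition coord_change :: "('a, 'e) chart \<Rightarrow> ('b, 'f) chart \<Rightarrow> ('a \<Rightarrow> 'b) \<Rightarrow> 'e \<Rightarrow> 'f" where
  "coord_change c d f = snd d \<circ> f \<circ> inv_into (fst c) (snd c)"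

definition mfd_open :: "('a, 'e::real_inner) mfd \<Rightarrow> 'a set \<Rightarrow> bool" where
  "mfd_open M W \<longleftrightarrow> W \<subseteq> pts M \<and> (\<forall>c\<in>atlas M. open (snd c ` (W \<inter> fst c)))"

definition manifold :: "('a, 'e::real_inner) mfd \<Rightarrow> bool" where
  "manifold M \<longleftrightarrow>
     (\<exists>B::'e set. finite B \<and> span B = UNIV) \<and>
     (\<Union>c\<in>atlas M. fst c) = pts M \<and>
     (\<forall>c\<in>atlas M. inj_on (snd c) (fst c) \<and> open (snd c ` fst c)) \<and>
     (\<forall>c\<in>atlas M. \<forall>d\<in>atlas M. open (snd c ` (fst c \<inter> fst d)) \<and>
        smooth_on (snd c ` (fst c \<inter> fst d)) (coord_change c d id)) \<and>
     Hausdorff_space (topology (mfd_open M)) \<and> second_countable (topology (mfd_open M))"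

lemma istopology_mfd_open:
  assumes "manifold M" shows "istopology (mfd_open M)"
  unfolding istopology_def
proof (intro conjI allI impI)
  fix S T assume S: "mfd_open M S" and T: "mfd_open M T"
  have "snd c ` (S \<inter> T \<inter> fst c) = snd c ` (S \<inter> fst c) \<inter> snd c ` (T \<inter> fst c)" if "c \<in> atlas M" for c
  proof -
    have "inj_on (snd c) (fst c)" using assms that by (auto simp: manifold_def)
    then show ?thesis by (auto simp: inj_on_def)
  qed
  with S T show "mfd_open M (S \<inter> T)" by (auto simp: mfd_open_def)
next
  fix K assume K: "\<forall>S\<in>K. mfd_open M S"
  have "snd c ` (\<Union> K \<inter> fst c) = (\<Union>S\<in>K. snd c ` (S \<inter> fst c))" for c :: "('a, 'b) chart" by auto
  with K show "mfd_open M (\<Union> K)" by (fastforce simp: mfd_open_def)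
qed

definition prod_mfd :: "('a, 'e) mfd \<Rightarrow> ('b, 'f) mfd \<Rightarrow> ('a \<times> 'b, 'e \<times> 'f) mfd" where
  "prod_mfd M N = \<lparr>pts = pts M \<times> pts N,
     atlas = {(fst c \<times> fst d, map_prod (snd c) (snd d)) | c d. c \<in> atlas M \<and> d \<in> atlas N}\<rparr>"

text \<open>\<open>f\<close> is smooth on a neighbourhood of \<open>p\<close>.\<close>

definition smooth_at :: "('a, 'e::real_inner) mfd \<Rightarrow> ('b, 'f::real_inner) mfd \<Rightarrow>
    ('a \<Rightarrow> 'b) \<Rightarrow> 'a \<Rightarrow> bool" where
  "smooth_at M N f p \<longleftrightarrow> (\<exists>c\<in>atlas M. \<exists>d\<in>atlas N. \<exists>W. mfd_open M W \<and> p \<in> W \<and> W \<subseteq> fst c \<and>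
     f ` W \<subseteq> fst d \<and> smooth_on (snd c ` W) (coord_change c d f))"

definition smooth_map :: "('a, 'e::real_inner) mfd \<Rightarrow> ('b, 'f::real_inner) mfd \<Rightarrow>
    ('a \<Rightarrow> 'b) \<Rightarrow> bool" where
  "smooth_map M N f \<longleftrightarrow> f \<in> pts M \<rightarrow> pts N \<and> (\<forall>p\<in>pts M. smooth_at M N f p)"

text \<open>Maps defined on a subset \<open>S\<close> of \<open>M\<close> are smooth if they extend locally to smooth maps
  on open subsets of \<open>M\<close>. For an embedded submanifold \<open>S\<close>, such as the fibre product of two
  submersions, this is smoothness with respect to the submanifold structure.\<close>

definition smooth_ext_at :: "('a, 'e::real_inner) mfd \<Rightarrow> 'a set \<Rightarrow> ('b, 'f::real_inner) mfd \<Rightarrow>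
    ('a \<Rightarrow> 'b) \<Rightarrow> 'a \<Rightarrow> ('a \<Rightarrow> 'b) \<Rightarrow> bool" where
  "smooth_ext_at M S N f p h \<longleftrightarrow> smooth_at M N h p \<and>
     (\<exists>W. mfd_open M W \<and> p \<in> W \<and> (\<forall>x\<in>W \<inter> S. h x = f x))"

definition smooth_map_on :: "('a, 'e::real_inner) mfd \<Rightarrow> 'a set \<Rightarrow> ('b, 'f::real_inner) mfd \<Rightarrow>
    ('a \<Rightarrow> 'b) \<Rightarrow> bool" where
  "smooth_map_on M S N f \<longleftrightarrow> S \<subseteq> pts M \<and> f \<in> S \<rightarrow> pts N \<and> (\<forall>p\<in>S. \<exists>h. smooth_ext_at M S N f p h)"


section \<open>Tangent bundles and differentials\<close>

text \<open>A tangent vector at \<open>p\<close> is the family of its coordinate vectors in all charts around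
  \<open>p\<close> (extended by \<open>0\<close> to the other charts), related by the derivatives of the changes of
  coordinates. The vector space operations on the tangent space are pointwise.\<close>

definition tspace :: "('a, 'e::real_inner) mfd \<Rightarrow> 'a \<Rightarrow> (('a, 'e) chart \<Rightarrow> 'e) set" where
  "tspace M p = {X.
     (\<forall>c. \<not> (c \<in> atlas M \<and> p \<in> fst c) \<longrightarrow> X c = 0) \<and>
     (\<forall>c\<in>atlas M. \<forall>d\<in>atlas M. p \<in> fst c \<longrightarrow> p \<in> fst d \<longrightarrow>
        X d = frechet_derivative (coord_change c d id) (at (snd c p)) (X c))}"

type_synonym ('a, 'e) tvec = "'a \<times> (('a, 'e) chart \<Rightarrow> 'e)"

definition TM :: "('a, 'e::real_inner) mfd \<Rightarrow> (('a, 'e) tvec, 'e \<times> 'e) mfd" where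
  "TM M = \<lparr>pts = (SIGMA p:pts M. tspace M p),
     atlas = {((SIGMA p:fst c. tspace M p), \<lambda>(p, X). (snd c p, X c)) | c. c \<in> atlas M}\<rparr>"

text \<open>The vector space \<open>T\<^sub>pM\<close> as a manifold with global linear charts.\<close>

definition tspace_mfd :: "('a, 'e::real_inner) mfd \<Rightarrow> 'a \<Rightarrow> (('a, 'e) tvec, 'e) mfd" where
  "tspace_mfd M p = \<lparr>pts = {p} \<times> tspace M p,
     atlas = {({p} \<times> tspace M p, \<lambda>(q, X). X c) | c. c \<in> atlas M \<and> p \<in> fst c}\<rparr>"

definition tlin :: "real \<Rightarrow> ('a, 'e::real_inner) tvec \<Rightarrow> real \<Rightarrow> ('a, 'e) tvec \<Rightarrow> ('a, 'e) tvec" where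
  "tlin a u b v = (fst u, \<lambda>c. a *\<^sub>R snd u c + b *\<^sub>R snd v c)"

definition tmap :: "('a, 'e::real_inner) mfd \<Rightarrow> ('b, 'f::real_inner) mfd \<Rightarrow> ('a \<Rightarrow> 'b) \<Rightarrow>
    ('a, 'e) tvec \<Rightarrow> ('b, 'f) tvec" where
  "tmap M N f v = (f (fst v), \<lambda>d. if d \<in> atlas N \<and> f (fst v) \<in> fst d then
     (let c = (SOME c. c \<in> atlas M \<and> fst v \<in> fst c)
      in frechet_derivative (coord_change c d f) (at (snd c (fst v))) (snd v c)) else 0)"

text \<open>Differential of a map that is smooth on a subset \<open>S\<close>. If \<open>S\<close> is an embedded
  submanifold, it does not depend on the chosen extension for vectors tangent to \<open>S\<close>,
  and it is only used for these.\<close>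

definition tmap_on :: "('a, 'e::real_inner) mfd \<Rightarrow> 'a set \<Rightarrow> ('b, 'f::real_inner) mfd \<Rightarrow>
    ('a \<Rightarrow> 'b) \<Rightarrow> ('a, 'e) tvec \<Rightarrow> ('b, 'f) tvec" where
  "tmap_on M S N f v = tmap M N (SOME h. smooth_ext_at M S N f (fst v) h) v"

text \<open>The identification \<open>TM \<times> TN \<cong> T(M \<times> N)\<close>.\<close>

definition tpair :: "('a, 'e::real_inner) mfd \<Rightarrow> ('b, 'f::real_inner) mfd \<Rightarrow>
    ('a, 'e) tvec \<Rightarrow> ('b, 'f) tvec \<Rightarrow> ('a \<times> 'b, 'e \<times> 'f) tvec" where
  "tpair M N u v = (THE w. w \<in> pts (TM (prod_mfd M N)) \<and>
     tmap (prod_mfd M N) M fst w = u \<and> tmap (prod_mfd M N) N snd w = v)"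

definition submersion :: "('a, 'e::real_inner) mfd \<Rightarrow> ('b, 'f::real_inner) mfd \<Rightarrow>
    ('a \<Rightarrow> 'b) \<Rightarrow> bool" where
  "submersion M N f \<longleftrightarrow> smooth_map M N f \<and>
     (\<forall>p\<in>pts M. tmap M N f ` ({p} \<times> tspace M p) = {f p} \<times> tspace N (f p))"


section \<open>Lie groups and Lie groupoids\<close>

definition lie_group :: "('a, 'e::real_inner) mfd \<Rightarrow> 'a monoid \<Rightarrow> bool" where
  "lie_group M H \<longleftrightarrow> manifold M \<and> group H \<and> carrier H = pts M \<and>
     smooth_map (prod_mfd M M) M (\<lambda>(g, h). g \<otimes>\<^bsub>H\<^esub> h) \<and> smooth_map M M (m_inv H)"

definition adj :: "('a, 'e::real_inner) mfd \<Rightarrow> 'a monoid \<Rightarrow> 'a \<Rightarrow> ('a, 'e) tvec \<Rightarrow> ('a, 'e) tvec" where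
  "adj M H g = tmap M M (\<lambda>h. g \<otimes>\<^bsub>H\<^esub> h \<otimes>\<^bsub>H\<^esub> inv\<^bsub>H\<^esub> g)"

record ('o, 'm, 'a, 'b) lie_gpd = "('o, 'm) cat" +
  Ob_atlas :: "('o, 'a) chart set"
  Mor_atlas :: "('m, 'b) chart set"

definition objM :: "('o, 'm, 'a, 'b, 'z) lie_gpd_scheme \<Rightarrow> ('o, 'a) mfd" where
  "objM X = \<lparr>pts = Ob X, atlas = Ob_atlas X\<rparr>"

definition morM :: "('o, 'm, 'a, 'b, 'z) lie_gpd_scheme \<Rightarrow> ('m, 'b) mfd" where
  "morM X = \<lparr>pts = Mor X, atlas = Mor_atlas X\<rparr>"

definition lie_groupoid :: "('o, 'm, 'a::real_inner, 'b::real_inner, 'z) lie_gpd_scheme \<Rightarrow> bool" where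
  "lie_groupoid X \<longleftrightarrow> groupoid X \<and> manifold (objM X) \<and> manifold (morM X) \<and>
     submersion (morM X) (objM X) (Src X) \<and> submersion (morM X) (objM X) (Tgt X) \<and>
     smooth_map (objM X) (morM X) (Idt X) \<and>
     smooth_map (morM X) (morM X) (mor_inv X) \<and>
     smooth_map_on (prod_mfd (morM X) (morM X)) (composable X) (morM X) (\<lambda>(g, f). Cmp X g f)"

definition smooth_functor ::
  "('o, 'm, 'a::real_inner, 'b::real_inner, 'y) lie_gpd_scheme \<Rightarrow>
   ('p, 'n, 'c::real_inner, 'd::real_inner, 'z) lie_gpd_scheme \<Rightarrow> ('o, 'm, 'p, 'n) ftr \<Rightarrow> bool" where
  "smooth_functor X Y F \<longleftrightarrow> is_functor X Y F \<and>
     smooth_map (objM X) (objM Y) (fst F) \<and> smooth_map (morM X) (morM Y) (snd F)"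

definition smooth_nat_iso ::
  "('o, 'm, 'a::real_inner, 'b::real_inner, 'y) lie_gpd_scheme \<Rightarrow>
   ('p, 'n, 'c::real_inner, 'd::real_inner, 'z) lie_gpd_scheme \<Rightarrow>
   ('o, 'm, 'p, 'n) ftr \<Rightarrow> ('o, 'm, 'p, 'n) ftr \<Rightarrow> ('o \<Rightarrow> 'n) \<Rightarrow> bool" where
  "smooth_nat_iso X Y F F' \<eta> \<longleftrightarrow> nat_iso X Y F F' \<eta> \<and> smooth_map (objM X) (morM Y) \<eta>"

definition prod_gpd ::
  "('o, 'm, 'a, 'b, 'y) lie_gpd_scheme \<Rightarrow> ('p, 'n, 'c, 'd, 'z) lie_gpd_scheme \<Rightarrow>
   ('o \<times> 'p, 'm \<times> 'n, 'a \<times> 'c, 'b \<times> 'd) lie_gpd" where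
  "prod_gpd X Y = cat.extend (prod_cat X Y)
     \<lparr>Ob_atlas = atlas (prod_mfd (objM X) (objM Y)), Mor_atlas = atlas (prod_mfd (morM X) (morM Y)), \<dots> = ()\<rparr>"

definition tangent_gpd :: "('o, 'm, 'a::real_inner, 'b::real_inner, 'z) lie_gpd_scheme \<Rightarrow>
    (('o, 'a) tvec, ('m, 'b) tvec, 'a \<times> 'a, 'b \<times> 'b) lie_gpd" where
  "tangent_gpd X = \<lparr>
     Ob = pts (TM (objM X)), Mor = pts (TM (morM X)),
     Src = tmap (morM X) (objM X) (Src X), Tgt = tmap (morM X) (objM X) (Tgt X),
     Idt = tmap (objM X) (morM X) (Idt X),
     Cmp = (\<lambda>v u. tmap_on (prod_mfd (morM X) (morM X)) (composable X) (morM X)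
              (\<lambda>(g, f). Cmp X g f) (tpair (morM X) (morM X) v u)),
     Ob_atlas = atlas (TM (objM X)), Mor_atlas = atlas (TM (morM X))\<rparr>"

definition tangent_functor ::
  "('o, 'm, 'a::real_inner, 'b::real_inner, 'y) lie_gpd_scheme \<Rightarrow>
   ('p, 'n, 'c::real_inner, 'd::real_inner, 'z) lie_gpd_scheme \<Rightarrow> ('o, 'm, 'p, 'n) ftr \<Rightarrow>
   (('o, 'a) tvec, ('m, 'b) tvec, ('p, 'c) tvec, ('n, 'd) tvec) ftr" where
  "tangent_functor X Y F =
     (restrict (tmap (objM X) (objM Y) (fst F)) (Ob (tangent_gpd X)),
      restrict (tmap (morM X) (morM Y) (snd F)) (Mor (tangent_gpd X)))"

definition tangent_ntr ::
  "('o, 'm, 'a::real_inner, 'b::real_inner, 'y) lie_gpd_scheme \<Rightarrow>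
   ('p, 'n, 'c::real_inner, 'd::real_inner, 'z) lie_gpd_scheme \<Rightarrow> ('o, 'm, 'p, 'n) ntr \<Rightarrow>
   (('o, 'a) tvec, ('m, 'b) tvec, ('p, 'c) tvec, ('n, 'd) tvec) ntr" where
  "tangent_ntr X Y t =
     (tangent_functor X Y (ntr_src t),
      restrict (tmap (objM X) (morM Y) (ntr_map t)) (Ob (tangent_gpd X)),
      tangent_functor X Y (ntr_tgt t))"


section \<open>Lie 2-groups and principal bundles over Lie groupoids\<close>

record ('o, 'm, 'a, 'b) lie_2gp = "('o, 'm, 'a, 'b) lie_gpd" +
  ogrp :: "'o monoid"
  mgrp :: "'m monoid"

definition lie_2group :: "('o, 'm, 'a::real_inner, 'b::real_inner) lie_2gp \<Rightarrow> bool" where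
  "lie_2group G \<longleftrightarrow> lie_groupoid G \<and> lie_group (objM G) (ogrp G) \<and> lie_group (morM G) (mgrp G) \<and>
     smooth_functor (prod_gpd G G) G
       (\<lambda>(g, h). g \<otimes>\<^bsub>ogrp G\<^esub> h, \<lambda>(a, b). a \<otimes>\<^bsub>mgrp G\<^esub> b)"

definition lie_2alg :: "('o, 'm, 'a::real_inner, 'b::real_inner) lie_2gp \<Rightarrow>
    (('o, 'a) tvec, ('m, 'b) tvec, 'a, 'b) lie_gpd" where
  "lie_2alg G = \<lparr>
     Ob = pts (tspace_mfd (objM G) \<one>\<^bsub>ogrp G\<^esub>), Mor = pts (tspace_mfd (morM G) \<one>\<^bsub>mgrp G\<^esub>),
     Src = Src (tangent_gpd G), Tgt = Tgt (tangent_gpd G),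
     Idt = Idt (tangent_gpd G), Cmp = Cmp (tangent_gpd G),
     Ob_atlas = atlas (tspace_mfd (objM G) \<one>\<^bsub>ogrp G\<^esub>),
     Mor_atlas = atlas (tspace_mfd (morM G) \<one>\<^bsub>mgrp G\<^esub>)\<rparr>"

definition right_action :: "'p set \<Rightarrow> 'g monoid \<Rightarrow> ('p \<times> 'g \<Rightarrow> 'p) \<Rightarrow> bool" where
  "right_action P H r \<longleftrightarrow> r \<in> P \<times> carrier H \<rightarrow> P \<and> (\<forall>p\<in>P. r (p, \<one>\<^bsub>H\<^esub>) = p) \<and>
     (\<forall>p\<in>P. \<forall>g\<in>carrier H. \<forall>h\<in>carrier H. r (r (p, g), h) = r (p, g \<otimes>\<^bsub>H\<^esub> h))"

definition principal_bundle ::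
  "('g, 'e::real_inner) mfd \<Rightarrow> 'g monoid \<Rightarrow> ('p, 'f::real_inner) mfd \<Rightarrow> ('x, 'h::real_inner) mfd \<Rightarrow>
   ('p \<Rightarrow> 'x) \<Rightarrow> ('p \<times> 'g \<Rightarrow> 'p) \<Rightarrow> bool" where
  "principal_bundle K H P B pr r \<longleftrightarrow> lie_group K H \<and> manifold P \<and> manifold B \<and>
     smooth_map P B pr \<and> smooth_map (prod_mfd P K) P r \<and> right_action (pts P) H r \<and>
     (\<forall>x\<in>pts B. \<exists>U t. mfd_open B U \<and> x \<in> U \<and>
        (let V = {p\<in>pts P. pr p \<in> U} in
           bij_betw t V (U \<times> pts K) \<and>
           smooth_map_on P V (prod_mfd B K) t \<and>
           smooth_map_on (prod_mfd B K) (U \<times> pts K) P (inv_into V t) \<and>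
           (\<forall>p\<in>V. fst (t p) = pr p) \<and>
           (\<forall>p\<in>V. \<forall>g\<in>pts K. r (p, g) \<in> V \<and> t (r (p, g)) = (pr p, snd (t p) \<otimes>\<^bsub>H\<^esub> g))))"

definition principal_2bundle ::
  "('g0, 'g1, 'a::real_inner, 'b::real_inner) lie_2gp \<Rightarrow>
   ('e0, 'e1, 'c::real_inner, 'd::real_inner) lie_gpd \<Rightarrow>
   ('x0, 'x1, 'k::real_inner, 'l::real_inner) lie_gpd \<Rightarrow>
   ('e0, 'e1, 'x0, 'x1) ftr \<Rightarrow> ('e0 \<times> 'g0, 'e1 \<times> 'g1, 'e0, 'e1) ftr \<Rightarrow> bool" where
  "principal_2bundle G E X pr r \<longleftrightarrow> lie_2group G \<and> lie_groupoid E \<and> lie_groupoid X \<and>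
     smooth_functor E X pr \<and> smooth_functor (prod_gpd E G) E r \<and>
     principal_bundle (objM G) (ogrp G) (objM E) (objM X) (fst pr) (fst r) \<and>
     principal_bundle (morM G) (mgrp G) (morM E) (morM X) (snd pr) (snd r)"


section \<open>The gauge 2-group\<close>

definition gauge_ob ::
  "('g0, 'g1, 'a::real_inner, 'b::real_inner) lie_2gp \<Rightarrow>
   ('e0, 'e1, 'c::real_inner, 'd::real_inner) lie_gpd \<Rightarrow>
   ('e0, 'e1, 'x0, 'x1) ftr \<Rightarrow> ('e0 \<times> 'g0, 'e1 \<times> 'g1, 'e0, 'e1) ftr \<Rightarrow> ('e0, 'e1, 'e0, 'e1) ftr set" where
  "gauge_ob G E pr r = {F.
     smooth_functor E E F \<and> functor_ext E F \<and>
     (\<exists>F'. smooth_functor E E F' \<and> fcomp_on E F' F = fid E \<and> fcomp_on E F F' = fid E) \<and>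
     (\<forall>p\<in>Ob E. \<forall>g\<in>Ob G. fst F (fst r (p, g)) = fst r (fst F p, g)) \<and>
     (\<forall>p\<in>Mor E. \<forall>g\<in>Mor G. snd F (snd r (p, g)) = snd r (snd F p, g)) \<and>
     (\<forall>p\<in>Ob E. fst pr (fst F p) = fst pr p) \<and>
     (\<forall>p\<in>Mor E. snd pr (snd F p) = snd pr p)}"

definition gauge_mor ::
  "('g0, 'g1, 'a::real_inner, 'b::real_inner) lie_2gp \<Rightarrow>
   ('e0, 'e1, 'c::real_inner, 'd::real_inner) lie_gpd \<Rightarrow>
   ('x0, 'x1, 'k::real_inner, 'l::real_inner) lie_gpd \<Rightarrow>
   ('e0, 'e1, 'x0, 'x1) ftr \<Rightarrow> ('e0 \<times> 'g0, 'e1 \<times> 'g1, 'e0, 'e1) ftr \<Rightarrow> ('e0, 'e1, 'e0, 'e1) ntr set" where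
  "gauge_mor G E X pr r = {(F, \<Psi>, F').
     F \<in> gauge_ob G E pr r \<and> F' \<in> gauge_ob G E pr r \<and>
     smooth_nat_iso E E F F' \<Psi> \<and> \<Psi> \<in> extensional (Ob E) \<and>
     (\<forall>p\<in>Ob E. \<forall>g\<in>Ob G. \<Psi> (fst r (p, g)) = snd r (\<Psi> p, Idt G g)) \<and>
     (\<forall>p\<in>Ob E. snd pr (\<Psi> p) = Idt X (fst pr p))}"

definition gauge_cat ::
  "('g0, 'g1, 'a::real_inner, 'b::real_inner) lie_2gp \<Rightarrow>
   ('e0, 'e1, 'c::real_inner, 'd::real_inner) lie_gpd \<Rightarrow>
   ('x0, 'x1, 'k::real_inner, 'l::real_inner) lie_gpd \<Rightarrow>
   ('e0, 'e1, 'x0, 'x1) ftr \<Rightarrow> ('e0 \<times> 'g0, 'e1 \<times> 'g1, 'e0, 'e1) ftr \<Rightarrow>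
   (('e0, 'e1, 'e0, 'e1) ftr, ('e0, 'e1, 'e0, 'e1) ntr) cat" where
  "gauge_cat G E X pr r = \<lparr>Ob = gauge_ob G E pr r, Mor = gauge_mor G E X pr r,
     Src = (\<lambda>t. ntr_src t), Tgt = (\<lambda>t. ntr_tgt t), Idt = ntr_id E E, Cmp = vcomp E E\<rparr>"

definition gauge_ogrp ::
  "('g0, 'g1, 'a::real_inner, 'b::real_inner) lie_2gp \<Rightarrow>
   ('e0, 'e1, 'c::real_inner, 'd::real_inner) lie_gpd \<Rightarrow>
   ('e0, 'e1, 'x0, 'x1) ftr \<Rightarrow> ('e0 \<times> 'g0, 'e1 \<times> 'g1, 'e0, 'e1) ftr \<Rightarrow> ('e0, 'e1, 'e0, 'e1) ftr monoid" where
  "gauge_ogrp G E pr r = \<lparr>carrier = gauge_ob G E pr r,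
     mult = (\<lambda>F F'. fcomp_on E F' F), one = fid E\<rparr>"

definition gauge_mgrp ::
  "('g0, 'g1, 'a::real_inner, 'b::real_inner) lie_2gp \<Rightarrow>
   ('e0, 'e1, 'c::real_inner, 'd::real_inner) lie_gpd \<Rightarrow>
   ('x0, 'x1, 'k::real_inner, 'l::real_inner) lie_gpd \<Rightarrow>
   ('e0, 'e1, 'x0, 'x1) ftr \<Rightarrow> ('e0 \<times> 'g0, 'e1 \<times> 'g1, 'e0, 'e1) ftr \<Rightarrow> ('e0, 'e1, 'e0, 'e1) ntr monoid" where
  "gauge_mgrp G E X pr r = \<lparr>carrier = gauge_mor G E X pr r,
     mult = (\<lambda>\<Psi> \<Psi>'. hcomp E E \<Psi>' \<Psi>), one = ntr_id E E (fid E)\<rparr>"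


section \<open>Connection 1-forms\<close>

definition fibrewise_linear :: "('a, 'e::real_inner) mfd \<Rightarrow>
    (('a, 'e) tvec \<Rightarrow> ('b, 'f::real_inner) tvec) \<Rightarrow> bool" where
  "fibrewise_linear M \<phi> \<longleftrightarrow> (\<forall>p\<in>pts M. \<forall>u\<in>{p} \<times> tspace M p. \<forall>v\<in>{p} \<times> tspace M p. \<forall>a b.
     \<phi> (tlin a u b v) = tlin a (\<phi> u) b (\<phi> v))"

definition fund_functor ::
  "('g0, 'g1, 'a::real_inner, 'b::real_inner) lie_2gp \<Rightarrow>
   ('e0, 'e1, 'c::real_inner, 'd::real_inner) lie_gpd \<Rightarrow>
   ('e0 \<times> 'g0, 'e1 \<times> 'g1, 'e0, 'e1) ftr \<Rightarrow>
   ('e0 \<times> ('g0, 'a) tvec, 'e1 \<times> ('g1, 'b) tvec, ('e0, 'c) tvec, ('e1, 'd) tvec) ftr" where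
  "fund_functor G E r =
     (\<lambda>(p, B). tmap (objM G) (objM E) (\<lambda>g. fst r (p, g)) B,
      \<lambda>(p, A). tmap (morM G) (morM E) (\<lambda>g. snd r (p, g)) A)"

definition equivariant_1form ::
  "('g0, 'g1, 'a::real_inner, 'b::real_inner) lie_2gp \<Rightarrow>
   ('e0, 'e1, 'c::real_inner, 'd::real_inner) lie_gpd \<Rightarrow>
   ('e0 \<times> 'g0, 'e1 \<times> 'g1, 'e0, 'e1) ftr \<Rightarrow>
   (('e0, 'c) tvec, ('e1, 'd) tvec, ('g0, 'a) tvec, ('g1, 'b) tvec) ftr \<Rightarrow> bool" where
  "equivariant_1form G E r \<omega> \<longleftrightarrow>
     smooth_functor (tangent_gpd E) (lie_2alg G) \<omega> \<and> functor_ext (tangent_gpd E) \<omega> \<and>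
     fibrewise_linear (objM E) (fst \<omega>) \<and> fibrewise_linear (morM E) (snd \<omega>) \<and>
     (\<forall>v\<in>pts (TM (objM E)). \<forall>g\<in>Ob G.
        fst \<omega> (tmap (objM E) (objM E) (\<lambda>p. fst r (p, g)) v)
          = adj (objM G) (ogrp G) (inv\<^bsub>ogrp G\<^esub> g) (fst \<omega> v)) \<and>
     (\<forall>v\<in>pts (TM (morM E)). \<forall>g\<in>Mor G.
        snd \<omega> (tmap (morM E) (morM E) (\<lambda>p. snd r (p, g)) v)
          = adj (morM G) (mgrp G) (inv\<^bsub>mgrp G\<^esub> g) (snd \<omega> v))"

definition strict_connection ::
  "('g0, 'g1, 'a::real_inner, 'b::real_inner) lie_2gp \<Rightarrow>
   ('e0, 'e1, 'c::real_inner, 'd::real_inner) lie_gpd \<Rightarrow>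
   ('e0 \<times> 'g0, 'e1 \<times> 'g1, 'e0, 'e1) ftr \<Rightarrow>
   (('e0, 'c) tvec, ('e1, 'd) tvec, ('g0, 'a) tvec, ('g1, 'b) tvec) ftr \<Rightarrow> bool" where
  "strict_connection G E r \<omega> \<longleftrightarrow> equivariant_1form G E r \<omega> \<and>
     fcomp_on (prod_gpd E (lie_2alg G)) \<omega> (fund_functor G E r)
       = (restrict snd (Ob (prod_gpd E (lie_2alg G))), restrict snd (Mor (prod_gpd E (lie_2alg G))))"

definition semi_strict_connection ::
  "('g0, 'g1, 'a::real_inner, 'b::real_inner) lie_2gp \<Rightarrow>
   ('e0, 'e1, 'c::real_inner, 'd::real_inner) lie_gpd \<Rightarrow>
   ('e0 \<times> 'g0, 'e1 \<times> 'g1, 'e0, 'e1) ftr \<Rightarrow>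
   (('e0, 'c) tvec, ('e1, 'd) tvec, ('g0, 'a) tvec, ('g1, 'b) tvec) ftr \<Rightarrow> bool" where
  "semi_strict_connection G E r \<omega> \<longleftrightarrow> equivariant_1form G E r \<omega> \<and>
     (\<exists>\<kappa>. smooth_nat_iso (prod_gpd E (lie_2alg G)) (lie_2alg G)
            (fcomp_on (prod_gpd E (lie_2alg G)) \<omega> (fund_functor G E r)) (snd, snd) \<kappa> \<and>
        (\<forall>p\<in>Ob E. \<forall>A\<in>Ob (lie_2alg G). \<forall>B\<in>Ob (lie_2alg G). \<forall>a b.
           \<kappa> (p, tlin a A b B) = tlin a (\<kappa> (p, A)) b (\<kappa> (p, B))) \<and>
        (\<forall>p\<in>Ob E. \<forall>g\<in>Ob G. \<forall>B\<in>Ob (lie_2alg G).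
           \<kappa> (fst r (p, g), adj (objM G) (ogrp G) (inv\<^bsub>ogrp G\<^esub> g) B)
             = adj (morM G) (mgrp G) (inv\<^bsub>mgrp G\<^esub> (Idt G g)) (\<kappa> (p, B))))"

definition conn_mor ::
  "('g0, 'g1, 'a::real_inner, 'b::real_inner) lie_2gp \<Rightarrow>
   ('e0, 'e1, 'c::real_inner, 'd::real_inner) lie_gpd \<Rightarrow>
   ('e0 \<times> 'g0, 'e1 \<times> 'g1, 'e0, 'e1) ftr \<Rightarrow>
   (('e0, 'c) tvec, ('e1, 'd) tvec, ('g0, 'a) tvec, ('g1, 'b) tvec) ntr \<Rightarrow> bool" where
  "conn_mor G E r t \<longleftrightarrow>
     smooth_nat_iso (tangent_gpd E) (lie_2alg G) (ntr_src t) (ntr_tgt t) (ntr_map t) \<and>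
     ntr_map t \<in> extensional (Ob (tangent_gpd E)) \<and>
     fibrewise_linear (objM E) (ntr_map t) \<and>
     (\<forall>v\<in>pts (TM (objM E)). \<forall>g\<in>Ob G.
        ntr_map t (tmap (objM E) (objM E) (\<lambda>p. fst r (p, g)) v)
          = adj (morM G) (mgrp G) (inv\<^bsub>mgrp G\<^esub> (Idt G g)) (ntr_map t v))"

definition conn_cat ::
  "('g0, 'g1, 'a::real_inner, 'b::real_inner) lie_2gp \<Rightarrow>
   ('e0, 'e1, 'c::real_inner, 'd::real_inner) lie_gpd \<Rightarrow>
   ('e0 \<times> 'g0, 'e1 \<times> 'g1, 'e0, 'e1) ftr \<Rightarrow>
   (('e0, 'c) tvec, ('e1, 'd) tvec, ('g0, 'a) tvec, ('g1, 'b) tvec) ftr set \<Rightarrow>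
   ((('e0, 'c) tvec, ('e1, 'd) tvec, ('g0, 'a) tvec, ('g1, 'b) tvec) ftr,
    (('e0, 'c) tvec, ('e1, 'd) tvec, ('g0, 'a) tvec, ('g1, 'b) tvec) ntr) cat" where
  "conn_cat G E r Q = \<lparr>Ob = Q,
     Mor = {t. ntr_src t \<in> Q \<and> ntr_tgt t \<in> Q \<and> conn_mor G E r t},
     Src = (\<lambda>t. ntr_src t), Tgt = (\<lambda>t. ntr_tgt t),
     Idt = ntr_id (tangent_gpd E) (lie_2alg G), Cmp = vcomp (tangent_gpd E) (lie_2alg G)\<rparr>"

definition "\<Omega>_semi G E r = conn_cat G E r {\<omega>. semi_strict_connection G E r \<omega>}"

definition "\<Omega>_strict G E r = conn_cat G E r {\<omega>. strict_connection G E r \<omega>}"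

definition gauge_act_ob ::
  "('e0, 'e1, 'c::real_inner, 'd::real_inner) lie_gpd \<Rightarrow> ('e0, 'e1, 'e0, 'e1) ftr \<Rightarrow>
   (('e0, 'c) tvec, ('e1, 'd) tvec, 'u, 'v) ftr \<Rightarrow> (('e0, 'c) tvec, ('e1, 'd) tvec, 'u, 'v) ftr" where
  "gauge_act_ob E F \<omega> = fcomp_on (tangent_gpd E) \<omega>
     (finv_on (tangent_gpd E) (tangent_gpd E) (tangent_functor E E F))"

definition gauge_act_mor ::
  "('g0, 'g1, 'a::real_inner, 'b::real_inner) lie_2gp \<Rightarrow>
   ('e0, 'e1, 'c::real_inner, 'd::real_inner) lie_gpd \<Rightarrow> ('e0, 'e1, 'e0, 'e1) ntr \<Rightarrow>
   (('e0, 'c) tvec, ('e1, 'd) tvec, ('g0, 'a) tvec, ('g1, 'b) tvec) ntr \<Rightarrow>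
   (('e0, 'c) tvec, ('e1, 'd) tvec, ('g0, 'a) tvec, ('g1, 'b) tvec) ntr" where
  "gauge_act_mor G E \<Psi> \<zeta> = hcomp (tangent_gpd E) (lie_2alg G) \<zeta>
     (hinv (tangent_gpd E) (tangent_ntr E E \<Psi>))"

end

theory Submission
  imports Defs
begin

text \<open>
  Everything in the construction of connection forms is natural, so a gauge transformation acts on
  forms through its differential, and the laws of the action are the images under differentiation
  of the group laws of the gauge 2-group. What has to be established is that differentiation
  respects all operations involved, and that composition in \<open>L(\<G>)\<close> respects
  linearity and equivariance. Three groups of results carry this.

  \<^item> Categories. The horizontal and vertical composition of natural transformations satisfy
    associativity and the interchange law (\<open>hcomp_assoc\<close>, \<open>hcomp_interchange\<close>),
    and a transformation between automorphisms of a groupoid has a horizontal inverse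
    (\<open>hinverse\<close>). This makes the gauge transformations a strict 2-group
    (\<open>strict_2group_automorphisms\<close>, \<open>gauge_strict_2group\<close>).

  \<^item> Differentiation. Composition in the tangent groupoid is the differential of a local
    extension of the composition map to all pairs of morphisms. On vectors that come from a smooth
    family of composable pairs the chain rule makes the extension irrelevant
    (\<open>tangent_Cmp_pullback\<close>), so that differentiation commutes with both compositions of
    transformations and with horizontal inversion (\<open>tangent_ntr_vcomp\<close>,
    \<open>tangent_ntr_hcomp\<close>, \<open>hinv_tangent_ntr\<close>). That the differential of a functor
    is a functor concerns arbitrary pairs of composable vectors. Since the source map is a
    submersion, such a pair is the velocity of a curve of composable pairs
    (\<open>derivative_vanishes_along_fibre_product\<close>, proved by Newton iteration), so the
    differential again does not depend on the extension (\<open>tmap_eq_on_fibre_product\<close>,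
    \<open>is_functor_tangent_functor\<close>).

  \<^item> The Lie 2-algebra. Over a unit, composition of tangent vectors is given by the linear
    formula \<open>B \<circ> A = B + A - 1\<^sub>*(Src\<^sub>* B)\<close> (\<open>tangent_Cmp_unit\<close>). Hence
    \<open>L(\<G>)\<close> is a groupoid whose composition is smooth, linear and compatible with the
    adjoint actions, and the morphisms between connection forms are closed under vertical
    composition and under horizontal composition with the differential of a gauge 2-morphism
    (\<open>conn_mor_vcomp\<close>, \<open>conn_mor_pullback\<close>).

  A gauge transformation \<open>F\<close> preserves the fundamental vector fields,
  \<open>F\<^sub>* \<delta>\<^sub>p(B) = \<delta>\<^bsub>F p\<^esub>(B)\<close>. Therefore pullback along \<open>F\<inverse>\<close>
  preserves strict connections, and it preserves semi-strict ones if \<open>\<kappa>\<close> is pulled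
  back as well (\<open>strict_pullback_form\<close>, \<open>semi_strict_pullback_form\<close>). The laws of
  the action are verified in \<open>gauge_action\<close> for both classes of forms at once.
\<close>

section \<open>Smooth functions on finite-dimensional inner product spaces\<close>

definition fin_dim :: "'e::real_inner itself \<Rightarrow> bool" where
  "fin_dim _ \<longleftrightarrow> (\<exists>B::'e set. finite B \<and> span B = UNIV)"

text \<open>An orthogonal spanning set with its coordinate functionals \<open>(x \<bullet> b) / (b \<bullet> b)\<close>, which
  are bounded. Expansions in these coordinates are the form in which finite dimension enters below.\<close>

lemma fin_dim_coordinates:
  assumes "fin_dim TYPE('e::real_inner)"
  obtains C :: "'e::real_inner set" and c :: "'e::real_inner \<Rightarrow> 'e \<Rightarrow> real"
  where "finite C" "\<And>b. bounded_linear (c b)" "\<And>x. (\<Sum>b\<in>C. c b x *\<^sub>R b) = x"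
proof -
  obtain B :: "'e set" where B: "finite B" "span B = UNIV"
    using assms by (auto simp: fin_dim_def)
  obtain C :: "'e set" where C: "finite C" "span C = UNIV" "pairwise orthogonal C"
    using basis_orthogonal[OF B(1)] B(2) by auto
  define c where "c b x = (x \<bullet> b) / (b \<bullet> b)" for b x :: 'e
  have bl: "bounded_linear (c b)" for b
    unfolding c_def by (intro bounded_linear_divide[THEN bounded_linear_compose] bounded_linear_inner_left)
  have lin: "linear (\<lambda>x. \<Sum>b\<in>C. c b x *\<^sub>R b)"
    by (intro linear_compose_sum ballI bounded_linear.linear bounded_linear_scaleR_left[THEN bounded_linear_compose] bl)
  have "(\<Sum>b\<in>C. c b x *\<^sub>R b) = x" for x
  proof -
    have "x \<in> span C" using C by simp
    moreover have "(\<Sum>b\<in>C. c b x *\<^sub>R b) = x" if "x \<in> C" for x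
    proof -
      have "c b x *\<^sub>R b = (if b = x then x else 0)" if "b \<in> C" for b
        using C(3) that \<open>x \<in> C\<close> by (auto simp: c_def pairwise_def orthogonal_def)
      then have "(\<Sum>b\<in>C. c b x *\<^sub>R b) = (\<Sum>b\<in>C. if b = x then x else 0)"
        by (intro sum.cong) auto
      also have "\<dots> = x" using C(1) that by simp
      finally show ?thesis .
    qed
    ultimately show ?thesis
      using linear_eq_on[OF lin linear_id, of x C] by simp
  qed
  with that C bl show thesis by blast
qed

lemma fin_dim_linear_bounded:
  fixes f :: "'e::real_inner \<Rightarrow> 'f::real_normed_vector"
  assumes "fin_dim TYPE('e)" and f: "linear f" shows "bounded_linear f"
proof -
  obtain C :: "'e set" and c where C: "finite C" "\<And>b. bounded_linear (c b)"
    "\<And>x. (\<Sum>b\<in>C. c b x *\<^sub>R b) = x"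
    using fin_dim_coordinates[OF assms(1)] by metis
  have "f = (\<lambda>x. \<Sum>b\<in>C. c b x *\<^sub>R f b)"
  proof
    fix x
    have "f x = f (\<Sum>b\<in>C. c b x *\<^sub>R b)" using C(3) by simp
    also have "\<dots> = (\<Sum>b\<in>C. c b x *\<^sub>R f b)" using f by (simp add: linear_sum linear_scale)
    finally show "f x = (\<Sum>b\<in>C. c b x *\<^sub>R f b)" .
  qed
  moreover have "bounded_linear (\<lambda>x. \<Sum>b\<in>C. c b x *\<^sub>R f b)"
    by (intro bounded_linear_sum bounded_linear_scaleR_left[THEN bounded_linear_compose] C)
  ultimately show ?thesis by simp
qed

lemma fin_dim_complete:
  assumes "fin_dim TYPE('e::real_inner)" shows "complete (UNIV :: 'e set)"
proof (rule completeI)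
  fix X :: "nat \<Rightarrow> 'e" assume X: "Cauchy X"
  obtain C :: "'e set" and c where C: "finite C" "\<And>b. bounded_linear (c b)"
    "\<And>x. (\<Sum>b\<in>C. c b x *\<^sub>R b) = x"
    using fin_dim_coordinates[OF assms(1)] by metis
  have "\<exists>l. (\<lambda>n. c b (X n)) \<longlonglongrightarrow> l" for b
    using bounded_linear.Cauchy[OF C(2) X] by (simp add: Cauchy_convergent convergentD)
  then obtain l where "\<And>b. (\<lambda>n. c b (X n)) \<longlonglongrightarrow> l b" by metis
  then have "(\<lambda>n. \<Sum>b\<in>C. c b (X n) *\<^sub>R b) \<longlonglongrightarrow> (\<Sum>b\<in>C. l b *\<^sub>R b)"
    by (intro tendsto_intros)
  then show "\<exists>l\<in>UNIV. X \<longlonglongrightarrow> l" using C(3) by auto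
qed

lemma fin_dim_prod:
  assumes "fin_dim TYPE('e::real_inner)" "fin_dim TYPE('f::real_inner)"
  shows "fin_dim TYPE('e \<times> 'f)"
proof -
  obtain B :: "'e set" where B: "finite B" "span B = UNIV"
    using assms by (auto simp: fin_dim_def)
  obtain C :: "'f set" where C: "finite C" "span C = UNIV"
    using assms by (auto simp: fin_dim_def)
  let ?D = "(\<lambda>b. (b, 0)) ` B \<union> (\<lambda>b. (0, b)) ` C"
  have l: "linear (\<lambda>x::'e. (x, 0::'f))" "linear (\<lambda>x::'f. (0::'e, x))"
    by (auto intro!: linearI)
  have "(x, 0) \<in> span ?D" for x
    using B linear_span_image[OF l(1), of B] span_mono[of "(\<lambda>b. (b, 0)) ` B" ?D] by auto
  moreover have "(0, y) \<in> span ?D" for y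
    using C linear_span_image[OF l(2), of C] span_mono[of "(\<lambda>b. (0, b)) ` C" ?D] by auto
  ultimately have "(x, 0) + (0, y) \<in> span ?D" for x y by (blast intro: span_add)
  then have "span ?D = UNIV" by auto
  with B C show ?thesis unfolding fin_dim_def by (intro exI[of _ ?D]) auto
qed

lemma Ck_on_cong:
  assumes "open S" "\<And>x. x \<in> S \<Longrightarrow> f x = g x" "Ck_on k S f"
  shows "Ck_on k S g"
  using assms(2,3)
proof (induction k arbitrary: f g)
  case 0
  then show ?case by (simp cong: continuous_on_cong)
next
  case (Suc k)
  have d: "(g has_derivative frechet_derivative f (at x)) (at x)" if "x \<in> S" for x
    using Suc.prems that has_derivative_transform_within_open[OF _ assms(1) that, of f _ UNIV g]
    by (simp add: frechet_derivative_works)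
  then have "frechet_derivative f (at x) v = frechet_derivative g (at x) v" if "x \<in> S" for x v
    using that frechet_derivative_at by metis
  then have "Ck_on k S (\<lambda>x. frechet_derivative g (at x) v)" for v
    using Suc.IH[of "\<lambda>x. frechet_derivative f (at x) v"] Suc.prems by simp
  with d show ?case by (auto simp: differentiable_def)
qed

lemma Ck_on_SucI:
  assumes S: "open S" and f: "\<And>x. x \<in> S \<Longrightarrow> (f has_derivative f' x) (at x)"
    and f': "\<And>v. Ck_on k S (\<lambda>x. f' x v)"
  shows "Ck_on (Suc k) S f"
proof -
  have "f' x v = frechet_derivative f (at x) v" if "x \<in> S" for x v
    using f[OF that] frechet_derivative_at by metis
  then have "Ck_on k S (\<lambda>x. frechet_derivative f (at x) v)" for v
    using Ck_on_cong[OF S _ f'] by simp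
  with f show ?thesis by (auto simp: differentiable_def)
qed

lemma Ck_on_SucD:
  "Ck_on (Suc k) S f \<Longrightarrow> Ck_on k S f"
proof (induction k arbitrary: f)
  case 0
  then show ?case
    by (auto intro!: continuous_at_imp_continuous_on differentiable_imp_continuous_within)
qed (metis Ck_on.simps(2))

lemma Ck_on_subset: "Ck_on k S f \<Longrightarrow> T \<subseteq> S \<Longrightarrow> Ck_on k T f"
  by (induction k arbitrary: f) (auto intro: continuous_on_subset)

lemma Ck_on_has_derivative:
  "Ck_on (Suc k) S f \<Longrightarrow> x \<in> S \<Longrightarrow> (f has_derivative frechet_derivative f (at x)) (at x)"
  by (simp add: frechet_derivative_works)

lemma Ck_on_const: "open S \<Longrightarrow> Ck_on k S (\<lambda>x. c)"
proof (induction k arbitrary: c)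
  case (Suc k)
  then show ?case by (intro Ck_on_SucI[where f' = "\<lambda>x v. 0"]) auto
qed simp

lemma Ck_on_bounded_linear:
  assumes "open S" "bounded_linear L" shows "Ck_on k S f \<Longrightarrow> Ck_on k S (\<lambda>x. L (f x))"
proof (induction k arbitrary: f)
  case 0
  then show ?case using assms by (auto intro: bounded_linear.continuous_on)
next
  case (Suc k)
  show ?case
    by (rule Ck_on_SucI[OF assms(1) bounded_linear.has_derivative[OF assms(2)]])
      (use Suc assms in \<open>auto intro: Ck_on_has_derivative\<close>)
qed

lemma Ck_on_add:
  assumes "open S" shows "Ck_on k S f \<Longrightarrow> Ck_on k S g \<Longrightarrow> Ck_on k S (\<lambda>x. f x + g x)"
proof (induction k arbitrary: f g)
  case 0
  then show ?case by (auto intro: continuous_on_add)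
next
  case (Suc k)
  show ?case
    by (rule Ck_on_SucI[OF assms has_derivative_add])
      (use Suc assms in \<open>auto intro: Ck_on_has_derivative\<close>)
qed

lemma Ck_on_sum:
  assumes "open S" "finite I" "\<And>i. i \<in> I \<Longrightarrow> Ck_on k S (f i)"
  shows "Ck_on k S (\<lambda>x. \<Sum>i\<in>I. f i x)"
  using assms(2,3) by (induction I) (auto intro: Ck_on_const Ck_on_add assms(1))

lemma Ck_on_scaleR:
  assumes "open S"
  shows "Ck_on k S f \<Longrightarrow> Ck_on k S g \<Longrightarrow> Ck_on k S (\<lambda>x. f x *\<^sub>R g x)"
proof (induction k arbitrary: f g)
  case 0
  then show ?case by (auto intro: continuous_on_scaleR)
next
  case (Suc k)
  have "Ck_on k S f" "Ck_on k S g" using Suc.prems Ck_on_SucD by metis+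
  with Suc show ?case
    by (intro Ck_on_SucI[OF assms has_derivative_scaleR[OF Ck_on_has_derivative[OF Suc.prems(1)]
        Ck_on_has_derivative[OF Suc.prems(2)]]] Ck_on_add assms) auto
qed

lemma Ck_on_Pair:
  assumes "open S"
  shows "Ck_on k S f \<Longrightarrow> Ck_on k S g \<Longrightarrow> Ck_on k S (\<lambda>x. (f x, g x))"
proof (induction k arbitrary: f g)
  case 0
  then show ?case by (auto intro: continuous_on_Pair)
next
  case (Suc k)
  show ?case
    by (rule Ck_on_SucI[OF assms has_derivative_Pair])
      (use Suc assms in \<open>auto intro!: Ck_on_has_derivative\<close>)
qed

text \<open>The derivative of \<open>g \<circ> f\<close> in direction \<open>v\<close> is \<open>g'(f x) (f'(x) v)\<close>, a directional derivative of
  \<open>g\<close> in a direction that varies with \<open>x\<close>. Expanding that direction in coordinates gives a sum of products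
  of a \<open>C\<^sup>k\<close> scalar function with directional derivatives of \<open>g\<close> in fixed directions, composed with \<open>f\<close>.\<close>

lemma Ck_on_compose:
  fixes f :: "'e::real_normed_vector \<Rightarrow> 'f::real_inner"
  assumes "fin_dim TYPE('f)" "open S" "open T" "f ` S \<subseteq> T"
  shows "Ck_on k S f \<Longrightarrow> Ck_on k T g \<Longrightarrow> Ck_on k S (\<lambda>x. g (f x))"
proof (induction k arbitrary: g)
  case 0
  then show ?case using assms(4) by (auto intro: continuous_on_compose2)
next
  case (Suc k)
  obtain C :: "'f set" and c where C: "finite C" "\<And>b. bounded_linear (c b)"
    "\<And>x. (\<Sum>b\<in>C. c b x *\<^sub>R b) = x"
    using fin_dim_coordinates[OF assms(1)] by metis
  let ?f' = "\<lambda>x. frechet_derivative f (at x)" and ?g' = "\<lambda>x. frechet_derivative g (at x)"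
  show ?case
  proof (rule Ck_on_SucI[OF assms(2)])
    fix x assume x: "x \<in> S"
    have "((g \<circ> f) has_derivative (?g' (f x) \<circ> ?f' x)) (at x)"
      using Suc.prems x assms(4) by (intro diff_chain_at Ck_on_has_derivative) auto
    moreover have "(?g' (f x) \<circ> ?f' x) v = (\<Sum>b\<in>C. c b (?f' x v) *\<^sub>R ?g' (f x) b)" for v
    proof -
      have "linear (?g' (f x))"
        using Suc.prems x assms(4) by (intro linear_frechet_derivative) auto
      then have "?g' (f x) (\<Sum>b\<in>C. c b (?f' x v) *\<^sub>R b) = (\<Sum>b\<in>C. c b (?f' x v) *\<^sub>R ?g' (f x) b)"
        by (simp add: linear_sum linear_scale)
      then show ?thesis by (simp add: C(3))
    qed
    ultimately show "((\<lambda>x. g (f x)) has_derivative (\<lambda>v. \<Sum>b\<in>C. c b (?f' x v) *\<^sub>R ?g' (f x) b)) (at x)"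
      by (simp add: o_def)
  next
    fix v
    have "Ck_on k S (\<lambda>x. ?g' (f x) b)" for b
      using Suc.IH[OF Ck_on_SucD[OF Suc.prems(1)], of "\<lambda>y. ?g' y b"] Suc.prems(2) by simp
    moreover have "Ck_on k S (\<lambda>x. c b (?f' x v))" for b
      by (rule Ck_on_bounded_linear[OF assms(2) C(2)]) (use Suc.prems(1) in simp)
    ultimately show "Ck_on k S (\<lambda>x. \<Sum>b\<in>C. c b (?f' x v) *\<^sub>R ?g' (f x) b)"
      by (intro Ck_on_sum Ck_on_scaleR assms C)
  qed
qed

lemma smooth_on_cong: "open S \<Longrightarrow> (\<And>x. x \<in> S \<Longrightarrow> f x = g x) \<Longrightarrow> smooth_on S f \<Longrightarrow> smooth_on S g"
  unfolding smooth_on_def using Ck_on_cong by metis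

lemma smooth_on_subset: "smooth_on S f \<Longrightarrow> T \<subseteq> S \<Longrightarrow> smooth_on T f"
  unfolding smooth_on_def using Ck_on_subset by metis

lemma smooth_on_has_derivative:
  "smooth_on S f \<Longrightarrow> x \<in> S \<Longrightarrow> (f has_derivative frechet_derivative f (at x)) (at x)"
  unfolding smooth_on_def using Ck_on_has_derivative by metis

lemma smooth_on_derivative_linear: "smooth_on S f \<Longrightarrow> x \<in> S \<Longrightarrow> linear (frechet_derivative f (at x))"
  using smooth_on_has_derivative has_derivative_linear by metis

lemma smooth_on_continuous: "smooth_on S f \<Longrightarrow> continuous_on S f"
  unfolding smooth_on_def using Ck_on.simps(1) by metis

lemma smooth_on_const: "open S \<Longrightarrow> smooth_on S (\<lambda>x. c)"
  by (simp add: smooth_on_def Ck_on_const)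

lemma smooth_on_bounded_linear_compose:
  "open S \<Longrightarrow> bounded_linear L \<Longrightarrow> smooth_on S f \<Longrightarrow> smooth_on S (\<lambda>x. L (f x))"
  by (simp add: smooth_on_def Ck_on_bounded_linear)

lemma Ck_on_ident: "open S \<Longrightarrow> Ck_on k S (\<lambda>x. x)"
proof (cases k)
  case (Suc j)
  assume "open S"
  then show ?thesis unfolding Suc by (intro Ck_on_SucI[where f' = "\<lambda>x v. v"]) (auto intro: Ck_on_const)
qed (simp add: continuous_on_id)

lemma smooth_on_ident: "open S \<Longrightarrow> smooth_on S (\<lambda>x. x)"
  by (simp add: smooth_on_def Ck_on_ident)

lemma smooth_on_bounded_linear: "open S \<Longrightarrow> bounded_linear L \<Longrightarrow> smooth_on S L"
  using smooth_on_bounded_linear_compose[OF _ _ smooth_on_ident] .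

lemma smooth_on_add: "open S \<Longrightarrow> smooth_on S f \<Longrightarrow> smooth_on S g \<Longrightarrow> smooth_on S (\<lambda>x. f x + g x)"
  by (simp add: smooth_on_def Ck_on_add)

lemma smooth_on_Pair: "open S \<Longrightarrow> smooth_on S f \<Longrightarrow> smooth_on S g \<Longrightarrow> smooth_on S (\<lambda>x. (f x, g x))"
  by (simp add: smooth_on_def Ck_on_Pair)

lemma smooth_on_compose:
  fixes f :: "'e::real_normed_vector \<Rightarrow> 'f::real_inner"
  assumes "fin_dim TYPE('f)" "open S" "open T" "f ` S \<subseteq> T" "smooth_on S f" "smooth_on T g"
  shows "smooth_on S (\<lambda>x. g (f x))"
  using assms by (simp add: smooth_on_def Ck_on_compose)

lemma smooth_on_directional_derivative:
  "smooth_on S f \<Longrightarrow> smooth_on S (\<lambda>x. frechet_derivative f (at x) v)"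
  unfolding smooth_on_def by (metis Ck_on.simps(2))

text \<open>The coordinate expression of the differential of a map, as a map between tangent bundles.\<close>

lemma smooth_on_differential:
  fixes f :: "'e::real_inner \<Rightarrow> 'f::real_normed_vector"
  assumes fd: "fin_dim TYPE('e)" and S: "open S" and f: "smooth_on S f"
  shows "smooth_on (S \<times> UNIV) (\<lambda>(x, v). frechet_derivative f (at x) v)"
proof -
  obtain C :: "'e set" and c where C: "finite C" "\<And>b. bounded_linear (c b)"
    "\<And>x. (\<Sum>b\<in>C. c b x *\<^sub>R b) = x"
    using fin_dim_coordinates[OF fd] by metis
  let ?g = "\<lambda>z. \<Sum>b\<in>C. c b (snd z) *\<^sub>R frechet_derivative f (at (fst z)) b"
  have o: "open (S \<times> (UNIV::'e set))" using S by (simp add: open_Times)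
  have "smooth_on (S \<times> (UNIV :: 'e set)) (\<lambda>z. frechet_derivative f (at (fst z)) b)" for b
    using smooth_on_compose[OF fd o S _ _ smooth_on_directional_derivative[OF f, of b], of fst]
      smooth_on_bounded_linear[OF o bounded_linear_fst] by auto
  moreover have "smooth_on (S \<times> UNIV) (\<lambda>z. c b (snd z))" for b
    by (intro smooth_on_bounded_linear[OF o] bounded_linear_compose[OF C(2)] bounded_linear_snd)
  ultimately have g: "smooth_on (S \<times> UNIV) ?g"
    unfolding smooth_on_def by (intro allI Ck_on_sum Ck_on_scaleR o C(1)) simp_all
  have "?g (x, v) = frechet_derivative f (at x) v" if "x \<in> S" for x v
  proof -
    have "linear (frechet_derivative f (at x))" by (rule smooth_on_derivative_linear[OF f that])
    then have "frechet_derivative f (at x) (\<Sum>b\<in>C. c b v *\<^sub>R b) = ?g (x, v)"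
      by (simp add: linear_sum linear_scale)
    then show ?thesis by (simp add: C(3))
  qed
  then show ?thesis by (intro smooth_on_cong[OF o _ g]) auto
qed

section \<open>Tangent vectors to a fibre product\<close>

lemma derivative_near:
  fixes f :: "'e::real_inner \<Rightarrow> 'f::real_normed_vector"
  assumes fd: "fin_dim TYPE('e)" and S: "open S" "p \<in> S" and f: "smooth_on S f" and e: "e > 0"
  shows "\<exists>r>0. ball p r \<subseteq> S \<and> (\<forall>x\<in>ball p r. \<forall>v. norm (frechet_derivative f (at p) v - frechet_derivative f (at x) v) \<le> e * norm v)"
proof -
  obtain C :: "'e set" and c where C: "finite C" "\<And>b. bounded_linear (c b)"
    "\<And>x. (\<Sum>b\<in>C. c b x *\<^sub>R b) = x"
    using fin_dim_coordinates[OF fd] by metis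
  let ?f' = "\<lambda>x. frechet_derivative f (at x)"
  let ?M = "\<lambda>x. \<Sum>b\<in>C. onorm (c b) * norm (?f' p b - ?f' x b)"
  have "isCont (\<lambda>x. ?f' x b) p" for b
    using smooth_on_continuous[OF smooth_on_directional_derivative[OF f]] S continuous_on_eq_continuous_at by blast
  then have "(?M \<longlongrightarrow> (\<Sum>b\<in>C. onorm (c b) * norm (?f' p b - ?f' p b))) (at p)"
    unfolding isCont_def by (intro tendsto_intros)
  then have "isCont ?M p" by (simp add: isCont_def)
  then obtain r1 where r1: "r1 > 0" "\<And>x. dist x p < r1 \<Longrightarrow> dist (?M x) (?M p) < e"
    using e unfolding continuous_at_eps_delta by blast
  obtain r2 where r2: "r2 > 0" "ball p r2 \<subseteq> S" using S openE by metis
  have "norm (?f' p v - ?f' x v) \<le> e * norm v" if x: "x \<in> ball p (min r1 r2)" for x v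
  proof -
    have "?M x \<le> e" using r1(2)[of x] x by (auto simp: dist_commute dist_real_def)
    have L: "linear (?f' p)" "linear (?f' x)"
      using smooth_on_derivative_linear[OF f] S x r2 by auto
    have "?f' p v - ?f' x v = ?f' p (\<Sum>b\<in>C. c b v *\<^sub>R b) - ?f' x (\<Sum>b\<in>C. c b v *\<^sub>R b)" by (simp add: C(3))
    also have "\<dots> = (\<Sum>b\<in>C. c b v *\<^sub>R (?f' p b - ?f' x b))"
      using L by (simp add: linear_sum linear_scale sum_subtractf scaleR_diff_right)
    finally have "norm (?f' p v - ?f' x v) \<le> (\<Sum>b\<in>C. norm (c b v *\<^sub>R (?f' p b - ?f' x b)))"
      by (simp only: norm_sum)
    also have "\<dots> \<le> (\<Sum>b\<in>C. onorm (c b) * norm v * norm (?f' p b - ?f' x b))"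
      using onorm[OF C(2)] by (intro sum_mono) (simp add: mult_right_mono)
    also have "\<dots> = ?M x * norm v" by (simp add: sum_distrib_left mult_ac)
    also have "\<dots> \<le> e * norm v" using \<open>?M x \<le> e\<close> by (intro mult_right_mono) auto
    finally show ?thesis .
  qed
  with r1 r2 show ?thesis by (intro exI[of _ "min r1 r2"]) auto
qed

lemma has_derivative_zero_by_domination:
  fixes e :: "real \<Rightarrow> 'a::real_normed_vector" and z :: "real \<Rightarrow> 'b::real_normed_vector"
  assumes e: "(e has_derivative (\<lambda>t. 0)) (at 0)" "e 0 = 0"
    and z: "\<forall>\<^sub>F t in nhds 0. norm (z t) \<le> 2 * norm (e t)"
  shows "(z has_derivative (\<lambda>t. 0)) (at 0)"
proof -
  have z0: "z 0 = 0" using eventually_nhds_x_imp_x[OF z] e(2) by simp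
  have "(\<lambda>t. norm (e t) / norm t) \<midarrow>0\<rightarrow> 0"
    using e by (simp add: has_derivative_at)
  then have lim: "(\<lambda>t. 2 * (norm (e t) / norm t)) \<midarrow>0\<rightarrow> 0" by (rule tendsto_mult_right_zero)
  have "\<forall>\<^sub>F t in at 0. norm (norm (z t) / norm t) \<le> 2 * (norm (e t) / norm t)"
    using z unfolding eventually_at_filter
    by eventually_elim (auto intro!: divide_right_mono)
  then have "(\<lambda>t. norm (z t) / norm t) \<midarrow>0\<rightarrow> 0" using lim by (rule Lim_null_comparison)
  then show ?thesis by (simp add: has_derivative_at z0)
qed

text \<open>The point is that \<open>(v, u)\<close> is the velocity of a curve in the fibre product \<open>{(x, y). a x = b y}\<close>, on
  which \<open>D\<close> vanishes. The straight line through \<open>(p, q)\<close> leaves the fibre product by an error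
  \<open>\<epsilon> t = b (q + t u) - a (p + t v)\<close>, which is \<open>o(t)\<close> because \<open>a' v = b' u\<close>. With a linear right
  inverse \<open>R\<close> of \<open>a'(p)\<close> the error is corrected by solving \<open>a (p + t v + R z) = b (q + t u)\<close> by
  Newton iteration with frozen derivative; the solution satisfies \<open>|z| \<le> 2 |\<epsilon> t|\<close>, so that
  the correction does not change the velocity.\<close>

lemma derivative_vanishes_along_fibre_product:
  fixes a :: "'e::real_inner \<Rightarrow> 'h::real_inner" and b :: "'f::real_inner \<Rightarrow> 'h"
    and D :: "'e \<times> 'f \<Rightarrow> 'k::real_normed_vector"
  assumes fd: "fin_dim TYPE('e)" "fin_dim TYPE('h)"
    and U: "open U" "p \<in> U" and a: "smooth_on U a" and b: "(b has_derivative b') (at q)"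
    and pq: "a p = b q" and surj: "surj (frechet_derivative a (at p))"
    and D: "(D has_derivative D') (at (p, q))"
    and W: "open W" "(p, q) \<in> W" "\<And>x y. (x, y) \<in> W \<Longrightarrow> a x = b y \<Longrightarrow> D (x, y) = 0"
    and vu: "frechet_derivative a (at p) v = b' u"
  shows "D' (v, u) = 0"
proof -
  let ?a' = "\<lambda>x. frechet_derivative a (at x)"
  have lin: "linear (?a' p)" by (rule smooth_on_derivative_linear[OF a U(2)])
  obtain R where R: "linear R" "?a' p \<circ> R = id"
    using linear_surjective_right_inverse[OF lin surj] by blast
  interpret R: bounded_linear R by (rule fin_dim_linear_bounded[OF fd(2) R(1)])
  obtain K where K: "K > 0" "\<And>x. norm (R x) \<le> norm x * K" using R.pos_bounded by blast
  \<comment> \<open>If \<open>a'\<close> varies by at most \<open>1 / (2 K)\<close> and \<open>|R| \<le> K\<close>, the iteration contracts by the factor \<open>1/2\<close>.\<close>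
  define e where "e = 1 / (2 * K)"
  have e: "e > 0" using K by (simp add: e_def)
  obtain r where r: "r > 0" "ball p r \<subseteq> U"
    "\<And>x v. x \<in> ball p r \<Longrightarrow> norm (?a' p v - ?a' x v) \<le> e * norm v"
    using derivative_near[OF fd(1) U a e] by metis
  define \<epsilon> where "\<epsilon> t = b (q + t *\<^sub>R u) - a (p + t *\<^sub>R v)" for t
  have \<epsilon>: "(\<epsilon> has_derivative (\<lambda>t. 0)) (at 0)" "\<epsilon> 0 = 0"
  proof -
    have "((\<lambda>t. q + t *\<^sub>R u) has_derivative (\<lambda>t. t *\<^sub>R u)) (at 0)"
      "((\<lambda>t. p + t *\<^sub>R v) has_derivative (\<lambda>t. t *\<^sub>R v)) (at 0)"
      by (auto intro!: derivative_eq_intros)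
    moreover have "(b has_derivative b') (at (q + 0 *\<^sub>R u))" "(a has_derivative ?a' p) (at (p + 0 *\<^sub>R v))"
      using b smooth_on_has_derivative[OF a U(2)] by auto
    ultimately have "(\<epsilon> has_derivative (\<lambda>t. b' (t *\<^sub>R u) - ?a' p (t *\<^sub>R v))) (at 0)"
      unfolding \<epsilon>_def by (intro has_derivative_diff) (auto dest: has_derivative_compose)
    moreover have "b' (t *\<^sub>R u) = ?a' p (t *\<^sub>R v)" for t
      using vu lin has_derivative_linear[OF b] by (simp add: linear_scale)
    ultimately show "(\<epsilon> has_derivative (\<lambda>t. 0)) (at 0)" by simp
    show "\<epsilon> 0 = 0" using pq by (simp add: \<epsilon>_def)
  qed
  have "isCont (\<lambda>t. norm (t *\<^sub>R v) + 2 * norm (\<epsilon> t) * K) 0"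
    using has_derivative_continuous[OF \<epsilon>(1)] by (intro continuous_intros) auto
  then have "(\<lambda>t. norm (t *\<^sub>R v) + 2 * norm (\<epsilon> t) * K) \<midarrow>0\<rightarrow> 0"
    using \<epsilon>(2) by (simp add: isCont_def)
  then have "\<forall>\<^sub>F t in at 0. norm (t *\<^sub>R v) + 2 * norm (\<epsilon> t) * K < r"
    using r(1) by (metis order_tendstoD(2))
  then have small: "\<forall>\<^sub>F t in nhds 0. norm (t *\<^sub>R v) + 2 * norm (\<epsilon> t) * K < r"
    using r(1) \<epsilon>(2) unfolding eventually_at_filter by (auto elim: eventually_mono)
  have ex: "\<exists>z. norm z \<le> 2 * norm (\<epsilon> t) \<and> a (p + t *\<^sub>R v + R z) = b (q + t *\<^sub>R u)"
    if t: "norm (t *\<^sub>R v) + 2 * norm (\<epsilon> t) * K < r" for t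
  proof -
    \<comment> \<open>The ball of radius \<open>2 |\<epsilon> t|\<close> is invariant: \<open>T\<close> contracts by \<open>1/2\<close> and \<open>T 0 = \<epsilon> t\<close>.\<close>
    define T where "T z = z - (a (p + t *\<^sub>R v + R z) - b (q + t *\<^sub>R u))" for z
    let ?s = "cball (0::'h) (2 * norm (\<epsilon> t))"
    have in_ball: "p + t *\<^sub>R v + R z \<in> ball p r" if "z \<in> ?s" for z
    proof -
      have "norm (R z) \<le> norm z * K" by (rule K(2))
      also have "\<dots> \<le> 2 * norm (\<epsilon> t) * K" using that K(1) by (intro mult_right_mono) auto
      finally have "norm (t *\<^sub>R v + R z) < r"
        using t norm_triangle_ineq[of "t *\<^sub>R v" "R z"] by linarith
      moreover have "p - (p + t *\<^sub>R v + R z) = - (t *\<^sub>R v + R z)" by (simp add: algebra_simps)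
      ultimately show ?thesis by (simp only: mem_ball dist_norm norm_minus_cancel)
    qed
    have T': "(T has_derivative (\<lambda>w. w - ?a' (p + t *\<^sub>R v + R z) (R w))) (at z within ?s)" if "z \<in> ?s" for z
    proof -
      have "((\<lambda>z. p + t *\<^sub>R v + R z) has_derivative R) (at z within ?s)"
        using has_derivative_add[OF has_derivative_const R.has_derivative[OF has_derivative_ident]] by simp
      moreover have "(a has_derivative ?a' (p + t *\<^sub>R v + R z)) (at (p + t *\<^sub>R v + R z))"
        using in_ball[OF that] r(2) by (intro smooth_on_has_derivative[OF a]) auto
      ultimately have "((\<lambda>z. a (p + t *\<^sub>R v + R z)) has_derivative (\<lambda>w. ?a' (p + t *\<^sub>R v + R z) (R w))) (at z within ?s)"
        by (rule has_derivative_compose)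
      from has_derivative_diff[OF has_derivative_ident has_derivative_diff[OF this has_derivative_const[of "b (q + t *\<^sub>R u)"]]]
      show ?thesis by (simp add: T_def[abs_def])
    qed
    have T'b: "onorm (\<lambda>w. w - ?a' (p + t *\<^sub>R v + R z) (R w)) \<le> 1 / 2" if "z \<in> ?s" for z
    proof (rule onorm_bound)
      fix w
      have w: "?a' p (R w) = w" using fun_cong[OF R(2), of w] by simp
      have "norm (?a' p (R w) - ?a' (p + t *\<^sub>R v + R z) (R w)) \<le> e * norm (R w)"
        by (rule r(3)[OF in_ball[OF that]])
      also have "\<dots> \<le> e * (norm w * K)" using e K(2) by (intro mult_left_mono) auto
      also have "\<dots> = 1 / 2 * norm w" using K(1) by (simp add: e_def)
      finally show "norm (w - ?a' (p + t *\<^sub>R v + R z) (R w)) \<le> 1 / 2 * norm w" by (simp only: w)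
    qed simp
    have lip: "norm (T x - T y) \<le> 1 / 2 * norm (x - y)" if "x \<in> ?s" "y \<in> ?s" for x y
      by (rule differentiable_bound[OF _ T' T'b that]) auto
    have T0: "T 0 = \<epsilon> t" by (simp add: T_def \<epsilon>_def)
    have "T ` ?s \<subseteq> ?s"
    proof safe
      fix z assume z: "z \<in> ?s"
      have "norm (T z - T 0) \<le> 1 / 2 * norm (z - 0)" by (rule lip[OF z]) simp
      then show "T z \<in> ?s" using z T0 norm_triangle_sub[of "T z" "T 0"] by simp
    qed
    moreover have "complete ?s"
      using fin_dim_complete[OF fd(2)] complete_closed_subset[of ?s UNIV] by simp
    moreover have "dist (T x) (T y) \<le> 1 / 2 * dist x y" if "x \<in> ?s" "y \<in> ?s" for x y
      using lip[OF that] by (simp only: dist_norm)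
    ultimately have "\<exists>!z\<in>?s. T z = z"
      by (intro Banach_fix[where c = "1/2"]) simp_all
    then obtain z where "z \<in> ?s" "T z = z" by blast
    then show ?thesis by (intro exI[of _ z]) (simp add: T_def)
  qed
  define z where "z t = (SOME z. norm z \<le> 2 * norm (\<epsilon> t) \<and> a (p + t *\<^sub>R v + R z) = b (q + t *\<^sub>R u))" for t
  have z: "\<forall>\<^sub>F t in nhds 0. norm (z t) \<le> 2 * norm (\<epsilon> t) \<and> a (p + t *\<^sub>R v + R (z t)) = b (q + t *\<^sub>R u)"
    using small by eventually_elim (use someI_ex[OF ex] in \<open>simp add: z_def\<close>)
  then have z': "(z has_derivative (\<lambda>t. 0)) (at 0)"
    by (intro has_derivative_zero_by_domination[OF \<epsilon>]) (auto elim: eventually_mono)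
  have z0: "z 0 = 0" using eventually_nhds_x_imp_x[OF z] \<epsilon>(2) by simp
  define w where "w t = (p + t *\<^sub>R v + R (z t), q + t *\<^sub>R u)" for t
  have w': "(w has_derivative (\<lambda>t. (t *\<^sub>R v, t *\<^sub>R u))) (at 0)"
  proof -
    have "((\<lambda>t. p + t *\<^sub>R v + R (z t)) has_derivative (\<lambda>t. t *\<^sub>R v)) (at 0)"
      using has_derivative_add[OF has_derivative_add[OF has_derivative_const
        has_derivative_scaleR_left[OF has_derivative_ident]] R.has_derivative[OF z']] by (simp add: R.zero)
    moreover have "((\<lambda>t. q + t *\<^sub>R u) has_derivative (\<lambda>t. t *\<^sub>R u)) (at 0)"
      using has_derivative_add[OF has_derivative_const has_derivative_scaleR_left[OF has_derivative_ident]] by simp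
    ultimately show ?thesis unfolding w_def by (rule has_derivative_Pair)
  qed
  have w0: "w 0 = (p, q)" by (simp add: w_def z0 R.zero)
  have "((\<lambda>t. D (w t)) has_derivative (\<lambda>t. D' (t *\<^sub>R v, t *\<^sub>R u))) (at 0)"
    using has_derivative_compose[OF w'] D w0 by simp
  moreover have "\<forall>\<^sub>F t in nhds 0. D (w t) = 0"
  proof -
    have "isCont w 0" by (rule has_derivative_continuous[OF w'])
    then have "(w \<longlongrightarrow> w 0) (nhds 0)" by (simp add: isCont_def tendsto_at_iff_tendsto_nhds)
    then have "\<forall>\<^sub>F t in nhds 0. w t \<in> W" using topological_tendstoD[of w "w 0" "nhds 0" W] W w0 by simp
    with z show ?thesis by eventually_elim (simp add: w_def W(3))
  qed
  then obtain V where V: "open V" "(0::real) \<in> V" "\<forall>t\<in>V. D (w t) = 0"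
    unfolding eventually_nhds by metis
  have "((\<lambda>t. D (w t)) has_derivative (\<lambda>t. 0)) (at 0)"
    by (rule has_derivative_transform_within_open[OF has_derivative_const V(1,2)]) (simp add: V(3))
  ultimately have "(\<lambda>t::real. D' (t *\<^sub>R v, t *\<^sub>R u)) = (\<lambda>t. 0)" by (rule has_derivative_unique)
  from fun_cong[OF this, of 1] show ?thesis by simp
qed

section \<open>Charts and smooth maps\<close>

text \<open>The part of the notion of a manifold that calculus in charts uses; it is inherited by products,
  tangent bundles and tangent spaces.\<close>

definition pre_manifold :: "('a, 'e::real_inner) mfd \<Rightarrow> bool" where
  "pre_manifold M \<longleftrightarrow> fin_dim TYPE('e) \<and> (\<Union>c\<in>atlas M. fst c) = pts M \<and>
     (\<forall>c\<in>atlas M. inj_on (snd c) (fst c) \<and> open (snd c ` fst c)) \<and>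
     (\<forall>c\<in>atlas M. \<forall>d\<in>atlas M. open (snd c ` (fst c \<inter> fst d)) \<and>
        smooth_on (snd c ` (fst c \<inter> fst d)) (coord_change c d id))"

lemma manifold_imp_pre_manifold: "manifold M \<Longrightarrow> pre_manifold M"
  by (simp add: manifold_def pre_manifold_def fin_dim_def)

abbreviation chart_inv :: "('a, 'e) chart \<Rightarrow> 'e \<Rightarrow> 'a" where
  "chart_inv c \<equiv> inv_into (fst c) (snd c)"

definition chart_at :: "('a, 'e) mfd \<Rightarrow> 'a \<Rightarrow> ('a, 'e) chart \<Rightarrow> bool" where
  "chart_at M p c \<longleftrightarrow> c \<in> atlas M \<and> p \<in> fst c"

lemma chart_at_atlas: "chart_at M p c \<Longrightarrow> c \<in> atlas M"
  by (simp add: chart_at_def)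

lemma chart_at_exists: "pre_manifold M \<Longrightarrow> p \<in> pts M \<Longrightarrow> \<exists>c. chart_at M p c"
  unfolding pre_manifold_def chart_at_def by blast

lemma chart_at_pts: "pre_manifold M \<Longrightarrow> chart_at M p c \<Longrightarrow> p \<in> pts M"
  by (auto simp: pre_manifold_def chart_at_def)

lemma chart_subset_pts: "pre_manifold M \<Longrightarrow> c \<in> atlas M \<Longrightarrow> fst c \<subseteq> pts M"
  by (auto simp: pre_manifold_def)

lemma chart_inv_left: "pre_manifold M \<Longrightarrow> c \<in> atlas M \<Longrightarrow> p \<in> fst c \<Longrightarrow> chart_inv c (snd c p) = p"
  by (simp add: pre_manifold_def)

lemma chart_open: "pre_manifold M \<Longrightarrow> c \<in> atlas M \<Longrightarrow> open (snd c ` fst c)"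
  by (simp add: pre_manifold_def)

lemma coord_change_apply:
  "pre_manifold M \<Longrightarrow> c \<in> atlas M \<Longrightarrow> p \<in> fst c \<Longrightarrow> coord_change c d f (snd c p) = snd d (f p)"
  by (simp add: coord_change_def chart_inv_left)

text \<open>Smoothness near \<open>p\<close> relative to one given pair of charts. By the compatibility of charts it holds
  for all pairs around \<open>p\<close> and \<open>f p\<close> if it holds for one (lemma \<open>smooth_atD\<close>), which is what
  makes the definitions of smoothness and of differentials usable.\<close>

definition smooth_in_charts :: "('a, 'e::real_inner) chart \<Rightarrow> ('b, 'f::real_inner) chart \<Rightarrow>
    ('a \<Rightarrow> 'b) \<Rightarrow> 'a \<Rightarrow> bool" where
  "smooth_in_charts c d f p \<longleftrightarrow> (\<exists>V. p \<in> V \<and> V \<subseteq> fst c \<and> f ` V \<subseteq> fst d \<and>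
     open (snd c ` V) \<and> smooth_on (snd c ` V) (coord_change c d f))"

lemma mfd_open_in_chart:
  assumes M: "pre_manifold M" and c: "c \<in> atlas M" and V: "V \<subseteq> fst c" "open (snd c ` V)"
  shows "mfd_open M V"
  unfolding mfd_open_def
proof (intro conjI ballI)
  show "V \<subseteq> pts M" using chart_subset_pts[OF M c] V by blast
next
  fix d assume d: "d \<in> atlas M"
  let ?A = "snd d ` (fst d \<inter> fst c)"
  have "smooth_on ?A (coord_change d c id)" "open ?A"
    using M c d by (auto simp: pre_manifold_def)
  then have "continuous_on ?A (coord_change d c id)" "open ?A"
    using smooth_on_continuous by blast+
  then have "open (?A \<inter> coord_change d c id -` (snd c ` V))"
    using V(2) continuous_open_preimage by blast
  moreover have "?A \<inter> coord_change d c id -` (snd c ` V) = snd d ` (V \<inter> fst d)" (is "?L = ?R")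
  proof
    show "?R \<subseteq> ?L"
    proof
      fix x assume "x \<in> ?R"
      then obtain p where p: "p \<in> V" "p \<in> fst d" "x = snd d p" by blast
      then have "coord_change d c id x = snd c p" using coord_change_apply[OF M d, of p c id] by simp
      then show "x \<in> ?L" using p V(1) by auto
    qed
    show "?L \<subseteq> ?R"
    proof
      fix x assume "x \<in> ?L"
      then obtain p q where p: "p \<in> fst d" "p \<in> fst c" "x = snd d p" and q: "q \<in> V" "coord_change d c id x = snd c q"
        by blast
      have "snd c p = snd c q" using q(2) coord_change_apply[OF M d p(1), of c id] p(3) by simp
      moreover have "q \<in> fst c" using q(1) V(1) by blast
      ultimately have "p = q" using chart_inv_left[OF M c] p(2) by metis
      then show "x \<in> ?R" using p q by blast
    qed
  qed
  ultimately show "open (snd d ` (V \<inter> fst d))" by simp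
qed

lemma mfd_open_pts: "pre_manifold M \<Longrightarrow> mfd_open M (pts M)"
  by (auto simp: mfd_open_def chart_open Int_absorb1 chart_subset_pts)

lemma mfd_open_Int:
  assumes M: "pre_manifold M" and "mfd_open M V" "mfd_open M W" shows "mfd_open M (V \<inter> W)"
  unfolding mfd_open_def
proof (intro conjI ballI)
  show "V \<inter> W \<subseteq> pts M" using assms by (auto simp: mfd_open_def)
  fix c assume c: "c \<in> atlas M"
  have "inj_on (snd c) (fst c)" using M c by (simp add: pre_manifold_def)
  then have "snd c ` (V \<inter> W \<inter> fst c) = snd c ` (V \<inter> fst c) \<inter> snd c ` (W \<inter> fst c)"
    by (auto simp: inj_on_def)
  then show "open (snd c ` (V \<inter> W \<inter> fst c))" using assms c by (auto simp: mfd_open_def)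
qed

lemma smooth_in_chartsD:
  "smooth_in_charts c d f p \<Longrightarrow> p \<in> fst c \<and> f p \<in> fst d"
  by (auto simp: smooth_in_charts_def)

lemma smooth_in_charts_has_derivative:
  assumes "smooth_in_charts c d f p"
  shows "(coord_change c d f has_derivative frechet_derivative (coord_change c d f) (at (snd c p))) (at (snd c p))"
proof -
  obtain V where "p \<in> V" "smooth_on (snd c ` V) (coord_change c d f)"
    using assms by (auto simp: smooth_in_charts_def)
  then show ?thesis by (intro smooth_on_has_derivative) auto
qed

text \<open>The chain rule in charts. Taking \<open>f\<close> or \<open>g\<close> to be the identity yields the rules for a change
  of charts.\<close>

lemma smooth_in_charts_compose:
  fixes c :: "('a, 'e::real_inner) chart" and d :: "('b, 'f::real_inner) chart" and e :: "('c, 'g::real_inner) chart"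
  assumes M: "pre_manifold M" "c \<in> atlas M" and N: "pre_manifold N" "d \<in> atlas N"
    and f: "smooth_in_charts c d f p" and g: "smooth_in_charts d e g (f p)"
  shows "smooth_in_charts c e (\<lambda>x. g (f x)) p"
    and "frechet_derivative (coord_change c e (\<lambda>x. g (f x))) (at (snd c p)) v =
      frechet_derivative (coord_change d e g) (at (snd d (f p))) (frechet_derivative (coord_change c d f) (at (snd c p)) v)"
proof -
  obtain V where V: "p \<in> V" "V \<subseteq> fst c" "f ` V \<subseteq> fst d"
     "open (snd c ` V)" "smooth_on (snd c ` V) (coord_change c d f)"
    using f by (auto simp: smooth_in_charts_def)
  obtain W where W: "f p \<in> W" "W \<subseteq> fst d" "g ` W \<subseteq> fst e"
     "open (snd d ` W)" "smooth_on (snd d ` W) (coord_change d e g)"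
    using g by (auto simp: smooth_in_charts_def)
  let ?V = "V \<inter> f -` W"
  let ?f = "coord_change c d f" and ?g = "coord_change d e g" and ?h = "coord_change c e (\<lambda>x. g (f x))"
  have eq: "snd c ` ?V = snd c ` V \<inter> ?f -` (snd d ` W)" (is "?L = ?R")
  proof
    show "?L \<subseteq> ?R"
    proof
      fix x assume "x \<in> ?L"
      then obtain q where q: "q \<in> V" "f q \<in> W" "x = snd c q" by blast
      then have "?f x = snd d (f q)" using coord_change_apply[OF M, of q d f] V(2) by auto
      then show "x \<in> ?R" using q by blast
    qed
    show "?R \<subseteq> ?L"
    proof
      fix x assume "x \<in> ?R"
      then obtain q y where q: "q \<in> V" "x = snd c q" and y: "y \<in> W" "?f x = snd d y" by blast
      have "snd d (f q) = snd d y" using q y coord_change_apply[OF M, of q d f] V(2) by auto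
      moreover have "f q \<in> fst d" "y \<in> fst d" using q y V W by blast+
      ultimately have "f q = y" using chart_inv_left[OF N] by metis
      then show "x \<in> ?L" using q y by blast
    qed
  qed
  have o: "open (snd c ` ?V)"
    unfolding eq using smooth_on_continuous[OF V(5)] V(4) W(4) continuous_open_preimage by blast
  have h: "?g (?f x) = ?h x" if "x \<in> snd c ` ?V" for x
  proof -
    obtain q where q: "q \<in> ?V" "x = snd c q" using \<open>x \<in> snd c ` ?V\<close> by blast
    then have "q \<in> fst c" "f q \<in> fst d" using V W by blast+
    then show ?thesis using q by (simp add: coord_change_apply[OF M] coord_change_apply[OF N])
  qed
  have fd: "fin_dim TYPE('f)" using N by (simp add: pre_manifold_def)
  have "smooth_on (snd c ` ?V) (\<lambda>x. ?g (?f x))"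
    by (rule smooth_on_compose[OF fd o W(4) _ _ W(5)])
      (use eq smooth_on_subset[OF V(5)] in auto)
  then have "smooth_on (snd c ` ?V) ?h" by (rule smooth_on_cong[OF o h, rotated])
  then show "smooth_in_charts c e (\<lambda>x. g (f x)) p"
    unfolding smooth_in_charts_def using o V W by (intro exI[of _ ?V]) auto
  have fp: "?f (snd c p) = snd d (f p)" using V coord_change_apply[OF M] by blast
  have d: "((\<lambda>x. ?g (?f x)) has_derivative
      (\<lambda>v. frechet_derivative ?g (at (snd d (f p))) (frechet_derivative ?f (at (snd c p)) v))) (at (snd c p))"
    using has_derivative_compose[OF smooth_in_charts_has_derivative[OF f]]
      smooth_in_charts_has_derivative[OF g] fp by simp
  have "(?h has_derivative
      (\<lambda>v. frechet_derivative ?g (at (snd d (f p))) (frechet_derivative ?f (at (snd c p)) v))) (at (snd c p))"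
    by (rule has_derivative_transform_within_open[OF d o _ h]) (use V W in auto)
  from frechet_derivative_at[OF this]
  show "frechet_derivative ?h (at (snd c p)) v =
      frechet_derivative ?g (at (snd d (f p))) (frechet_derivative ?f (at (snd c p)) v)" by metis
qed

lemma smooth_in_charts_id:
  assumes M: "pre_manifold M" and "chart_at M p c" "chart_at M p d"
  shows "smooth_in_charts c d (\<lambda>x. x) p"
  unfolding smooth_in_charts_def using assms
  by (intro exI[of _ "fst c \<inter> fst d"]) (auto simp: pre_manifold_def chart_at_def id_def)

lemma derivative_identity_chart:
  assumes M: "pre_manifold M" and c: "chart_at M p c"
  shows "frechet_derivative (coord_change c c (\<lambda>x. x)) (at (snd c p)) v = v"
proof -
  have "coord_change c c (\<lambda>x. x) y = y" if "y \<in> snd c ` fst c" for y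
    using that coord_change_apply[OF M chart_at_atlas[OF c], of _ c "\<lambda>x. x"] by auto
  then have "(coord_change c c (\<lambda>x. x) has_derivative (\<lambda>v. v)) (at (snd c p))"
    using c by (intro has_derivative_transform_within_open[OF has_derivative_ident chart_open[OF M chart_at_atlas[OF c]]])
      (auto simp: chart_at_def)
  then show ?thesis using frechet_derivative_at by metis
qed

lemma smooth_in_charts_cong:
  assumes M: "pre_manifold M" "c \<in> atlas M" and f: "smooth_in_charts c d f p"
    and W: "mfd_open M W" "p \<in> W" "\<And>x. x \<in> W \<Longrightarrow> f x = g x"
  shows "smooth_in_charts c d g p"
    and "frechet_derivative (coord_change c d f) (at (snd c p)) = frechet_derivative (coord_change c d g) (at (snd c p))"
proof -
  obtain V where V: "p \<in> V" "V \<subseteq> fst c" "f ` V \<subseteq> fst d"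
     "open (snd c ` V)" "smooth_on (snd c ` V) (coord_change c d f)"
    using f by (auto simp: smooth_in_charts_def)
  have "mfd_open M (V \<inter> W)" by (intro mfd_open_Int mfd_open_in_chart[OF _ M(2)] M V W)
  then have o: "open (snd c ` (V \<inter> W))" using V(2) M(2) by (auto simp: mfd_open_def Int_absorb2 le_infI1)
  have eq: "coord_change c d f x = coord_change c d g x" if "x \<in> snd c ` (V \<inter> W)" for x
  proof -
    from that obtain q where q: "q \<in> V" "q \<in> W" "x = snd c q" by blast
    then have "q \<in> fst c" using V by blast
    then show ?thesis by (simp add: coord_change_apply[OF M] q(3) W(3)[OF q(2)])
  qed
  have "smooth_on (snd c ` (V \<inter> W)) (coord_change c d g)"
    by (rule smooth_on_cong[OF o eq]) (use smooth_on_subset[OF V(5), of "snd c ` (V \<inter> W)"] in blast)+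
  then show "smooth_in_charts c d g p"
    unfolding smooth_in_charts_def using o V W
    by (intro exI[of _ "V \<inter> W"] conjI) (auto simp flip: W(3))
  have "(coord_change c d g has_derivative frechet_derivative (coord_change c d f) (at (snd c p))) (at (snd c p))"
    by (rule has_derivative_transform_within_open[OF smooth_in_charts_has_derivative[OF f] o _ eq]) (use V W in auto)
  then show "frechet_derivative (coord_change c d f) (at (snd c p)) = frechet_derivative (coord_change c d g) (at (snd c p))"
    using frechet_derivative_at by metis
qed

lemma smooth_at_iff:
  assumes M: "pre_manifold M" and N: "pre_manifold N"
  shows "smooth_at M N f p \<longleftrightarrow> (\<exists>c d. chart_at M p c \<and> chart_at N (f p) d \<and> smooth_in_charts c d f p)"
proof
  assume "smooth_at M N f p"
  then obtain c d W where W: "c \<in> atlas M" "d \<in> atlas N" "mfd_open M W" "p \<in> W" "W \<subseteq> fst c"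
     "f ` W \<subseteq> fst d" "smooth_on (snd c ` W) (coord_change c d f)"
    unfolding smooth_at_def by blast
  then have "open (snd c ` W)" by (auto simp: mfd_open_def Int_absorb2)
  with W show "\<exists>c d. chart_at M p c \<and> chart_at N (f p) d \<and> smooth_in_charts c d f p"
    unfolding smooth_in_charts_def chart_at_def by blast
next
  assume "\<exists>c d. chart_at M p c \<and> chart_at N (f p) d \<and> smooth_in_charts c d f p"
  then show "smooth_at M N f p"
    unfolding smooth_in_charts_def chart_at_def smooth_at_def
    using mfd_open_in_chart[OF M] by meson
qed

lemma smooth_atI:
  assumes "pre_manifold M" "pre_manifold N" "c \<in> atlas M" "d \<in> atlas N" "smooth_in_charts c d f p"
  shows "smooth_at M N f p"
  unfolding smooth_at_iff[OF assms(1,2)] using assms smooth_in_chartsD[OF assms(5)] unfolding chart_at_def by blast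

lemma smooth_atD:
  assumes M: "pre_manifold M" and N: "pre_manifold N" and f: "smooth_at M N f p"
    and c: "chart_at M p c" and d: "chart_at N (f p) d"
  shows "smooth_in_charts c d f p"
proof -
  obtain c0 d0 where h: "chart_at M p c0" "chart_at N (f p) d0" "smooth_in_charts c0 d0 f p"
    using f unfolding smooth_at_iff[OF M N] by blast
  note 1 = smooth_in_charts_compose(1)[OF M chart_at_atlas[OF c] M chart_at_atlas[OF h(1)] smooth_in_charts_id[OF M c h(1)] h(3)]
  show ?thesis
    using smooth_in_charts_compose(1)[OF M chart_at_atlas[OF c] N chart_at_atlas[OF h(2)] 1 smooth_in_charts_id[OF N h(2) d]] .
qed

lemma smooth_at_pts:
  assumes "pre_manifold M" "pre_manifold N" "smooth_at M N f p" shows "p \<in> pts M" "f p \<in> pts N"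
  using assms unfolding smooth_at_iff[OF assms(1,2)] using chart_at_pts by metis+

lemma smooth_at_compose:
  assumes M: "pre_manifold M" and N: "pre_manifold N" and P: "pre_manifold P"
    and f: "smooth_at M N f p" and g: "smooth_at N P g (f p)"
  shows "smooth_at M P (\<lambda>x. g (f x)) p"
proof -
  obtain c d where h: "chart_at M p c" "chart_at N (f p) d" "smooth_in_charts c d f p"
    using f unfolding smooth_at_iff[OF M N] by blast
  obtain e where e: "chart_at P (g (f p)) e" using smooth_at_pts[OF N P g] chart_at_exists[OF P] by blast
  show ?thesis unfolding smooth_at_iff[OF M P]
    using smooth_in_charts_compose(1)[OF M chart_at_atlas[OF h(1)] N chart_at_atlas[OF h(2)] h(3)]
      smooth_atD[OF N P g h(2) e] h e by blast
qed

lemma smooth_at_cong: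
  assumes M: "pre_manifold M" and N: "pre_manifold N" and f: "smooth_at M N f p"
    and W: "mfd_open M W" "p \<in> W" "\<And>x. x \<in> W \<Longrightarrow> f x = g x"
  shows "smooth_at M N g p"
proof -
  obtain c d where h: "chart_at M p c" "chart_at N (f p) d" "smooth_in_charts c d f p"
    using f unfolding smooth_at_iff[OF M N] by blast
  then show ?thesis using smooth_in_charts_cong(1)[OF M chart_at_atlas[OF h(1)] h(3) W] smooth_atI[OF M N]
    chart_at_atlas by metis
qed

lemma smooth_mapD: "smooth_map M N f \<Longrightarrow> p \<in> pts M \<Longrightarrow> smooth_at M N f p"
  and smooth_map_pts: "smooth_map M N f \<Longrightarrow> p \<in> pts M \<Longrightarrow> f p \<in> pts N"
  by (auto simp: smooth_map_def)

lemma smooth_mapI: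
  assumes "pre_manifold M" "pre_manifold N" "\<And>p. p \<in> pts M \<Longrightarrow> smooth_at M N f p"
  shows "smooth_map M N f"
  using assms smooth_at_pts[OF assms(1,2)] by (auto simp: smooth_map_def)

lemma smooth_map_compose:
  assumes "pre_manifold M" "pre_manifold N" "pre_manifold P" "smooth_map M N f" "smooth_map N P g"
  shows "smooth_map M P (\<lambda>x. g (f x))"
  by (rule smooth_mapI[OF assms(1,3)])
    (rule smooth_at_compose[OF assms(1-3) smooth_mapD[OF assms(4)] smooth_mapD[OF assms(5) smooth_map_pts[OF assms(4)]]])

lemma smooth_map_cong:
  assumes "pre_manifold M" "pre_manifold N" "smooth_map M N f" "\<And>x. x \<in> pts M \<Longrightarrow> f x = g x"
  shows "smooth_map M N g"
  by (rule smooth_mapI[OF assms(1,2)])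
    (rule smooth_at_cong[OF assms(1,2) smooth_mapD[OF assms(3)] mfd_open_pts[OF assms(1)] _ assms(4)])

lemma smooth_map_id: "pre_manifold M \<Longrightarrow> smooth_map M M (\<lambda>x. x)"
  using smooth_in_charts_id chart_at_exists
  by (fastforce intro!: smooth_mapI simp: smooth_at_iff)

lemma smooth_map_const:
  assumes M: "pre_manifold M" and N: "pre_manifold N" and y: "y \<in> pts N"
  shows "smooth_map M N (\<lambda>x. y)"
proof (intro smooth_mapI M N)
  fix p assume "p \<in> pts M"
  then obtain c where c: "chart_at M p c" using chart_at_exists[OF M] by blast
  obtain d where d: "chart_at N y d" using chart_at_exists[OF N y] by blast
  have "coord_change c d (\<lambda>x. y) = (\<lambda>x. snd d y)" by (auto simp: coord_change_def)
  then have "smooth_in_charts c d (\<lambda>x. y) p"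
    unfolding smooth_in_charts_def using c d chart_open[OF M chart_at_atlas[OF c]]
    by (intro exI[of _ "fst c"]) (auto simp: chart_at_def smooth_on_const)
  then show "smooth_at M N (\<lambda>x. y) p" using smooth_atI[OF M N] c d chart_at_atlas by metis
qed

section \<open>Tangent vectors and differentials\<close>

lemma pts_TM: "v \<in> pts (TM M) \<longleftrightarrow> fst v \<in> pts M \<and> snd v \<in> tspace M (fst v)"
  by (cases v) (simp add: TM_def)

lemma tvec_chart: "pre_manifold M \<Longrightarrow> v \<in> pts (TM M) \<Longrightarrow> \<exists>c. chart_at M (fst v) c"
  by (erule chart_at_exists) (simp add: pts_TM)

lemma tspace_zero: "X \<in> tspace M p \<Longrightarrow> \<not> chart_at M p c \<Longrightarrow> X c = 0"
  unfolding tspace_def chart_at_def by blast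

lemma tspace_change:
  "X \<in> tspace M p \<Longrightarrow> chart_at M p c \<Longrightarrow> chart_at M p d \<Longrightarrow>
     X d = frechet_derivative (coord_change c d (\<lambda>x. x)) (at (snd c p)) (X c)"
  by (auto simp: tspace_def chart_at_def id_def)

lemma tspace_eqI:
  assumes "X \<in> tspace M p" "Y \<in> tspace M p" "chart_at M p c" "X c = Y c"
  shows "X = Y"
proof
  fix d show "X d = Y d"
  proof (cases "chart_at M p d")
    case True
    then show ?thesis
      using tspace_change[OF assms(1,3) True] tspace_change[OF assms(2,3) True] assms(4) by simp
  qed (simp add: tspace_zero[OF assms(1)] tspace_zero[OF assms(2)])
qed

lemma tvec_eqI:
  assumes "u \<in> pts (TM M)" "v \<in> pts (TM M)" "fst u = fst v" "chart_at M (fst u) c" "snd u c = snd v c"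
  shows "u = v"
  using assms tspace_eqI[of "snd u" M "fst u" "snd v" c] by (auto simp: pts_TM prod_eq_iff)

lemma tspaceI:
  assumes "\<And>c. \<not> chart_at M p c \<Longrightarrow> X c = 0"
    and "\<And>c d. chart_at M p c \<Longrightarrow> chart_at M p d \<Longrightarrow>
      X d = frechet_derivative (coord_change c d (\<lambda>x. x)) (at (snd c p)) (X c)"
  shows "X \<in> tspace M p"
  using assms unfolding tspace_def chart_at_def id_def by blast

text \<open>A tangent vector is determined by, and can be prescribed by, its coordinates in a single chart;
  the cocycle condition is the chain rule for changes of coordinates.\<close>

lemma tspace_exists:
  assumes M: "pre_manifold M" and c: "chart_at M p c"
  shows "\<exists>X\<in>tspace M p. X c = e"
proof -
  define X where "X d = (if chart_at M p d then frechet_derivative (coord_change c d (\<lambda>x. x)) (at (snd c p)) e else 0)" for d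
  have "X \<in> tspace M p"
  proof (rule tspaceI)
    fix d d' assume d: "chart_at M p d" and d': "chart_at M p d'"
    show "X d' = frechet_derivative (coord_change d d' (\<lambda>x. x)) (at (snd d p)) (X d)"
      using smooth_in_charts_compose(2)[OF M chart_at_atlas[OF c] M chart_at_atlas[OF d]
        smooth_in_charts_id[OF M c d] smooth_in_charts_id[OF M d d']] d d' by (simp add: X_def)
  qed (simp add: X_def)
  moreover have "X c = e" using derivative_identity_chart[OF M c] c by (simp add: X_def)
  ultimately show ?thesis by blast
qed

lemma fst_tmap [simp]: "fst (tmap M N f v) = f (fst v)"
  by (simp add: tmap_def)

text \<open>Independence of the chart selected in the definition of the differential, by the chain rule and the
  cocycle condition.\<close>

lemma tmap_chart:
  assumes M: "pre_manifold M" and N: "pre_manifold N" and f: "smooth_at M N f p"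
    and X: "v \<in> pts (TM M)" "fst v = p" and c: "chart_at M p c" and d: "chart_at N (f p) d"
  shows "snd (tmap M N f v) d = frechet_derivative (coord_change c d f) (at (snd c p)) (snd v c)"
proof -
  define c' where "c' = (SOME c. c \<in> atlas M \<and> fst v \<in> fst c)"
  have c': "chart_at M p c'"
    using someI[of "\<lambda>c. c \<in> atlas M \<and> fst v \<in> fst c" c] c X by (simp add: c'_def chart_at_def)
  have "snd (tmap M N f v) d = frechet_derivative (coord_change c' d f) (at (snd c' p)) (snd v c')"
    using d X by (simp add: tmap_def Let_def c'_def chart_at_def)
  also have "snd v c' = frechet_derivative (coord_change c c' (\<lambda>x. x)) (at (snd c p)) (snd v c)"
    using X c c' tspace_change[of "snd v" M p c c'] by (simp add: pts_TM)
  also have "frechet_derivative (coord_change c' d f) (at (snd c' p)) \<dots> =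
      frechet_derivative (coord_change c d f) (at (snd c p)) (snd v c)"
    using smooth_in_charts_compose(2)[OF M chart_at_atlas[OF c] M chart_at_atlas[OF c']
        smooth_in_charts_id[OF M c c'] smooth_atD[OF M N f c' d]] by simp
  finally show ?thesis .
qed

lemma tmap_zero: "\<not> chart_at N (f (fst v)) d \<Longrightarrow> snd (tmap M N f v) d = 0"
  by (auto simp: tmap_def chart_at_def)

lemma tmap_pts:
  assumes M: "pre_manifold M" and N: "pre_manifold N" and f: "smooth_at M N f (fst v)"
    and v: "v \<in> pts (TM M)"
  shows "tmap M N f v \<in> pts (TM N)"
proof -
  obtain c where c: "chart_at M (fst v) c" using tvec_chart[OF M v] by blast
  have "snd (tmap M N f v) \<in> tspace N (f (fst v))"
  proof (rule tspaceI)
    fix d d' assume d: "chart_at N (f (fst v)) d" and d': "chart_at N (f (fst v)) d'"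
    show "snd (tmap M N f v) d' = frechet_derivative (coord_change d d' (\<lambda>x. x)) (at (snd d (f (fst v)))) (snd (tmap M N f v) d)"
      using smooth_in_charts_compose(2)[OF M chart_at_atlas[OF c] N chart_at_atlas[OF d]
          smooth_atD[OF M N f c d] smooth_in_charts_id[OF N d d']]
      by (simp add: tmap_chart[OF M N f v refl c d] tmap_chart[OF M N f v refl c d'])
  qed (rule tmap_zero)
  then show ?thesis using smooth_at_pts[OF M N f] by (simp add: pts_TM)
qed

lemma tmap_compose:
  assumes M: "pre_manifold M" and N: "pre_manifold N" and P: "pre_manifold P"
    and f: "smooth_at M N f (fst v)" and g: "smooth_at N P g (f (fst v))" and v: "v \<in> pts (TM M)"
  shows "tmap N P g (tmap M N f v) = tmap M P (\<lambda>x. g (f x)) v"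
proof -
  obtain c where c: "chart_at M (fst v) c" using tvec_chart[OF M v] by blast
  obtain d where d: "chart_at N (f (fst v)) d"
    using chart_at_exists[OF N] smooth_at_pts[OF M N f] by blast
  obtain e where e: "chart_at P (g (f (fst v))) e"
    using chart_at_exists[OF P] smooth_at_pts[OF N P g] by blast
  have fv: "tmap M N f v \<in> pts (TM N)" by (rule tmap_pts[OF M N f v])
  have gf: "smooth_at M P (\<lambda>x. g (f x)) (fst v)" by (rule smooth_at_compose[OF M N P f g])
  show ?thesis
  proof (rule tvec_eqI)
    show "tmap N P g (tmap M N f v) \<in> pts (TM P)" using tmap_pts[OF N P _ fv] g by simp
    show "tmap M P (\<lambda>x. g (f x)) v \<in> pts (TM P)" by (rule tmap_pts[OF M P gf v])
    show "chart_at P (fst (tmap N P g (tmap M N f v))) e" using e by simp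
    show "snd (tmap N P g (tmap M N f v)) e = snd (tmap M P (\<lambda>x. g (f x)) v) e"
      using smooth_in_charts_compose(2)[OF M chart_at_atlas[OF c] N chart_at_atlas[OF d]
          smooth_atD[OF M N f c d] smooth_atD[OF N P g d e]]
      by (simp add: tmap_chart[OF N P g fv _ d e] tmap_chart[OF M N f v refl c d] tmap_chart[OF M P gf v refl c e])
  qed simp
qed

lemma tmap_cong:
  assumes M: "pre_manifold M" and N: "pre_manifold N" and f: "smooth_at M N f (fst v)" and v: "v \<in> pts (TM M)"
    and W: "mfd_open M W" "fst v \<in> W" "\<And>x. x \<in> W \<Longrightarrow> f x = g x"
  shows "tmap M N f v = tmap M N g v"
proof -
  obtain c where c: "chart_at M (fst v) c" using tvec_chart[OF M v] by blast
  have fg: "f (fst v) = g (fst v)" by (rule W(3)[OF W(2)])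
  have g: "smooth_at M N g (fst v)" by (rule smooth_at_cong[OF M N f W])
  have "snd (tmap M N f v) d = snd (tmap M N g v) d" for d
  proof (cases "chart_at N (f (fst v)) d")
    case True
    then show ?thesis
      using smooth_in_charts_cong(2)[OF M chart_at_atlas[OF c] smooth_atD[OF M N f c True] W] fg
      by (simp add: tmap_chart[OF M N f v refl c] tmap_chart[OF M N g v refl c])
  next
    case False
    then show ?thesis using fg by (simp add: tmap_zero)
  qed
  with fg show ?thesis by (simp add: prod_eq_iff fun_eq_iff)
qed

lemma tmap_cong_pts:
  assumes "pre_manifold M" "pre_manifold N" "smooth_map M N f" "v \<in> pts (TM M)"
    and "\<And>x. x \<in> pts M \<Longrightarrow> f x = g x"
  shows "tmap M N f v = tmap M N g v"
  using tmap_cong[OF assms(1,2) smooth_mapD[OF assms(3)] assms(4) mfd_open_pts[OF assms(1)] _ assms(5)] assms(4)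
  unfolding pts_TM by blast

lemma tmap_ident:
  assumes M: "pre_manifold M" and v: "v \<in> pts (TM M)"
  shows "tmap M M (\<lambda>x. x) v = v"
proof -
  obtain c where c: "chart_at M (fst v) c" using tvec_chart[OF M v] by blast
  have i: "smooth_at M M (\<lambda>x. x) (fst v)" using smooth_mapD[OF smooth_map_id[OF M]] v by (simp add: pts_TM)
  show ?thesis
    by (rule tvec_eqI[OF tmap_pts[OF M M i v] v, of c])
      (simp_all add: c tmap_chart[OF M M i v refl c c] derivative_identity_chart[OF M c])
qed

lemma fst_tlin [simp]: "fst (tlin a u b v) = fst u"
  and snd_tlin [simp]: "snd (tlin a u b v) c = a *\<^sub>R snd u c + b *\<^sub>R snd v c"
  by (simp_all add: tlin_def)

lemma tlin_pts:
  assumes M: "pre_manifold M" and u: "u \<in> pts (TM M)" and v: "v \<in> pts (TM M)" and uv: "fst u = fst v"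
  shows "tlin a u b v \<in> pts (TM M)"
proof -
  have "snd (tlin a u b v) \<in> tspace M (fst u)"
  proof (rule tspaceI)
    fix c d assume c: "chart_at M (fst u) c" and d: "chart_at M (fst u) d"
    have "linear (frechet_derivative (coord_change c d (\<lambda>x. x)) (at (snd c (fst u))))"
      using smooth_in_charts_has_derivative[OF smooth_in_charts_id[OF M c d]] by (rule has_derivative_linear)
    then show "snd (tlin a u b v) d = frechet_derivative (coord_change c d (\<lambda>x. x)) (at (snd c (fst u))) (snd (tlin a u b v) c)"
      using tspace_change[OF _ c d] u v uv by (simp add: linear_add linear_scale pts_TM)
  qed (use tspace_zero[of "snd u" M "fst u"] tspace_zero[of "snd v" M "fst v"] u v uv in \<open>simp add: pts_TM\<close>)
  then show ?thesis using u by (simp add: pts_TM)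
qed

lemma tmap_tlin:
  assumes M: "pre_manifold M" and N: "pre_manifold N" and f: "smooth_at M N f (fst u)"
    and u: "u \<in> pts (TM M)" and v: "v \<in> pts (TM M)" and uv: "fst u = fst v"
  shows "tmap M N f (tlin a u b v) = tlin a (tmap M N f u) b (tmap M N f v)"
proof -
  obtain c where c: "chart_at M (fst u) c" using tvec_chart[OF M u] by blast
  have fv: "fst (tlin a u b v) = fst u" by (simp add: tlin_def)
  have "snd (tmap M N f (tlin a u b v)) d = snd (tlin a (tmap M N f u) b (tmap M N f v)) d" for d
  proof (cases "chart_at N (f (fst u)) d")
    case True
    have "linear (frechet_derivative (coord_change c d f) (at (snd c (fst u))))"
      using smooth_in_charts_has_derivative[OF smooth_atD[OF M N f c True]] by (rule has_derivative_linear)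
    then show ?thesis
      by (simp del: fst_tlin add: tmap_chart[OF M N f tlin_pts[OF M u v uv] fv c True] tmap_chart[OF M N f u refl c True]
          tmap_chart[OF M N f v uv[symmetric] c True] linear_add linear_scale)
  next
    case False
    then show ?thesis using uv by (simp add: tmap_zero)
  qed
  then show ?thesis by (simp add: prod_eq_iff fun_eq_iff)
qed

section \<open>Products\<close>

definition prod_chart :: "('a, 'e) chart \<Rightarrow> ('b, 'f) chart \<Rightarrow> ('a \<times> 'b, 'e \<times> 'f) chart" where
  "prod_chart c d = (fst c \<times> fst d, map_prod (snd c) (snd d))"

lemma pts_prod_mfd [simp]: "pts (prod_mfd M N) = pts M \<times> pts N"
  by (simp add: prod_mfd_def)

lemma atlas_prod_mfd: "e \<in> atlas (prod_mfd M N) \<longleftrightarrow> (\<exists>c\<in>atlas M. \<exists>d\<in>atlas N. e = prod_chart c d)"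
  unfolding prod_mfd_def prod_chart_def mfd.simps by blast

lemma fst_prod_chart [simp]: "fst (prod_chart c d) = fst c \<times> fst d"
  and snd_prod_chart [simp]: "snd (prod_chart c d) = map_prod (snd c) (snd d)"
  by (simp_all add: prod_chart_def)

lemma image_map_prod_Times: "map_prod f g ` (A \<times> B) = f ` A \<times> g ` B"
  by auto

lemma prod_chart_inv:
  assumes "pre_manifold M" "c \<in> atlas M" "pre_manifold N" "d \<in> atlas N" "p \<in> fst c" "q \<in> fst d"
  shows "chart_inv (prod_chart c d) (snd c p, snd d q) = (p, q)"
proof -
  have "inj_on (snd (prod_chart c d)) (fst (prod_chart c d))"
    using assms by (auto simp: pre_manifold_def intro: map_prod_inj_on)
  from inv_into_f_f[OF this, of "(p, q)"] assms show ?thesis by simp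
qed

lemma pre_manifold_prod:
  fixes M :: "('a, 'e::real_inner) mfd" and N :: "('b, 'f::real_inner) mfd"
  assumes M: "pre_manifold M" and N: "pre_manifold N"
  shows "pre_manifold (prod_mfd M N)"
  unfolding pre_manifold_def
proof (intro conjI ballI)
  show "fin_dim TYPE('e \<times> 'f)" using assms by (simp add: pre_manifold_def fin_dim_prod)
  show "(\<Union>e\<in>atlas (prod_mfd M N). fst e) = pts (prod_mfd M N)"
  proof -
    have "(\<Union>e\<in>atlas (prod_mfd M N). fst e) = (\<Union>c\<in>atlas M. fst c) \<times> (\<Union>d\<in>atlas N. fst d)"
      by (auto simp: prod_mfd_def) blast
    then show ?thesis using assms by (simp add: pre_manifold_def)
  qed
next
  fix e assume "e \<in> atlas (prod_mfd M N)"
  then obtain c d where e: "c \<in> atlas M" "d \<in> atlas N" "e = prod_chart c d" by (auto simp: atlas_prod_mfd)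
  then show "inj_on (snd e) (fst e)" using assms by (auto simp: pre_manifold_def intro: map_prod_inj_on)
  show "open (snd e ` fst e)"
    using e chart_open[OF M] chart_open[OF N] by (simp add: image_map_prod_Times open_Times)
  fix e' assume "e' \<in> atlas (prod_mfd M N)"
  then obtain c' d' where e': "c' \<in> atlas M" "d' \<in> atlas N" "e' = prod_chart c' d'" by (auto simp: atlas_prod_mfd)
  let ?A = "snd c ` (fst c \<inter> fst c')" and ?B = "snd d ` (fst d \<inter> fst d')"
  have AB: "snd e ` (fst e \<inter> fst e') = ?A \<times> ?B"
    using e e' by (simp add: Times_Int_Times image_map_prod_Times)
  have A: "open ?A" "smooth_on ?A (coord_change c c' id)"
    using M e e' by (auto simp: pre_manifold_def)
  have B: "open ?B" "smooth_on ?B (coord_change d d' id)"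
    using N e e' by (auto simp: pre_manifold_def)
  show o: "open (snd e ` (fst e \<inter> fst e'))" unfolding AB using A B by (simp add: open_Times)
  have fd: "fin_dim TYPE('e)" "fin_dim TYPE('f)" using assms by (auto simp: pre_manifold_def)
  have s: "smooth_on (?A \<times> ?B) (\<lambda>z. (coord_change c c' id (fst z), coord_change d d' id (snd z)))"
    using A B fd
    by (intro smooth_on_Pair smooth_on_compose[OF _ _ A(1) _ _ A(2)] smooth_on_compose[OF _ _ B(1) _ _ B(2)]
        smooth_on_bounded_linear bounded_linear_fst bounded_linear_snd) (auto simp: open_Times)
  show "smooth_on (snd e ` (fst e \<inter> fst e')) (coord_change e e' id)"
    unfolding AB
  proof (rule smooth_on_cong[OF _ _ s])
    show "open (?A \<times> ?B)" using o AB by simp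
    fix z assume "z \<in> ?A \<times> ?B"
    then obtain p q where z: "z = (snd c p, snd d q)" "p \<in> fst c" "q \<in> fst d" by auto
    then show "(coord_change c c' id (fst z), coord_change d d' id (snd z)) = coord_change e e' id z"
      using prod_chart_inv[OF M e(1) N e(2) z(2,3)] e e'
      by (simp add: coord_change_apply[OF M] coord_change_apply[OF N]) (simp add: coord_change_def)
  qed
qed

lemma chart_at_prod: "chart_at M p c \<Longrightarrow> chart_at N q d \<Longrightarrow> chart_at (prod_mfd M N) (p, q) (prod_chart c d)"
  by (auto simp: chart_at_def atlas_prod_mfd)

lemma smooth_in_charts_Pair:
  assumes P: "pre_manifold P" "e \<in> atlas P" and a: "smooth_in_charts e c a p" and b: "smooth_in_charts e d b p"
  shows "smooth_in_charts e (prod_chart c d) (\<lambda>x. (a x, b x)) p"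
proof -
  obtain V where V: "p \<in> V" "V \<subseteq> fst e" "a ` V \<subseteq> fst c" "open (snd e ` V)" "smooth_on (snd e ` V) (coord_change e c a)"
    using a by (auto simp: smooth_in_charts_def)
  obtain W where W: "p \<in> W" "W \<subseteq> fst e" "b ` W \<subseteq> fst d" "open (snd e ` W)" "smooth_on (snd e ` W) (coord_change e d b)"
    using b by (auto simp: smooth_in_charts_def)
  have "mfd_open P (V \<inter> W)" by (intro mfd_open_Int mfd_open_in_chart[OF _ P(2)] P V W)
  then have "open (snd e ` (V \<inter> W \<inter> fst e))" using P(2) by (auto simp: mfd_open_def)
  moreover have "V \<inter> W \<inter> fst e = V \<inter> W" using V by blast
  ultimately have o: "open (snd e ` (V \<inter> W))" by simp
  have eq: "coord_change e (prod_chart c d) (\<lambda>x. (a x, b x)) = (\<lambda>x. (coord_change e c a x, coord_change e d b x))"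
    by (auto simp: coord_change_def)
  have "smooth_on (snd e ` (V \<inter> W)) (coord_change e (prod_chart c d) (\<lambda>x. (a x, b x)))"
    unfolding eq using smooth_on_subset[OF V(5), of "snd e ` (V \<inter> W)"] smooth_on_subset[OF W(5), of "snd e ` (V \<inter> W)"]
    by (intro smooth_on_Pair[OF o]) blast+
  then show ?thesis unfolding smooth_in_charts_def using o V W by (intro exI[of _ "V \<inter> W"]) auto
qed

lemma smooth_in_charts_fst_snd:
  assumes M: "pre_manifold M" "chart_at M p c" and N: "pre_manifold N" "chart_at N q d"
  shows "smooth_in_charts (prod_chart c d) c fst (p, q)"
    and "smooth_in_charts (prod_chart c d) d snd (p, q)"
    and "frechet_derivative (coord_change (prod_chart c d) c fst) (at (snd c p, snd d q)) = fst"
    and "frechet_derivative (coord_change (prod_chart c d) d snd) (at (snd c p, snd d q)) = snd"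
proof -
  let ?S = "snd (prod_chart c d) ` fst (prod_chart c d)"
  note cd = chart_at_atlas[OF M(2)] chart_at_atlas[OF N(2)]
  have o: "open ?S"
    using chart_open[OF M(1) cd(1)] chart_open[OF N(1) cd(2)] by (simp add: image_map_prod_Times open_Times)
  have pq: "(snd c p, snd d q) \<in> ?S" using M N by (auto simp: chart_at_def)
  have "coord_change (prod_chart c d) c fst z = fst z \<and> coord_change (prod_chart c d) d snd z = snd z" if "z \<in> ?S" for z
  proof -
    from that obtain p q where z: "z = (snd c p, snd d q)" "p \<in> fst c" "q \<in> fst d" by auto
    then show ?thesis using prod_chart_inv[OF M(1) cd(1) N(1) cd(2) z(2,3)] by (simp add: coord_change_def)
  qed
  then have eq: "\<And>z. z \<in> ?S \<Longrightarrow> fst z = coord_change (prod_chart c d) c fst z"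
    "\<And>z. z \<in> ?S \<Longrightarrow> snd z = coord_change (prod_chart c d) d snd z" by simp_all
  have "smooth_on ?S (coord_change (prod_chart c d) c fst)"
    by (rule smooth_on_cong[OF o eq(1) smooth_on_bounded_linear[OF o bounded_linear_fst]])
  then show "smooth_in_charts (prod_chart c d) c fst (p, q)"
    unfolding smooth_in_charts_def using o M N by (intro exI[of _ "fst (prod_chart c d)"]) (auto simp: chart_at_def)
  have "smooth_on ?S (coord_change (prod_chart c d) d snd)"
    by (rule smooth_on_cong[OF o eq(2) smooth_on_bounded_linear[OF o bounded_linear_snd]])
  then show "smooth_in_charts (prod_chart c d) d snd (p, q)"
    unfolding smooth_in_charts_def using o M N by (intro exI[of _ "fst (prod_chart c d)"]) (auto simp: chart_at_def)
  have "(coord_change (prod_chart c d) c fst has_derivative fst) (at (snd c p, snd d q))"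
    by (rule has_derivative_transform_within_open[OF bounded_linear_imp_has_derivative[OF bounded_linear_fst] o pq eq(1)])
  then show "frechet_derivative (coord_change (prod_chart c d) c fst) (at (snd c p, snd d q)) = fst"
    using frechet_derivative_at by metis
  have "(coord_change (prod_chart c d) d snd has_derivative snd) (at (snd c p, snd d q))"
    by (rule has_derivative_transform_within_open[OF bounded_linear_imp_has_derivative[OF bounded_linear_snd] o pq eq(2)])
  then show "frechet_derivative (coord_change (prod_chart c d) d snd) (at (snd c p, snd d q)) = snd"
    using frechet_derivative_at by metis
qed

lemma smooth_at_Pair:
  assumes P: "pre_manifold P" and M: "pre_manifold M" and N: "pre_manifold N"
    and a: "smooth_at P M a p" and b: "smooth_at P N b p"
  shows "smooth_at P (prod_mfd M N) (\<lambda>x. (a x, b x)) p"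
proof -
  obtain e where e: "chart_at P p e" using smooth_at_pts[OF P M a] chart_at_exists[OF P] by blast
  obtain c where c: "chart_at M (a p) c" using smooth_at_pts[OF P M a] chart_at_exists[OF M] by blast
  obtain d where d: "chart_at N (b p) d" using smooth_at_pts[OF P N b] chart_at_exists[OF N] by blast
  show ?thesis
    by (rule smooth_atI[OF P pre_manifold_prod[OF M N] chart_at_atlas[OF e] chart_at_atlas[OF chart_at_prod[OF c d]]
      smooth_in_charts_Pair[OF P chart_at_atlas[OF e] smooth_atD[OF P M a e c] smooth_atD[OF P N b e d]]])
qed

lemma smooth_map_fst: "pre_manifold M \<Longrightarrow> pre_manifold N \<Longrightarrow> smooth_map (prod_mfd M N) M fst"
  and smooth_map_snd: "pre_manifold M \<Longrightarrow> pre_manifold N \<Longrightarrow> smooth_map (prod_mfd M N) N snd"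
proof -
  assume M: "pre_manifold M" and N: "pre_manifold N"
  have "smooth_at (prod_mfd M N) M fst pq \<and> smooth_at (prod_mfd M N) N snd pq" if "pq \<in> pts (prod_mfd M N)" for pq
  proof -
    from that obtain p q where pq: "pq = (p, q)" "p \<in> pts M" "q \<in> pts N" by auto
    obtain c where c: "chart_at M p c" using chart_at_exists[OF M pq(2)] by blast
    obtain d where d: "chart_at N q d" using chart_at_exists[OF N pq(3)] by blast
    show ?thesis unfolding pq(1)
      using smooth_in_charts_fst_snd(1,2)[OF M c N d] c d chart_at_prod[OF c d]
        smooth_atI[OF pre_manifold_prod[OF M N]] M N chart_at_atlas by meson
  qed
  then show "smooth_map (prod_mfd M N) M fst" "smooth_map (prod_mfd M N) N snd"
    by (intro smooth_mapI[OF pre_manifold_prod[OF M N] M] smooth_mapI[OF pre_manifold_prod[OF M N] N]; blast)+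
qed

lemma smooth_map_Pair:
  assumes "pre_manifold P" "pre_manifold M" "pre_manifold N" "smooth_map P M a" "smooth_map P N b"
  shows "smooth_map P (prod_mfd M N) (\<lambda>x. (a x, b x))"
  by (rule smooth_mapI[OF assms(1) pre_manifold_prod[OF assms(2,3)]])
    (rule smooth_at_Pair[OF assms(1-3) smooth_mapD[OF assms(4)] smooth_mapD[OF assms(5)]])

lemma tmap_fst_snd_chart:
  assumes M: "pre_manifold M" "chart_at M p c" and N: "pre_manifold N" "chart_at N q d"
    and w: "w \<in> pts (TM (prod_mfd M N))" "fst w = (p, q)"
  shows "snd (tmap (prod_mfd M N) M fst w) c = fst (snd w (prod_chart c d))"
    and "snd (tmap (prod_mfd M N) N snd w) d = snd (snd w (prod_chart c d))"
proof -
  note MN = pre_manifold_prod[OF M(1) N(1)]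
  have pq: "(p, q) \<in> pts (prod_mfd M N)" using w by (simp add: pts_TM)
  note f = smooth_mapD[OF smooth_map_fst[OF M(1) N(1)] pq] smooth_mapD[OF smooth_map_snd[OF M(1) N(1)] pq]
  show "snd (tmap (prod_mfd M N) M fst w) c = fst (snd w (prod_chart c d))"
    using tmap_chart[OF MN M(1) f(1) w chart_at_prod[OF M(2) N(2)], of c] M(2)
    by (simp add: smooth_in_charts_fst_snd(3)[OF M N])
  show "snd (tmap (prod_mfd M N) N snd w) d = snd (snd w (prod_chart c d))"
    using tmap_chart[OF MN N(1) f(2) w chart_at_prod[OF M(2) N(2)], of d] N(2)
    by (simp add: smooth_in_charts_fst_snd(4)[OF M N])
qed

lemma tvec_prod_eqI:
  assumes M: "pre_manifold M" and N: "pre_manifold N"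
    and w: "w \<in> pts (TM (prod_mfd M N))" and w': "w' \<in> pts (TM (prod_mfd M N))"
    and eq: "tmap (prod_mfd M N) M fst w = tmap (prod_mfd M N) M fst w'"
      "tmap (prod_mfd M N) N snd w = tmap (prod_mfd M N) N snd w'"
  shows "w = w'"
proof -
  obtain p q where pq: "fst w = (p, q)" "p \<in> pts M" "q \<in> pts N" using w by (auto simp: pts_TM)
  have pq': "fst w' = (p, q)" using eq fst_tmap pq(1) by (metis fst_conv snd_conv prod.collapse)
  obtain c where c: "chart_at M p c" using chart_at_exists[OF M pq(2)] by blast
  obtain d where d: "chart_at N q d" using chart_at_exists[OF N pq(3)] by blast
  show ?thesis
  proof (rule tvec_eqI[OF w w', of "prod_chart c d"])
    show "snd w (prod_chart c d) = snd w' (prod_chart c d)"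
      using tmap_fst_snd_chart[OF M c N d w pq(1)] tmap_fst_snd_chart[OF M c N d w' pq'] eq
      by (simp add: prod_eq_iff)
  qed (use pq pq' chart_at_prod[OF c d] in auto)
qed

lemma tvec_prod_exists:
  assumes M: "pre_manifold M" and N: "pre_manifold N" and u: "u \<in> pts (TM M)" and v: "v \<in> pts (TM N)"
  shows "\<exists>w. w \<in> pts (TM (prod_mfd M N)) \<and> tmap (prod_mfd M N) M fst w = u \<and> tmap (prod_mfd M N) N snd w = v"
proof -
  note MN = pre_manifold_prod[OF M N]
  obtain c where c: "chart_at M (fst u) c" using tvec_chart[OF M u] by blast
  obtain d where d: "chart_at N (fst v) d" using tvec_chart[OF N v] by blast
  obtain X where X: "X \<in> tspace (prod_mfd M N) (fst u, fst v)" "X (prod_chart c d) = (snd u c, snd v d)"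
    using tspace_exists[OF MN chart_at_prod[OF c d]] by blast
  let ?w = "((fst u, fst v), X)"
  have w: "?w \<in> pts (TM (prod_mfd M N))" using X u v by (simp add: pts_TM)
  then have pq: "fst ?w \<in> pts (prod_mfd M N)" by (simp add: pts_TM)
  note f = smooth_mapD[OF smooth_map_fst[OF M N] pq] smooth_mapD[OF smooth_map_snd[OF M N] pq]
  have "tmap (prod_mfd M N) M fst ?w = u"
    by (rule tvec_eqI[OF tmap_pts[OF MN M f(1) w] u, of c])
      (use c X tmap_fst_snd_chart(1)[OF M c N d w] in auto)
  moreover have "tmap (prod_mfd M N) N snd ?w = v"
    by (rule tvec_eqI[OF tmap_pts[OF MN N f(2) w] v, of d])
      (use d X tmap_fst_snd_chart(2)[OF M c N d w] in auto)
  ultimately show ?thesis using w by blast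
qed

text \<open>The identification \<open>TM \<times> TN \<cong> T(M \<times> N)\<close> in the definition of \<^const>\<open>tpair\<close> is well defined:
  in a product chart a tangent vector is the pair of the coordinates of its two projections.\<close>

lemma tpair:
  assumes M: "pre_manifold M" and N: "pre_manifold N" and u: "u \<in> pts (TM M)" and v: "v \<in> pts (TM N)"
  shows "tpair M N u v \<in> pts (TM (prod_mfd M N))"
    and "tmap (prod_mfd M N) M fst (tpair M N u v) = u"
    and "tmap (prod_mfd M N) N snd (tpair M N u v) = v"
    and "fst (tpair M N u v) = (fst u, fst v)"
proof -
  have "\<exists>!w. w \<in> pts (TM (prod_mfd M N)) \<and> tmap (prod_mfd M N) M fst w = u \<and> tmap (prod_mfd M N) N snd w = v"
    using tvec_prod_exists[OF assms] tvec_prod_eqI[OF M N] by (intro ex_ex1I) auto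
  from theI'[OF this] show *: "tpair M N u v \<in> pts (TM (prod_mfd M N))"
    "tmap (prod_mfd M N) M fst (tpair M N u v) = u"
    "tmap (prod_mfd M N) N snd (tpair M N u v) = v" by (simp_all add: tpair_def)
  show "fst (tpair M N u v) = (fst u, fst v)" using *(2,3) fst_tmap by (metis prod.collapse)
qed

lemma tpair_eqI:
  assumes "pre_manifold M" "pre_manifold N" "w \<in> pts (TM (prod_mfd M N))"
    and "tmap (prod_mfd M N) M fst w = u" "tmap (prod_mfd M N) N snd w = v"
    and "u \<in> pts (TM M)" "v \<in> pts (TM N)"
  shows "tpair M N u v = w"
  using tvec_prod_eqI[OF assms(1,2) tpair(1)[OF assms(1,2,6,7)] assms(3)] tpair[OF assms(1,2,6,7)] assms by simp

lemma tpair_tmap: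
  assumes P: "pre_manifold P" and M: "pre_manifold M" and N: "pre_manifold N" and w: "w \<in> pts (TM P)"
    and a: "smooth_at P M a (fst w)" and b: "smooth_at P N b (fst w)"
  shows "tpair M N (tmap P M a w) (tmap P N b w) = tmap P (prod_mfd M N) (\<lambda>x. (a x, b x)) w"
proof (rule tpair_eqI[OF M N])
  note MN = pre_manifold_prod[OF M N] and ab = smooth_at_Pair[OF P M N a b]
  have pq: "(a (fst w), b (fst w)) \<in> pts (prod_mfd M N)" using smooth_at_pts[OF P MN ab] by simp
  show "tmap P (prod_mfd M N) (\<lambda>x. (a x, b x)) w \<in> pts (TM (prod_mfd M N))" by (rule tmap_pts[OF P MN ab w])
  show "tmap (prod_mfd M N) M fst (tmap P (prod_mfd M N) (\<lambda>x. (a x, b x)) w) = tmap P M a w"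
    using tmap_compose[OF P MN M ab _ w] smooth_mapD[OF smooth_map_fst[OF M N] pq] by simp
  show "tmap (prod_mfd M N) N snd (tmap P (prod_mfd M N) (\<lambda>x. (a x, b x)) w) = tmap P N b w"
    using tmap_compose[OF P MN N ab _ w] smooth_mapD[OF smooth_map_snd[OF M N] pq] by simp
  show "tmap P M a w \<in> pts (TM M)" by (rule tmap_pts[OF P M a w])
  show "tmap P N b w \<in> pts (TM N)" by (rule tmap_pts[OF P N b w])
qed

lemma tpair_tlin:
  assumes M: "pre_manifold M" and N: "pre_manifold N" and u: "u \<in> pts (TM M)" "u' \<in> pts (TM M)" "fst u = fst u'"
    and v: "v \<in> pts (TM N)" "v' \<in> pts (TM N)" "fst v = fst v'"
  shows "tpair M N (tlin a u b u') (tlin a v b v') = tlin a (tpair M N u v) b (tpair M N u' v')"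
proof -
  note MN = pre_manifold_prod[OF M N] and t = tpair[OF M N u(1) v(1)] and t' = tpair[OF M N u(2) v(2)]
  have e: "fst (tpair M N u v) = fst (tpair M N u' v')" using t(4) t'(4) u v by simp
  have pq: "fst (tpair M N u v) \<in> pts (prod_mfd M N)" using t(1) by (simp add: pts_TM)
  note f = smooth_mapD[OF smooth_map_fst[OF M N] pq] smooth_mapD[OF smooth_map_snd[OF M N] pq]
  show ?thesis
    by (rule tpair_eqI[OF M N])
      (simp_all add: tlin_pts[OF MN t(1) t'(1) e] tlin_pts[OF M u] tlin_pts[OF N v]
         tmap_tlin[OF MN M f(1) t(1) t'(1) e] tmap_tlin[OF MN N f(2) t(1) t'(1) e] t t')
qed

text \<open>In charts the difference of \<open>h\<close> and \<open>h'\<close> vanishes on the fibre product of the coordinate expressions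
  of \<open>s\<close> and \<open>t\<close>, so its derivative vanishes on vectors tangent to that fibre product. The surjectivity
  of the derivative of \<open>s\<close> that this needs is the submersion property.\<close>

lemma tmap_eq_on_fibre_product:
  fixes M :: "('a, 'e::real_inner) mfd" and N :: "('b, 'f::real_inner) mfd"
    and B :: "('x, 'h::real_inner) mfd" and K :: "('y, 'k::real_inner) mfd"
  assumes M: "pre_manifold M" and N: "pre_manifold N" and B: "pre_manifold B" and K: "pre_manifold K"
    and s: "submersion M B s" and t: "smooth_map N B t"
    and w: "w \<in> pts (TM (prod_mfd M N))"
    and h: "smooth_at (prod_mfd M N) K h (fst w)" "smooth_at (prod_mfd M N) K h' (fst w)"
    and W: "mfd_open (prod_mfd M N) W" "fst w \<in> W"
      "\<And>x y. (x, y) \<in> W \<Longrightarrow> s x = t y \<Longrightarrow> h (x, y) = h' (x, y)"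
    and st: "tmap M B s (tmap (prod_mfd M N) M fst w) = tmap N B t (tmap (prod_mfd M N) N snd w)"
  shows "tmap (prod_mfd M N) K h w = tmap (prod_mfd M N) K h' w"
proof -
  note MN = pre_manifold_prod[OF M N]
  obtain p q where pq: "fst w = (p, q)" "p \<in> pts M" "q \<in> pts N" using w by (auto simp: pts_TM)
  let ?u = "tmap (prod_mfd M N) M fst w" and ?v = "tmap (prod_mfd M N) N snd w"
  have spq: "s p = t q" using arg_cong[OF st, of fst] pq(1) by simp
  have hpq: "h (p, q) = h' (p, q)" using W(2,3) pq spq by simp
  obtain c where c: "chart_at M p c" using chart_at_exists[OF M pq(2)] by blast
  obtain d where d: "chart_at N q d" using chart_at_exists[OF N pq(3)] by blast
  have s': "smooth_map M B s" using s by (simp add: submersion_def)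
  note s'' = smooth_mapD[OF s' pq(2)] and t'' = smooth_mapD[OF t pq(3)]
  obtain b where b: "chart_at B (s p) b" using chart_at_exists[OF B smooth_map_pts[OF s' pq(2)]] by blast
  obtain k where k: "chart_at K (h (p, q)) k"
    using chart_at_exists[OF K smooth_at_pts(2)[OF MN K h(1)]] unfolding pq(1) by blast
  note cd = chart_at_prod[OF c d]
  have pqM: "(p, q) \<in> pts (prod_mfd M N)" using pq by simp
  note fst_sm = smooth_mapD[OF smooth_map_fst[OF M N] pqM] and snd_sm = smooth_mapD[OF smooth_map_snd[OF M N] pqM]
  have u: "?u \<in> pts (TM M)" "fst ?u = p" using tmap_pts[OF MN M _ w] fst_sm pq by simp_all
  have v: "?v \<in> pts (TM N)" "fst ?v = q" using tmap_pts[OF MN N _ w] snd_sm pq by simp_all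
  have h1: "smooth_at (prod_mfd M N) K h (p, q)" "smooth_at (prod_mfd M N) K h' (p, q)" using h pq by simp_all
  have k': "chart_at K (h' (p, q)) k" using k hpq by simp
  obtain V where V: "p \<in> V" "V \<subseteq> fst c" "s ` V \<subseteq> fst b" "open (snd c ` V)" "smooth_on (snd c ` V) (coord_change c b s)"
    using smooth_atD[OF M B s'' c b] unfolding smooth_in_charts_def by blast
  have b': "chart_at B (t q) b" using b spq by simp
  obtain V' where V': "q \<in> V'" "V' \<subseteq> fst d" "t ` V' \<subseteq> fst b" "open (snd d ` V')"
    using smooth_atD[OF N B t'' d b'] unfolding smooth_in_charts_def by blast
  let ?O = "W \<inter> (V \<times> V')"
  have "mfd_open (prod_mfd M N) (V \<times> V')"
    by (rule mfd_open_in_chart[OF MN chart_at_atlas[OF cd]])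
      (use V V' in \<open>auto simp: image_map_prod_Times open_Times\<close>)
  then have "mfd_open (prod_mfd M N) ?O" using mfd_open_Int[OF MN W(1)] by blast
  then have "open (snd (prod_chart c d) ` (?O \<inter> fst (prod_chart c d)))"
    using chart_at_atlas[OF cd] by (auto simp: mfd_open_def)
  moreover have "?O \<inter> fst (prod_chart c d) = ?O" using V V' by auto
  ultimately have O: "open (snd (prod_chart c d) ` ?O)" by simp
  let ?h = "coord_change (prod_chart c d) k h" and ?h' = "coord_change (prod_chart c d) k h'"
  let ?D = "\<lambda>z. ?h z - ?h' z"
  have hd: "smooth_in_charts (prod_chart c d) k h (p, q)" "smooth_in_charts (prod_chart c d) k h' (p, q)"
    using smooth_atD[OF MN K h1(1) cd k] smooth_atD[OF MN K h1(2) cd k'] by simp_all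
  have D': "(?D has_derivative (\<lambda>z. frechet_derivative ?h (at (snd c p, snd d q)) z - frechet_derivative ?h' (at (snd c p, snd d q)) z))
      (at (snd c p, snd d q))"
    using has_derivative_diff[OF smooth_in_charts_has_derivative[OF hd(1)] smooth_in_charts_has_derivative[OF hd(2)]] by simp
  have zero: "?D (x, y) = 0" if xy: "(x, y) \<in> snd (prod_chart c d) ` ?O"
    and ab: "coord_change c b s x = coord_change d b t y" for x y
  proof -
    from xy obtain p' q' where z: "(p', q') \<in> W" "p' \<in> V" "q' \<in> V'" "x = snd c p'" "y = snd d q'" by auto
    have dom: "p' \<in> fst c" "q' \<in> fst d" "s p' \<in> fst b" "t q' \<in> fst b" using z V V' by auto
    have "snd b (s p') = snd b (t q')"
      using ab z dom by (simp add: coord_change_apply[OF M chart_at_atlas[OF c]] coord_change_apply[OF N chart_at_atlas[OF d]])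
    then have "s p' = t q'" using chart_inv_left[OF B chart_at_atlas[OF b]] dom by metis
    then have "h (p', q') = h' (p', q')" using W(3) z by blast
    then show ?thesis
      using prod_chart_inv[OF M chart_at_atlas[OF c] N chart_at_atlas[OF d] dom(1,2)] z by (simp add: coord_change_def)
  qed
  have surj: "surj (frechet_derivative (coord_change c b s) (at (snd c p)))"
    unfolding surj_def
  proof
    fix e :: 'h
    obtain Y where Y: "Y \<in> tspace B (s p)" "Y b = e" using tspace_exists[OF B b] by blast
    then have "(s p, Y) \<in> tmap M B s ` ({p} \<times> tspace M p)" using s pq by (simp add: submersion_def)
    then obtain X where X: "X \<in> tspace M p" "(s p, Y) = tmap M B s (p, X)" by blast
    have "(p, X) \<in> pts (TM M)" using X(1) pq by (simp add: pts_TM)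
    then have "snd (tmap M B s (p, X)) b = frechet_derivative (coord_change c b s) (at (snd c p)) (X c)"
      using tmap_chart[OF M B s'' _ _ c b, of "(p, X)"] by simp
    then show "\<exists>x. e = frechet_derivative (coord_change c b s) (at (snd c p)) x"
      using Y(2) by (simp flip: X(2)) blast
  qed
  have a_b: "frechet_derivative (coord_change c b s) (at (snd c p)) (snd ?u c)
      = frechet_derivative (coord_change d b t) (at (snd d q)) (snd ?v d)"
    using tmap_chart[OF M B s'' u c b] tmap_chart[OF N B t'' v d b'] st by simp
  have fd: "fin_dim TYPE('e)" "fin_dim TYPE('h)" using M B by (auto simp: pre_manifold_def)
  have pV: "snd c p \<in> snd c ` V" using V by blast
  have tb: "(coord_change d b t has_derivative frechet_derivative (coord_change d b t) (at (snd d q))) (at (snd d q))"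
    by (rule smooth_in_charts_has_derivative[OF smooth_atD[OF N B t'' d b']])
  have ab0: "coord_change c b s (snd c p) = coord_change d b t (snd d q)"
    using c d spq by (simp add: coord_change_apply[OF M chart_at_atlas[OF c]] coord_change_apply[OF N chart_at_atlas[OF d]] chart_at_def)
  have pqO: "(snd c p, snd d q) \<in> snd (prod_chart c d) ` ?O" using W pq V V' by force
  have "frechet_derivative ?h (at (snd c p, snd d q)) (snd ?u c, snd ?v d) - frechet_derivative ?h' (at (snd c p, snd d q)) (snd ?u c, snd ?v d) = 0"
    by (rule derivative_vanishes_along_fibre_product[OF fd V(4) pV V(5) tb ab0 surj D' O pqO zero a_b])
  moreover have "(snd ?u c, snd ?v d) = snd w (prod_chart c d)"
    using tmap_fst_snd_chart[OF M c N d w pq(1)] by simp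
  ultimately have "frechet_derivative ?h (at (snd (prod_chart c d) (p, q))) (snd w (prod_chart c d))
    = frechet_derivative ?h' (at (snd (prod_chart c d) (p, q))) (snd w (prod_chart c d))" by simp
  then have "snd (tmap (prod_mfd M N) K h w) k = snd (tmap (prod_mfd M N) K h' w) k"
    using tmap_chart[OF MN K h1(1) w pq(1) cd k] tmap_chart[OF MN K h1(2) w pq(1) cd k'] by simp
  then show ?thesis
    using tvec_eqI[OF tmap_pts[OF MN K h(1) w] tmap_pts[OF MN K h(2) w], of k] hpq k pq by simp
qed

section \<open>Tangent bundles and tangent spaces as manifolds\<close>

definition tangent_chart :: "('a, 'e::real_inner) mfd \<Rightarrow> ('a, 'e) chart \<Rightarrow> (('a, 'e) tvec, 'e \<times> 'e) chart" where
  "tangent_chart M c = ((SIGMA p:fst c. tspace M p), \<lambda>(p, X). (snd c p, X c))"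

lemma fst_tangent_chart [simp]: "fst (tangent_chart M c) = (SIGMA p:fst c. tspace M p)"
  and snd_tangent_chart [simp]: "snd (tangent_chart M c) v = (snd c (fst v), snd v c)"
  by (simp_all add: tangent_chart_def split_beta)

lemma atlas_TM: "e \<in> atlas (TM M) \<longleftrightarrow> (\<exists>c\<in>atlas M. e = tangent_chart M c)"
  unfolding TM_def tangent_chart_def mfd.simps by blast

lemma tangent_chart_image:
  assumes M: "pre_manifold M" and c: "c \<in> atlas M" and V: "V \<subseteq> fst c"
  shows "snd (tangent_chart M c) ` (SIGMA p:V. tspace M p) = snd c ` V \<times> UNIV"
proof (intro equalityI subsetI)
  fix z assume "z \<in> snd c ` V \<times> (UNIV :: 'b set)"
  then obtain p where p: "p \<in> V" "fst z = snd c p" by auto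
  then obtain X where "X \<in> tspace M p" "X c = snd z"
    using tspace_exists[OF M, of p c "snd z"] V c by (auto simp: chart_at_def)
  then show "z \<in> snd (tangent_chart M c) ` (SIGMA p:V. tspace M p)"
    using p by (intro image_eqI[of _ _ "(p, X)"]) (auto simp: prod_eq_iff)
qed auto

lemma tangent_chart_inj:
  assumes M: "pre_manifold M" and c: "c \<in> atlas M"
  shows "inj_on (snd (tangent_chart M c)) (fst (tangent_chart M c))"
proof (rule inj_onI)
  fix u v assume u: "u \<in> fst (tangent_chart M c)" and v: "v \<in> fst (tangent_chart M c)"
    and uv: "snd (tangent_chart M c) u = snd (tangent_chart M c) v"
  have "fst u \<in> fst c" "fst v \<in> fst c" "snd c (fst u) = snd c (fst v)" using u v uv by auto
  then have "fst u = fst v" using chart_inv_left[OF M c] by metis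
  moreover from this have "snd u = snd v"
    using tspace_eqI[of "snd u" M "fst u" "snd v" c] u v uv c by (auto simp: chart_at_def)
  ultimately show "u = v" by (simp add: prod_eq_iff)
qed

text \<open>The common coordinate computation for changes of charts of the tangent bundle and for differentials:
  both have the form \<open>(x, v) \<mapsto> (f x, f'(x) v)\<close>.\<close>

lemma smooth_on_tangent_coordinates:
  fixes M :: "('a, 'e::real_inner) mfd"
  assumes M: "pre_manifold M" and c: "c \<in> atlas M"
    and V: "V \<subseteq> fst c" "open (snd c ` V)" "smooth_on (snd c ` V) (coord_change c d f)"
    and F: "\<And>v. fst v \<in> V \<Longrightarrow> snd v \<in> tspace M (fst v) \<Longrightarrow> fst (F v) = f (fst v) \<and>
      snd (F v) d = frechet_derivative (coord_change c d f) (at (snd c (fst v))) (snd v c)"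
  shows "smooth_on (snd c ` V \<times> UNIV) (coord_change (tangent_chart M c) (tangent_chart N d) F)"
proof -
  have fd: "fin_dim TYPE('e)" using M by (simp add: pre_manifold_def)
  let ?f = "coord_change c d f"
  have o: "open (snd c ` V \<times> (UNIV :: 'e set))" using V(2) by (simp add: open_Times)
  have "smooth_on (snd c ` V \<times> (UNIV :: 'e set)) (\<lambda>z. ?f (fst z))"
    by (rule smooth_on_compose[OF fd o V(2) _ _ V(3)]) (auto intro: smooth_on_bounded_linear[OF o] bounded_linear_fst)
  then have s: "smooth_on (snd c ` V \<times> UNIV) (\<lambda>z. (?f (fst z), (\<lambda>(x, v). frechet_derivative ?f (at x) v) z))"
    by (rule smooth_on_Pair[OF o _ smooth_on_differential[OF fd V(2,3)]])
  show ?thesis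
  proof (rule smooth_on_cong[OF o _ s])
    fix z :: "'e \<times> 'e" assume "z \<in> snd c ` V \<times> UNIV"
    then have "z \<in> snd (tangent_chart M c) ` (SIGMA p:V. tspace M p)" by (simp only: tangent_chart_image[OF M c V(1)])
    then obtain v where v: "fst v \<in> V" "snd v \<in> tspace M (fst v)" "z = snd (tangent_chart M c) v" by auto
    have "v \<in> fst (tangent_chart M c)" using v V by (cases v) auto
    then have "chart_inv (tangent_chart M c) z = v"
      using inv_into_f_f[OF tangent_chart_inj[OF M c]] v(3) by simp
    then show "(?f (fst z), (\<lambda>(x, v). frechet_derivative ?f (at x) v) z)
        = coord_change (tangent_chart M c) (tangent_chart N d) F z"
      using F[OF v(1,2)] v V(1) coord_change_apply[OF M c, of "fst v" d f]
      by (auto simp: coord_change_def[of "tangent_chart M c"])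
  qed
qed

lemma pre_manifold_TM:
  fixes M :: "('a, 'e::real_inner) mfd"
  assumes M: "pre_manifold M" shows "pre_manifold (TM M)"
  unfolding pre_manifold_def
proof (intro conjI ballI)
  show "fin_dim TYPE('e \<times> 'e)" using assms by (simp add: pre_manifold_def fin_dim_prod)
  have "(\<Union>e\<in>atlas (TM M). fst e) = (SIGMA p:(\<Union>c\<in>atlas M. fst c). tspace M p)"
    by (auto simp: TM_def) blast
  then show "(\<Union>e\<in>atlas (TM M). fst e) = pts (TM M)"
    using M by (simp add: pre_manifold_def TM_def)
next
  fix e assume "e \<in> atlas (TM M)"
  then obtain c where c: "c \<in> atlas M" "e = tangent_chart M c" by (auto simp: atlas_TM)
  show "inj_on (snd e) (fst e)" using tangent_chart_inj[OF M] c by simp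
  show "open (snd e ` fst e)"
    using c tangent_chart_image[OF M c(1) order_refl] chart_open[OF M c(1)] by (simp add: open_Times)
  fix e' assume "e' \<in> atlas (TM M)"
  then obtain d where d: "d \<in> atlas M" "e' = tangent_chart M d" by (auto simp: atlas_TM)
  let ?V = "fst c \<inter> fst d"
  have int: "fst e \<inter> fst e' = (SIGMA p:?V. tspace M p)" using c d by auto
  have im: "snd e ` (fst e \<inter> fst e') = snd c ` ?V \<times> UNIV"
    unfolding int unfolding c(2) by (rule tangent_chart_image[OF M c(1)]) simp
  have V: "open (snd c ` ?V)" "smooth_on (snd c ` ?V) (coord_change c d id)"
    using M c d by (auto simp: pre_manifold_def)
  show "open (snd e ` (fst e \<inter> fst e'))" unfolding im using V by (simp add: open_Times)
  show "smooth_on (snd e ` (fst e \<inter> fst e')) (coord_change e e' id)"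
    unfolding im unfolding c(2) d(2)
  proof (rule smooth_on_tangent_coordinates[OF M c(1) _ V])
    fix v assume v: "fst v \<in> ?V" "snd v \<in> tspace M (fst v)"
    have "chart_at M (fst v) c" "chart_at M (fst v) d" using v c d by (auto simp: chart_at_def)
    from tspace_change[OF v(2) this]
    show "fst (id v) = id (fst v) \<and>
        snd (id v) d = frechet_derivative (coord_change c d id) (at (snd c (fst v))) (snd v c)"
      by (simp add: id_def)
  qed simp
qed

lemma smooth_map_tmap:
  assumes M: "pre_manifold M" and N: "pre_manifold N" and f: "smooth_map M N f"
  shows "smooth_map (TM M) (TM N) (tmap M N f)"
proof (rule smooth_mapI[OF pre_manifold_TM[OF M] pre_manifold_TM[OF N]])
  fix v assume v: "v \<in> pts (TM M)"
  have p: "fst v \<in> pts M" using v by (simp add: pts_TM)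
  note fv = smooth_mapD[OF f p]
  obtain c where c: "chart_at M (fst v) c" using tvec_chart[OF M v] by blast
  obtain d where d: "chart_at N (f (fst v)) d" using chart_at_exists[OF N] smooth_at_pts[OF M N fv] by blast
  obtain V where V: "fst v \<in> V" "V \<subseteq> fst c" "f ` V \<subseteq> fst d" "open (snd c ` V)" "smooth_on (snd c ` V) (coord_change c d f)"
    using smooth_atD[OF M N fv c d] unfolding smooth_in_charts_def by blast
  let ?V = "SIGMA p:V. tspace M p"
  note im = tangent_chart_image[OF M chart_at_atlas[OF c] V(2)]
  have c': "chart_at M (fst u) c" "chart_at N (f (fst u)) d" "u \<in> pts (TM M)"
    if "fst u \<in> V" "snd u \<in> tspace M (fst u)" for u
    using that V c d chart_subset_pts[OF M chart_at_atlas[OF c]] by (auto simp: chart_at_def pts_TM)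
  have tm: "snd (tmap M N f u) d = frechet_derivative (coord_change c d f) (at (snd c (fst u))) (snd u c)"
    if "fst u \<in> V" "snd u \<in> tspace M (fst u)" for u
  proof -
    have "smooth_at M N f (fst u)" using smooth_mapD[OF f] c'(3)[OF that] by (simp add: pts_TM)
    from tmap_chart[OF M N this c'(3)[OF that] refl c'(1)[OF that] c'(2)[OF that]] show ?thesis .
  qed
  have "smooth_on (snd (tangent_chart M c) ` ?V) (coord_change (tangent_chart M c) (tangent_chart N d) (tmap M N f))"
    unfolding im by (rule smooth_on_tangent_coordinates[OF M chart_at_atlas[OF c] V(2,4,5)]) (use tm in simp)
  moreover have "tmap M N f ` ?V \<subseteq> fst (tangent_chart N d)"
  proof
    fix y assume "y \<in> tmap M N f ` ?V"
    then obtain u where u: "fst u \<in> V" "snd u \<in> tspace M (fst u)" "y = tmap M N f u" by auto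
    then have "y \<in> pts (TM N)" using tmap_pts[OF M N _ c'(3)] smooth_mapD[OF f] c'(3)[OF u(1,2)] by (auto simp: pts_TM)
    then show "y \<in> fst (tangent_chart N d)" using u V by (cases y) (auto simp: pts_TM tmap_def)
  qed
  moreover have "v \<in> ?V" using v V by (cases v) (simp add: pts_TM)
  moreover have "?V \<subseteq> fst (tangent_chart M c)" using V by auto
  moreover have "open (snd (tangent_chart M c) ` ?V)" unfolding im using V by (simp add: open_Times)
  ultimately have "smooth_in_charts (tangent_chart M c) (tangent_chart N d) (tmap M N f) v"
    unfolding smooth_in_charts_def by blast
  then show "smooth_at (TM M) (TM N) (tmap M N f) v"
    using smooth_atI[OF pre_manifold_TM[OF M] pre_manifold_TM[OF N]] chart_at_atlas[OF c] chart_at_atlas[OF d] atlas_TM by metis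
qed

definition tspace_chart :: "('a, 'e::real_inner) mfd \<Rightarrow> 'a \<Rightarrow> ('a, 'e) chart \<Rightarrow> (('a, 'e) tvec, 'e) chart" where
  "tspace_chart M p c = ({p} \<times> tspace M p, \<lambda>(q, X). X c)"

lemma fst_tspace_chart [simp]: "fst (tspace_chart M p c) = {p} \<times> tspace M p"
  and snd_tspace_chart [simp]: "snd (tspace_chart M p c) v = snd v c"
  by (simp_all add: tspace_chart_def split_beta)

lemma atlas_tspace_mfd: "e \<in> atlas (tspace_mfd M p) \<longleftrightarrow> (\<exists>c. chart_at M p c \<and> e = tspace_chart M p c)"
  by (auto simp: tspace_mfd_def tspace_chart_def chart_at_def)

lemma pts_tspace_mfd: "v \<in> pts (tspace_mfd M p) \<longleftrightarrow> fst v = p \<and> snd v \<in> tspace M p"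
  by (cases v) (auto simp: tspace_mfd_def)

lemma chart_at_tspace_mfd:
  assumes c: "chart_at M p c" and v: "v \<in> pts (tspace_mfd M p)"
  shows "chart_at (tspace_mfd M p) v (tspace_chart M p c)"
  unfolding chart_at_def[of "tspace_mfd M p"] atlas_tspace_mfd
proof
  show "\<exists>d. chart_at M p d \<and> tspace_chart M p c = tspace_chart M p d" by (rule exI[of _ c]) (simp add: c)
  show "v \<in> fst (tspace_chart M p c)" using v by (cases v) (simp add: pts_tspace_mfd)
qed

lemma tspace_mfd_TM: "p \<in> pts M \<Longrightarrow> v \<in> pts (tspace_mfd M p) \<longleftrightarrow> v \<in> pts (TM M) \<and> fst v = p"
  by (auto simp: pts_tspace_mfd pts_TM)

lemma tspace_chart_image:
  assumes M: "pre_manifold M" and c: "chart_at M p c"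
  shows "snd (tspace_chart M p c) ` fst (tspace_chart M p c) = UNIV"
proof (intro equalityI subsetI)
  fix x :: 'b
  obtain X where "X \<in> tspace M p" "X c = x" using tspace_exists[OF M c] by blast
  then show "x \<in> snd (tspace_chart M p c) ` fst (tspace_chart M p c)"
    by (intro image_eqI[of _ _ "(p, X)"]) auto
qed simp

lemma tspace_chart_inj: "chart_at M p c \<Longrightarrow> inj_on (snd (tspace_chart M p c)) (fst (tspace_chart M p c))"
  by (rule inj_onI) (auto intro: tspace_eqI)

lemma smooth_on_tspace_coordinates:
  fixes M :: "('a, 'e::real_inner) mfd"
  assumes M: "pre_manifold M" and c: "chart_at M p c" and L: "linear L"
    and F: "\<And>v. v \<in> pts (tspace_mfd M p) \<Longrightarrow> snd (F v) d = L (snd v c)"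
  shows "smooth_on UNIV (coord_change (tspace_chart M p c) (tspace_chart N q d) F)"
proof -
  have fd: "fin_dim TYPE('e)" using M by (simp add: pre_manifold_def)
  show ?thesis
  proof (rule smooth_on_cong[OF open_UNIV _ smooth_on_bounded_linear[OF open_UNIV fin_dim_linear_bounded[OF fd L]]])
    fix z :: 'e
    have "z \<in> snd (tspace_chart M p c) ` fst (tspace_chart M p c)" by (simp only: tspace_chart_image[OF M c]) simp
    then obtain v where v: "v \<in> fst (tspace_chart M p c)" "z = snd (tspace_chart M p c) v" by blast
    then have "chart_inv (tspace_chart M p c) z = v"
      using inv_into_f_f[OF tspace_chart_inj[OF c]] by simp
    moreover have "v \<in> pts (tspace_mfd M p)" using v by (auto simp: pts_tspace_mfd)
    ultimately show "L z = coord_change (tspace_chart M p c) (tspace_chart N q d) F z"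
      using F v(2) by (simp add: coord_change_def)
  qed
qed

lemma pre_manifold_tspace_mfd:
  fixes M :: "('a, 'e::real_inner) mfd"
  assumes M: "pre_manifold M" and p: "p \<in> pts M" shows "pre_manifold (tspace_mfd M p)"
  unfolding pre_manifold_def
proof (intro conjI ballI)
  show "fin_dim TYPE('e)" using assms by (simp add: pre_manifold_def)
  obtain c where c: "chart_at M p c" using chart_at_exists[OF M p] by blast
  have e: "fst e = {p} \<times> tspace M p" if "e \<in> atlas (tspace_mfd M p)" for e
    using that by (auto simp: tspace_mfd_def)
  have "tspace_chart M p c \<in> atlas (tspace_mfd M p)" unfolding atlas_tspace_mfd by (rule exI[of _ c]) (simp add: c)
  then have "(\<Union>e\<in>atlas (tspace_mfd M p). fst e) = {p} \<times> tspace M p" using e by blast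
  then show "(\<Union>e\<in>atlas (tspace_mfd M p). fst e) = pts (tspace_mfd M p)"
    by (simp add: tspace_mfd_def)
next
  fix e assume "e \<in> atlas (tspace_mfd M p)"
  then obtain c where c: "chart_at M p c" "e = tspace_chart M p c" by (auto simp: atlas_tspace_mfd)
  show "inj_on (snd e) (fst e)" using tspace_chart_inj[OF c(1)] c by simp
  show "open (snd e ` fst e)" unfolding c(2) tspace_chart_image[OF M c(1)] by simp
  fix e' assume "e' \<in> atlas (tspace_mfd M p)"
  then obtain d where d: "chart_at M p d" "e' = tspace_chart M p d" by (auto simp: atlas_tspace_mfd)
  have im: "snd e ` (fst e \<inter> fst e') = UNIV" using tspace_chart_image[OF M c(1)] by (simp add: c(2) d(2))
  show "open (snd e ` (fst e \<inter> fst e'))" unfolding im by simp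
  have "linear (frechet_derivative (coord_change c d (\<lambda>x. x)) (at (snd c p)))"
    using smooth_in_charts_has_derivative[OF smooth_in_charts_id[OF M c(1) d(1)]] by (rule has_derivative_linear)
  then show "smooth_on (snd e ` (fst e \<inter> fst e')) (coord_change e e' id)"
    unfolding im unfolding c(2) d(2)
  proof (rule smooth_on_tspace_coordinates[OF M c(1)])
    fix v assume "v \<in> pts (tspace_mfd M p)"
    then have "snd v \<in> tspace M p" by (simp add: pts_tspace_mfd)
    from tspace_change[OF this c(1) d(1)]
    show "snd (id v) d = frechet_derivative (coord_change c d (\<lambda>x. x)) (at (snd c p)) (snd v c)" by simp
  qed
qed

lemma smooth_map_tmap_tspace:
  assumes M: "pre_manifold M" and N: "pre_manifold N" and f: "smooth_at M N f p"
  shows "smooth_map (tspace_mfd M p) (tspace_mfd N (f p)) (tmap M N f)"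
proof -
  note p = smooth_at_pts[OF M N f]
  note T = pre_manifold_tspace_mfd[OF M p(1)] pre_manifold_tspace_mfd[OF N p(2)]
  show ?thesis
  proof (rule smooth_mapI[OF T])
    fix v assume v: "v \<in> pts (tspace_mfd M p)"
    obtain c where c: "chart_at M p c" using chart_at_exists[OF M p(1)] by blast
    obtain d where d: "chart_at N (f p) d" using chart_at_exists[OF N p(2)] by blast
    have L: "linear (frechet_derivative (coord_change c d f) (at (snd c p)))"
      using smooth_in_charts_has_derivative[OF smooth_atD[OF M N f c d]] by (rule has_derivative_linear)
    have u: "u \<in> pts (TM M)" "fst u = p" if "u \<in> pts (tspace_mfd M p)" for u
      using that tspace_mfd_TM[OF p(1)] by auto
    have sm: "smooth_on UNIV (coord_change (tspace_chart M p c) (tspace_chart N (f p) d) (tmap M N f))"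
      by (rule smooth_on_tspace_coordinates[OF M c L tmap_chart[OF M N f u c d]])
    have "tmap M N f u \<in> fst (tspace_chart N (f p) d)" if "u \<in> fst (tspace_chart M p c)" for u
    proof -
      have u': "u \<in> pts (TM M)" "fst u = p" using that p by (auto simp: pts_TM)
      then show ?thesis using tmap_pts[OF M N _ u'(1)] f by (cases "tmap M N f u") (auto simp: pts_TM tmap_def)
    qed
    then have im: "tmap M N f ` fst (tspace_chart M p c) \<subseteq> fst (tspace_chart N (f p) d)" by blast
    have "smooth_in_charts (tspace_chart M p c) (tspace_chart N (f p) d) (tmap M N f) v"
      unfolding smooth_in_charts_def
    proof (intro exI[of _ "fst (tspace_chart M p c)"] conjI)
      show "v \<in> fst (tspace_chart M p c)" using v by (cases v) (simp add: pts_tspace_mfd)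
    qed (simp_all only: tspace_chart_image[OF M c] open_UNIV subset_refl im sm)
    then show "smooth_at (tspace_mfd M p) (tspace_mfd N (f p)) (tmap M N f) v"
      using smooth_atI[OF T] c d atlas_tspace_mfd by metis
  qed
qed

lemma smooth_map_tlin:
  assumes P: "pre_manifold P" and M: "pre_manifold M" and p: "p \<in> pts M"
    and A: "smooth_map P (tspace_mfd M p) A" and B: "smooth_map P (tspace_mfd M p) B"
  shows "smooth_map P (tspace_mfd M p) (\<lambda>x. tlin a (A x) b (B x))"
proof -
  note T = pre_manifold_tspace_mfd[OF M p]
  show ?thesis
  proof (rule smooth_mapI[OF P T])
    fix x assume x: "x \<in> pts P"
    obtain c where c: "chart_at M p c" using chart_at_exists[OF M p] by blast
    obtain e where e: "chart_at P x e" using chart_at_exists[OF P x] by blast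
    let ?c = "tspace_chart M p c"
    have c': "chart_at (tspace_mfd M p) (A x) ?c" "chart_at (tspace_mfd M p) (B x) ?c"
      by (intro chart_at_tspace_mfd c smooth_map_pts[OF A x] smooth_map_pts[OF B x])+
    obtain V where V: "x \<in> V" "V \<subseteq> fst e" "A ` V \<subseteq> fst ?c" "open (snd e ` V)" "smooth_on (snd e ` V) (coord_change e ?c A)"
      using smooth_atD[OF P T smooth_mapD[OF A x] e c'(1)] unfolding smooth_in_charts_def by blast
    obtain W where W: "x \<in> W" "W \<subseteq> fst e" "B ` W \<subseteq> fst ?c" "open (snd e ` W)" "smooth_on (snd e ` W) (coord_change e ?c B)"
      using smooth_atD[OF P T smooth_mapD[OF B x] e c'(2)] unfolding smooth_in_charts_def by blast
    have "mfd_open P (V \<inter> W)" by (intro mfd_open_Int mfd_open_in_chart[OF _ chart_at_atlas[OF e]] P V W)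
    then have "open (snd e ` (V \<inter> W \<inter> fst e))" using chart_at_atlas[OF e] by (auto simp: mfd_open_def)
    moreover have "V \<inter> W \<inter> fst e = V \<inter> W" using V by blast
    ultimately have o: "open (snd e ` (V \<inter> W))" by simp
    have eq: "coord_change e ?c (\<lambda>x. tlin a (A x) b (B x)) = (\<lambda>x. a *\<^sub>R coord_change e ?c A x + b *\<^sub>R coord_change e ?c B x)"
      by (auto simp: coord_change_def)
    have "smooth_on (snd e ` (V \<inter> W)) (coord_change e ?c (\<lambda>x. tlin a (A x) b (B x)))"
      unfolding eq using smooth_on_subset[OF V(5), of "snd e ` (V \<inter> W)"] smooth_on_subset[OF W(5), of "snd e ` (V \<inter> W)"]
      by (intro smooth_on_add[OF o] smooth_on_bounded_linear_compose[OF o bounded_linear_scaleR_right]) blast+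
    moreover have "tlin a (A y) b (B y) \<in> fst ?c" if "y \<in> V \<inter> W" for y
    proof -
      have "A y \<in> pts (TM M)" "B y \<in> pts (TM M)" "fst (A y) = p" "fst (B y) = p"
        using that V W p by (auto simp: pts_TM image_subset_iff mem_Times_iff)
      then show ?thesis using tlin_pts[OF M, of "A y" "B y" a b] by (auto simp: pts_TM mem_Times_iff simp del: snd_tlin)
    qed
    ultimately have "smooth_in_charts e ?c (\<lambda>x. tlin a (A x) b (B x)) x"
      unfolding smooth_in_charts_def using V W o by (intro exI[of _ "V \<inter> W"]) blast
    then show "smooth_at P (tspace_mfd M p) (\<lambda>x. tlin a (A x) b (B x)) x"
      by (rule smooth_atI[OF P T chart_at_atlas[OF e] chart_at_atlas[OF c'(1)]])
  qed
qed

section \<open>Horizontal and vertical composition\<close>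

lemma category_Src: "category C \<Longrightarrow> f \<in> Mor C \<Longrightarrow> Src C f \<in> Ob C"
  and category_Tgt: "category C \<Longrightarrow> f \<in> Mor C \<Longrightarrow> Tgt C f \<in> Ob C"
  and category_Idt: "category C \<Longrightarrow> x \<in> Ob C \<Longrightarrow> Idt C x \<in> Mor C"
  and category_Src_Idt: "category C \<Longrightarrow> x \<in> Ob C \<Longrightarrow> Src C (Idt C x) = x"
  and category_Tgt_Idt: "category C \<Longrightarrow> x \<in> Ob C \<Longrightarrow> Tgt C (Idt C x) = x"
  and category_Cmp: "category C \<Longrightarrow> f \<in> Mor C \<Longrightarrow> g \<in> Mor C \<Longrightarrow> Src C g = Tgt C f \<Longrightarrow> Cmp C g f \<in> Mor C"
  and category_Src_Cmp: "category C \<Longrightarrow> f \<in> Mor C \<Longrightarrow> g \<in> Mor C \<Longrightarrow> Src C g = Tgt C f \<Longrightarrow> Src C (Cmp C g f) = Src C f"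
  and category_Tgt_Cmp: "category C \<Longrightarrow> f \<in> Mor C \<Longrightarrow> g \<in> Mor C \<Longrightarrow> Src C g = Tgt C f \<Longrightarrow> Tgt C (Cmp C g f) = Tgt C g"
  and category_Idt_right: "category C \<Longrightarrow> f \<in> Mor C \<Longrightarrow> Src C f = x \<Longrightarrow> Cmp C f (Idt C x) = f"
  and category_Idt_left: "category C \<Longrightarrow> f \<in> Mor C \<Longrightarrow> Tgt C f = x \<Longrightarrow> Cmp C (Idt C x) f = f"
  and category_assoc: "category C \<Longrightarrow> f \<in> Mor C \<Longrightarrow> g \<in> Mor C \<Longrightarrow> h \<in> Mor C \<Longrightarrow>
    Src C g = Tgt C f \<Longrightarrow> Src C h = Tgt C g \<Longrightarrow> Cmp C h (Cmp C g f) = Cmp C (Cmp C h g) f"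
  by (auto simp: category_def)

lemmas category_simps = category_Src category_Tgt category_Idt category_Src_Idt category_Tgt_Idt
  category_Cmp category_Src_Cmp category_Tgt_Cmp category_Idt_right category_Idt_left

text \<open>The closure properties under which functors can be composed. For the tangent groupoid they are
  immediate from its definition, whereas its laws are statements about differentials.\<close>

definition precategory :: "('o, 'm, 'z) cat_scheme \<Rightarrow> bool" where
  "precategory C \<longleftrightarrow>
     (\<forall>f\<in>Mor C. Src C f \<in> Ob C \<and> Tgt C f \<in> Ob C) \<and> (\<forall>x\<in>Ob C. Idt C x \<in> Mor C) \<and>
     (\<forall>f\<in>Mor C. \<forall>g\<in>Mor C. Src C g = Tgt C f \<longrightarrow> Cmp C g f \<in> Mor C)"

lemma category_precategory: "category C \<Longrightarrow> precategory C"
  by (auto simp: category_def precategory_def)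

lemma functor_Ob: "is_functor C D F \<Longrightarrow> x \<in> Ob C \<Longrightarrow> fst F x \<in> Ob D"
  and functor_Mor: "is_functor C D F \<Longrightarrow> f \<in> Mor C \<Longrightarrow> snd F f \<in> Mor D"
  and functor_Src: "is_functor C D F \<Longrightarrow> f \<in> Mor C \<Longrightarrow> Src D (snd F f) = fst F (Src C f)"
  and functor_Tgt: "is_functor C D F \<Longrightarrow> f \<in> Mor C \<Longrightarrow> Tgt D (snd F f) = fst F (Tgt C f)"
  and functor_Idt: "is_functor C D F \<Longrightarrow> x \<in> Ob C \<Longrightarrow> snd F (Idt C x) = Idt D (fst F x)"
  and functor_Cmp: "is_functor C D F \<Longrightarrow> f \<in> Mor C \<Longrightarrow> g \<in> Mor C \<Longrightarrow> Src C g = Tgt C f \<Longrightarrow>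
     snd F (Cmp C g f) = Cmp D (snd F g) (snd F f)"
  by (auto simp: is_functor_def composable_def)

lemma is_functorI:
  assumes "\<And>x. x \<in> Ob C \<Longrightarrow> fst F x \<in> Ob D" "\<And>f. f \<in> Mor C \<Longrightarrow> snd F f \<in> Mor D"
    and "\<And>f. f \<in> Mor C \<Longrightarrow> Src D (snd F f) = fst F (Src C f)" "\<And>f. f \<in> Mor C \<Longrightarrow> Tgt D (snd F f) = fst F (Tgt C f)"
    and "\<And>x. x \<in> Ob C \<Longrightarrow> snd F (Idt C x) = Idt D (fst F x)"
    and "\<And>f g. f \<in> Mor C \<Longrightarrow> g \<in> Mor C \<Longrightarrow> Src C g = Tgt C f \<Longrightarrow> snd F (Cmp C g f) = Cmp D (snd F g) (snd F f)"
  shows "is_functor C D F"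
  using assms by (auto simp: is_functor_def composable_def)

lemma fst_fcomp_on [simp]: "x \<in> Ob C \<Longrightarrow> fst (fcomp_on C H F) x = fst H (fst F x)"
  and snd_fcomp_on [simp]: "f \<in> Mor C \<Longrightarrow> snd (fcomp_on C H F) f = snd H (snd F f)"
  by (simp_all add: fcomp_on_def)

lemma fst_fid [simp]: "x \<in> Ob C \<Longrightarrow> fst (fid C) x = x"
  and snd_fid [simp]: "f \<in> Mor C \<Longrightarrow> snd (fid C) f = f"
  by (simp_all add: fid_def)

lemma functor_ext_fcomp_on [simp]: "functor_ext C (fcomp_on C H F)"
  and functor_ext_fid [simp]: "functor_ext C (fid C)"
  by (simp_all add: functor_ext_def fcomp_on_def fid_def)

lemma functor_eqI:
  assumes "functor_ext C F" "functor_ext C F'" "\<And>x. x \<in> Ob C \<Longrightarrow> fst F x = fst F' x" "\<And>f. f \<in> Mor C \<Longrightarrow> snd F f = snd F' f"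
  shows "F = F'"
  using assms unfolding functor_ext_def by (auto simp: prod_eq_iff intro: extensionalityI)

lemma is_functor_cong:
  assumes C: "precategory C" and F: "is_functor C D F"
    and "\<And>x. x \<in> Ob C \<Longrightarrow> fst F x = fst F' x" "\<And>f. f \<in> Mor C \<Longrightarrow> snd F f = snd F' f"
  shows "is_functor C D F'"
  using functor_Ob[OF F] functor_Mor[OF F] functor_Src[OF F] functor_Tgt[OF F] functor_Idt[OF F] functor_Cmp[OF F]
    C assms(3,4) by (intro is_functorI) (simp_all add: precategory_def)

lemma is_functor_fid: "precategory C \<Longrightarrow> is_functor C C (fid C)"
  by (rule is_functorI) (simp_all add: precategory_def)

lemma is_functor_fcomp_on:
  assumes C: "precategory C" and F: "is_functor C B F" and H: "is_functor B D H"
  shows "is_functor C D (fcomp_on C H F)"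
  using C functor_Ob[OF F] functor_Mor[OF F] functor_Src[OF F] functor_Tgt[OF F] functor_Idt[OF F] functor_Cmp[OF F]
    functor_Ob[OF H] functor_Mor[OF H] functor_Src[OF H] functor_Tgt[OF H] functor_Idt[OF H] functor_Cmp[OF H]
  by (intro is_functorI) (simp_all add: precategory_def)

lemma fcomp_on_assoc:
  assumes F: "is_functor C B F"
  shows "fcomp_on C (fcomp_on B K H) F = fcomp_on C K (fcomp_on C H F)"
  by (rule functor_eqI[of C]) (simp_all add: functor_Ob[OF F] functor_Mor[OF F])

lemma fcomp_on_fid_right: "functor_ext C F \<Longrightarrow> fcomp_on C F (fid C) = F"
  by (rule functor_eqI[of C]) simp_all

lemma fcomp_on_fid_left: "functor_ext C F \<Longrightarrow> is_functor C D F \<Longrightarrow> fcomp_on C (fid D) F = F"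
  by (rule functor_eqI[of C]) (simp_all add: functor_Ob functor_Mor)

lemma finv_on_eq:
  assumes F: "is_functor C C F" and F': "is_functor C C F'" "functor_ext C F'"
    and inv: "fcomp_on C F' F = fid C" "fcomp_on C F F' = fid C"
  shows "finv_on C C F = F'"
proof -
  have 1: "fst F' (fst F x) = x" "fst F (fst F' x) = x" if "x \<in> Ob C" for x
    using fst_fcomp_on[OF that, of F' F] fst_fcomp_on[OF that, of F F'] that by (simp_all add: inv)
  have 2: "snd F' (snd F x) = x" "snd F (snd F' x) = x" if "x \<in> Mor C" for x
    using snd_fcomp_on[OF that, of F' F] snd_fcomp_on[OF that, of F F'] that by (simp_all add: inv)
  have inj: "inj_on (fst F) (Ob C)" "inj_on (snd F) (Mor C)"
    using 1 2 by (auto intro: inj_on_inverseI)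
  show ?thesis
  proof (rule functor_eqI[of C])
    fix x assume x: "x \<in> Ob C"
    have "inv_into (Ob C) (fst F) (fst F (fst F' x)) = fst F' x" by (rule inv_into_f_f[OF inj(1) functor_Ob[OF F'(1) x]])
    then show "fst (finv_on C C F) x = fst F' x" using 1(2)[OF x] x by (simp add: finv_on_def)
  next
    fix x assume x: "x \<in> Mor C"
    have "inv_into (Mor C) (snd F) (snd F (snd F' x)) = snd F' x" by (rule inv_into_f_f[OF inj(2) functor_Mor[OF F'(1) x]])
    then show "snd (finv_on C C F) x = snd F' x" using 2(2)[OF x] x by (simp add: finv_on_def)
  qed (use F' in \<open>simp_all add: functor_ext_def finv_on_def\<close>)
qed

definition is_ntr :: "('o, 'm, 'y) cat_scheme \<Rightarrow> ('p, 'n, 'z) cat_scheme \<Rightarrow> ('o, 'm, 'p, 'n) ntr \<Rightarrow> bool" where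
  "is_ntr C D t \<longleftrightarrow> nat_trans C D (ntr_src t) (ntr_tgt t) (ntr_map t)"

lemma ntr_functor_src: "is_ntr C D t \<Longrightarrow> is_functor C D (ntr_src t)"
  and ntr_functor_tgt: "is_ntr C D t \<Longrightarrow> is_functor C D (ntr_tgt t)"
  and ntr_Mor: "is_ntr C D t \<Longrightarrow> x \<in> Ob C \<Longrightarrow> ntr_map t x \<in> Mor D"
  and ntr_Src: "is_ntr C D t \<Longrightarrow> x \<in> Ob C \<Longrightarrow> Src D (ntr_map t x) = fst (ntr_src t) x"
  and ntr_Tgt: "is_ntr C D t \<Longrightarrow> x \<in> Ob C \<Longrightarrow> Tgt D (ntr_map t x) = fst (ntr_tgt t) x"
  and ntr_natural: "is_ntr C D t \<Longrightarrow> f \<in> Mor C \<Longrightarrow>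
     Cmp D (ntr_map t (Tgt C f)) (snd (ntr_src t) f) = Cmp D (snd (ntr_tgt t) f) (ntr_map t (Src C f))"
  by (auto simp: is_ntr_def nat_trans_def)

lemma is_ntrI:
  assumes "is_functor C D (ntr_src t)" "is_functor C D (ntr_tgt t)"
    and "\<And>x. x \<in> Ob C \<Longrightarrow> ntr_map t x \<in> Mor D" "\<And>x. x \<in> Ob C \<Longrightarrow> Src D (ntr_map t x) = fst (ntr_src t) x"
    and "\<And>x. x \<in> Ob C \<Longrightarrow> Tgt D (ntr_map t x) = fst (ntr_tgt t) x"
    and "\<And>f. f \<in> Mor C \<Longrightarrow> Cmp D (ntr_map t (Tgt C f)) (snd (ntr_src t) f) = Cmp D (snd (ntr_tgt t) f) (ntr_map t (Src C f))"
  shows "is_ntr C D t"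
  using assms by (auto simp: is_ntr_def nat_trans_def)

lemma ntr_id_simps [simp]:
  "ntr_src (ntr_id C D F) = F" "ntr_tgt (ntr_id C D F) = F"
  "x \<in> Ob C \<Longrightarrow> ntr_map (ntr_id C D F) x = Idt D (fst F x)"
  "ntr_map (ntr_id C D F) \<in> extensional (Ob C)"
  by (simp_all add: ntr_id_def)

lemma vcomp_simps [simp]:
  "ntr_src (vcomp C D t s) = ntr_src s" "ntr_tgt (vcomp C D t s) = ntr_tgt t"
  "x \<in> Ob C \<Longrightarrow> ntr_map (vcomp C D t s) x = Cmp D (ntr_map t x) (ntr_map s x)"
  "ntr_map (vcomp C D t s) \<in> extensional (Ob C)"
  by (simp_all add: vcomp_def)

lemma hcomp_simps [simp]:
  "ntr_src (hcomp C D t s) = fcomp_on C (ntr_src t) (ntr_src s)"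
  "ntr_tgt (hcomp C D t s) = fcomp_on C (ntr_tgt t) (ntr_tgt s)"
  "x \<in> Ob C \<Longrightarrow> ntr_map (hcomp C D t s) x = Cmp D (ntr_map t (fst (ntr_tgt s) x)) (snd (ntr_src t) (ntr_map s x))"
  "ntr_map (hcomp C D t s) \<in> extensional (Ob C)"
  by (simp_all add: hcomp_def)

lemma ntr_eqI:
  assumes "ntr_src t = ntr_src s" "ntr_tgt t = ntr_tgt s"
    and "ntr_map t \<in> extensional (Ob C)" "ntr_map s \<in> extensional (Ob C)" "\<And>x. x \<in> Ob C \<Longrightarrow> ntr_map t x = ntr_map s x"
  shows "t = s"
  using assms by (auto simp: prod_eq_iff intro: extensionalityI)

lemma is_ntr_id:
  assumes "precategory C" "category D" "is_functor C D F" shows "is_ntr C D (ntr_id C D F)"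
  using assms by (intro is_ntrI)
    (simp_all add: category_simps functor_Ob functor_Mor functor_Src functor_Tgt precategory_def)

lemma is_ntr_vcomp:
  assumes C: "precategory C" and D: "category D" and s: "is_ntr C D s" and t: "is_ntr C D t" and st: "ntr_tgt s = ntr_src t"
  shows "is_ntr C D (vcomp C D t s)"
proof (rule is_ntrI)
  fix f assume f: "f \<in> Mor C"
  then have xy: "Src C f \<in> Ob C" "Tgt C f \<in> Ob C" using C by (auto simp: precategory_def)
  let ?s = "ntr_map s" and ?t = "ntr_map t" and ?x = "Src C f" and ?y = "Tgt C f"
  note S = ntr_functor_src[OF s] and T = ntr_functor_src[OF t] and T' = ntr_functor_tgt[OF t]
  note mor = ntr_Mor[OF s] ntr_Mor[OF t] functor_Mor[OF S f] functor_Mor[OF T f] functor_Mor[OF T' f]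
  note st_simps = xy st ntr_Src[OF s] ntr_Tgt[OF s] ntr_Src[OF t] ntr_Tgt[OF t]
    functor_Src[OF S f] functor_Tgt[OF S f] functor_Src[OF T f] functor_Tgt[OF T f] functor_Src[OF T' f] functor_Tgt[OF T' f]
  have "Cmp D (Cmp D (?t ?y) (?s ?y)) (snd (ntr_src s) f) = Cmp D (?t ?y) (Cmp D (?s ?y) (snd (ntr_src s) f))"
    using mor by (intro category_assoc[OF D, symmetric]) (simp_all add: st_simps)
  also have "\<dots> = Cmp D (?t ?y) (Cmp D (snd (ntr_src t) f) (?s ?x))" using ntr_natural[OF s f] st by simp
  also have "\<dots> = Cmp D (Cmp D (?t ?y) (snd (ntr_src t) f)) (?s ?x)"
    using mor by (intro category_assoc[OF D]) (simp_all add: st_simps)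
  also have "\<dots> = Cmp D (Cmp D (snd (ntr_tgt t) f) (?t ?x)) (?s ?x)" using ntr_natural[OF t f] by simp
  also have "\<dots> = Cmp D (snd (ntr_tgt t) f) (Cmp D (?t ?x) (?s ?x))"
    using mor by (intro category_assoc[OF D, symmetric]) (simp_all add: st_simps)
  finally show "Cmp D (ntr_map (vcomp C D t s) (Tgt C f)) (snd (ntr_src (vcomp C D t s)) f) =
         Cmp D (snd (ntr_tgt (vcomp C D t s)) f) (ntr_map (vcomp C D t s) (Src C f))"
    using xy by simp
qed (use s t st D in \<open>simp_all add: ntr_functor_src ntr_functor_tgt category_simps ntr_Mor ntr_Src ntr_Tgt\<close>)

text \<open>The square of \<open>t \<circ>\<^sub>H s\<close> is the image of the naturality square of \<open>s\<close> under \<open>ntr_src t\<close>,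
  pasted to the naturality square of \<open>t\<close> at \<open>snd (ntr_tgt s) f\<close>.\<close>

lemma is_ntr_hcomp:
  assumes C: "precategory C" and D: "category D" and s: "is_ntr C B s" and t: "is_ntr B D t"
  shows "is_ntr C D (hcomp C D t s)"
proof (rule is_ntrI)
  note S = ntr_functor_src[OF s] and S' = ntr_functor_tgt[OF s] and T = ntr_functor_src[OF t] and T' = ntr_functor_tgt[OF t]
  show "is_functor C D (ntr_src (hcomp C D t s))" "is_functor C D (ntr_tgt (hcomp C D t s))"
    using is_functor_fcomp_on[OF C] S S' T T' by simp_all
  let ?s = "ntr_map s" and ?t = "ntr_map t" and ?H = "snd (ntr_src t)" and ?H' = "snd (ntr_tgt t)"
    and ?F = "snd (ntr_src s)" and ?F' = "snd (ntr_tgt s)" and ?P = "fst (ntr_tgt s)"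
  note ob = functor_Ob[OF S'] functor_Ob[OF S] ntr_Mor[OF s]
  note rules = ob ntr_Mor[OF t] functor_Mor[OF T] functor_Mor[OF T'] functor_Mor[OF S] functor_Mor[OF S'] ntr_Src[OF s] ntr_Tgt[OF s] ntr_Src[OF t] ntr_Tgt[OF t]
    functor_Src[OF T] functor_Tgt[OF T] functor_Src[OF T'] functor_Tgt[OF T'] functor_Src[OF S] functor_Tgt[OF S] functor_Src[OF S'] functor_Tgt[OF S']
  fix x assume x: "x \<in> Ob C"
  show "ntr_map (hcomp C D t s) x \<in> Mor D"
    "Src D (ntr_map (hcomp C D t s) x) = fst (ntr_src (hcomp C D t s)) x"
    "Tgt D (ntr_map (hcomp C D t s) x) = fst (ntr_tgt (hcomp C D t s)) x"
    using x by (simp_all add: rules category_simps[OF D])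
next
  note S = ntr_functor_src[OF s] and S' = ntr_functor_tgt[OF s] and T = ntr_functor_src[OF t] and T' = ntr_functor_tgt[OF t]
  let ?s = "ntr_map s" and ?t = "ntr_map t" and ?H = "snd (ntr_src t)" and ?H' = "snd (ntr_tgt t)"
    and ?F = "snd (ntr_src s)" and ?F' = "snd (ntr_tgt s)" and ?P = "fst (ntr_tgt s)"
  note rules = functor_Ob[OF S'] functor_Ob[OF S] ntr_Mor[OF s] ntr_Mor[OF t] functor_Mor[OF T] functor_Mor[OF T'] functor_Mor[OF S] functor_Mor[OF S'] ntr_Src[OF s] ntr_Tgt[OF s] ntr_Src[OF t] ntr_Tgt[OF t]
    functor_Src[OF T] functor_Tgt[OF T] functor_Src[OF T'] functor_Tgt[OF T'] functor_Src[OF S] functor_Tgt[OF S] functor_Src[OF S'] functor_Tgt[OF S']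
  fix f assume f: "f \<in> Mor C"
  let ?x = "Src C f" and ?y = "Tgt C f"
  have xy: "?x \<in> Ob C" "?y \<in> Ob C" using C f by (auto simp: precategory_def)
  have "Cmp D (Cmp D (?t (?P ?y)) (?H (?s ?y))) (?H (?F f)) = Cmp D (?t (?P ?y)) (Cmp D (?H (?s ?y)) (?H (?F f)))"
    using f xy by (intro category_assoc[OF D, symmetric]) (simp_all add: rules)
  also have "Cmp D (?H (?s ?y)) (?H (?F f)) = ?H (Cmp B (?s ?y) (?F f))"
    using f xy by (intro functor_Cmp[OF T, symmetric]) (simp_all add: rules)
  also have "\<dots> = ?H (Cmp B (?F' f) (?s ?x))" using ntr_natural[OF s f] by simp
  also have "\<dots> = Cmp D (?H (?F' f)) (?H (?s ?x))"
    using f xy by (intro functor_Cmp[OF T]) (simp_all add: rules)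
  also have "Cmp D (?t (?P ?y)) \<dots> = Cmp D (Cmp D (?t (?P ?y)) (?H (?F' f))) (?H (?s ?x))"
    using f xy by (intro category_assoc[OF D]) (simp_all add: rules)
  also have "Cmp D (?t (?P ?y)) (?H (?F' f)) = Cmp D (?H' (?F' f)) (?t (?P ?x))"
    using ntr_natural[OF t functor_Mor[OF S' f]] f by (simp add: rules)
  also have "Cmp D \<dots> (?H (?s ?x)) = Cmp D (?H' (?F' f)) (Cmp D (?t (?P ?x)) (?H (?s ?x)))"
    using f xy by (intro category_assoc[OF D, symmetric]) (simp_all add: rules)
  finally show "Cmp D (ntr_map (hcomp C D t s) (Tgt C f)) (snd (ntr_src (hcomp C D t s)) f) =
         Cmp D (snd (ntr_tgt (hcomp C D t s)) f) (ntr_map (hcomp C D t s) (Src C f))"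
    using xy f by simp
qed

lemma vcomp_assoc:
  assumes D: "category D" and s: "is_ntr C D s" and t: "is_ntr C D t" and u: "is_ntr C D u"
    and "ntr_tgt s = ntr_src t" "ntr_tgt t = ntr_src u"
  shows "vcomp C D u (vcomp C D t s) = vcomp C D (vcomp C D u t) s"
  by (rule ntr_eqI[of _ _ C])
    (use assms in \<open>simp_all add: category_assoc[OF D] ntr_Mor ntr_Src ntr_Tgt\<close>)

lemma vcomp_id_right:
  assumes "category D" "is_ntr C D t" "ntr_map t \<in> extensional (Ob C)" "ntr_src t = F"
  shows "vcomp C D t (ntr_id C D F) = t"
  by (rule ntr_eqI[of _ _ C]) (use assms in \<open>auto simp: category_simps ntr_Mor ntr_Src\<close>)

lemma vcomp_id_left:
  assumes "category D" "is_ntr C D t" "ntr_map t \<in> extensional (Ob C)" "ntr_tgt t = F"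
  shows "vcomp C D (ntr_id C D F) t = t"
  by (rule ntr_eqI[of _ _ C]) (use assms in \<open>auto simp: category_simps ntr_Mor ntr_Tgt\<close>)

lemma hcomp_assoc:
  assumes D: "category D" and s: "is_ntr C B s" and t: "is_ntr B A t" and u: "is_ntr A D u"
  shows "hcomp C D (hcomp B D u t) s = hcomp C D u (hcomp C A t s)"
proof (rule ntr_eqI[of _ _ C])
  note S = ntr_functor_src[OF s] and S' = ntr_functor_tgt[OF s] and T = ntr_functor_src[OF t] and T' = ntr_functor_tgt[OF t]
  note U = ntr_functor_src[OF u]
  show "ntr_src (hcomp C D (hcomp B D u t) s) = ntr_src (hcomp C D u (hcomp C A t s))"
    "ntr_tgt (hcomp C D (hcomp B D u t) s) = ntr_tgt (hcomp C D u (hcomp C A t s))"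
    by (simp_all add: fcomp_on_assoc[OF S] fcomp_on_assoc[OF S'])
  fix x assume x: "x \<in> Ob C"
  note rules = x functor_Ob[OF S'] ntr_Mor[OF s] ntr_Mor[OF t] ntr_Mor[OF u] functor_Mor[OF T] functor_Mor[OF U] functor_Ob[OF T']
    ntr_Src[OF s] ntr_Tgt[OF s] ntr_Src[OF t] ntr_Tgt[OF t] ntr_Src[OF u] ntr_Tgt[OF u]
    functor_Src[OF T] functor_Tgt[OF T] functor_Src[OF U] functor_Tgt[OF U]
  have "snd (ntr_src u) (Cmp A (ntr_map t (fst (ntr_tgt s) x)) (snd (ntr_src t) (ntr_map s x)))
      = Cmp D (snd (ntr_src u) (ntr_map t (fst (ntr_tgt s) x))) (snd (ntr_src u) (snd (ntr_src t) (ntr_map s x)))"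
    by (intro functor_Cmp[OF U]) (simp_all add: rules)
  then show "ntr_map (hcomp C D (hcomp B D u t) s) x = ntr_map (hcomp C D u (hcomp C A t s)) x"
    by (simp add: rules category_assoc[OF D])
qed simp_all

text \<open>The interchange law, from naturality of \<open>t\<close> at the components of \<open>s'\<close>.\<close>

lemma hcomp_interchange:
  assumes D: "category D" and s: "is_ntr C B s" and s': "is_ntr C B s'" and t: "is_ntr B D t" and t': "is_ntr B D t'"
    and ss: "ntr_tgt s = ntr_src s'" and tt: "ntr_tgt t = ntr_src t'"
  shows "hcomp C D (vcomp B D t' t) (vcomp C B s' s) = vcomp C D (hcomp C D t' s') (hcomp C D t s)"
proof (rule ntr_eqI[of _ _ C])
  note S'' = ntr_functor_tgt[OF s'] and S' = ntr_functor_tgt[OF s] and T = ntr_functor_src[OF t] and T' = ntr_functor_tgt[OF t]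
  fix x assume x: "x \<in> Ob C"
  note rules = x functor_Ob[OF S''] functor_Ob[OF S'] ntr_Mor[OF s] ntr_Mor[OF s'] ntr_Mor[OF t] ntr_Mor[OF t'] functor_Mor[OF T] functor_Mor[OF T']
    ntr_Src[OF s] ntr_Tgt[OF s] ntr_Src[OF s'] ntr_Tgt[OF s'] ntr_Src[OF t] ntr_Tgt[OF t] ntr_Src[OF t'] ntr_Tgt[OF t']
    functor_Src[OF T] functor_Tgt[OF T] functor_Src[OF T'] functor_Tgt[OF T'] ss[symmetric] tt[symmetric]
  let ?s = "ntr_map s x" and ?s' = "ntr_map s' x" and ?H = "snd (ntr_src t)" and ?H' = "snd (ntr_tgt t)"
  let ?y = "fst (ntr_tgt s) x" and ?z = "fst (ntr_tgt s') x"
  let ?t = "ntr_map t" and ?t' = "ntr_map t'"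
  have "Cmp D (Cmp D (?t' ?z) (?t ?z)) (?H (Cmp B ?s' ?s)) = Cmp D (Cmp D (?t' ?z) (?t ?z)) (Cmp D (?H ?s') (?H ?s))"
    by (subst functor_Cmp[OF T]) (simp_all add: rules)
  also have "\<dots> = Cmp D (Cmp D (Cmp D (?t' ?z) (?t ?z)) (?H ?s')) (?H ?s)"
    by (intro category_assoc[OF D]) (simp_all add: rules category_simps[OF D])
  also have "Cmp D (Cmp D (?t' ?z) (?t ?z)) (?H ?s') = Cmp D (?t' ?z) (Cmp D (?t ?z) (?H ?s'))"
    by (intro category_assoc[OF D, symmetric]) (simp_all add: rules)
  also have "Cmp D (?t ?z) (?H ?s') = Cmp D (?H' ?s') (?t ?y)"
    using ntr_natural[OF t, of ?s'] by (simp add: rules)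
  also have "Cmp D (?t' ?z) \<dots> = Cmp D (Cmp D (?t' ?z) (?H' ?s')) (?t ?y)"
    by (intro category_assoc[OF D]) (simp_all add: rules)
  also have "Cmp D \<dots> (?H ?s) = Cmp D (Cmp D (?t' ?z) (?H' ?s')) (Cmp D (?t ?y) (?H ?s))"
    by (intro category_assoc[OF D, symmetric]) (simp_all add: rules category_simps[OF D])
  finally show "ntr_map (hcomp C D (vcomp B D t' t) (vcomp C B s' s)) x = ntr_map (vcomp C D (hcomp C D t' s') (hcomp C D t s)) x"
    by (simp add: rules)
qed simp_all

lemma hcomp_ntr_id:
  assumes D: "category D" and F: "is_functor C B F" and H: "is_functor B D H"
  shows "hcomp C D (ntr_id B D H) (ntr_id C B F) = ntr_id C D (fcomp_on C H F)"
  by (rule ntr_eqI[of _ _ C])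
    (simp_all add: functor_Ob[OF F] functor_Ob[OF H] functor_Idt[OF H] category_simps[OF D])

lemma hcomp_id_right:
  assumes C: "precategory C" and D: "category D" and t: "is_ntr C D t" and "functor_ext C (ntr_src t)" "functor_ext C (ntr_tgt t)"
    "ntr_map t \<in> extensional (Ob C)"
  shows "hcomp C D t (ntr_id C C (fid C)) = t"
proof (rule ntr_eqI[of _ _ C])
  fix x assume "x \<in> Ob C"
  then show "ntr_map (hcomp C D t (ntr_id C C (fid C))) x = ntr_map t x"
    by (simp add: functor_Idt[OF ntr_functor_src[OF t]] category_Idt_right[OF D] ntr_Mor[OF t] ntr_Src[OF t])
qed (simp_all add: assms fcomp_on_fid_right)

section \<open>Groupoids and the 2-group of automorphisms\<close>

lemma groupoid_category: "groupoid C \<Longrightarrow> category C"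
  by (simp add: groupoid_def)

lemma inverse_mor_unique:
  assumes C: "category C" and g: "inverse_mor C f g" and h: "inverse_mor C f h" shows "g = h"
proof -
  have "g = Cmp C g (Cmp C f h)" using g h C by (simp add: inverse_mor_def category_Idt_right)
  also have "\<dots> = Cmp C (Cmp C g f) h" using g h by (intro category_assoc[OF C]) (auto simp: inverse_mor_def)
  also have "\<dots> = h" using g h C by (simp add: inverse_mor_def category_Idt_left)
  finally show ?thesis .
qed

lemma mor_inv_eqI: "category C \<Longrightarrow> inverse_mor C f g \<Longrightarrow> mor_inv C f = g"
  unfolding mor_inv_def using inverse_mor_unique by (metis the_equality)

lemma inverse_mor_mor_inv: "groupoid C \<Longrightarrow> f \<in> Mor C \<Longrightarrow> inverse_mor C f (mor_inv C f)"
  using mor_inv_eqI unfolding groupoid_def iso_mor_def by metis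

lemma mor_inv_Mor: "groupoid C \<Longrightarrow> f \<in> Mor C \<Longrightarrow> mor_inv C f \<in> Mor C"
  and mor_inv_Src: "groupoid C \<Longrightarrow> f \<in> Mor C \<Longrightarrow> Src C (mor_inv C f) = Tgt C f"
  and mor_inv_Tgt: "groupoid C \<Longrightarrow> f \<in> Mor C \<Longrightarrow> Tgt C (mor_inv C f) = Src C f"
  and mor_inv_left: "groupoid C \<Longrightarrow> f \<in> Mor C \<Longrightarrow> Cmp C (mor_inv C f) f = Idt C (Src C f)"
  and mor_inv_right: "groupoid C \<Longrightarrow> f \<in> Mor C \<Longrightarrow> Cmp C f (mor_inv C f) = Idt C (Tgt C f)"
  using inverse_mor_mor_inv by (force simp: inverse_mor_def)+

lemma functor_mor_inv:
  assumes C: "groupoid C" and D: "category D" and F: "is_functor C D F" and f: "f \<in> Mor C"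
  shows "snd F (mor_inv C f) = mor_inv D (snd F f)"
proof (rule mor_inv_eqI[OF D, symmetric])
  note C' = groupoid_category[OF C] and i = mor_inv_Mor[OF C f] mor_inv_Src[OF C f] mor_inv_Tgt[OF C f]
  have "Cmp D (snd F (mor_inv C f)) (snd F f) = snd F (Cmp C (mor_inv C f) f)"
    "Cmp D (snd F f) (snd F (mor_inv C f)) = snd F (Cmp C f (mor_inv C f))"
    using f i by (simp_all add: functor_Cmp[OF F])
  then show "inverse_mor D (snd F f) (snd F (mor_inv C f))"
    using f i by (simp add: inverse_mor_def functor_Mor[OF F] functor_Src[OF F] functor_Tgt[OF F]
      mor_inv_left[OF C] mor_inv_right[OF C] functor_Idt[OF F] category_Src[OF C'] category_Tgt[OF C'])
qed

lemma groupoid_square_inv: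
  assumes C: "groupoid C" and mor: "a \<in> Mor C" "b \<in> Mor C" "g \<in> Mor C" "h \<in> Mor C"
    and st: "Src C a = Tgt C g" "Src C h = Tgt C b" "Src C g = Src C b" "Tgt C h = Tgt C a"
    and eq: "Cmp C a g = Cmp C h b"
  shows "Cmp C (mor_inv C a) h = Cmp C g (mor_inv C b)"
proof -
  note C' = groupoid_category[OF C]
  note rules = mor st mor_inv_Mor[OF C] mor_inv_Src[OF C] mor_inv_Tgt[OF C] category_simps[OF C']
  have "Cmp C g (mor_inv C b) = Cmp C (Cmp C (Cmp C (mor_inv C a) a) g) (mor_inv C b)"
    by (simp add: rules mor_inv_left[OF C])
  also have "Cmp C (Cmp C (mor_inv C a) a) g = Cmp C (mor_inv C a) (Cmp C a g)"
    by (intro category_assoc[OF C', symmetric]) (simp_all add: rules)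
  also have "\<dots> = Cmp C (mor_inv C a) (Cmp C h b)" by (simp add: eq)
  also have "\<dots> = Cmp C (Cmp C (mor_inv C a) h) b"
    by (intro category_assoc[OF C']) (simp_all add: rules)
  also have "Cmp C \<dots> (mor_inv C b) = Cmp C (Cmp C (mor_inv C a) h) (Cmp C b (mor_inv C b))"
    by (intro category_assoc[OF C', symmetric]) (simp_all add: rules)
  also have "\<dots> = Cmp C (mor_inv C a) h" by (simp add: rules mor_inv_right[OF C])
  finally show ?thesis by simp
qed

lemma nat_iso_groupoid: "groupoid D \<Longrightarrow> nat_iso C D F F' \<eta> \<longleftrightarrow> nat_trans C D F F' \<eta>"
  by (auto simp: nat_iso_def nat_trans_def groupoid_def)

text \<open>The inverse of \<open>\<eta> : F \<Rightarrow> F'\<close> for horizontal composition has the components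
  \<open>(F\<inverse>(\<eta>\<^bsub>F'\<inverse> y\<^esub>))\<inverse> : F\<inverse> y \<rightarrow> F'\<inverse> y\<close>; naturality is the inverted naturality square
  of \<open>\<eta>\<close> at \<open>F'\<inverse> f\<close>, transported by \<open>F\<inverse>\<close>.\<close>

definition hinverse :: "('o, 'm, 'y) cat_scheme \<Rightarrow> ('o, 'm, 'o, 'm) ntr \<Rightarrow> ('o, 'm, 'o, 'm) ntr" where
  "hinverse C t = (finv_on C C (ntr_src t),
     restrict (\<lambda>y. mor_inv C (snd (finv_on C C (ntr_src t)) (ntr_map t (fst (finv_on C C (ntr_tgt t)) y)))) (Ob C),
     finv_on C C (ntr_tgt t))"

lemma hinverse_simps [simp]:
  "ntr_src (hinverse C t) = finv_on C C (ntr_src t)" "ntr_tgt (hinverse C t) = finv_on C C (ntr_tgt t)"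
  "y \<in> Ob C \<Longrightarrow> ntr_map (hinverse C t) y = mor_inv C (snd (finv_on C C (ntr_src t)) (ntr_map t (fst (finv_on C C (ntr_tgt t)) y)))"
  "ntr_map (hinverse C t) \<in> extensional (Ob C)"
  by (simp_all add: hinverse_def)

lemma hinverse:
  assumes C: "groupoid C" and t: "is_ntr C C t"
    and F: "is_functor C C (finv_on C C (ntr_src t))" "fcomp_on C (ntr_src t) (finv_on C C (ntr_src t)) = fid C"
      "fcomp_on C (finv_on C C (ntr_src t)) (ntr_src t) = fid C"
    and F': "is_functor C C (finv_on C C (ntr_tgt t))" "fcomp_on C (ntr_tgt t) (finv_on C C (ntr_tgt t)) = fid C"
      "fcomp_on C (finv_on C C (ntr_tgt t)) (ntr_tgt t) = fid C"
  shows "is_ntr C C (hinverse C t)" and "hcomp C C t (hinverse C t) = ntr_id C C (fid C)"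
    and "hcomp C C (hinverse C t) t = ntr_id C C (fid C)"
proof -
  let ?F = "ntr_src t" and ?F' = "ntr_tgt t" and ?G = "finv_on C C (ntr_src t)" and ?G' = "finv_on C C (ntr_tgt t)"
  note C' = groupoid_category[OF C]
  have FG: "fst ?F (fst ?G x) = x" "fst ?G (fst ?F x) = x" "fst ?F' (fst ?G' x) = x" "fst ?G' (fst ?F' x) = x"
    if "x \<in> Ob C" for x
    using F(2,3) F'(2,3) that fst_fcomp_on[OF that] fst_fid[OF that] by metis+
  have FGm: "snd ?F (snd ?G x) = x" "snd ?G (snd ?F x) = x" "snd ?F' (snd ?G' x) = x" if "x \<in> Mor C" for x
    using F(2,3) F'(2) that snd_fcomp_on[OF that] snd_fid[OF that] by metis+
  let ?a = "\<lambda>y. snd ?G (ntr_map t (fst ?G' y))"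
  note F0 = ntr_functor_src[OF t]
  note rules = functor_Ob[OF F(1)] functor_Ob[OF F'(1)] functor_Mor[OF F(1)] functor_Mor[OF F'(1)] functor_Src[OF F(1)]
    functor_Tgt[OF F(1)] functor_Src[OF F'(1)] functor_Tgt[OF F'(1)] ntr_Mor[OF t] ntr_Src[OF t] ntr_Tgt[OF t] FG
    category_Src[OF C'] category_Tgt[OF C'] functor_Mor[OF F0] functor_Src[OF F0] functor_Tgt[OF F0]
  have a: "?a y \<in> Mor C" "Src C (?a y) = fst ?G' y" "Tgt C (?a y) = fst ?G y" if "y \<in> Ob C" for y
    using that by (simp_all add: rules)
  show "is_ntr C C (hinverse C t)"
  proof (rule is_ntrI)
    fix f assume f: "f \<in> Mor C"
    let ?x = "Src C f" and ?y = "Tgt C f"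
    have xy: "?x \<in> Ob C" "?y \<in> Ob C" using f by (simp_all add: rules)
    have "Cmp C (?a ?y) (snd ?G' f) = Cmp C (?a ?y) (snd ?G (snd ?F (snd ?G' f)))" using f by (simp add: FGm rules)
    also have "\<dots> = snd ?G (Cmp C (ntr_map t (fst ?G' ?y)) (snd ?F (snd ?G' f)))"
      using f xy by (subst functor_Cmp[OF F(1)]) (simp_all add: rules)
    also have "Cmp C (ntr_map t (fst ?G' ?y)) (snd ?F (snd ?G' f)) = Cmp C (snd ?F' (snd ?G' f)) (ntr_map t (fst ?G' ?x))"
      using ntr_natural[OF t functor_Mor[OF F'(1) f]] f by (simp add: rules)
    also have "snd ?F' (snd ?G' f) = f" using f by (simp add: FGm)
    also have "snd ?G (Cmp C f (ntr_map t (fst ?G' ?x))) = Cmp C (snd ?G f) (?a ?x)"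
      using f xy by (subst functor_Cmp[OF F(1)]) (simp_all add: rules)
    finally have "Cmp C (mor_inv C (?a ?y)) (snd ?G f) = Cmp C (snd ?G' f) (mor_inv C (?a ?x))"
      using f xy a[OF xy(1)] a[OF xy(2)] by (intro groupoid_square_inv[OF C]) (simp_all add: rules)
    then show "Cmp C (ntr_map (hinverse C t) (Tgt C f)) (snd (ntr_src (hinverse C t)) f) =
         Cmp C (snd (ntr_tgt (hinverse C t)) f) (ntr_map (hinverse C t) (Src C f))" using xy by simp
  qed (use F F' a in \<open>simp_all add: mor_inv_Mor[OF C] mor_inv_Src[OF C] mor_inv_Tgt[OF C]\<close>)
  show "hcomp C C t (hinverse C t) = ntr_id C C (fid C)"
  proof (rule ntr_eqI[of _ _ C])
    fix y assume y: "y \<in> Ob C"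
    have "snd ?F (mor_inv C (?a y)) = mor_inv C (snd ?F (?a y))"
      using a[OF y] by (intro functor_mor_inv[OF C C' F0])
    also have "snd ?F (?a y) = ntr_map t (fst ?G' y)" using y by (simp add: FGm rules)
    finally show "ntr_map (hcomp C C t (hinverse C t)) y = ntr_map (ntr_id C C (fid C)) y"
      using y by (simp add: mor_inv_right[OF C] rules)
  qed (simp_all add: F F')
  show "hcomp C C (hinverse C t) t = ntr_id C C (fid C)"
  proof (rule ntr_eqI[of _ _ C])
    fix x assume x: "x \<in> Ob C"
    then show "ntr_map (hcomp C C (hinverse C t) t) x = ntr_map (ntr_id C C (fid C)) x"
      using functor_Ob[OF ntr_functor_tgt[OF t] x] by (simp add: mor_inv_left[OF C] rules)
  qed (simp_all add: F F')
qed

text \<open>Automorphisms and their natural transformations form a strict 2-group as soon as they are closed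
  under the operations. That inversion is a functor needs no separate construction: by the interchange law
  the composite of two inverses is inverse to the composite, and inverses in a group are unique.\<close>

lemma strict_2group_automorphisms:
  fixes C :: "('o, 'm, 'z) cat_scheme"
  assumes C: "category C"
    and S0: "\<And>F. F \<in> S0 \<Longrightarrow> is_functor C C F \<and> functor_ext C F" "fid C \<in> S0"
      "\<And>F H. F \<in> S0 \<Longrightarrow> H \<in> S0 \<Longrightarrow> fcomp_on C H F \<in> S0"
      "\<And>F. F \<in> S0 \<Longrightarrow> \<exists>H\<in>S0. fcomp_on C F H = fid C"
    and S1: "\<And>t. t \<in> S1 \<Longrightarrow> ntr_src t \<in> S0 \<and> ntr_tgt t \<in> S0 \<and> is_ntr C C t \<and> ntr_map t \<in> extensional (Ob C)"
      "\<And>F. F \<in> S0 \<Longrightarrow> ntr_id C C F \<in> S1"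
      "\<And>t s. t \<in> S1 \<Longrightarrow> s \<in> S1 \<Longrightarrow> ntr_tgt s = ntr_src t \<Longrightarrow> vcomp C C t s \<in> S1"
      "\<And>t s. t \<in> S1 \<Longrightarrow> s \<in> S1 \<Longrightarrow> hcomp C C t s \<in> S1"
      "\<And>t. t \<in> S1 \<Longrightarrow> \<exists>s\<in>S1. hcomp C C t s = ntr_id C C (fid C)"
  shows "strict_2group \<lparr>Ob = S0, Mor = S1, Src = (\<lambda>t. ntr_src t), Tgt = (\<lambda>t. ntr_tgt t), Idt = ntr_id C C, Cmp = vcomp C C\<rparr>
     \<lparr>carrier = S0, mult = (\<lambda>F F'. fcomp_on C F' F), one = fid C\<rparr>
     \<lparr>carrier = S1, mult = (\<lambda>\<Psi> \<Psi>'. hcomp C C \<Psi>' \<Psi>), one = ntr_id C C (fid C)\<rparr>" (is "strict_2group ?C ?H0 ?H1")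
proof -
  note pC = category_precategory[OF C]
  have cat: "category ?C"
    unfolding category_def using S0 S1
    by (auto simp: vcomp_assoc[OF C] intro!: vcomp_id_left[OF C] vcomp_id_right[OF C])
  have g0: "group ?H0"
  proof (rule groupI)
    fix x y z assume "x \<in> carrier ?H0" "y \<in> carrier ?H0" "z \<in> carrier ?H0"
    then show "x \<otimes>\<^bsub>?H0\<^esub> y \<otimes>\<^bsub>?H0\<^esub> z = x \<otimes>\<^bsub>?H0\<^esub> (y \<otimes>\<^bsub>?H0\<^esub> z)"
      using S0(1) fcomp_on_assoc[of C C x z y] by simp
  qed (use S0 in \<open>auto simp: fcomp_on_fid_right\<close>)
  have g1: "group ?H1"
  proof (rule groupI)
    fix x y z assume "x \<in> carrier ?H1" "y \<in> carrier ?H1" "z \<in> carrier ?H1"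
    then show "x \<otimes>\<^bsub>?H1\<^esub> y \<otimes>\<^bsub>?H1\<^esub> z = x \<otimes>\<^bsub>?H1\<^esub> (y \<otimes>\<^bsub>?H1\<^esub> z)"
      using S1(1) hcomp_assoc[OF C, of C C x C y z] by simp
  next
    fix x assume x: "x \<in> carrier ?H1"
    then show "\<one>\<^bsub>?H1\<^esub> \<otimes>\<^bsub>?H1\<^esub> x = x"
      using S1(1) S0(1) by (simp add: hcomp_id_right[OF pC C])
    show "\<exists>y\<in>carrier ?H1. y \<otimes>\<^bsub>?H1\<^esub> x = \<one>\<^bsub>?H1\<^esub>" using x S1(5) by simp
  qed (use S0 S1 in auto)
  have mult: "is_functor (prod_cat ?C ?C) ?C (\<lambda>(x, y). x \<otimes>\<^bsub>?H0\<^esub> y, \<lambda>(f, g). f \<otimes>\<^bsub>?H1\<^esub> g)"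
  proof (rule is_functorI)
    fix x assume "x \<in> Ob (prod_cat ?C ?C)"
    then show "snd (\<lambda>(x, y). x \<otimes>\<^bsub>?H0\<^esub> y, \<lambda>(f, g). f \<otimes>\<^bsub>?H1\<^esub> g) (Idt (prod_cat ?C ?C) x) =
         Idt ?C (fst (\<lambda>(x, y). x \<otimes>\<^bsub>?H0\<^esub> y, \<lambda>(f, g). f \<otimes>\<^bsub>?H1\<^esub> g) x)"
      using S0(1) by (auto simp: prod_cat_def hcomp_ntr_id[OF C])
  next
    fix f g assume "f \<in> Mor (prod_cat ?C ?C)" "g \<in> Mor (prod_cat ?C ?C)" "Src (prod_cat ?C ?C) g = Tgt (prod_cat ?C ?C) f"
    then show "snd (\<lambda>(x, y). x \<otimes>\<^bsub>?H0\<^esub> y, \<lambda>(f, g). f \<otimes>\<^bsub>?H1\<^esub> g) (Cmp (prod_cat ?C ?C) g f) =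
         Cmp ?C (snd (\<lambda>(x, y). x \<otimes>\<^bsub>?H0\<^esub> y, \<lambda>(f, g). f \<otimes>\<^bsub>?H1\<^esub> g) g) (snd (\<lambda>(x, y). x \<otimes>\<^bsub>?H0\<^esub> y, \<lambda>(f, g). f \<otimes>\<^bsub>?H1\<^esub> g) f)"
      using S1(1) by (cases f; cases g) (simp add: prod_cat_def hcomp_interchange[OF C])
  qed (use S0 S1 in \<open>auto simp: prod_cat_def\<close>)
  interpret H0: group ?H0 by (rule g0)
  interpret H1: group ?H1 by (rule g1)
  let ?i0 = "m_inv ?H0" and ?i1 = "m_inv ?H1"
  have i1: "?i1 t \<in> S1" "hcomp C C t (?i1 t) = ntr_id C C (fid C)" if "t \<in> S1" for t
    using H1.inv_closed[of t] H1.l_inv[of t] that by simp_all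
  have i1_src: "ntr_src (?i1 t) = ?i0 (ntr_src t)" "ntr_tgt (?i1 t) = ?i0 (ntr_tgt t)" if "t \<in> S1" for t
    using S1(1)[OF that] S1(1)[OF i1(1)[OF that]] arg_cong[OF i1(2)[OF that], of "\<lambda>t. ntr_src t"]
      arg_cong[OF i1(2)[OF that], of "\<lambda>t. ntr_tgt t"] H0.inv_equality[of "ntr_src (?i1 t)" "ntr_src t"]
      H0.inv_equality[of "ntr_tgt (?i1 t)" "ntr_tgt t"] by simp_all
  have inv: "is_functor ?C ?C (?i0, ?i1)"
  proof (rule is_functorI)
    fix x assume "x \<in> Ob ?C"
    then have x: "x \<in> S0" by simp
    then have ix: "?i0 x \<in> S0" "fcomp_on C x (?i0 x) = fid C" using H0.inv_closed[of x] H0.l_inv[of x] by simp_all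
    have "hcomp C C (ntr_id C C x) (ntr_id C C (?i0 x)) = ntr_id C C (fid C)"
      using S0(1)[OF x] S0(1)[OF ix(1)] ix(2) by (simp add: hcomp_ntr_id[OF C])
    then show "snd (?i0, ?i1) (Idt ?C x) = Idt ?C (fst (?i0, ?i1) x)"
      using H1.inv_equality[of "ntr_id C C (?i0 x)" "ntr_id C C x"] S1(2) x ix by simp
  next
    fix f g assume "f \<in> Mor ?C" "g \<in> Mor ?C" "Src ?C g = Tgt ?C f"
    then have fg: "f \<in> S1" "g \<in> S1" "ntr_tgt f = ntr_src g" by simp_all
    have ifg: "ntr_tgt (?i1 f) = ntr_src (?i1 g)" using fg by (simp add: i1_src)
    have "hcomp C C (vcomp C C g f) (vcomp C C (?i1 g) (?i1 f)) = vcomp C C (hcomp C C g (?i1 g)) (hcomp C C f (?i1 f))"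
      using S1(1) i1 fg ifg by (intro hcomp_interchange[OF C]) auto
    also have "\<dots> = ntr_id C C (fid C)"
      using i1 fg S0(1,2) by (simp add: vcomp_id_left[OF C is_ntr_id[OF pC C is_functor_fid[OF pC]]])
    finally show "snd (?i0, ?i1) (Cmp ?C g f) = Cmp ?C (snd (?i0, ?i1) g) (snd (?i0, ?i1) f)"
      using H1.inv_equality[of "vcomp C C (?i1 g) (?i1 f)" "vcomp C C g f"] S1(3) i1 fg ifg by simp
  qed (use H0.inv_closed i1 i1_src in auto)
  show ?thesis unfolding strict_2group_def using cat g0 g1 mult inv by simp
qed

section \<open>The tangent groupoid\<close>

text \<open>Continuity of smooth maps.\<close>

lemma smooth_at_neighbourhood:
  assumes M: "pre_manifold M" and N: "pre_manifold N" and f: "smooth_at M N f p"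
    and W: "mfd_open N W" "f p \<in> W"
  shows "\<exists>V. mfd_open M V \<and> p \<in> V \<and> f ` V \<subseteq> W"
proof -
  obtain c d where c: "chart_at M p c" and d: "chart_at N (f p) d" and s: "smooth_in_charts c d f p"
    using f unfolding smooth_at_iff[OF M N] by blast
  obtain V where V: "p \<in> V" "V \<subseteq> fst c" "f ` V \<subseteq> fst d" "open (snd c ` V)" "smooth_on (snd c ` V) (coord_change c d f)"
    using s unfolding smooth_in_charts_def by blast
  note c' = chart_at_atlas[OF c] and d' = chart_at_atlas[OF d]
  let ?V = "V \<inter> f -` W" and ?f = "coord_change c d f"
  have "snd c ` ?V = snd c ` V \<inter> ?f -` (snd d ` (W \<inter> fst d))" (is "?L = ?R")
  proof (intro equalityI subsetI)
    fix x assume "x \<in> ?L"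
    then obtain q where q: "q \<in> V" "f q \<in> W" "x = snd c q" by blast
    then have "?f x = snd d (f q)" using coord_change_apply[OF M c', of q d f] V(2) by auto
    then show "x \<in> ?R" using q V(3) by blast
  next
    fix x assume "x \<in> ?R"
    then obtain q y where q: "q \<in> V" "x = snd c q" and y: "y \<in> W" "y \<in> fst d" "?f x = snd d y" by blast
    have "snd d (f q) = snd d y" using q y coord_change_apply[OF M c', of q d f] V(2) by auto
    moreover have "f q \<in> fst d" using q V by blast
    ultimately have "f q = y" using chart_inv_left[OF N d'] y(2) by metis
    then show "x \<in> ?L" using q y by blast
  qed
  moreover have "open (snd d ` (W \<inter> fst d))" using W d' by (simp add: mfd_open_def)
  ultimately have "open (snd c ` ?V)"
    using smooth_on_continuous[OF V(5)] V(4) continuous_open_preimage by metis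
  then have "mfd_open M ?V" by (intro mfd_open_in_chart[OF M c']) (use V in auto)
  then show ?thesis using V W by (intro exI[of _ ?V]) auto
qed

lemma pts_objM [simp]: "pts (objM X) = Ob X"
  and pts_morM [simp]: "pts (morM X) = Mor X"
  by (simp_all add: objM_def morM_def)

lemma tangent_gpd_simps [simp]:
  "Ob (tangent_gpd X) = pts (TM (objM X))" "Mor (tangent_gpd X) = pts (TM (morM X))"
  "Src (tangent_gpd X) = tmap (morM X) (objM X) (Src X)" "Tgt (tangent_gpd X) = tmap (morM X) (objM X) (Tgt X)"
  "Idt (tangent_gpd X) = tmap (objM X) (morM X) (Idt X)"
  "objM (tangent_gpd X) = TM (objM X)" "morM (tangent_gpd X) = TM (morM X)"
  by (simp_all add: tangent_gpd_def objM_def morM_def TM_def)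


lemma lie_groupoid_groupoid: "lie_groupoid X \<Longrightarrow> groupoid X"
  and lie_groupoid_objM: "lie_groupoid X \<Longrightarrow> pre_manifold (objM X)"
  and lie_groupoid_morM: "lie_groupoid X \<Longrightarrow> pre_manifold (morM X)"
  and lie_groupoid_Src: "lie_groupoid X \<Longrightarrow> smooth_map (morM X) (objM X) (Src X)"
  and lie_groupoid_Tgt: "lie_groupoid X \<Longrightarrow> smooth_map (morM X) (objM X) (Tgt X)"
  and lie_groupoid_Src_submersion: "lie_groupoid X \<Longrightarrow> submersion (morM X) (objM X) (Src X)"
  and lie_groupoid_Idt: "lie_groupoid X \<Longrightarrow> smooth_map (objM X) (morM X) (Idt X)"
  and lie_groupoid_inv: "lie_groupoid X \<Longrightarrow> smooth_map (morM X) (morM X) (mor_inv X)"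
  by (auto simp: lie_groupoid_def submersion_def manifold_imp_pre_manifold)

lemma lie_groupoid_category: "lie_groupoid X \<Longrightarrow> category X"
  by (intro groupoid_category lie_groupoid_groupoid)

text \<open>The smooth extension of the composition, near the composable pair \<open>p\<close>, by which the composition of
  the tangent groupoid is defined. It depends on \<open>p\<close> only, so that composition of vectors over \<open>p\<close> is
  the restriction of one linear map.\<close>

definition Cmp_extension :: "('o, 'm, 'a::real_inner, 'b::real_inner, 'z) lie_gpd_scheme \<Rightarrow> 'm \<times> 'm \<Rightarrow> 'm \<times> 'm \<Rightarrow> 'm" where
  "Cmp_extension X p = (SOME h. smooth_ext_at (prod_mfd (morM X) (morM X)) (composable X) (morM X) (\<lambda>(g, f). Cmp X g f) p h)"

lemma Cmp_extension:
  assumes X: "lie_groupoid X" and gf: "(g, f) \<in> composable X"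
  shows "smooth_at (prod_mfd (morM X) (morM X)) (morM X) (Cmp_extension X (g, f)) (g, f)"
    and "\<exists>W. mfd_open (prod_mfd (morM X) (morM X)) W \<and> (g, f) \<in> W \<and>
      (\<forall>x y. (x, y) \<in> W \<longrightarrow> (x, y) \<in> composable X \<longrightarrow> Cmp_extension X (g, f) (x, y) = Cmp X x y)"
proof -
  have "\<exists>h. smooth_ext_at (prod_mfd (morM X) (morM X)) (composable X) (morM X) (\<lambda>(g, f). Cmp X g f) (g, f) h"
    using X gf by (auto simp: lie_groupoid_def smooth_map_on_def)
  from someI_ex[OF this]
  have "smooth_ext_at (prod_mfd (morM X) (morM X)) (composable X) (morM X) (\<lambda>(g, f). Cmp X g f) (g, f) (Cmp_extension X (g, f))"
    by (simp add: Cmp_extension_def)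
  then show "smooth_at (prod_mfd (morM X) (morM X)) (morM X) (Cmp_extension X (g, f)) (g, f)"
    and "\<exists>W. mfd_open (prod_mfd (morM X) (morM X)) W \<and> (g, f) \<in> W \<and>
      (\<forall>x y. (x, y) \<in> W \<longrightarrow> (x, y) \<in> composable X \<longrightarrow> Cmp_extension X (g, f) (x, y) = Cmp X x y)"
    unfolding smooth_ext_at_def by fastforce+
qed

lemma tangent_Cmp:
  assumes X: "lie_groupoid X" and u: "u \<in> pts (TM (morM X))" and v: "v \<in> pts (TM (morM X))"
  shows "Cmp (tangent_gpd X) v u = tmap (prod_mfd (morM X) (morM X)) (morM X) (Cmp_extension X (fst v, fst u)) (tpair (morM X) (morM X) v u)"
  using tpair(4)[OF lie_groupoid_morM[OF X] lie_groupoid_morM[OF X] v u]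
  by (simp add: tangent_gpd_def tmap_on_def Cmp_extension_def)

lemma tangent_composable:
  assumes u: "u \<in> pts (TM (morM X))" and v: "v \<in> pts (TM (morM X))"
    and vu: "tmap (morM X) (objM X) (Src X) v = tmap (morM X) (objM X) (Tgt X) u"
  shows "(fst v, fst u) \<in> composable X"
  using u v arg_cong[OF vu, of fst] by (auto simp: pts_TM composable_def)

lemma precategory_tangent_gpd:
  assumes X: "lie_groupoid X" shows "precategory (tangent_gpd X)"
  unfolding precategory_def
proof (intro conjI ballI impI)
  note M = lie_groupoid_morM[OF X] and O = lie_groupoid_objM[OF X]
  fix u assume "u \<in> Mor (tangent_gpd X)"
  then have u: "u \<in> pts (TM (morM X))" by simp
  then have b: "fst u \<in> pts (morM X)" by (simp add: pts_TM)
  show "Src (tangent_gpd X) u \<in> Ob (tangent_gpd X)" "Tgt (tangent_gpd X) u \<in> Ob (tangent_gpd X)"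
    using tmap_pts[OF M O smooth_mapD[OF lie_groupoid_Src[OF X] b] u]
      tmap_pts[OF M O smooth_mapD[OF lie_groupoid_Tgt[OF X] b] u] by simp_all
  fix v assume "v \<in> Mor (tangent_gpd X)" and vu: "Src (tangent_gpd X) v = Tgt (tangent_gpd X) u"
  then have v: "v \<in> pts (TM (morM X))" by simp
  have c: "(fst v, fst u) \<in> composable X" using vu by (intro tangent_composable u v) simp
  show "Cmp (tangent_gpd X) v u \<in> Mor (tangent_gpd X)"
    unfolding tangent_Cmp[OF X u v] tangent_gpd_simps
    using Cmp_extension(1)[OF X c] tpair(4)[OF M M v u]
    by (intro tmap_pts[OF pre_manifold_prod[OF M M] M _ tpair(1)[OF M M v u]]) simp
next
  fix x assume "x \<in> Ob (tangent_gpd X)"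
  then have x: "x \<in> pts (TM (objM X))" by simp
  then have b: "fst x \<in> pts (objM X)" by (simp add: pts_TM)
  show "Idt (tangent_gpd X) x \<in> Mor (tangent_gpd X)"
    using tmap_pts[OF lie_groupoid_objM[OF X] lie_groupoid_morM[OF X] smooth_mapD[OF lie_groupoid_Idt[OF X] b] x] by simp
qed

lemma Cmp_pullback_local:
  assumes X: "lie_groupoid X" and P: "pre_manifold P" and p: "p \<in> pts P"
    and a: "smooth_map P (morM X) a" and b: "smooth_map P (morM X) b"
    and ab: "\<And>x. x \<in> pts P \<Longrightarrow> Src X (a x) = Tgt X (b x)"
  shows "\<exists>V. mfd_open P V \<and> p \<in> V \<and> (\<forall>x\<in>V. Cmp_extension X (a p, b p) (a x, b x) = Cmp X (a x) (b x))"
    and "smooth_at (prod_mfd (morM X) (morM X)) (morM X) (Cmp_extension X (a p, b p)) (a p, b p)"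
proof -
  note M = lie_groupoid_morM[OF X]
  have c: "(a x, b x) \<in> composable X" if "x \<in> pts P" for x
    using smooth_map_pts[OF a that] smooth_map_pts[OF b that] ab[OF that] by (simp add: composable_def)
  show "smooth_at (prod_mfd (morM X) (morM X)) (morM X) (Cmp_extension X (a p, b p)) (a p, b p)"
    by (rule Cmp_extension(1)[OF X c[OF p]])
  obtain W where W: "mfd_open (prod_mfd (morM X) (morM X)) W" "(a p, b p) \<in> W"
    "\<And>x y. (x, y) \<in> W \<Longrightarrow> (x, y) \<in> composable X \<Longrightarrow> Cmp_extension X (a p, b p) (x, y) = Cmp X x y"
    using Cmp_extension(2)[OF X c[OF p]] by blast
  obtain V where V: "mfd_open P V" "p \<in> V" "(\<lambda>x. (a x, b x)) ` V \<subseteq> W"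
    using smooth_at_neighbourhood[OF P pre_manifold_prod[OF M M] smooth_at_Pair[OF P M M smooth_mapD[OF a p] smooth_mapD[OF b p]] W(1,2)]
    by blast
  have "V \<subseteq> pts P" using V by (simp add: mfd_open_def)
  then have "Cmp_extension X (a p, b p) (a x, b x) = Cmp X (a x) (b x)" if "x \<in> V" for x
    using W(3)[of "a x" "b x"] c[of x] V(3) that by blast
  with V show "\<exists>V. mfd_open P V \<and> p \<in> V \<and> (\<forall>x\<in>V. Cmp_extension X (a p, b p) (a x, b x) = Cmp X (a x) (b x))" by blast
qed

lemma smooth_map_Cmp:
  assumes X: "lie_groupoid X" and P: "pre_manifold P"
    and a: "smooth_map P (morM X) a" and b: "smooth_map P (morM X) b"
    and ab: "\<And>x. x \<in> pts P \<Longrightarrow> Src X (a x) = Tgt X (b x)"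
  shows "smooth_map P (morM X) (\<lambda>x. Cmp X (a x) (b x))"
proof (rule smooth_mapI[OF P lie_groupoid_morM[OF X]])
  fix p assume p: "p \<in> pts P"
  note M = lie_groupoid_morM[OF X]
  obtain V where V: "mfd_open P V" "p \<in> V" "\<And>x. x \<in> V \<Longrightarrow> Cmp_extension X (a p, b p) (a x, b x) = Cmp X (a x) (b x)"
    using Cmp_pullback_local(1)[OF X P p a b ab] by blast
  have "smooth_at P (morM X) (\<lambda>x. Cmp_extension X (a p, b p) (a x, b x)) p"
    by (rule smooth_at_compose[OF P pre_manifold_prod[OF M M] M smooth_at_Pair[OF P M M smooth_mapD[OF a p] smooth_mapD[OF b p]]
      Cmp_pullback_local(2)[OF X P p a b ab]])
  then show "smooth_at P (morM X) (\<lambda>x. Cmp X (a x) (b x)) p"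
    by (rule smooth_at_cong[OF P M _ V])
qed

text \<open>Composition in the tangent groupoid of vectors that come from smooth families \<open>a\<close>, \<open>b\<close> of
  composable morphisms: the pair \<open>(a, b)\<close> maps into the composable pairs, so the chosen extension of
  the composition may be replaced by the composition itself, and the chain rule applies. Every identity that
  holds for families thereby passes to tangent vectors.\<close>

lemma tangent_Cmp_pullback:
  assumes X: "lie_groupoid X" and P: "pre_manifold P" and w: "w \<in> pts (TM P)"
    and a: "smooth_map P (morM X) a" and b: "smooth_map P (morM X) b"
    and ab: "\<And>x. x \<in> pts P \<Longrightarrow> Src X (a x) = Tgt X (b x)"
  shows "Cmp (tangent_gpd X) (tmap P (morM X) a w) (tmap P (morM X) b w) = tmap P (morM X) (\<lambda>x. Cmp X (a x) (b x)) w"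
proof -
  have p: "fst w \<in> pts P" using w by (simp add: pts_TM)
  note M = lie_groupoid_morM[OF X] and ap = smooth_mapD[OF a p] and bp = smooth_mapD[OF b p]
  obtain V where V: "mfd_open P V" "fst w \<in> V" "\<And>x. x \<in> V \<Longrightarrow> Cmp_extension X (a (fst w), b (fst w)) (a x, b x) = Cmp X (a x) (b x)"
    using Cmp_pullback_local(1)[OF X P p a b ab] by blast
  note h = Cmp_pullback_local(2)[OF X P p a b ab] and abp = smooth_at_Pair[OF P M M ap bp]
  have "Cmp (tangent_gpd X) (tmap P (morM X) a w) (tmap P (morM X) b w)
      = tmap P (morM X) (\<lambda>x. Cmp_extension X (a (fst w), b (fst w)) (a x, b x)) w"
    by (simp add: tangent_Cmp[OF X tmap_pts[OF P M bp w] tmap_pts[OF P M ap w]] tpair_tmap[OF P M M w ap bp]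
        tmap_compose[OF P pre_manifold_prod[OF M M] M abp h w])
  also have "\<dots> = tmap P (morM X) (\<lambda>x. Cmp X (a x) (b x)) w"
    by (rule tmap_cong[OF P M _ w V]) (rule smooth_at_compose[OF P pre_manifold_prod[OF M M] M abp h])
  finally show ?thesis .
qed

lemma smooth_functor_objM: "smooth_functor X Y F \<Longrightarrow> smooth_map (objM X) (objM Y) (fst F)"
  and smooth_functor_morM: "smooth_functor X Y F \<Longrightarrow> smooth_map (morM X) (morM Y) (snd F)"
  and smooth_functor_is_functor: "smooth_functor X Y F \<Longrightarrow> is_functor X Y F"
  by (simp_all add: smooth_functor_def)

lemma tangent_functor_simps [simp]:
  "v \<in> pts (TM (objM X)) \<Longrightarrow> fst (tangent_functor X Y F) v = tmap (objM X) (objM Y) (fst F) v"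
  "w \<in> pts (TM (morM X)) \<Longrightarrow> snd (tangent_functor X Y F) w = tmap (morM X) (morM Y) (snd F) w"
  "functor_ext (tangent_gpd X) (tangent_functor X Y F)"
  by (simp_all add: tangent_functor_def functor_ext_def)

text \<open>Preservation of composites of arbitrary composable tangent vectors compares the maps
  \<open>F \<circ> h\<close> and \<open>h' \<circ> (F \<times> F)\<close>, where \<open>h\<close> and \<open>h'\<close> are the
  extensions of the two compositions. They agree on composable pairs, the fibre product of source and
  target, hence have the same differential on tangent vectors to it because the source map is a submersion.\<close>

lemma is_functor_tangent_functor:
  assumes X: "lie_groupoid X" and Y: "lie_groupoid Y" and F: "smooth_functor X Y F"
  shows "is_functor (tangent_gpd X) (tangent_gpd Y) (tangent_functor X Y F)"
proof -
  note MX = lie_groupoid_morM[OF X] and OX = lie_groupoid_objM[OF X] and MY = lie_groupoid_morM[OF Y] and OY = lie_groupoid_objM[OF Y]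
  note F0 = smooth_functor_objM[OF F] and F1 = smooth_functor_morM[OF F] and F2 = smooth_functor_is_functor[OF F]
  note pre = precategory_tangent_gpd[OF X]
  have ob: "tmap (objM X) (objM Y) (fst F) v \<in> pts (TM (objM Y))" if "v \<in> pts (TM (objM X))" for v
    using smooth_map_pts[OF smooth_map_tmap[OF OX OY F0] that] .
  have mor: "tmap (morM X) (morM Y) (snd F) v \<in> pts (TM (morM Y))" if "v \<in> pts (TM (morM X))" for v
    using smooth_map_pts[OF smooth_map_tmap[OF MX MY F1] that] .
  show ?thesis
  proof (rule is_functorI)
    fix u assume "u \<in> Mor (tangent_gpd X)"
    then have u: "u \<in> pts (TM (morM X))" by simp
    then have b: "fst u \<in> pts (morM X)" by (simp add: pts_TM)
    have S: "tmap (morM X) (objM X) (Src X) u \<in> pts (TM (objM X))" "tmap (morM X) (objM X) (Tgt X) u \<in> pts (TM (objM X))"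
      using pre u by (auto simp: precategory_def)
    have fb: "snd F (fst u) \<in> pts (morM Y)" "Src X (fst u) \<in> pts (objM X)" "Tgt X (fst u) \<in> pts (objM X)"
      using smooth_map_pts[OF F1 b] smooth_map_pts[OF lie_groupoid_Src[OF X] b] smooth_map_pts[OF lie_groupoid_Tgt[OF X] b] .
    have "tmap (morM X) (objM Y) (\<lambda>x. Src Y (snd F x)) u = tmap (morM X) (objM Y) (\<lambda>x. fst F (Src X x)) u"
      by (rule tmap_cong_pts[OF MX OY smooth_map_compose[OF MX MY OY F1 lie_groupoid_Src[OF Y]] u]) (simp add: functor_Src[OF F2])
    then show "Src (tangent_gpd Y) (snd (tangent_functor X Y F) u) = fst (tangent_functor X Y F) (Src (tangent_gpd X) u)"
      using u S by (simp add: tmap_compose[OF MX MY OY smooth_mapD[OF F1 b] smooth_mapD[OF lie_groupoid_Src[OF Y] fb(1)]]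
        tmap_compose[OF MX OX OY smooth_mapD[OF lie_groupoid_Src[OF X] b] smooth_mapD[OF F0 fb(2)]])
    have "tmap (morM X) (objM Y) (\<lambda>x. Tgt Y (snd F x)) u = tmap (morM X) (objM Y) (\<lambda>x. fst F (Tgt X x)) u"
      by (rule tmap_cong_pts[OF MX OY smooth_map_compose[OF MX MY OY F1 lie_groupoid_Tgt[OF Y]] u]) (simp add: functor_Tgt[OF F2])
    then show "Tgt (tangent_gpd Y) (snd (tangent_functor X Y F) u) = fst (tangent_functor X Y F) (Tgt (tangent_gpd X) u)"
      using u S by (simp add: tmap_compose[OF MX MY OY smooth_mapD[OF F1 b] smooth_mapD[OF lie_groupoid_Tgt[OF Y] fb(1)]]
        tmap_compose[OF MX OX OY smooth_mapD[OF lie_groupoid_Tgt[OF X] b] smooth_mapD[OF F0 fb(3)]])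
  next
    fix x assume "x \<in> Ob (tangent_gpd X)"
    then have x: "x \<in> pts (TM (objM X))" by simp
    then have b: "fst x \<in> pts (objM X)" by (simp add: pts_TM)
    have Ix: "tmap (objM X) (morM X) (Idt X) x \<in> pts (TM (morM X))" using pre x by (simp add: precategory_def)
    have fb: "fst F (fst x) \<in> pts (objM Y)" "Idt X (fst x) \<in> pts (morM X)"
      using smooth_map_pts[OF F0 b] smooth_map_pts[OF lie_groupoid_Idt[OF X] b] .
    have "tmap (objM X) (morM Y) (\<lambda>x. snd F (Idt X x)) x = tmap (objM X) (morM Y) (\<lambda>x. Idt Y (fst F x)) x"
      by (rule tmap_cong_pts[OF OX MY smooth_map_compose[OF OX MX MY lie_groupoid_Idt[OF X] F1] x]) (simp add: functor_Idt[OF F2])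
    then show "snd (tangent_functor X Y F) (Idt (tangent_gpd X) x) = Idt (tangent_gpd Y) (fst (tangent_functor X Y F) x)"
      using x Ix by (simp add: tmap_compose[OF OX MX MY smooth_mapD[OF lie_groupoid_Idt[OF X] b] smooth_mapD[OF F1 fb(2)]]
        tmap_compose[OF OX OY MY smooth_mapD[OF F0 b] smooth_mapD[OF lie_groupoid_Idt[OF Y] fb(1)]])
  next
    fix u v assume "u \<in> Mor (tangent_gpd X)" "v \<in> Mor (tangent_gpd X)" and "Src (tangent_gpd X) v = Tgt (tangent_gpd X) u"
    then have u: "u \<in> pts (TM (morM X))" and v: "v \<in> pts (TM (morM X))"
      and vu: "tmap (morM X) (objM X) (Src X) v = tmap (morM X) (objM X) (Tgt X) u" by simp_all
    have b: "fst u \<in> pts (morM X)" "fst v \<in> pts (morM X)" using u v by (simp_all add: pts_TM)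
    let ?F = "snd F" and ?XX = "prod_mfd (morM X) (morM X)" and ?YY = "prod_mfd (morM Y) (morM Y)"
    let ?hX = "Cmp_extension X (fst v, fst u)" and ?hY = "Cmp_extension Y (?F (fst v), ?F (fst u))"
    let ?FF = "\<lambda>z. (?F (fst z), ?F (snd z))" and ?w = "tpair (morM X) (morM X) v u"
    note XX = pre_manifold_prod[OF MX MX] and YY = pre_manifold_prod[OF MY MY]
    note w = tpair[OF MX MX v u]
    have cX: "(fst v, fst u) \<in> composable X" by (rule tangent_composable[OF u v vu])
    have cFY: "(?F x, ?F y) \<in> composable Y" if "(x, y) \<in> composable X" for x y
      using that by (auto simp: composable_def functor_Mor[OF F2] functor_Src[OF F2] functor_Tgt[OF F2])
    note cY = cFY[OF cX]
    have FF: "smooth_map ?XX ?YY ?FF"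
      using smooth_map_Pair[OF XX MY MY smooth_map_compose[OF XX MX MY smooth_map_fst[OF MX MX] F1]
        smooth_map_compose[OF XX MX MY smooth_map_snd[OF MX MX] F1]] .
    have vu': "(fst v, fst u) \<in> pts ?XX" using b by simp
    have hX: "smooth_at ?XX (morM X) ?hX (fst ?w)" using Cmp_extension(1)[OF X cX] w(4) by simp
    have hY: "smooth_at ?YY (morM Y) ?hY (?F (fst v), ?F (fst u))" using Cmp_extension(1)[OF Y cY] .
    obtain WX where WX: "mfd_open ?XX WX" "(fst v, fst u) \<in> WX"
      "\<And>x y. (x, y) \<in> WX \<Longrightarrow> (x, y) \<in> composable X \<Longrightarrow> ?hX (x, y) = Cmp X x y"
      using Cmp_extension(2)[OF X cX] by blast
    obtain WY where WY: "mfd_open ?YY WY" "(?F (fst v), ?F (fst u)) \<in> WY"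
      "\<And>x y. (x, y) \<in> WY \<Longrightarrow> (x, y) \<in> composable Y \<Longrightarrow> ?hY (x, y) = Cmp Y x y"
      using Cmp_extension(2)[OF Y cY] by blast
    obtain V where V: "mfd_open ?XX V" "(fst v, fst u) \<in> V" "?FF ` V \<subseteq> WY"
      using smooth_at_neighbourhood[OF XX YY smooth_mapD[OF FF vu'] WY(1)] WY(2) by auto
    have FFw: "smooth_at ?XX ?YY ?FF (fst ?w)" using smooth_mapD[OF FF vu'] w(4) by simp
    have hYw: "smooth_at ?YY (morM Y) ?hY (?FF (fst ?w))" using hY w(4) by simp
    have F1w: "smooth_at (morM X) (morM Y) ?F (?hX (fst ?w))"
      using smooth_mapD[OF F1 smooth_at_pts(2)[OF XX MX hX]] .
    have "tmap ?XX (morM Y) (\<lambda>z. ?F (?hX z)) ?w = tmap ?XX (morM Y) (\<lambda>z. ?hY (?FF z)) ?w"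
    proof (rule tmap_eq_on_fibre_product[OF MX MX OX MY lie_groupoid_Src_submersion[OF X] lie_groupoid_Tgt[OF X] w(1), of _ _ "WX \<inter> V"])
      show "smooth_at ?XX (morM Y) (\<lambda>z. ?F (?hX z)) (fst ?w)" by (rule smooth_at_compose[OF XX MX MY hX F1w])
      show "smooth_at ?XX (morM Y) (\<lambda>z. ?hY (?FF z)) (fst ?w)" by (rule smooth_at_compose[OF XX YY MY FFw hYw])
      show "mfd_open ?XX (WX \<inter> V)" by (rule mfd_open_Int[OF XX WX(1) V(1)])
      show "fst ?w \<in> WX \<inter> V" using w WX V by simp
      show "tmap (morM X) (objM X) (Src X) (tmap ?XX (morM X) fst ?w) = tmap (morM X) (objM X) (Tgt X) (tmap ?XX (morM X) snd ?w)"
        using vu w by simp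
    next
      fix x y assume xy: "(x, y) \<in> WX \<inter> V" "Src X x = Tgt X y"
      then have "(x, y) \<in> pts ?XX" using V(1) unfolding mfd_open_def by blast
      then have c: "(x, y) \<in> composable X" using xy by (simp add: composable_def)
      then have "?hX (x, y) = Cmp X x y" "?hY (?F x, ?F y) = Cmp Y (?F x) (?F y)"
        using WX(3) WY(3) cFY xy V(3) by auto
      then show "?F (?hX (x, y)) = ?hY (?FF (x, y))"
        using functor_Cmp[OF F2, of y x] c by (simp add: composable_def)
    qed
    moreover have "tmap (morM X) (morM Y) ?F (tmap ?XX (morM X) ?hX ?w) = tmap ?XX (morM Y) (\<lambda>z. ?F (?hX z)) ?w"
      by (rule tmap_compose[OF XX MX MY hX F1w w(1)])
    moreover have "tpair (morM Y) (morM Y) (tmap (morM X) (morM Y) ?F v) (tmap (morM X) (morM Y) ?F u) = tmap ?XX ?YY ?FF ?w"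
    proof -
      note f = smooth_mapD[OF smooth_map_fst[OF MX MX] vu'] smooth_mapD[OF smooth_map_snd[OF MX MX] vu']
      have f': "smooth_at ?XX (morM X) fst (fst ?w)" "smooth_at ?XX (morM X) snd (fst ?w)" using f w(4) by simp_all
      have F': "smooth_at (morM X) (morM Y) ?F (fst (fst ?w))" "smooth_at (morM X) (morM Y) ?F (snd (fst ?w))"
        using smooth_mapD[OF F1 b(1)] smooth_mapD[OF F1 b(2)] w(4) by simp_all
      show ?thesis
        using tpair_tmap[OF XX MY MY w(1) smooth_at_compose[OF XX MX MY f'(1) F'(1)] smooth_at_compose[OF XX MX MY f'(2) F'(2)]]
          tmap_compose[OF XX MX MY f'(1) F'(1) w(1)] tmap_compose[OF XX MX MY f'(2) F'(2) w(1)] w by simp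
    qed
    moreover have "tmap ?YY (morM Y) ?hY (tmap ?XX ?YY ?FF ?w) = tmap ?XX (morM Y) (\<lambda>z. ?hY (?FF z)) ?w"
      by (rule tmap_compose[OF XX YY MY FFw hYw w(1)])
    moreover have "Cmp (tangent_gpd X) v u \<in> pts (TM (morM X))" using pre u v vu by (simp add: precategory_def)
    ultimately show "snd (tangent_functor X Y F) (Cmp (tangent_gpd X) v u) =
        Cmp (tangent_gpd Y) (snd (tangent_functor X Y F) v) (snd (tangent_functor X Y F) u)"
      using u v by (simp add: tangent_Cmp[OF X u v] tangent_Cmp[OF Y mor[OF u] mor[OF v]])
  qed (use ob mor in simp_all)
qed

section \<open>Differentials of smooth natural transformations\<close>

lemma smooth_functor_cong:
  assumes X: "lie_groupoid X" and Y: "lie_groupoid Y" and F: "smooth_functor X Y F"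
    and "\<And>x. x \<in> Ob X \<Longrightarrow> fst F x = fst F' x" "\<And>f. f \<in> Mor X \<Longrightarrow> snd F f = snd F' f"
  shows "smooth_functor X Y F'"
  unfolding smooth_functor_def
  using is_functor_cong[OF category_precategory[OF lie_groupoid_category[OF X]] smooth_functor_is_functor[OF F] assms(4,5)]
    smooth_map_cong[OF lie_groupoid_objM[OF X] lie_groupoid_objM[OF Y] smooth_functor_objM[OF F], of "fst F'"] assms(4)
    smooth_map_cong[OF lie_groupoid_morM[OF X] lie_groupoid_morM[OF Y] smooth_functor_morM[OF F], of "snd F'"] assms(5)
  by simp

lemma smooth_functor_fid: "lie_groupoid X \<Longrightarrow> smooth_functor X X (fid X)"
  by (rule smooth_functor_cong[of X X "(\<lambda>x. x, \<lambda>x. x)"])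
    (auto simp: smooth_functor_def smooth_map_id lie_groupoid_objM lie_groupoid_morM is_functor_def composable_def)

lemma smooth_functor_fcomp_on:
  assumes X: "lie_groupoid X" and Y: "lie_groupoid Y" and Z: "lie_groupoid Z"
    and F: "smooth_functor X Y F" and H: "smooth_functor Y Z H"
  shows "smooth_functor X Z (fcomp_on X H F)"
  unfolding smooth_functor_def
proof (intro conjI)
  show "is_functor X Z (fcomp_on X H F)"
    by (rule is_functor_fcomp_on[OF category_precategory[OF lie_groupoid_category[OF X]] smooth_functor_is_functor[OF F] smooth_functor_is_functor[OF H]])
  show "smooth_map (objM X) (objM Z) (fst (fcomp_on X H F))"
    by (rule smooth_map_cong[OF lie_groupoid_objM[OF X] lie_groupoid_objM[OF Z]
      smooth_map_compose[OF lie_groupoid_objM[OF X] lie_groupoid_objM[OF Y] lie_groupoid_objM[OF Z] smooth_functor_objM[OF F] smooth_functor_objM[OF H]]])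
      simp
  show "smooth_map (morM X) (morM Z) (snd (fcomp_on X H F))"
    by (rule smooth_map_cong[OF lie_groupoid_morM[OF X] lie_groupoid_morM[OF Z]
      smooth_map_compose[OF lie_groupoid_morM[OF X] lie_groupoid_morM[OF Y] lie_groupoid_morM[OF Z] smooth_functor_morM[OF F] smooth_functor_morM[OF H]]])
      simp
qed

lemma tmap_compose_map:
  assumes "pre_manifold M" "pre_manifold N" "pre_manifold P" "smooth_map M N f" "smooth_map N P g" "v \<in> pts (TM M)"
  shows "tmap N P g (tmap M N f v) = tmap M P (\<lambda>x. g (f x)) v"
proof -
  have "fst v \<in> pts M" using assms(6) by (simp add: pts_TM)
  then show ?thesis
    using tmap_compose[OF assms(1-3)] smooth_mapD[OF assms(4)] smooth_mapD[OF assms(5)] smooth_map_pts[OF assms(4)] assms(6) by blast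
qed

lemma tmap_map_pts:
  assumes "pre_manifold M" "pre_manifold N" "smooth_map M N f" "v \<in> pts (TM M)"
  shows "tmap M N f v \<in> pts (TM N)"
  using smooth_map_pts[OF smooth_map_tmap[OF assms(1-3)] assms(4)] .

lemma tangent_functor_fcomp_on:
  assumes X: "lie_groupoid X" and Y: "lie_groupoid Y" and Z: "lie_groupoid Z"
    and F: "smooth_functor X Y F" and H: "smooth_functor Y Z H"
  shows "tangent_functor X Z (fcomp_on X H F) = fcomp_on (tangent_gpd X) (tangent_functor Y Z H) (tangent_functor X Y F)"
proof (rule functor_eqI[of "tangent_gpd X"])
  note o = lie_groupoid_objM[OF X] lie_groupoid_objM[OF Y] lie_groupoid_objM[OF Z]
  note m = lie_groupoid_morM[OF X] lie_groupoid_morM[OF Y] lie_groupoid_morM[OF Z]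
  note HF = smooth_functor_fcomp_on[OF X Y Z F H]
  fix v assume "v \<in> Ob (tangent_gpd X)"
  then have v: "v \<in> pts (TM (objM X))" by simp
  show "fst (tangent_functor X Z (fcomp_on X H F)) v = fst (fcomp_on (tangent_gpd X) (tangent_functor Y Z H) (tangent_functor X Y F)) v"
    using v tmap_map_pts[OF o(1,2) smooth_functor_objM[OF F] v]
      tmap_compose_map[OF o smooth_functor_objM[OF F] smooth_functor_objM[OF H] v]
      tmap_cong_pts[OF o(1,3) smooth_functor_objM[OF HF] v, of "\<lambda>x. fst H (fst F x)"] by simp
next
  note o = lie_groupoid_objM[OF X] lie_groupoid_objM[OF Y] lie_groupoid_objM[OF Z]
  note m = lie_groupoid_morM[OF X] lie_groupoid_morM[OF Y] lie_groupoid_morM[OF Z]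
  note HF = smooth_functor_fcomp_on[OF X Y Z F H]
  fix v assume "v \<in> Mor (tangent_gpd X)"
  then have v: "v \<in> pts (TM (morM X))" by simp
  show "snd (tangent_functor X Z (fcomp_on X H F)) v = snd (fcomp_on (tangent_gpd X) (tangent_functor Y Z H) (tangent_functor X Y F)) v"
    using v tmap_map_pts[OF m(1,2) smooth_functor_morM[OF F] v]
      tmap_compose_map[OF m smooth_functor_morM[OF F] smooth_functor_morM[OF H] v]
      tmap_cong_pts[OF m(1,3) smooth_functor_morM[OF HF] v, of "\<lambda>x. snd H (snd F x)"] by simp
qed simp_all

lemma tangent_functor_fid:
  assumes X: "lie_groupoid X" shows "tangent_functor X X (fid X) = fid (tangent_gpd X)"
proof (rule functor_eqI[of "tangent_gpd X"])
  note I = smooth_functor_fid[OF X]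
  fix v assume "v \<in> Ob (tangent_gpd X)"
  then have v: "v \<in> pts (TM (objM X))" by simp
  show "fst (tangent_functor X X (fid X)) v = fst (fid (tangent_gpd X)) v"
    using v tmap_cong_pts[OF lie_groupoid_objM[OF X] lie_groupoid_objM[OF X] smooth_functor_objM[OF I] v, of "\<lambda>x. x"]
      tmap_ident[OF lie_groupoid_objM[OF X] v] by simp
next
  note I = smooth_functor_fid[OF X]
  fix v assume "v \<in> Mor (tangent_gpd X)"
  then have v: "v \<in> pts (TM (morM X))" by simp
  show "snd (tangent_functor X X (fid X)) v = snd (fid (tangent_gpd X)) v"
    using v tmap_cong_pts[OF lie_groupoid_morM[OF X] lie_groupoid_morM[OF X] smooth_functor_morM[OF I] v, of "\<lambda>x. x"]
      tmap_ident[OF lie_groupoid_morM[OF X] v] by simp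
qed simp_all

definition smooth_ntr where
  "smooth_ntr X Y t \<longleftrightarrow> is_ntr X Y t \<and> smooth_functor X Y (ntr_src t) \<and> smooth_functor X Y (ntr_tgt t) \<and>
     smooth_map (objM X) (morM Y) (ntr_map t)"

lemma smooth_ntrD:
  assumes "smooth_ntr X Y t"
  shows "is_ntr X Y t" "smooth_functor X Y (ntr_src t)" "smooth_functor X Y (ntr_tgt t)" "smooth_map (objM X) (morM Y) (ntr_map t)"
  using assms by (simp_all add: smooth_ntr_def)

lemma tangent_ntr_simps [simp]:
  "ntr_src (tangent_ntr X Y t) = tangent_functor X Y (ntr_src t)" "ntr_tgt (tangent_ntr X Y t) = tangent_functor X Y (ntr_tgt t)"
  "v \<in> pts (TM (objM X)) \<Longrightarrow> ntr_map (tangent_ntr X Y t) v = tmap (objM X) (morM Y) (ntr_map t) v"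
  "ntr_map (tangent_ntr X Y t) \<in> extensional (pts (TM (objM X)))"
  by (simp_all add: tangent_ntr_def)

lemma tangent_extensional [simp]:
  "ntr_map (ntr_id (tangent_gpd X) B F) \<in> extensional (pts (TM (objM X)))"
  "ntr_map (vcomp (tangent_gpd X) C t s) \<in> extensional (pts (TM (objM X)))"
  "ntr_map (hcomp (tangent_gpd X) D u r) \<in> extensional (pts (TM (objM X)))"
  by (simp_all add: ntr_id_def vcomp_def hcomp_def)

lemma is_ntr_tangent_ntr:
  assumes X: "lie_groupoid X" and Y: "lie_groupoid Y" and t: "smooth_ntr X Y t"
  shows "is_ntr (tangent_gpd X) (tangent_gpd Y) (tangent_ntr X Y t)"
proof -
  note o = lie_groupoid_objM[OF X] lie_groupoid_objM[OF Y] and m = lie_groupoid_morM[OF X] lie_groupoid_morM[OF Y]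
  note t' = smooth_ntrD[OF t]
  note CX = lie_groupoid_category[OF X]
  show ?thesis
  proof (rule is_ntrI)
    show "is_functor (tangent_gpd X) (tangent_gpd Y) (ntr_src (tangent_ntr X Y t))"
      "is_functor (tangent_gpd X) (tangent_gpd Y) (ntr_tgt (tangent_ntr X Y t))"
      using is_functor_tangent_functor[OF X Y] t' by simp_all
    fix v assume "v \<in> Ob (tangent_gpd X)"
    then have v: "v \<in> pts (TM (objM X))" by simp
    show "ntr_map (tangent_ntr X Y t) v \<in> Mor (tangent_gpd Y)"
      using v tmap_map_pts[OF o(1) m(2) t'(4) v] by simp
    show "Src (tangent_gpd Y) (ntr_map (tangent_ntr X Y t) v) = fst (ntr_src (tangent_ntr X Y t)) v"
      using v tmap_compose_map[OF o(1) m(2) o(2) t'(4) lie_groupoid_Src[OF Y] v]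
        tmap_cong_pts[OF o smooth_functor_objM[OF t'(2)] v, of "\<lambda>x. Src Y (ntr_map t x)"] by (simp add: ntr_Src[OF t'(1)])
    show "Tgt (tangent_gpd Y) (ntr_map (tangent_ntr X Y t) v) = fst (ntr_tgt (tangent_ntr X Y t)) v"
      using v tmap_compose_map[OF o(1) m(2) o(2) t'(4) lie_groupoid_Tgt[OF Y] v]
        tmap_cong_pts[OF o smooth_functor_objM[OF t'(3)] v, of "\<lambda>x. Tgt Y (ntr_map t x)"] by (simp add: ntr_Tgt[OF t'(1)])
  next
    fix w assume "w \<in> Mor (tangent_gpd X)"
    then have w: "w \<in> pts (TM (morM X))" by simp
    note S = lie_groupoid_Src[OF X] and T = lie_groupoid_Tgt[OF X]
    note Fs = smooth_functor_morM[OF t'(2)] and Ft = smooth_functor_morM[OF t'(3)]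
    note tS = smooth_map_compose[OF m(1) o(1) m(2) S t'(4)] and tT = smooth_map_compose[OF m(1) o(1) m(2) T t'(4)]
    have c1: "Src Y (ntr_map t (Tgt X x)) = Tgt Y (snd (ntr_src t) x)" if "x \<in> pts (morM X)" for x
      using that by (simp add: ntr_Src[OF t'(1)] category_simps[OF CX] functor_Tgt[OF ntr_functor_src[OF t'(1)]])
    have c2: "Src Y (snd (ntr_tgt t) x) = Tgt Y (ntr_map t (Src X x))" if "x \<in> pts (morM X)" for x
      using that by (simp add: ntr_Tgt[OF t'(1)] category_simps[OF CX] functor_Src[OF ntr_functor_tgt[OF t'(1)]])
    have "Cmp (tangent_gpd Y) (tmap (morM X) (morM Y) (\<lambda>x. ntr_map t (Tgt X x)) w) (tmap (morM X) (morM Y) (snd (ntr_src t)) w)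
       = tmap (morM X) (morM Y) (\<lambda>x. Cmp Y (ntr_map t (Tgt X x)) (snd (ntr_src t) x)) w"
      by (rule tangent_Cmp_pullback[OF Y m(1) w tT Fs c1])
    also have "\<dots> = tmap (morM X) (morM Y) (\<lambda>x. Cmp Y (snd (ntr_tgt t) x) (ntr_map t (Src X x))) w"
      by (rule tmap_cong_pts[OF m smooth_map_Cmp[OF Y m(1) tT Fs c1] w]) (simp_all add: ntr_natural[OF t'(1)])
    also have "\<dots> = Cmp (tangent_gpd Y) (tmap (morM X) (morM Y) (snd (ntr_tgt t)) w) (tmap (morM X) (morM Y) (\<lambda>x. ntr_map t (Src X x)) w)"
      by (rule tangent_Cmp_pullback[OF Y m(1) w Ft tS c2, symmetric])
    finally show "Cmp (tangent_gpd Y) (ntr_map (tangent_ntr X Y t) (Tgt (tangent_gpd X) w)) (snd (ntr_src (tangent_ntr X Y t)) w) =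
         Cmp (tangent_gpd Y) (snd (ntr_tgt (tangent_ntr X Y t)) w) (ntr_map (tangent_ntr X Y t) (Src (tangent_gpd X) w))"
      using w by (simp add: tmap_map_pts[OF m(1) o(1) S] tmap_map_pts[OF m(1) o(1) T]
        tmap_compose_map[OF m(1) o(1) m(2) S t'(4)] tmap_compose_map[OF m(1) o(1) m(2) T t'(4)])
  qed
qed

lemma smooth_ntr_id:
  assumes X: "lie_groupoid X" and Y: "lie_groupoid Y" and F: "smooth_functor X Y F"
  shows "smooth_ntr X Y (ntr_id X Y F)"
proof -
  have "smooth_map (objM X) (morM Y) (ntr_map (ntr_id X Y F))"
    by (rule smooth_map_cong[OF lie_groupoid_objM[OF X] lie_groupoid_morM[OF Y]
       smooth_map_compose[OF lie_groupoid_objM[OF X] lie_groupoid_objM[OF Y] lie_groupoid_morM[OF Y] smooth_functor_objM[OF F] lie_groupoid_Idt[OF Y]]])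
      simp
  then show ?thesis unfolding smooth_ntr_def
    using F is_ntr_id[OF category_precategory[OF lie_groupoid_category[OF X]] lie_groupoid_category[OF Y]] by (simp add: smooth_functor_def)
qed

lemma smooth_ntr_vcomp:
  assumes X: "lie_groupoid X" and Y: "lie_groupoid Y" and s: "smooth_ntr X Y s" and t: "smooth_ntr X Y t" and st: "ntr_tgt s = ntr_src t"
  shows "smooth_ntr X Y (vcomp X Y t s)"
proof -
  note s' = smooth_ntrD[OF s] and t' = smooth_ntrD[OF t]
  have "smooth_map (objM X) (morM Y) (\<lambda>x. Cmp Y (ntr_map t x) (ntr_map s x))"
    by (rule smooth_map_Cmp[OF Y lie_groupoid_objM[OF X] t'(4) s'(4)]) (simp add: ntr_Src[OF t'(1)] ntr_Tgt[OF s'(1)] st)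
  then have "smooth_map (objM X) (morM Y) (ntr_map (vcomp X Y t s))"
    by (rule smooth_map_cong[OF lie_groupoid_objM[OF X] lie_groupoid_morM[OF Y]]) simp
  then show ?thesis unfolding smooth_ntr_def
    using s' t' is_ntr_vcomp[OF category_precategory[OF lie_groupoid_category[OF X]] lie_groupoid_category[OF Y] s'(1) t'(1) st] by simp
qed

lemma smooth_ntr_hcomp:
  assumes X: "lie_groupoid X" and Y: "lie_groupoid Y" and Z: "lie_groupoid Z" and s: "smooth_ntr X Y s" and t: "smooth_ntr Y Z t"
  shows "smooth_ntr X Z (hcomp X Z t s)"
proof -
  note s' = smooth_ntrD[OF s] and t' = smooth_ntrD[OF t]
  note o = lie_groupoid_objM[OF X] lie_groupoid_objM[OF Y] and m = lie_groupoid_morM[OF Y] lie_groupoid_morM[OF Z]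
  have "smooth_map (objM X) (morM Z) (\<lambda>x. Cmp Z (ntr_map t (fst (ntr_tgt s) x)) (snd (ntr_src t) (ntr_map s x)))"
    by (rule smooth_map_Cmp[OF Z o(1) smooth_map_compose[OF o m(2) smooth_functor_objM[OF s'(3)] t'(4)]
         smooth_map_compose[OF o(1) m s'(4) smooth_functor_morM[OF t'(2)]]])
      (simp add: ntr_Src[OF t'(1)] functor_Ob[OF ntr_functor_tgt[OF s'(1)]] functor_Tgt[OF ntr_functor_src[OF t'(1)]] ntr_Mor[OF s'(1)] ntr_Tgt[OF s'(1)])
  then have "smooth_map (objM X) (morM Z) (ntr_map (hcomp X Z t s))"
    by (rule smooth_map_cong[OF o(1) m(2)]) simp
  then show ?thesis unfolding smooth_ntr_def
    using smooth_functor_fcomp_on[OF X Y Z] s' t'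
      is_ntr_hcomp[OF category_precategory[OF lie_groupoid_category[OF X]] lie_groupoid_category[OF Z] s'(1) t'(1)] by simp
qed

lemma tangent_ntr_id:
  assumes X: "lie_groupoid X" and Y: "lie_groupoid Y" and F: "smooth_functor X Y F"
  shows "tangent_ntr X Y (ntr_id X Y F) = ntr_id (tangent_gpd X) (tangent_gpd Y) (tangent_functor X Y F)"
proof (rule ntr_eqI[of _ _ "tangent_gpd X"])
  note o = lie_groupoid_objM[OF X] lie_groupoid_objM[OF Y] and m = lie_groupoid_morM[OF Y]
  fix v assume "v \<in> Ob (tangent_gpd X)"
  then have v: "v \<in> pts (TM (objM X))" by simp
  show "ntr_map (tangent_ntr X Y (ntr_id X Y F)) v = ntr_map (ntr_id (tangent_gpd X) (tangent_gpd Y) (tangent_functor X Y F)) v"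
    using v tmap_cong_pts[OF o(1) m smooth_ntrD(4)[OF smooth_ntr_id[OF X Y F]] v, of "\<lambda>x. Idt Y (fst F x)"]
      tmap_compose_map[OF o m smooth_functor_objM[OF F] lie_groupoid_Idt[OF Y] v] by simp
qed simp_all

lemma tangent_ntr_vcomp:
  assumes X: "lie_groupoid X" and Y: "lie_groupoid Y" and s: "smooth_ntr X Y s" and t: "smooth_ntr X Y t" and st: "ntr_tgt s = ntr_src t"
  shows "tangent_ntr X Y (vcomp X Y t s) = vcomp (tangent_gpd X) (tangent_gpd Y) (tangent_ntr X Y t) (tangent_ntr X Y s)"
proof (rule ntr_eqI[of _ _ "tangent_gpd X"])
  note s' = smooth_ntrD[OF s] and t' = smooth_ntrD[OF t]
  fix v assume "v \<in> Ob (tangent_gpd X)"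
  then have v: "v \<in> pts (TM (objM X))" by simp
  have "Cmp (tangent_gpd Y) (tmap (objM X) (morM Y) (ntr_map t) v) (tmap (objM X) (morM Y) (ntr_map s) v)
     = tmap (objM X) (morM Y) (\<lambda>x. Cmp Y (ntr_map t x) (ntr_map s x)) v"
    by (rule tangent_Cmp_pullback[OF Y lie_groupoid_objM[OF X] v t'(4) s'(4)]) (simp add: ntr_Src[OF t'(1)] ntr_Tgt[OF s'(1)] st)
  then show "ntr_map (tangent_ntr X Y (vcomp X Y t s)) v = ntr_map (vcomp (tangent_gpd X) (tangent_gpd Y) (tangent_ntr X Y t) (tangent_ntr X Y s)) v"
    using v tmap_cong_pts[OF lie_groupoid_objM[OF X] lie_groupoid_morM[OF Y] smooth_ntrD(4)[OF smooth_ntr_vcomp[OF X Y s t st]] v,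
      of "\<lambda>x. Cmp Y (ntr_map t x) (ntr_map s x)"] by simp
qed simp_all

lemma tangent_ntr_hcomp:
  assumes X: "lie_groupoid X" and Y: "lie_groupoid Y" and Z: "lie_groupoid Z" and s: "smooth_ntr X Y s" and t: "smooth_ntr Y Z t"
  shows "tangent_ntr X Z (hcomp X Z t s) = hcomp (tangent_gpd X) (tangent_gpd Z) (tangent_ntr Y Z t) (tangent_ntr X Y s)"
proof (rule ntr_eqI[of _ _ "tangent_gpd X"])
  note s' = smooth_ntrD[OF s] and t' = smooth_ntrD[OF t]
  note o = lie_groupoid_objM[OF X] lie_groupoid_objM[OF Y] and m = lie_groupoid_morM[OF Y] lie_groupoid_morM[OF Z]
  note a = smooth_map_compose[OF o m(2) smooth_functor_objM[OF s'(3)] t'(4)]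
    and b = smooth_map_compose[OF o(1) m s'(4) smooth_functor_morM[OF t'(2)]]
  fix v assume "v \<in> Ob (tangent_gpd X)"
  then have v: "v \<in> pts (TM (objM X))" by simp
  have "Cmp (tangent_gpd Z) (tmap (objM X) (morM Z) (\<lambda>x. ntr_map t (fst (ntr_tgt s) x)) v) (tmap (objM X) (morM Z) (\<lambda>x. snd (ntr_src t) (ntr_map s x)) v)
     = tmap (objM X) (morM Z) (\<lambda>x. Cmp Z (ntr_map t (fst (ntr_tgt s) x)) (snd (ntr_src t) (ntr_map s x))) v"
    by (rule tangent_Cmp_pullback[OF Z o(1) v a b])
      (simp add: ntr_Src[OF t'(1)] functor_Ob[OF ntr_functor_tgt[OF s'(1)]] functor_Tgt[OF ntr_functor_src[OF t'(1)]] ntr_Mor[OF s'(1)] ntr_Tgt[OF s'(1)])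
  then show "ntr_map (tangent_ntr X Z (hcomp X Z t s)) v = ntr_map (hcomp (tangent_gpd X) (tangent_gpd Z) (tangent_ntr Y Z t) (tangent_ntr X Y s)) v"
    using v tmap_cong_pts[OF o(1) m(2) smooth_ntrD(4)[OF smooth_ntr_hcomp[OF X Y Z s t]] v,
      of "\<lambda>x. Cmp Z (ntr_map t (fst (ntr_tgt s) x)) (snd (ntr_src t) (ntr_map s x))"]
      tmap_compose_map[OF o m(2) smooth_functor_objM[OF s'(3)] t'(4) v] tmap_compose_map[OF o(1) m s'(4) smooth_functor_morM[OF t'(2)] v]
      tmap_map_pts[OF o smooth_functor_objM[OF s'(3)] v] tmap_map_pts[OF o(1) m(1) s'(4) v] by simp
qed (simp_all add: tangent_functor_fcomp_on[OF X Y Z] smooth_ntrD[OF s] smooth_ntrD[OF t])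

section \<open>The horizontal inverse of a differential\<close>

definition smooth_aut where
  "smooth_aut E F \<longleftrightarrow> smooth_functor E E F \<and> functor_ext E F \<and>
     (\<exists>F'. smooth_functor E E F' \<and> fcomp_on E F' F = fid E \<and> fcomp_on E F F' = fid E)"

lemma smooth_aut_inverse:
  assumes E: "lie_groupoid E" and F: "smooth_aut E F"
  shows "smooth_functor E E (finv_on E E F)" "functor_ext E (finv_on E E F)"
    "fcomp_on E (finv_on E E F) F = fid E" "fcomp_on E F (finv_on E E F) = fid E"
proof -
  obtain F' where F': "smooth_functor E E F'" "fcomp_on E F' F = fid E" "fcomp_on E F F' = fid E"
    using F by (auto simp: smooth_aut_def)
  have FE: "smooth_functor E E F" "functor_ext E F" using F by (auto simp: smooth_aut_def)
  define H where "H = fcomp_on E F' (fid E)"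
  note I = smooth_functor_fid[OF E]
  have H: "smooth_functor E E H" "functor_ext E H"
    using smooth_functor_fcomp_on[OF E E E I F'(1)] by (simp_all add: H_def)
  have "fcomp_on E H F = fcomp_on E F' (fcomp_on E (fid E) F)"
    unfolding H_def by (rule fcomp_on_assoc[OF smooth_functor_is_functor[OF FE(1)]])
  also have "fcomp_on E (fid E) F = F" by (rule fcomp_on_fid_left[OF FE(2) smooth_functor_is_functor[OF FE(1)]])
  finally have 1: "fcomp_on E H F = fid E" using F' by simp
  have "fcomp_on E F H = fcomp_on E (fcomp_on E F F') (fid E)"
    unfolding H_def by (rule fcomp_on_assoc[OF smooth_functor_is_functor[OF I], symmetric])
  then have 2: "fcomp_on E F H = fid E" using F' by (simp add: fcomp_on_fid_right)
  have "finv_on E E F = H" using finv_on_eq[OF _ _ H(2) 1 2] FE(1) H(1) by (simp add: smooth_functor_def)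
  then show "smooth_functor E E (finv_on E E F)" "functor_ext E (finv_on E E F)"
    "fcomp_on E (finv_on E E F) F = fid E" "fcomp_on E F (finv_on E E F) = fid E"
    using H 1 2 by simp_all
qed

lemma smooth_aut_finv_on: "lie_groupoid E \<Longrightarrow> smooth_aut E F \<Longrightarrow> smooth_aut E (finv_on E E F)"
  using smooth_aut_inverse unfolding smooth_aut_def by metis

lemma smooth_aut_apply:
  assumes E: "lie_groupoid E" and F: "smooth_aut E F"
  shows "x \<in> Ob E \<Longrightarrow> fst F (fst (finv_on E E F) x) = x" "x \<in> Ob E \<Longrightarrow> fst (finv_on E E F) (fst F x) = x"
    "f \<in> Mor E \<Longrightarrow> snd F (snd (finv_on E E F) f) = f" "f \<in> Mor E \<Longrightarrow> snd (finv_on E E F) (snd F f) = f"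
  using smooth_aut_inverse(3,4)[OF E F] fst_fcomp_on fst_fid snd_fcomp_on snd_fid by metis+

lemma finv_on_tangent_functor:
  assumes E: "lie_groupoid E" and F: "smooth_aut E F"
  shows "finv_on (tangent_gpd E) (tangent_gpd E) (tangent_functor E E F) = tangent_functor E E (finv_on E E F)"
proof (rule finv_on_eq)
  have FE: "smooth_functor E E F" using F by (auto simp: smooth_aut_def)
  note G = smooth_aut_inverse[OF E F]
  show "is_functor (tangent_gpd E) (tangent_gpd E) (tangent_functor E E F)"
    "is_functor (tangent_gpd E) (tangent_gpd E) (tangent_functor E E (finv_on E E F))"
    by (intro is_functor_tangent_functor E FE G)+
  show "fcomp_on (tangent_gpd E) (tangent_functor E E (finv_on E E F)) (tangent_functor E E F) = fid (tangent_gpd E)"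
    "fcomp_on (tangent_gpd E) (tangent_functor E E F) (tangent_functor E E (finv_on E E F)) = fid (tangent_gpd E)"
    by (simp_all flip: tangent_functor_fcomp_on[OF E E E FE G(1)] tangent_functor_fcomp_on[OF E E E G(1) FE]
       add: G tangent_functor_fid[OF E])
qed simp

lemma smooth_hinverse:
  assumes E: "lie_groupoid E" and t: "smooth_ntr E E t" and F: "smooth_aut E (ntr_src t)" and F': "smooth_aut E (ntr_tgt t)"
  shows "smooth_ntr E E (hinverse E t)" "hcomp E E t (hinverse E t) = ntr_id E E (fid E)"
    "hcomp E E (hinverse E t) t = ntr_id E E (fid E)"
proof -
  note G = smooth_aut_inverse[OF E F] and G' = smooth_aut_inverse[OF E F'] and t' = smooth_ntrD[OF t]
  note h = hinverse[OF lie_groupoid_groupoid[OF E] t'(1) smooth_functor_is_functor[OF G(1)] G(4,3) smooth_functor_is_functor[OF G'(1)] G'(4,3)]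
  note o = lie_groupoid_objM[OF E] and m = lie_groupoid_morM[OF E]
  have "smooth_map (objM E) (morM E) (ntr_map (hinverse E t))"
    by (rule smooth_map_cong[OF o m smooth_map_compose[OF o m m smooth_map_compose[OF o m m
        smooth_map_compose[OF o o m smooth_functor_objM[OF G'(1)] t'(4)] smooth_functor_morM[OF G(1)]] lie_groupoid_inv[OF E]]])
      simp
  then show "smooth_ntr E E (hinverse E t)" using h G G' by (simp add: smooth_ntr_def)
  show "hcomp E E t (hinverse E t) = ntr_id E E (fid E)" "hcomp E E (hinverse E t) t = ntr_id E E (fid E)" by (rule h)+
qed

text \<open>By functoriality of differentiation the differential of \<open>hinverse E t\<close> is a horizontal inverse. Its
  uniqueness is cancellation in the tangent groupoid. For a competitor \<open>s\<close> put \<open>w = ntr_map s y\<close>. The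
  equation \<open>s \<circ>\<^sub>H t\<^sub>* = id\<close> says that \<open>w \<circ> A\<^sub>* y\<close> is an identity, where \<open>A z = F\<inverse>(\<eta>\<^bsub>F'\<inverse> z\<^esub>)\<close>.
  Since \<open>y\<close> is the image of \<open>w\<close> under the differential of \<open>F \<circ> Src\<close>, associativity of the composition
  of \<open>w\<close>, \<open>A\<^sub>* y\<close> and \<open>(A\<inverse>)\<^sub>* y\<close> is the differential, at \<open>w\<close>, of associativity for the family
  \<open>x, A(F(Src x)), A(F(Src x))\<inverse>\<close> indexed by the morphisms \<open>x\<close> of \<open>E\<close>.\<close>

lemma hinv_tangent_ntr:
  assumes E: "lie_groupoid E" and t: "smooth_ntr E E t" and F: "smooth_aut E (ntr_src t)" and F': "smooth_aut E (ntr_tgt t)"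
  shows "hinv (tangent_gpd E) (tangent_ntr E E t) = tangent_ntr E E (hinverse E t)"
  unfolding hinv_def
proof (rule the_equality)
  let ?TE = "tangent_gpd E" and ?T = "tangent_ntr E E" and ?h = "hinverse E t"
  note h = smooth_hinverse[OF E t F F']
  show "ntr_src (?T ?h) = finv_on ?TE ?TE (ntr_src (?T t)) \<and> ntr_tgt (?T ?h) = finv_on ?TE ?TE (ntr_tgt (?T t)) \<and>
    nat_trans ?TE ?TE (ntr_src (?T ?h)) (ntr_tgt (?T ?h)) (ntr_map (?T ?h)) \<and> ntr_map (?T ?h) \<in> extensional (Ob ?TE) \<and>
    hcomp ?TE ?TE (?T ?h) (?T t) = ntr_id ?TE ?TE (fid ?TE) \<and> hcomp ?TE ?TE (?T t) (?T ?h) = ntr_id ?TE ?TE (fid ?TE)"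
  proof (intro conjI)
    show "nat_trans ?TE ?TE (ntr_src (?T ?h)) (ntr_tgt (?T ?h)) (ntr_map (?T ?h))"
      using is_ntr_tangent_ntr[OF E E h(1)] by (simp only: is_ntr_def)
    show "hcomp ?TE ?TE (?T ?h) (?T t) = ntr_id ?TE ?TE (fid ?TE)" "hcomp ?TE ?TE (?T t) (?T ?h) = ntr_id ?TE ?TE (fid ?TE)"
      by (simp_all flip: tangent_ntr_hcomp[OF E E E t h(1)] tangent_ntr_hcomp[OF E E E h(1) t]
          add: h tangent_ntr_id[OF E E smooth_functor_fid[OF E]] tangent_functor_fid[OF E])
  qed (simp_all add: finv_on_tangent_functor[OF E F] finv_on_tangent_functor[OF E F'])
  fix s assume "ntr_src s = finv_on ?TE ?TE (ntr_src (?T t)) \<and> ntr_tgt s = finv_on ?TE ?TE (ntr_tgt (?T t)) \<and>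
    nat_trans ?TE ?TE (ntr_src s) (ntr_tgt s) (ntr_map s) \<and> ntr_map s \<in> extensional (Ob ?TE) \<and>
    hcomp ?TE ?TE s (?T t) = ntr_id ?TE ?TE (fid ?TE) \<and> hcomp ?TE ?TE (?T t) s = ntr_id ?TE ?TE (fid ?TE)"
  then have s0: "ntr_src s = finv_on ?TE ?TE (ntr_src (?T t))" "ntr_tgt s = finv_on ?TE ?TE (ntr_tgt (?T t))"
    "is_ntr ?TE ?TE s" "ntr_map s \<in> extensional (Ob ?TE)" "hcomp ?TE ?TE s (?T t) = ntr_id ?TE ?TE (fid ?TE)"
    unfolding is_ntr_def by blast+
  then have s: "ntr_src s = tangent_functor E E (finv_on E E (ntr_src t))" "ntr_tgt s = tangent_functor E E (finv_on E E (ntr_tgt t))"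
     "is_ntr ?TE ?TE s" "ntr_map s \<in> extensional (Ob ?TE)" "hcomp ?TE ?TE s (?T t) = ntr_id ?TE ?TE (fid ?TE)"
    by (simp_all add: finv_on_tangent_functor[OF E F] finv_on_tangent_functor[OF E F'])
  show "s = ?T ?h"
  proof (rule ntr_eqI[of _ _ ?TE])
    let ?F = "ntr_src t" and ?F' = "ntr_tgt t" and ?G = "finv_on E E (ntr_src t)" and ?G' = "finv_on E E (ntr_tgt t)"
    note G = smooth_aut_inverse[OF E F] and G' = smooth_aut_inverse[OF E F'] and t' = smooth_ntrD[OF t]
    note o = lie_groupoid_objM[OF E] and m = lie_groupoid_morM[OF E] and C = lie_groupoid_groupoid[OF E]
    note C' = groupoid_category[OF C]
    let ?OO = "tmap (objM E) (objM E)" and ?OM = "tmap (objM E) (morM E)" and ?MO = "tmap (morM E) (objM E)" and ?MM = "tmap (morM E) (morM E)"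
    fix y assume "y \<in> Ob ?TE"
    then have y: "y \<in> pts (TM (objM E))" by simp
    let ?w = "ntr_map s y"
    \<comment> \<open>\<open>B\<close> is the component of \<open>hinverse E t\<close>; \<open>a\<close> and \<open>b\<close> are \<open>A\<close> and \<open>B\<close> as families over the morphisms.\<close>
    define A where "A z = snd ?G (ntr_map t (fst ?G' z))" for z
    define B where "B z = mor_inv E (A z)" for z
    define a where "a x = A (fst ?F (Src E x))" for x
    define b where "b x = B (fst ?F (Src E x))" for x
    have w: "?w \<in> pts (TM (morM E))" using ntr_Mor[OF s(3)] y by simp
    have wS: "?MO (Src E) ?w = ?OO (fst ?G) y" using ntr_Src[OF s(3), of y] y s(1) by simp
    note sG = smooth_functor_objM[OF G(1)] and sG' = smooth_functor_objM[OF G'(1)]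
    have sA: "smooth_map (objM E) (morM E) A"
      unfolding A_def[abs_def] by (rule smooth_map_compose[OF o m m smooth_map_compose[OF o o m sG' t'(4)] smooth_functor_morM[OF G(1)]])
    have sB: "smooth_map (objM E) (morM E) B"
      unfolding B_def[abs_def] by (rule smooth_map_compose[OF o m m sA lie_groupoid_inv[OF E]])
    have sFS: "smooth_map (morM E) (objM E) (\<lambda>x. fst ?F (Src E x))"
      by (rule smooth_map_compose[OF m o o lie_groupoid_Src[OF E] smooth_functor_objM[OF t'(2)]])
    have sa: "smooth_map (morM E) (morM E) a" and sb: "smooth_map (morM E) (morM E) b"
      unfolding a_def[abs_def] b_def[abs_def] using smooth_map_compose[OF m o m sFS] sA sB by blast+
    note rules = functor_Ob[OF smooth_functor_is_functor[OF G(1)]] functor_Ob[OF smooth_functor_is_functor[OF G'(1)]]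
      functor_Mor[OF smooth_functor_is_functor[OF G(1)]] functor_Src[OF smooth_functor_is_functor[OF G(1)]] functor_Tgt[OF smooth_functor_is_functor[OF G(1)]]
      functor_Ob[OF smooth_functor_is_functor[OF t'(2)]] ntr_Mor[OF t'(1)] ntr_Src[OF t'(1)] ntr_Tgt[OF t'(1)] smooth_aut_apply[OF E F] smooth_aut_apply[OF E F']
      mor_inv_Mor[OF C] mor_inv_Src[OF C] mor_inv_Tgt[OF C] category_Src[OF C'] category_Tgt[OF C']
    have Az: "A z \<in> Mor E" "Src E (A z) = fst ?G' z" "Tgt E (A z) = fst ?G z" if "z \<in> Ob E" for z
      using that by (simp_all add: A_def rules)
    have ax: "a x \<in> Mor E" "Tgt E (a x) = Src E x" "b x \<in> Mor E" "Tgt E (b x) = Src E (a x)" "Cmp E (a x) (b x) = Idt E (Src E x)"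
      if "x \<in> Mor E" for x
      using that Az[of "fst ?F (Src E x)"] by (simp_all add: a_def b_def B_def rules mor_inv_right[OF C])
    have Ty: "?MO (\<lambda>x. fst ?F (Src E x)) ?w = y"
    proof -
      have "?MO (\<lambda>x. fst ?F (Src E x)) ?w = ?OO (fst ?F) (?MO (Src E) ?w)"
        by (rule tmap_compose_map[OF m o o lie_groupoid_Src[OF E] smooth_functor_objM[OF t'(2)] w, symmetric])
      also have "\<dots> = ?OO (\<lambda>x. fst ?F (fst ?G x)) y"
        unfolding wS by (rule tmap_compose_map[OF o o o sG smooth_functor_objM[OF t'(2)] y])
      also have "\<dots> = ?OO (\<lambda>x. x) y"
        by (rule tmap_cong_pts[OF o o smooth_map_compose[OF o o o sG smooth_functor_objM[OF t'(2)]] y]) (simp add: smooth_aut_apply[OF E F])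
      finally show ?thesis by (simp add: tmap_ident[OF o y])
    qed
    have aw: "?MM a ?w = ?OM A y" and bw: "?MM b ?w = ?OM B y"
      unfolding a_def[abs_def] b_def[abs_def]
      using tmap_compose_map[OF m o m sFS sA w] tmap_compose_map[OF m o m sFS sB w] Ty by simp_all
    note idm = smooth_map_id[OF m]
    note c1 = smooth_map_Cmp[OF E m idm sa]
    have "?w = ?MM (\<lambda>x. x) ?w" by (simp add: tmap_ident[OF m w])
    also have "\<dots> = ?MM (\<lambda>x. Cmp E (Cmp E x (a x)) (b x)) ?w"
    proof (rule tmap_cong_pts[OF m m idm w])
      fix x assume "x \<in> pts (morM E)"
      then have x: "x \<in> Mor E" by simp
      have "Cmp E (Cmp E x (a x)) (b x) = Cmp E x (Cmp E (a x) (b x))"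
        using x ax[OF x] by (intro category_assoc[OF C', symmetric]) simp_all
      then show "x = Cmp E (Cmp E x (a x)) (b x)" using ax[OF x] x by (simp add: category_simps[OF C'])
    qed
    also have "\<dots> = Cmp ?TE (?MM (\<lambda>x. Cmp E x (a x)) ?w) (?MM b ?w)"
      using ax by (intro tangent_Cmp_pullback[OF E m w c1 sb, symmetric]) (simp_all add: category_simps[OF C'])
    also have "?MM (\<lambda>x. Cmp E x (a x)) ?w = Cmp ?TE ?w (?MM a ?w)"
      using tangent_Cmp_pullback[OF E m w idm sa] ax by (simp add: tmap_ident[OF m w])
    also have "Cmp ?TE ?w (?MM a ?w) = ?OM (Idt E) (?OO (fst ?G') y)"
    proof -
      let ?x = "?OO (fst ?G') y"
      have x: "?x \<in> pts (TM (objM E))" by (rule tmap_map_pts[OF o o sG' y])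
      have y': "?OO (fst ?F') ?x = y"
        using tmap_compose_map[OF o o o sG' smooth_functor_objM[OF t'(3)] y]
          tmap_cong_pts[OF o o smooth_map_id[OF o] y, of "\<lambda>x. fst ?F' (fst ?G' x)"]
        by (simp add: smooth_aut_apply[OF E F'] tmap_ident[OF o y])
      have "?MM (snd ?G) (?OM (ntr_map t) ?x) = ?OM A y"
        unfolding A_def[abs_def]
        using tmap_compose_map[OF o o m sG' t'(4) y] tmap_compose_map[OF o m m smooth_map_compose[OF o o m sG' t'(4)] smooth_functor_morM[OF G(1)] y] by simp
      then show ?thesis
        using arg_cong[OF s(5), of "\<lambda>t. ntr_map t ?x"] x y' tmap_map_pts[OF o m t'(4) x] s(1) aw by simp
    qed
    also have "Cmp ?TE (?OM (Idt E) (?OO (fst ?G') y)) (?MM b ?w) = Cmp ?TE (?OM (\<lambda>z. Idt E (fst ?G' z)) y) (?OM B y)"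
      using bw tmap_compose_map[OF o o m sG' lie_groupoid_Idt[OF E] y] by simp
    also have "\<dots> = ?OM (\<lambda>z. Cmp E (Idt E (fst ?G' z)) (B z)) y"
      by (rule tangent_Cmp_pullback[OF E o y smooth_map_compose[OF o o m sG' lie_groupoid_Idt[OF E]] sB])
        (use Az in \<open>simp add: B_def rules category_simps[OF C']\<close>)
    also have "\<dots> = ?OM (ntr_map ?h) y"
      by (rule tmap_cong_pts[OF o m _ y, symmetric])
       (use Az smooth_ntrD(4)[OF h(1)] in \<open>simp_all add: B_def rules category_simps[OF C'] flip: A_def\<close>)
    finally show "ntr_map s y = ntr_map (?T ?h) y" using y by simp
  qed (use s in simp_all)
qed

section \<open>The gauge 2-group\<close>

lemma prod_gpd_simps [simp]:
  "Ob (prod_gpd X Y) = Ob X \<times> Ob Y" "Mor (prod_gpd X Y) = Mor X \<times> Mor Y"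
  "Src (prod_gpd X Y) = map_prod (Src X) (Src Y)" "Tgt (prod_gpd X Y) = map_prod (Tgt X) (Tgt Y)"
  "Idt (prod_gpd X Y) = map_prod (Idt X) (Idt Y)" "Cmp (prod_gpd X Y) (a', b') (a, b) = (Cmp X a' a, Cmp Y b' b)"
  "objM (prod_gpd X Y) = prod_mfd (objM X) (objM Y)" "morM (prod_gpd X Y) = prod_mfd (morM X) (morM Y)"
  by (simp_all add: prod_gpd_def prod_cat_def cat.extend_def objM_def morM_def prod_mfd_def)

lemma mor_inv_Idt: "category C \<Longrightarrow> x \<in> Ob C \<Longrightarrow> mor_inv C (Idt C x) = Idt C x"
  by (rule mor_inv_eqI) (simp_all add: inverse_mor_def category_simps)

lemma mor_inv_functor_prod:
  assumes E: "groupoid E" and G: "groupoid G" and C: "category C" and r: "is_functor (prod_gpd E G) C r" and a: "a \<in> Mor E" "b \<in> Mor G"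
  shows "mor_inv C (snd r (a, b)) = snd r (mor_inv E a, mor_inv G b)"
proof (rule mor_inv_eqI[OF C])
  note E' = groupoid_category[OF E] and G' = groupoid_category[OF G]
  note rules = a mor_inv_Mor[OF E] mor_inv_Mor[OF G] mor_inv_Src[OF E] mor_inv_Src[OF G] mor_inv_Tgt[OF E] mor_inv_Tgt[OF G]
    mor_inv_left[OF E] mor_inv_left[OF G] mor_inv_right[OF E] mor_inv_right[OF G] category_Src[OF E'] category_Tgt[OF E'] category_Src[OF G'] category_Tgt[OF G']
  have "Cmp C (snd r (mor_inv E a, mor_inv G b)) (snd r (a, b)) = snd r (Cmp (prod_gpd E G) (mor_inv E a, mor_inv G b) (a, b))"
    "Cmp C (snd r (a, b)) (snd r (mor_inv E a, mor_inv G b)) = snd r (Cmp (prod_gpd E G) (a, b) (mor_inv E a, mor_inv G b))"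
    by (intro functor_Cmp[OF r, symmetric]; simp add: rules)+
  moreover have "snd r (Idt E x, Idt G y) = Idt C (fst r (x, y))" if "x \<in> Ob E" "y \<in> Ob G" for x y
    using functor_Idt[OF r, of "(x, y)"] that by simp
  ultimately show "inverse_mor C (snd r (a, b)) (snd r (mor_inv E a, mor_inv G b))"
    unfolding inverse_mor_def
    using functor_Mor[OF r, of "(a, b)"] functor_Mor[OF r, of "(mor_inv E a, mor_inv G b)"]
      functor_Src[OF r, of "(a, b)"] functor_Src[OF r, of "(mor_inv E a, mor_inv G b)"]
      functor_Tgt[OF r, of "(a, b)"] functor_Tgt[OF r, of "(mor_inv E a, mor_inv G b)"]
    by (simp add: rules)
qed

lemma mem_gauge_ob:
  "F \<in> gauge_ob G E pr r \<longleftrightarrow> smooth_aut E F \<and>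
     (\<forall>p\<in>Ob E. \<forall>g\<in>Ob G. fst F (fst r (p, g)) = fst r (fst F p, g)) \<and>
     (\<forall>p\<in>Mor E. \<forall>g\<in>Mor G. snd F (snd r (p, g)) = snd r (snd F p, g)) \<and>
     (\<forall>p\<in>Ob E. fst pr (fst F p) = fst pr p) \<and> (\<forall>p\<in>Mor E. snd pr (snd F p) = snd pr p)"
  by (auto simp: gauge_ob_def smooth_aut_def)

text \<open>In a groupoid every natural transformation is invertible, so the invertibility clause disappears.\<close>

lemma mem_gauge_mor:
  assumes "groupoid E"
  shows "t \<in> gauge_mor G E X pr r \<longleftrightarrow> ntr_src t \<in> gauge_ob G E pr r \<and> ntr_tgt t \<in> gauge_ob G E pr r \<and>
     smooth_ntr E E t \<and> ntr_map t \<in> extensional (Ob E) \<and>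
     (\<forall>p\<in>Ob E. \<forall>g\<in>Ob G. ntr_map t (fst r (p, g)) = snd r (ntr_map t p, Idt G g)) \<and>
     (\<forall>p\<in>Ob E. snd pr (ntr_map t p) = Idt X (fst pr p))"
  by (cases t) (auto simp: gauge_mor_def smooth_ntr_def smooth_nat_iso_def nat_iso_groupoid[OF assms] is_ntr_def mem_gauge_ob smooth_aut_def)

locale principal_2bundle_setting =
  fixes G :: "('g0, 'g1, 'a::real_inner, 'b::real_inner) lie_2gp"
    and E :: "('e0, 'e1, 'c::real_inner, 'd::real_inner) lie_gpd"
    and X :: "('x0, 'x1, 'k::real_inner, 'l::real_inner) lie_gpd"
    and pr :: "('e0, 'e1, 'x0, 'x1) ftr"
    and r :: "('e0 \<times> 'g0, 'e1 \<times> 'g1, 'e0, 'e1) ftr"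
  assumes principal: "principal_2bundle G E X pr r"
begin

lemma lie_2group_G: "lie_2group G" and lie_groupoid_E: "lie_groupoid E" and lie_groupoid_X: "lie_groupoid X"
  and projection: "smooth_functor E X pr" and action: "smooth_functor (prod_gpd E G) E r"
  using principal by (simp_all add: principal_2bundle_def)

lemma lie_groupoid_G: "lie_groupoid G"
  using lie_2group_G by (simp add: lie_2group_def)

lemmas groupoid_E = lie_groupoid_groupoid[OF lie_groupoid_E]
  and category_E = lie_groupoid_category[OF lie_groupoid_E]
  and category_X = lie_groupoid_category[OF lie_groupoid_X]
  and category_G = lie_groupoid_category[OF lie_groupoid_G]
  and is_functor_r = smooth_functor_is_functor[OF action]
  and is_functor_pr = smooth_functor_is_functor[OF projection]

lemma action_Ob: "p \<in> Ob E \<Longrightarrow> g \<in> Ob G \<Longrightarrow> fst r (p, g) \<in> Ob E"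
  and action_Mor: "a \<in> Mor E \<Longrightarrow> b \<in> Mor G \<Longrightarrow> snd r (a, b) \<in> Mor E"
  and action_Idt: "p \<in> Ob E \<Longrightarrow> g \<in> Ob G \<Longrightarrow> Idt E (fst r (p, g)) = snd r (Idt E p, Idt G g)"
  and action_Cmp: "a \<in> Mor E \<Longrightarrow> a' \<in> Mor E \<Longrightarrow> b \<in> Mor G \<Longrightarrow> b' \<in> Mor G \<Longrightarrow> Src E a' = Tgt E a \<Longrightarrow> Src G b' = Tgt G b \<Longrightarrow>
    Cmp E (snd r (a', b')) (snd r (a, b)) = snd r (Cmp E a' a, Cmp G b' b)"
  using functor_Ob[OF is_functor_r, of "(p, g)"] functor_Mor[OF is_functor_r, of "(a, b)"]
    functor_Idt[OF is_functor_r, of "(p, g)"] functor_Cmp[OF is_functor_r, of "(a, b)" "(a', b')"] by auto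

lemma action_Cmp_Idt: "a \<in> Mor E \<Longrightarrow> a' \<in> Mor E \<Longrightarrow> g \<in> Ob G \<Longrightarrow> Src E a' = Tgt E a \<Longrightarrow>
    Cmp E (snd r (a', Idt G g)) (snd r (a, Idt G g)) = snd r (Cmp E a' a, Idt G g)"
  by (simp add: action_Cmp category_simps[OF category_G])

lemma action_mor_inv: "a \<in> Mor E \<Longrightarrow> g \<in> Ob G \<Longrightarrow> mor_inv E (snd r (a, Idt G g)) = snd r (mor_inv E a, Idt G g)"
  by (simp add: mor_inv_functor_prod[OF groupoid_E lie_groupoid_groupoid[OF lie_groupoid_G] category_E is_functor_r]
      category_Idt[OF category_G] mor_inv_Idt[OF category_G])

lemma gauge_obD:
  assumes "F \<in> gauge_ob G E pr r"
  shows "smooth_aut E F" "smooth_functor E E F" "is_functor E E F" "functor_ext E F"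
    "p \<in> Ob E \<Longrightarrow> g \<in> Ob G \<Longrightarrow> fst F (fst r (p, g)) = fst r (fst F p, g)"
    "a \<in> Mor E \<Longrightarrow> b \<in> Mor G \<Longrightarrow> snd F (snd r (a, b)) = snd r (snd F a, b)"
    "p \<in> Ob E \<Longrightarrow> fst pr (fst F p) = fst pr p" "a \<in> Mor E \<Longrightarrow> snd pr (snd F a) = snd pr a"
  using assms by (auto simp: mem_gauge_ob smooth_aut_def smooth_functor_def)

lemma gauge_morD:
  assumes "t \<in> gauge_mor G E X pr r"
  shows "ntr_src t \<in> gauge_ob G E pr r" "ntr_tgt t \<in> gauge_ob G E pr r" "smooth_ntr E E t" "is_ntr E E t" "ntr_map t \<in> extensional (Ob E)"
    "p \<in> Ob E \<Longrightarrow> g \<in> Ob G \<Longrightarrow> ntr_map t (fst r (p, g)) = snd r (ntr_map t p, Idt G g)"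
    "p \<in> Ob E \<Longrightarrow> snd pr (ntr_map t p) = Idt X (fst pr p)"
  using assms by (auto simp: mem_gauge_mor[OF groupoid_E] smooth_ntr_def)

lemma fid_gauge_ob: "fid E \<in> gauge_ob G E pr r"
proof -
  have "fcomp_on E (fid E) (fid E) = fid E" by (simp add: fcomp_on_fid_right)
  then have "smooth_aut E (fid E)" using smooth_functor_fid[OF lie_groupoid_E] functor_ext_fid unfolding smooth_aut_def by blast
  then show ?thesis unfolding mem_gauge_ob by (simp add: action_Ob action_Mor)
qed

lemma smooth_aut_fcomp_on:
  assumes F: "smooth_aut E F" and H: "smooth_aut E H" shows "smooth_aut E (fcomp_on E H F)"
proof -
  let ?F' = "finv_on E E F" and ?H' = "finv_on E E H"
  have f: "smooth_functor E E F" "functor_ext E F" "smooth_functor E E H" "functor_ext E H"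
    using F H by (auto simp: smooth_aut_def)
  note F' = smooth_aut_inverse[OF lie_groupoid_E F] and H' = smooth_aut_inverse[OF lie_groupoid_E H]
  note fa = smooth_functor_is_functor[OF f(1)] smooth_functor_is_functor[OF f(3)]
    smooth_functor_is_functor[OF F'(1)] smooth_functor_is_functor[OF H'(1)]
  note sf = smooth_functor_fcomp_on[OF lie_groupoid_E lie_groupoid_E lie_groupoid_E]
  note af = smooth_aut_apply[OF lie_groupoid_E F] smooth_aut_apply[OF lie_groupoid_E H] functor_Ob[OF fa(1)] functor_Mor[OF fa(1)]
    functor_Ob[OF fa(4)] functor_Mor[OF fa(4)]
  have "fcomp_on E (fcomp_on E ?F' ?H') (fcomp_on E H F) = fid E"
    by (rule functor_eqI[of E]) (simp_all add: af functor_Ob[OF fa(2)] functor_Mor[OF fa(2)])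
  moreover have "fcomp_on E (fcomp_on E H F) (fcomp_on E ?F' ?H') = fid E"
    by (rule functor_eqI[of E]) (simp_all add: af functor_Ob[OF fa(3)] functor_Mor[OF fa(3)])
  ultimately show ?thesis
    unfolding smooth_aut_def using sf[OF f(1,3)] sf[OF H'(1) F'(1)] functor_ext_fcomp_on by blast
qed

lemma fcomp_on_gauge_ob:
  assumes F: "F \<in> gauge_ob G E pr r" and H: "H \<in> gauge_ob G E pr r" shows "fcomp_on E H F \<in> gauge_ob G E pr r"
proof -
  note f = gauge_obD[OF F] and h = gauge_obD[OF H]
  show ?thesis unfolding mem_gauge_ob
    using smooth_aut_fcomp_on[OF f(1) h(1)] functor_Ob[OF f(3)] functor_Mor[OF f(3)]
    by (simp add: action_Ob action_Mor f(5-8) h(5-8))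
qed

lemma finv_on_gauge_ob:
  assumes F: "F \<in> gauge_ob G E pr r" shows "finv_on E E F \<in> gauge_ob G E pr r"
proof -
  note f = gauge_obD[OF F] and E = lie_groupoid_E
  let ?H = "finv_on E E F"
  note H = smooth_functor_is_functor[OF smooth_aut_inverse(1)[OF E f(1)]]
  note a = smooth_aut_apply[OF E f(1)]
  have 1: "fst ?H (fst r (p, g)) = fst r (fst ?H p, g)" if "p \<in> Ob E" "g \<in> Ob G" for p g
    using f(5)[OF functor_Ob[OF H that(1)] that(2)] a(2)[OF action_Ob[OF functor_Ob[OF H that(1)] that(2)]] a(1)[OF that(1)] by simp
  have 2: "snd ?H (snd r (p, g)) = snd r (snd ?H p, g)" if "p \<in> Mor E" "g \<in> Mor G" for p g
    using f(6)[OF functor_Mor[OF H that(1)] that(2)] a(4)[OF action_Mor[OF functor_Mor[OF H that(1)] that(2)]] a(3)[OF that(1)] by simp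
  have 3: "fst pr (fst ?H p) = fst pr p" if "p \<in> Ob E" for p
    using f(7)[OF functor_Ob[OF H that]] a(1)[OF that] by simp
  have 4: "snd pr (snd ?H p) = snd pr p" if "p \<in> Mor E" for p
    using f(8)[OF functor_Mor[OF H that]] a(3)[OF that] by simp
  show ?thesis unfolding mem_gauge_ob using smooth_aut_finv_on[OF E f(1)] 1 2 3 4 by blast
qed

lemma ntr_id_gauge_mor:
  assumes F: "F \<in> gauge_ob G E pr r" shows "ntr_id E E F \<in> gauge_mor G E X pr r"
proof -
  note f = gauge_obD[OF F]
  show ?thesis unfolding mem_gauge_mor[OF groupoid_E]
    using F smooth_ntr_id[OF lie_groupoid_E lie_groupoid_E f(2)]
    by (simp add: action_Ob f(5,7) functor_Ob[OF f(3)] action_Idt functor_Idt[OF is_functor_pr])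
qed

lemma vcomp_gauge_mor:
  assumes s: "s \<in> gauge_mor G E X pr r" and t: "t \<in> gauge_mor G E X pr r" and st: "ntr_tgt s = ntr_src t"
  shows "vcomp E E t s \<in> gauge_mor G E X pr r"
proof -
  note s' = gauge_morD[OF s] and t' = gauge_morD[OF t]
  note rules = ntr_Mor[OF s'(4)] ntr_Mor[OF t'(4)] ntr_Src[OF t'(4)] ntr_Tgt[OF s'(4)] st
  show ?thesis unfolding mem_gauge_mor[OF groupoid_E]
    using s'(1) t'(2) smooth_ntr_vcomp[OF lie_groupoid_E lie_groupoid_E s'(3) t'(3) st]
    by (simp add: action_Ob s'(6,7) t'(6,7) rules action_Cmp_Idt functor_Cmp[OF is_functor_pr] category_simps[OF category_X] functor_Ob[OF is_functor_pr])
qed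

lemma hcomp_gauge_mor:
  assumes s: "s \<in> gauge_mor G E X pr r" and t: "t \<in> gauge_mor G E X pr r"
  shows "hcomp E E t s \<in> gauge_mor G E X pr r"
proof -
  note s' = gauge_morD[OF s] and t' = gauge_morD[OF t]
  note F' = gauge_obD[OF s'(2)] and H = gauge_obD[OF t'(1)]
  note rules = ntr_Mor[OF s'(4)] ntr_Mor[OF t'(4)] ntr_Src[OF t'(4)] ntr_Tgt[OF s'(4)] functor_Ob[OF F'(3)] functor_Mor[OF H(3)] functor_Tgt[OF H(3)]
  show ?thesis unfolding mem_gauge_mor[OF groupoid_E]
    using fcomp_on_gauge_ob[OF s'(1) t'(1)] fcomp_on_gauge_ob[OF s'(2) t'(2)] smooth_ntr_hcomp[OF lie_groupoid_E lie_groupoid_E lie_groupoid_E s'(3) t'(3)]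
    by (simp add: action_Ob s'(6,7) t'(6,7) rules F'(5,7) H(6,8) category_Idt[OF category_G] action_Cmp_Idt functor_Cmp[OF is_functor_pr] category_simps[OF category_X] functor_Ob[OF is_functor_pr])
qed

lemma hinverse_gauge_mor:
  assumes t: "t \<in> gauge_mor G E X pr r"
  shows "hinverse E t \<in> gauge_mor G E X pr r" "hcomp E E t (hinverse E t) = ntr_id E E (fid E)"
proof -
  note t' = gauge_morD[OF t]
  note F = gauge_obD[OF t'(1)] and F' = gauge_obD[OF t'(2)]
  note iF = finv_on_gauge_ob[OF t'(1)] and iF' = finv_on_gauge_ob[OF t'(2)]
  note H = gauge_obD[OF iF] and H' = gauge_obD[OF iF']
  note h = smooth_hinverse[OF lie_groupoid_E t'(3) F(1) F'(1)]
  show "hcomp E E t (hinverse E t) = ntr_id E E (fid E)" by (rule h(2))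
  note rules = ntr_Mor[OF t'(4)] functor_Ob[OF H'(3)] functor_Mor[OF H(3)]
  show "hinverse E t \<in> gauge_mor G E X pr r"
    unfolding mem_gauge_mor[OF groupoid_E]
    using iF iF' h(1)
    by (simp add: action_Ob t'(6,7) rules H(6,8) H'(5,7) category_Idt[OF category_G] action_mor_inv
      functor_mor_inv[OF groupoid_E category_X is_functor_pr] functor_Ob[OF is_functor_pr] mor_inv_Idt[OF category_X])
qed

text \<open>Equivariance under \<open>1\<^sub>g\<close> is stable under the operations because the action is a functor and
  \<open>1\<^sub>g \<circ> 1\<^sub>g = 1\<^sub>g = 1\<^sub>g\<inverse>\<close>; projecting to an identity is stable because the projection is a functor.\<close>

lemma gauge_strict_2group:
  "strict_2group (gauge_cat G E X pr r) (gauge_ogrp G E pr r) (gauge_mgrp G E X pr r)"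
  unfolding gauge_cat_def gauge_ogrp_def gauge_mgrp_def
proof (rule strict_2group_automorphisms[OF category_E])
  fix F assume "F \<in> gauge_ob G E pr r"
  then show "\<exists>H\<in>gauge_ob G E pr r. fcomp_on E F H = fid E"
    using finv_on_gauge_ob smooth_aut_inverse(4)[OF lie_groupoid_E] gauge_obD(1) by metis
next
  fix t assume "t \<in> gauge_mor G E X pr r"
  then show "\<exists>s\<in>gauge_mor G E X pr r. hcomp E E t s = ntr_id E E (fid E)"
    using hinverse_gauge_mor by metis
qed (auto simp: gauge_obD gauge_morD fid_gauge_ob fcomp_on_gauge_ob ntr_id_gauge_mor vcomp_gauge_mor hcomp_gauge_mor)

lemma gauge_inv:
  shows "F \<in> gauge_ob G E pr r \<Longrightarrow> m_inv (gauge_ogrp G E pr r) F = finv_on E E F"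
    and "t \<in> gauge_mor G E X pr r \<Longrightarrow> m_inv (gauge_mgrp G E X pr r) t = hinverse E t"
proof -
  have g: "group (gauge_ogrp G E pr r)" "group (gauge_mgrp G E X pr r)"
    using gauge_strict_2group by (simp_all add: strict_2group_def)
  show "m_inv (gauge_ogrp G E pr r) F = finv_on E E F" if "F \<in> gauge_ob G E pr r"
    using group.inv_equality[OF g(1), of "finv_on E E F" F] finv_on_gauge_ob[OF that] that smooth_aut_inverse(4)[OF lie_groupoid_E gauge_obD(1)[OF that]]
    by (simp add: gauge_ogrp_def)
  show "m_inv (gauge_mgrp G E X pr r) t = hinverse E t" if "t \<in> gauge_mor G E X pr r"
    using group.inv_equality[OF g(2), of "hinverse E t" t] hinverse_gauge_mor[OF that] that
    by (simp add: gauge_mgrp_def)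
qed

end

section \<open>The Lie 2-algebra\<close>

lemma tvec_eqI_pointwise: "fst u = fst v \<Longrightarrow> (\<And>c. snd u c = snd v c) \<Longrightarrow> u = v"
  by (simp add: prod_eq_iff fun_eq_iff)

lemma lie_group_manifold: "lie_group M H \<Longrightarrow> pre_manifold M"
  and lie_group_group: "lie_group M H \<Longrightarrow> group H"
  and lie_group_carrier: "lie_group M H \<Longrightarrow> carrier H = pts M"
  by (simp_all add: lie_group_def manifold_imp_pre_manifold)

lemma smooth_map_mult:
  assumes G: "lie_group M H" and P: "pre_manifold P" and a: "smooth_map P M a" and b: "smooth_map P M b"
  shows "smooth_map P M (\<lambda>x. a x \<otimes>\<^bsub>H\<^esub> b x)"
proof -
  have "smooth_map (prod_mfd M M) M (\<lambda>(g, h). g \<otimes>\<^bsub>H\<^esub> h)" using G by (simp add: lie_group_def)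
  from smooth_map_compose[OF P pre_manifold_prod[OF lie_group_manifold[OF G] lie_group_manifold[OF G]] lie_group_manifold[OF G]
    smooth_map_Pair[OF P lie_group_manifold[OF G] lie_group_manifold[OF G] a b] this]
  show ?thesis by simp
qed

lemma smooth_map_conj:
  assumes G: "lie_group M H" and g: "g \<in> carrier H"
  shows "smooth_map M M (\<lambda>h. g \<otimes>\<^bsub>H\<^esub> h \<otimes>\<^bsub>H\<^esub> inv\<^bsub>H\<^esub> g)"
proof -
  interpret group H by (rule lie_group_group[OF G])
  note M = lie_group_manifold[OF G]
  have "g \<in> pts M" "inv\<^bsub>H\<^esub> g \<in> pts M" using g lie_group_carrier[OF G] by auto
  then show ?thesis by (intro smooth_map_mult[OF G M] smooth_map_const smooth_map_id M)
qed

lemma adj_pts: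
  assumes G: "lie_group M H" and g: "g \<in> carrier H" and A: "A \<in> pts (tspace_mfd M \<one>\<^bsub>H\<^esub>)"
  shows "adj M H g A \<in> pts (tspace_mfd M \<one>\<^bsub>H\<^esub>)"
proof -
  interpret group H by (rule lie_group_group[OF G])
  have one: "\<one>\<^bsub>H\<^esub> \<in> pts M" using lie_group_carrier[OF G] by auto
  have "A \<in> pts (TM M)" "fst A = \<one>\<^bsub>H\<^esub>" using A tspace_mfd_TM[OF one] by auto
  then show ?thesis
    unfolding adj_def using tmap_map_pts[OF lie_group_manifold[OF G] lie_group_manifold[OF G] smooth_map_conj[OF G g]] g
    by (simp add: tspace_mfd_TM[OF one])
qed

lemma adj_tlin:
  assumes G: "lie_group M H" and g: "g \<in> carrier H" and A: "A \<in> pts (tspace_mfd M \<one>\<^bsub>H\<^esub>)" and B: "B \<in> pts (tspace_mfd M \<one>\<^bsub>H\<^esub>)"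
  shows "adj M H g (tlin a A b B) = tlin a (adj M H g A) b (adj M H g B)"
proof -
  interpret group H by (rule lie_group_group[OF G])
  have one: "\<one>\<^bsub>H\<^esub> \<in> pts M" using lie_group_carrier[OF G] by auto
  have "A \<in> pts (TM M)" "fst A = \<one>\<^bsub>H\<^esub>" "B \<in> pts (TM M)" "fst B = \<one>\<^bsub>H\<^esub>" using A B tspace_mfd_TM[OF one] by auto
  then show ?thesis
    unfolding adj_def using smooth_mapD[OF smooth_map_conj[OF G g] one]
    by (intro tmap_tlin[OF lie_group_manifold[OF G] lie_group_manifold[OF G]]) simp_all
qed

text \<open>A smooth homomorphism intertwines the conjugations, hence the adjoint actions.\<close>

lemma tmap_adj:
  assumes G: "lie_group M H" and G': "lie_group N K" and f: "smooth_map M N f"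
    and hom: "\<And>x y. x \<in> carrier H \<Longrightarrow> y \<in> carrier H \<Longrightarrow> f (x \<otimes>\<^bsub>H\<^esub> y) = f x \<otimes>\<^bsub>K\<^esub> f y"
    and g: "g \<in> carrier H" and A: "A \<in> pts (TM M)"
  shows "tmap M N f (adj M H g A) = adj N K (f g) (tmap M N f A)"
proof -
  interpret H: group H by (rule lie_group_group[OF G])
  interpret K: group K by (rule lie_group_group[OF G'])
  note M = lie_group_manifold[OF G] and N = lie_group_manifold[OF G']
  have fc: "f x \<in> carrier K" if "x \<in> carrier H" for x
    using smooth_map_pts[OF f, of x] that lie_group_carrier[OF G] lie_group_carrier[OF G'] by simp
  then have "f \<in> hom H K" using hom by (auto simp: hom_def)
  then have inv: "f (inv\<^bsub>H\<^esub> g) = inv\<^bsub>K\<^esub> (f g)"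
    using g by (intro group_hom.hom_inv) (auto simp: group_hom_def group_hom_axioms_def H.group_axioms K.group_axioms)
  have "tmap M N f (adj M H g A) = tmap M N (\<lambda>x. f (g \<otimes>\<^bsub>H\<^esub> x \<otimes>\<^bsub>H\<^esub> inv\<^bsub>H\<^esub> g)) A"
    unfolding adj_def by (rule tmap_compose_map[OF M M N smooth_map_conj[OF G g] f A])
  also have "\<dots> = tmap M N (\<lambda>x. f g \<otimes>\<^bsub>K\<^esub> f x \<otimes>\<^bsub>K\<^esub> inv\<^bsub>K\<^esub> (f g)) A"
    by (rule tmap_cong_pts[OF M N smooth_map_compose[OF M M N smooth_map_conj[OF G g] f] A])
      (use g in \<open>simp add: hom inv flip: lie_group_carrier[OF G]\<close>)
  also have "\<dots> = adj N K (f g) (tmap M N f A)"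
    unfolding adj_def by (rule tmap_compose_map[OF M N N f smooth_map_conj[OF G' fc[OF g]] A, symmetric])
  finally show ?thesis .
qed

locale lie_2group_setting =
  fixes G :: "('g0, 'g1, 'a::real_inner, 'b::real_inner) lie_2gp"
  assumes lie_2group: "lie_2group G"
begin

abbreviation "LO \<equiv> tspace_mfd (objM G) \<one>\<^bsub>ogrp G\<^esub>"
abbreviation "LM \<equiv> tspace_mfd (morM G) \<one>\<^bsub>mgrp G\<^esub>"
abbreviation "S \<equiv> tmap (morM G) (objM G) (Src G)"
abbreviation "T \<equiv> tmap (morM G) (objM G) (Tgt G)"
abbreviation "U \<equiv> tmap (objM G) (morM G) (Idt G)"

lemma lie_gpd: "lie_groupoid G" and lie_group_ogrp: "lie_group (objM G) (ogrp G)" and lie_group_mgrp: "lie_group (morM G) (mgrp G)"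
  and is_functor_mult: "is_functor (prod_gpd G G) G (\<lambda>(g, h). g \<otimes>\<^bsub>ogrp G\<^esub> h, \<lambda>(a, b). a \<otimes>\<^bsub>mgrp G\<^esub> b)"
  using lie_2group by (simp_all add: lie_2group_def smooth_functor_def)

lemmas cat_G = lie_groupoid_category[OF lie_gpd] and objM_G = lie_groupoid_objM[OF lie_gpd] and morM_G = lie_groupoid_morM[OF lie_gpd]

sublocale H0: group "ogrp G" by (rule lie_group_group[OF lie_group_ogrp])
sublocale H1: group "mgrp G" by (rule lie_group_group[OF lie_group_mgrp])

lemma carrier_ogrp: "carrier (ogrp G) = Ob G" and carrier_mgrp: "carrier (mgrp G) = Mor G"
  using lie_group_carrier[OF lie_group_ogrp] lie_group_carrier[OF lie_group_mgrp] by simp_all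

lemma one_ogrp: "\<one>\<^bsub>ogrp G\<^esub> \<in> Ob G" and one_mgrp: "\<one>\<^bsub>mgrp G\<^esub> \<in> Mor G"
  using carrier_ogrp carrier_mgrp by auto

lemma Src_mult: "a \<in> Mor G \<Longrightarrow> b \<in> Mor G \<Longrightarrow> Src G (a \<otimes>\<^bsub>mgrp G\<^esub> b) = Src G a \<otimes>\<^bsub>ogrp G\<^esub> Src G b"
  and Tgt_mult: "a \<in> Mor G \<Longrightarrow> b \<in> Mor G \<Longrightarrow> Tgt G (a \<otimes>\<^bsub>mgrp G\<^esub> b) = Tgt G a \<otimes>\<^bsub>ogrp G\<^esub> Tgt G b"
  and Idt_mult: "g \<in> Ob G \<Longrightarrow> h \<in> Ob G \<Longrightarrow> Idt G (g \<otimes>\<^bsub>ogrp G\<^esub> h) = Idt G g \<otimes>\<^bsub>mgrp G\<^esub> Idt G h"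
  using functor_Src[OF is_functor_mult, of "(a, b)"] functor_Tgt[OF is_functor_mult, of "(a, b)"]
    functor_Idt[OF is_functor_mult, of "(g, h)"] by auto

lemma Idt_one: "Idt G \<one>\<^bsub>ogrp G\<^esub> = \<one>\<^bsub>mgrp G\<^esub>"
proof -
  have c: "Idt G \<one>\<^bsub>ogrp G\<^esub> \<in> carrier (mgrp G)" using one_ogrp by (simp add: carrier_mgrp category_Idt[OF cat_G])
  have "Idt G \<one>\<^bsub>ogrp G\<^esub> \<otimes>\<^bsub>mgrp G\<^esub> Idt G \<one>\<^bsub>ogrp G\<^esub> = Idt G \<one>\<^bsub>ogrp G\<^esub>" using Idt_mult[OF one_ogrp one_ogrp] by simp
  then show ?thesis using c by simp
qed

lemma Src_one: "Src G \<one>\<^bsub>mgrp G\<^esub> = \<one>\<^bsub>ogrp G\<^esub>" and Tgt_one: "Tgt G \<one>\<^bsub>mgrp G\<^esub> = \<one>\<^bsub>ogrp G\<^esub>"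
  using category_Src_Idt[OF cat_G one_ogrp] category_Tgt_Idt[OF cat_G one_ogrp] by (simp_all add: Idt_one)

lemma inv_Idt: "g \<in> Ob G \<Longrightarrow> inv\<^bsub>mgrp G\<^esub> (Idt G g) = Idt G (inv\<^bsub>ogrp G\<^esub> g)"
  using Idt_mult[of "inv\<^bsub>ogrp G\<^esub> g" g] H0.inv_closed[of g] H0.l_inv[of g]
  by (intro H1.inv_equality) (simp_all add: carrier_ogrp carrier_mgrp Idt_one category_Idt[OF cat_G])

lemma inv_Ob: "g \<in> Ob G \<Longrightarrow> inv\<^bsub>ogrp G\<^esub> g \<in> Ob G"
  using H0.inv_closed[of g] by (simp add: carrier_ogrp)

lemma lie_2alg_simps [simp]:
  "Ob (lie_2alg G) = pts LO" "Mor (lie_2alg G) = pts LM"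
  "Src (lie_2alg G) = S" "Tgt (lie_2alg G) = T" "Idt (lie_2alg G) = U"
  "Cmp (lie_2alg G) = Cmp (tangent_gpd G)"
  "objM (lie_2alg G) = LO" "morM (lie_2alg G) = LM"
  by (simp_all add: lie_2alg_def objM_def morM_def tspace_mfd_def)

lemma LO_TM: "B \<in> pts LO \<longleftrightarrow> B \<in> pts (TM (objM G)) \<and> fst B = \<one>\<^bsub>ogrp G\<^esub>"
  and LM_TM: "A \<in> pts LM \<longleftrightarrow> A \<in> pts (TM (morM G)) \<and> fst A = \<one>\<^bsub>mgrp G\<^esub>"
  using tspace_mfd_TM[of _ "objM G"] tspace_mfd_TM[of _ "morM G"] one_ogrp one_mgrp by simp_all

lemma pre_manifold_LO: "pre_manifold LO" and pre_manifold_LM: "pre_manifold LM"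
  by (intro pre_manifold_tspace_mfd objM_G morM_G; simp add: one_ogrp one_mgrp)+

lemma S_pts: "A \<in> pts LM \<Longrightarrow> S A \<in> pts LO" and T_pts: "A \<in> pts LM \<Longrightarrow> T A \<in> pts LO" and U_pts: "B \<in> pts LO \<Longrightarrow> U B \<in> pts LM"
  using tmap_map_pts[OF morM_G objM_G lie_groupoid_Src[OF lie_gpd], of A] tmap_map_pts[OF morM_G objM_G lie_groupoid_Tgt[OF lie_gpd], of A]
    tmap_map_pts[OF objM_G morM_G lie_groupoid_Idt[OF lie_gpd], of B] by (simp_all add: LO_TM LM_TM Src_one Tgt_one Idt_one)

lemma tlin_LO: "A \<in> pts LO \<Longrightarrow> B \<in> pts LO \<Longrightarrow> tlin a A b B \<in> pts LO"
  and tlin_LM: "A' \<in> pts LM \<Longrightarrow> B' \<in> pts LM \<Longrightarrow> tlin a A' b B' \<in> pts LM"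
  using tlin_pts[OF objM_G, of A B a b] tlin_pts[OF morM_G, of A' B' a b] by (simp_all add: LO_TM LM_TM)

lemma S_tlin: "A \<in> pts LM \<Longrightarrow> B \<in> pts LM \<Longrightarrow> S (tlin a A b B) = tlin a (S A) b (S B)"
  and T_tlin: "A \<in> pts LM \<Longrightarrow> B \<in> pts LM \<Longrightarrow> T (tlin a A b B) = tlin a (T A) b (T B)"
  and U_tlin: "C \<in> pts LO \<Longrightarrow> D \<in> pts LO \<Longrightarrow> U (tlin a C b D) = tlin a (U C) b (U D)"
  using tmap_tlin[OF morM_G objM_G smooth_mapD[OF lie_groupoid_Src[OF lie_gpd]], of A B a b]
    tmap_tlin[OF morM_G objM_G smooth_mapD[OF lie_groupoid_Tgt[OF lie_gpd]], of A B a b]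
    tmap_tlin[OF objM_G morM_G smooth_mapD[OF lie_groupoid_Idt[OF lie_gpd]], of C D a b] one_ogrp one_mgrp
  by (simp_all add: LO_TM LM_TM)

lemma SU: "B \<in> pts LO \<Longrightarrow> S (U B) = B" and TU: "B \<in> pts LO \<Longrightarrow> T (U B) = B"
proof -
  assume "B \<in> pts LO"
  then have B: "B \<in> pts (TM (objM G))" by (simp add: LO_TM)
  note idt = lie_groupoid_Idt[OF lie_gpd]
  show "S (U B) = B"
    using tmap_compose_map[OF objM_G morM_G objM_G idt lie_groupoid_Src[OF lie_gpd] B]
      tmap_cong_pts[OF objM_G objM_G smooth_map_id[OF objM_G] B, of "\<lambda>x. Src G (Idt G x)"] tmap_ident[OF objM_G B]
    by (simp add: category_Src_Idt[OF cat_G])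
  show "T (U B) = B"
    using tmap_compose_map[OF objM_G morM_G objM_G idt lie_groupoid_Tgt[OF lie_gpd] B]
      tmap_cong_pts[OF objM_G objM_G smooth_map_id[OF objM_G] B, of "\<lambda>x. Tgt G (Idt G x)"] tmap_ident[OF objM_G B]
    by (simp add: category_Tgt_Idt[OF cat_G])
qed

text \<open>Write \<open>(B, A) = (B, 1\<^sub>*S B) + (0, W)\<close> with \<open>W = A - 1\<^sub>*S B\<close>. As \<open>T W = 0\<close>, the second summand is
  \<open>(1\<^sub>*T W, W)\<close>. The composition of vectors over a fixed pair is linear, and the unit laws give the values
  \<open>B\<close> and \<open>W\<close> on the two summands.\<close>

lemma tangent_Cmp_unit:
  assumes B: "B \<in> pts LM" and A: "A \<in> pts LM" and BA: "S B = T A"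
  shows "Cmp (tangent_gpd G) B A = tlin 1 B 1 (tlin 1 A (-1) (U (S B)))"
proof -
  let ?MM = "prod_mfd (morM G) (morM G)" and ?e = "\<one>\<^bsub>mgrp G\<^esub>"
  let ?h = "Cmp_extension G (?e, ?e)" and ?p = "tpair (morM G) (morM G)"
  note MM = pre_manifold_prod[OF morM_G morM_G]
  define W where "W = tlin 1 A (-1) (U (S B))"
  define Z where "Z = tlin 0 B 0 B"
  have W: "W \<in> pts LM" unfolding W_def by (intro tlin_LM A U_pts S_pts B)
  have Z: "Z \<in> pts LM" unfolding Z_def by (intro tlin_LM B)
  have USB: "U (S B) \<in> pts LM" by (intro U_pts S_pts B)
  have UTW: "U (T W) = Z"
  proof -
    have "T W = tlin 1 (T A) (-1) (T A)" using BA 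
      unfolding W_def T_tlin[OF A USB] TU[OF S_pts[OF B]] by simp
    then have "U (T W) = tlin 1 (U (T A)) (-1) (U (T A))" by (simp add: U_tlin[OF T_pts[OF A] T_pts[OF A]])
    then show ?thesis
      using A B by (intro tvec_eqI_pointwise) (simp_all add: Z_def LM_TM Tgt_one Idt_one)
  qed
  have B1: "B = tlin 1 B 1 Z" and A1: "A = tlin 1 (U (S B)) 1 W"
    using A B by (auto intro!: tvec_eqI_pointwise simp: Z_def W_def LM_TM Src_one Idt_one)
  have tm: "V \<in> pts (TM (morM G))" "fst V = ?e" if "V \<in> pts LM" for V using that by (simp_all add: LM_TM)
  have ee: "(?e, ?e) \<in> composable G" by (simp add: composable_def one_mgrp Src_one Tgt_one)
  note h = Cmp_extension(1)[OF lie_gpd ee]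
  have cmp: "Cmp (tangent_gpd G) V V' = tmap ?MM (morM G) ?h (?p V V')" if "V \<in> pts LM" "V' \<in> pts LM" for V V'
    using tangent_Cmp[OF lie_gpd tm(1)[OF that(2)] tm(1)[OF that(1)]] tm(2)[OF that(1)] tm(2)[OF that(2)] by simp
  have p: "?p V V' \<in> pts (TM ?MM)" "fst (?p V V') = (?e, ?e)" if "V \<in> pts LM" "V' \<in> pts LM" for V V'
    using tpair[OF morM_G morM_G tm(1)[OF that(1)] tm(1)[OF that(2)]] tm(2)[OF that(1)] tm(2)[OF that(2)] by simp_all
  have "?p B A = ?p (tlin 1 B 1 Z) (tlin 1 (U (S B)) 1 W)" using B1 A1 by simp
  also have "\<dots> = tlin 1 (?p B (U (S B))) 1 (?p Z W)"
    using tm B Z USB W by (intro tpair_tlin[OF morM_G morM_G]) (simp_all add: Src_one Idt_one)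
  finally have "Cmp (tangent_gpd G) B A = tmap ?MM (morM G) ?h (tlin 1 (?p B (U (S B))) 1 (?p Z W))"
    by (simp add: cmp[OF B A])
  also have "\<dots> = tlin 1 (tmap ?MM (morM G) ?h (?p B (U (S B)))) 1 (tmap ?MM (morM G) ?h (?p Z W))"
    using p[OF B USB] p[OF Z W] h by (intro tmap_tlin[OF MM morM_G]) simp_all
  also have "\<dots> = tlin 1 (Cmp (tangent_gpd G) B (U (S B))) 1 (Cmp (tangent_gpd G) (U (T W)) W)"
    by (simp add: cmp[OF B USB] cmp[OF Z W] UTW)
  also have "Cmp (tangent_gpd G) B (U (S B)) = B"
  proof -
    note id = smooth_map_id[OF morM_G] and s = lie_groupoid_Src[OF lie_gpd] and i = lie_groupoid_Idt[OF lie_gpd]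
    note si = smooth_map_compose[OF morM_G objM_G morM_G s i]
    have "Cmp (tangent_gpd G) (tmap (morM G) (morM G) (\<lambda>x. x) B) (tmap (morM G) (morM G) (\<lambda>x. Idt G (Src G x)) B)
        = tmap (morM G) (morM G) (\<lambda>x. Cmp G x (Idt G (Src G x))) B"
      by (rule tangent_Cmp_pullback[OF lie_gpd morM_G tm(1)[OF B] id si]) (simp add: category_simps[OF cat_G])
    also have "\<dots> = tmap (morM G) (morM G) (\<lambda>x. x) B"
      by (rule tmap_cong_pts[OF morM_G morM_G id tm(1)[OF B], symmetric]) (simp add: category_simps[OF cat_G])
    finally show ?thesis using tmap_compose_map[OF morM_G objM_G morM_G s i tm(1)[OF B]] by (simp add: tmap_ident[OF morM_G tm(1)[OF B]])
  qed
  also have "Cmp (tangent_gpd G) (U (T W)) W = W"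
  proof -
    note id = smooth_map_id[OF morM_G] and s = lie_groupoid_Tgt[OF lie_gpd] and i = lie_groupoid_Idt[OF lie_gpd]
    note si = smooth_map_compose[OF morM_G objM_G morM_G s i]
    have "Cmp (tangent_gpd G) (tmap (morM G) (morM G) (\<lambda>x. Idt G (Tgt G x)) W) (tmap (morM G) (morM G) (\<lambda>x. x) W)
        = tmap (morM G) (morM G) (\<lambda>x. Cmp G (Idt G (Tgt G x)) x) W"
      by (rule tangent_Cmp_pullback[OF lie_gpd morM_G tm(1)[OF W] si id]) (simp add: category_simps[OF cat_G])
    also have "\<dots> = tmap (morM G) (morM G) (\<lambda>x. x) W"
      by (rule tmap_cong_pts[OF morM_G morM_G id tm(1)[OF W], symmetric]) (simp add: category_simps[OF cat_G])
    finally show ?thesis using tmap_compose_map[OF morM_G objM_G morM_G s i tm(1)[OF W]] by (simp add: tmap_ident[OF morM_G tm(1)[OF W]])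
  qed
  finally show ?thesis by (simp add: W_def)
qed

lemma fst_LO: "B \<in> pts LO \<Longrightarrow> fst B = \<one>\<^bsub>ogrp G\<^esub>" and fst_LM: "A \<in> pts LM \<Longrightarrow> fst A = \<one>\<^bsub>mgrp G\<^esub>"
  by (simp_all add: LO_TM LM_TM)

lemma Cmp_LM: "B \<in> pts LM \<Longrightarrow> A \<in> pts LM \<Longrightarrow> S B = T A \<Longrightarrow> Cmp (tangent_gpd G) B A \<in> pts LM"
  and S_Cmp: "B \<in> pts LM \<Longrightarrow> A \<in> pts LM \<Longrightarrow> S B = T A \<Longrightarrow> S (Cmp (tangent_gpd G) B A) = S A"
  and T_Cmp: "B \<in> pts LM \<Longrightarrow> A \<in> pts LM \<Longrightarrow> S B = T A \<Longrightarrow> T (Cmp (tangent_gpd G) B A) = T B"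
proof -
  assume B: "B \<in> pts LM" and A: "A \<in> pts LM" and BA: "S B = T A"
  note m = A B U_pts S_pts T_pts tlin_LM tlin_LO
  show "Cmp (tangent_gpd G) B A \<in> pts LM" using A B by (simp add: tangent_Cmp_unit[OF B A BA] m)
  have "S (Cmp (tangent_gpd G) B A) = tlin 1 (S B) 1 (tlin 1 (S A) (-1) (S B))"
    by (simp add: tangent_Cmp_unit[OF B A BA] m S_tlin SU)
  also have "\<dots> = S A" using fst_LO[OF S_pts[OF A]] fst_LO[OF S_pts[OF B]] by (intro tvec_eqI_pointwise) simp_all
  finally show "S (Cmp (tangent_gpd G) B A) = S A" .
  have "T (Cmp (tangent_gpd G) B A) = tlin 1 (T B) 1 (tlin 1 (T A) (-1) (S B))"
    by (simp add: tangent_Cmp_unit[OF B A BA] m T_tlin TU)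
  also have "\<dots> = T B" using fst_LO[OF T_pts[OF A]] fst_LO[OF T_pts[OF B]] BA by (intro tvec_eqI_pointwise) simp_all
  finally show "T (Cmp (tangent_gpd G) B A) = T B" .
qed

text \<open>With the linear formula for composition, the laws are identities between linear combinations.\<close>

lemma category_lie_2alg: "category (lie_2alg G)"
  unfolding category_def
proof (intro conjI ballI impI)
  fix f assume "f \<in> Mor (lie_2alg G)"
  then have f: "f \<in> pts LM" by simp
  have eq: "S f = T (U (S f))" "S (U (T f)) = T f" by (simp_all add: SU TU S_pts T_pts f)
  have "Cmp (tangent_gpd G) f (U (S f)) = tlin 1 f 1 (tlin 1 (U (S f)) (-1) (U (S f)))"
    by (rule tangent_Cmp_unit[OF f U_pts[OF S_pts[OF f]] eq(1)])
  also have "\<dots> = f" by (intro tvec_eqI_pointwise) simp_all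
  finally show "Cmp (lie_2alg G) f (Idt (lie_2alg G) (Src (lie_2alg G) f)) = f" by simp
  have "Cmp (tangent_gpd G) (U (T f)) f = tlin 1 (U (T f)) 1 (tlin 1 f (-1) (U (S (U (T f)))))"
    by (rule tangent_Cmp_unit[OF U_pts[OF T_pts[OF f]] f eq(2)])
  also have "\<dots> = f" using fst_LM[OF f] fst_LM[OF U_pts[OF T_pts[OF f]]] by (intro tvec_eqI_pointwise) (simp_all only: eq, simp_all)
  finally show "Cmp (lie_2alg G) (Idt (lie_2alg G) (Tgt (lie_2alg G) f)) f = f" by simp
  fix g h assume "g \<in> Mor (lie_2alg G)" "h \<in> Mor (lie_2alg G)" and gf: "Src (lie_2alg G) g = Tgt (lie_2alg G) f" and hg: "Src (lie_2alg G) h = Tgt (lie_2alg G) g"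
  then have g: "g \<in> pts LM" and h: "h \<in> pts LM" and gf: "S g = T f" and hg: "S h = T g" by simp_all
  note gf' = Cmp_LM[OF g f gf] and hg' = Cmp_LM[OF h g hg]
  have hgf: "S h = T (Cmp (tangent_gpd G) g f)" "S (Cmp (tangent_gpd G) h g) = T f"
    using T_Cmp[OF g f gf] S_Cmp[OF h g hg] gf hg by simp_all
  show "Cmp (lie_2alg G) h (Cmp (lie_2alg G) g f) = Cmp (lie_2alg G) (Cmp (lie_2alg G) h g) f"
    unfolding lie_2alg_simps tangent_Cmp_unit[OF h gf' hgf(1)] tangent_Cmp_unit[OF hg' f hgf(2)] S_Cmp[OF h g hg]
    unfolding tangent_Cmp_unit[OF g f gf] tangent_Cmp_unit[OF h g hg]
    by (intro tvec_eqI_pointwise) (simp_all add: fst_LM[OF g] fst_LM[OF h])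
qed (auto simp: S_pts T_pts U_pts SU TU Cmp_LM S_Cmp T_Cmp)

lemma groupoid_lie_2alg: "groupoid (lie_2alg G)"
  unfolding groupoid_def
proof (intro conjI ballI category_lie_2alg)
  fix f assume "f \<in> Mor (lie_2alg G)"
  then have f: "f \<in> pts LM" by simp
  \<comment> \<open>The solution of \<open>i + f - 1\<^sub>*T f = 1\<^sub>*S f\<close>.\<close>
  define i where "i = tlin 1 (U (S f)) 1 (tlin 1 (U (T f)) (-1) f)"
  note m = f U_pts S_pts T_pts tlin_LM tlin_LO
  have i: "i \<in> pts LM" by (simp add: i_def m)
  have Si: "S i = T f" and Ti: "T i = S f"
    by (simp_all add: i_def S_tlin T_tlin m SU TU)
     (auto intro!: tvec_eqI_pointwise simp: fst_LO m fst_LM[OF f] Src_one Tgt_one)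
  have "Cmp (tangent_gpd G) i f = U (S f)" "Cmp (tangent_gpd G) f i = U (T f)"
    by (simp_all only: tangent_Cmp_unit[OF i f Si] tangent_Cmp_unit[OF f i Ti[symmetric]] Si)
      (auto intro!: tvec_eqI_pointwise simp: i_def m fst_LM[OF f] Src_one Tgt_one Idt_one)
  then show "iso_mor (lie_2alg G) f"
    unfolding iso_mor_def inverse_mor_def using f i Si Ti by (intro exI[of _ i]) simp
qed

lemma smooth_map_S: "smooth_map LM LO S" and smooth_map_U: "smooth_map LO LM U"
  using smooth_map_tmap_tspace[OF morM_G objM_G smooth_mapD[OF lie_groupoid_Src[OF lie_gpd]], of "\<one>\<^bsub>mgrp G\<^esub>"]
    smooth_map_tmap_tspace[OF objM_G morM_G smooth_mapD[OF lie_groupoid_Idt[OF lie_gpd]], of "\<one>\<^bsub>ogrp G\<^esub>"]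
  by (simp_all add: one_ogrp one_mgrp Src_one Idt_one)

lemma smooth_map_Cmp_LM:
  assumes P: "pre_manifold P" and a: "smooth_map P LM a" and b: "smooth_map P LM b" and ab: "\<And>x. x \<in> pts P \<Longrightarrow> S (a x) = T (b x)"
  shows "smooth_map P LM (\<lambda>x. Cmp (tangent_gpd G) (a x) (b x))"
proof -
  have e: "\<one>\<^bsub>mgrp G\<^esub> \<in> pts (morM G)" using one_mgrp by simp
  note us = smooth_map_compose[OF P pre_manifold_LO pre_manifold_LM smooth_map_compose[OF P pre_manifold_LM pre_manifold_LO a smooth_map_S] smooth_map_U]
  have "smooth_map P LM (\<lambda>x. tlin 1 (a x) 1 (tlin 1 (b x) (-1) (U (S (a x)))))"
    by (intro smooth_map_tlin[OF P morM_G e] a b us)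
  then show ?thesis
    by (rule smooth_map_cong[OF P pre_manifold_LM])
      (simp add: tangent_Cmp_unit[OF smooth_map_pts[OF a] smooth_map_pts[OF b] ab])
qed

lemma Cmp_tlin:
  assumes B: "B \<in> pts LM" "B' \<in> pts LM" and A: "A \<in> pts LM" "A' \<in> pts LM" and BA: "S B = T A" "S B' = T A'"
  shows "Cmp (tangent_gpd G) (tlin a B b B') (tlin a A b A') = tlin a (Cmp (tangent_gpd G) B A) b (Cmp (tangent_gpd G) B' A')"
proof -
  have eq: "S (tlin a B b B') = T (tlin a A b A')" using BA by (simp add: S_tlin[OF B] T_tlin[OF A])
  show ?thesis
    unfolding tangent_Cmp_unit[OF tlin_LM[OF B] tlin_LM[OF A] eq] tangent_Cmp_unit[OF B(1) A(1) BA(1)] tangent_Cmp_unit[OF B(2) A(2) BA(2)]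
      S_tlin[OF B] U_tlin[OF S_pts[OF B(1)] S_pts[OF B(2)]]
    by (intro tvec_eqI_pointwise) (simp_all add: algebra_simps)
qed

abbreviation "AdO \<equiv> adj (objM G) (ogrp G)"
abbreviation "AdM \<equiv> adj (morM G) (mgrp G)"

lemma AdM_pts: "h \<in> Mor G \<Longrightarrow> A \<in> pts LM \<Longrightarrow> AdM h A \<in> pts LM"
  using adj_pts[OF lie_group_mgrp] by (simp add: carrier_mgrp)

lemma AdM_tlin: "h \<in> Mor G \<Longrightarrow> A \<in> pts LM \<Longrightarrow> B \<in> pts LM \<Longrightarrow> AdM h (tlin a A b B) = tlin a (AdM h A) b (AdM h B)"
  using adj_tlin[OF lie_group_mgrp] by (simp add: carrier_mgrp)

lemma U_AdO: "g \<in> Ob G \<Longrightarrow> B \<in> pts LO \<Longrightarrow> U (AdO g B) = AdM (Idt G g) (U B)"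
  and S_AdM: "h \<in> Mor G \<Longrightarrow> A \<in> pts LM \<Longrightarrow> S (AdM h A) = AdO (Src G h) (S A)"
  and T_AdM: "h \<in> Mor G \<Longrightarrow> A \<in> pts LM \<Longrightarrow> T (AdM h A) = AdO (Tgt G h) (T A)"
  using tmap_adj[OF lie_group_ogrp lie_group_mgrp lie_groupoid_Idt[OF lie_gpd], of g B]
    tmap_adj[OF lie_group_mgrp lie_group_ogrp lie_groupoid_Src[OF lie_gpd], of h A]
    tmap_adj[OF lie_group_mgrp lie_group_ogrp lie_groupoid_Tgt[OF lie_gpd], of h A]
  by (simp_all add: carrier_ogrp carrier_mgrp Idt_mult Src_mult Tgt_mult LO_TM LM_TM)

lemma AdM_Cmp:
  assumes g: "g \<in> Ob G" and B: "B \<in> pts LM" and A: "A \<in> pts LM" and BA: "S B = T A"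
  shows "AdM (Idt G g) (Cmp (tangent_gpd G) B A) = Cmp (tangent_gpd G) (AdM (Idt G g) B) (AdM (Idt G g) A)"
proof -
  have h: "Idt G g \<in> Mor G" "Src G (Idt G g) = g" "Tgt G (Idt G g) = g" using g by (simp_all add: category_simps[OF cat_G])
  have eq: "S (AdM (Idt G g) B) = T (AdM (Idt G g) A)" using BA by (simp add: S_AdM[OF h(1) B] T_AdM[OF h(1) A] h)
  note USB = U_pts[OF S_pts[OF B]]
  show ?thesis
    unfolding tangent_Cmp_unit[OF B A BA] tangent_Cmp_unit[OF AdM_pts[OF h(1) B] AdM_pts[OF h(1) A] eq]
    by (simp add: AdM_tlin[OF h(1)] A B USB tlin_LM S_AdM[OF h(1) B] U_AdO[OF g S_pts[OF B]] h)
qed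

end

section \<open>Connection forms\<close>

lemma fibrewise_linear_iff:
  "fibrewise_linear M \<phi> \<longleftrightarrow> (\<forall>u\<in>pts (TM M). \<forall>v\<in>pts (TM M). fst u = fst v \<longrightarrow>
     (\<forall>a b. \<phi> (tlin a u b v) = tlin a (\<phi> u) b (\<phi> v)))" (is "?L \<longleftrightarrow> ?R")
proof
  assume L: ?L
  show ?R
  proof (intro ballI impI allI)
    fix u v a b assume "u \<in> pts (TM M)" "v \<in> pts (TM M)" "fst u = fst v"
    then have "fst u \<in> pts M" "u \<in> {fst u} \<times> tspace M (fst u)" "v \<in> {fst u} \<times> tspace M (fst u)"
      by (auto simp: pts_TM mem_Times_iff)
    then show "\<phi> (tlin a u b v) = tlin a (\<phi> u) b (\<phi> v)"
      by (rule L[unfolded fibrewise_linear_def, rule_format])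
  qed
next
  assume R: ?R
  show ?L unfolding fibrewise_linear_def
  proof (intro ballI allI)
    fix p u v a b assume "p \<in> pts M" "u \<in> {p} \<times> tspace M p" "v \<in> {p} \<times> tspace M p"
    then have "u \<in> pts (TM M)" "v \<in> pts (TM M)" "fst u = fst v" by (auto simp: pts_TM)
    then show "\<phi> (tlin a u b v) = tlin a (\<phi> u) b (\<phi> v)" using R by blast
  qed
qed

lemma prod_gpd_category:
  assumes C: "category C" and D: "category D" shows "category (prod_gpd C D)"
  unfolding category_def
  by (auto simp: category_simps[OF C] category_simps[OF D] category_assoc[OF C] category_assoc[OF D])

lemma gauge_cat_simps [simp]:
  "Ob (gauge_cat G E X pr r) = gauge_ob G E pr r" "Mor (gauge_cat G E X pr r) = gauge_mor G E X pr r"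
  "Src (gauge_cat G E X pr r) t = ntr_src t" "Tgt (gauge_cat G E X pr r) t = ntr_tgt t"
  "Idt (gauge_cat G E X pr r) = ntr_id E E" "Cmp (gauge_cat G E X pr r) = vcomp E E"
  by (simp_all add: gauge_cat_def)

lemma conn_cat_simps [simp]:
  "Ob (conn_cat G E r Q) = Q" "t \<in> Mor (conn_cat G E r Q) \<longleftrightarrow> ntr_src t \<in> Q \<and> ntr_tgt t \<in> Q \<and> conn_mor G E r t"
  "Src (conn_cat G E r Q) t = ntr_src t" "Tgt (conn_cat G E r Q) t = ntr_tgt t"
  "Idt (conn_cat G E r Q) = ntr_id (tangent_gpd E) (lie_2alg G)" "Cmp (conn_cat G E r Q) = vcomp (tangent_gpd E) (lie_2alg G)"
  by (simp_all add: conn_cat_def)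

lemma gauge_grp_simps [simp]:
  "one (gauge_ogrp G E pr r) = fid E" "mult (gauge_ogrp G E pr r) F F' = fcomp_on E F' F"
  "one (gauge_mgrp G E X pr r) = ntr_id E E (fid E)" "mult (gauge_mgrp G E X pr r) t t' = hcomp E E t' t"
  by (simp_all add: gauge_ogrp_def gauge_mgrp_def)

context principal_2bundle_setting
begin

sublocale lie_2group_setting G by unfold_locales (rule lie_2group_G)

abbreviation "TE \<equiv> tangent_gpd E"
abbreviation "L \<equiv> lie_2alg G"
abbreviation "OE \<equiv> objM E"
abbreviation "ME \<equiv> morM E"

lemmas objM_E = lie_groupoid_objM[OF lie_groupoid_E] and morM_E = lie_groupoid_morM[OF lie_groupoid_E]
  and precat_TE = precategory_tangent_gpd[OF lie_groupoid_E]

lemma smooth_right_Ob: "g \<in> Ob G \<Longrightarrow> smooth_map OE OE (\<lambda>p. fst r (p, g))"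
  and smooth_orbit_Ob: "p \<in> Ob E \<Longrightarrow> smooth_map (objM G) OE (\<lambda>g. fst r (p, g))"
proof -
  have r: "smooth_map (prod_mfd OE (objM G)) OE (fst r)" using smooth_functor_objM[OF action] by simp
  note EG = pre_manifold_prod[OF objM_E objM_G]
  show "smooth_map OE OE (\<lambda>p. fst r (p, g))" if "g \<in> Ob G"
    using that by (intro smooth_map_compose[OF objM_E EG objM_E _ r] smooth_map_Pair objM_E objM_G smooth_map_id smooth_map_const) simp
  show "smooth_map (objM G) OE (\<lambda>g. fst r (p, g))" if "p \<in> Ob E"
    using that by (intro smooth_map_compose[OF objM_G EG objM_E _ r] smooth_map_Pair objM_E objM_G smooth_map_id smooth_map_const) simp
qed

lemma smooth_right_Mor: "h \<in> Mor G \<Longrightarrow> smooth_map ME ME (\<lambda>p. snd r (p, h))"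
  and smooth_orbit_Mor: "a \<in> Mor E \<Longrightarrow> smooth_map (morM G) ME (\<lambda>g. snd r (a, g))"
proof -
  have r: "smooth_map (prod_mfd ME (morM G)) ME (snd r)" using smooth_functor_morM[OF action] by simp
  note EG = pre_manifold_prod[OF morM_E morM_G]
  show "smooth_map ME ME (\<lambda>p. snd r (p, h))" if "h \<in> Mor G"
    using that by (intro smooth_map_compose[OF morM_E EG morM_E _ r] smooth_map_Pair morM_E morM_G smooth_map_id smooth_map_const) simp
  show "smooth_map (morM G) ME (\<lambda>g. snd r (a, g))" if "a \<in> Mor E"
    using that by (intro smooth_map_compose[OF morM_G EG morM_E _ r] smooth_map_Pair morM_E morM_G smooth_map_id smooth_map_const) simp
qed

abbreviation right_Ob :: "'g0 \<Rightarrow> ('e0, 'c) tvec \<Rightarrow> ('e0, 'c) tvec" where "right_Ob g \<equiv> tmap OE OE (\<lambda>p. fst r (p, g))"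
abbreviation right_Mor :: "'g1 \<Rightarrow> ('e1, 'd) tvec \<Rightarrow> ('e1, 'd) tvec" where "right_Mor h \<equiv> tmap ME ME (\<lambda>p. snd r (p, h))"

lemma equivariant_1form_iff:
  "equivariant_1form G E r \<omega> \<longleftrightarrow> is_functor TE L \<omega> \<and> smooth_map (TM OE) LO (fst \<omega>) \<and> smooth_map (TM ME) LM (snd \<omega>) \<and>
     functor_ext TE \<omega> \<and> fibrewise_linear OE (fst \<omega>) \<and> fibrewise_linear ME (snd \<omega>) \<and>
     (\<forall>v\<in>pts (TM OE). \<forall>g\<in>Ob G. fst \<omega> (right_Ob g v) = AdO (inv\<^bsub>ogrp G\<^esub> g) (fst \<omega> v)) \<and>
     (\<forall>v\<in>pts (TM ME). \<forall>h\<in>Mor G. snd \<omega> (right_Mor h v) = AdM (inv\<^bsub>mgrp G\<^esub> h) (snd \<omega> v))"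
  by (auto simp: equivariant_1form_def smooth_functor_def)

lemma equivariant_1formD:
  assumes "equivariant_1form G E r \<omega>"
  shows "is_functor TE L \<omega>" "smooth_map (TM OE) LO (fst \<omega>)" "smooth_map (TM ME) LM (snd \<omega>)" "functor_ext TE \<omega>"
    "u \<in> pts (TM OE) \<Longrightarrow> v \<in> pts (TM OE) \<Longrightarrow> fst u = fst v \<Longrightarrow> fst \<omega> (tlin a u b v) = tlin a (fst \<omega> u) b (fst \<omega> v)"
    "u' \<in> pts (TM ME) \<Longrightarrow> v' \<in> pts (TM ME) \<Longrightarrow> fst u' = fst v' \<Longrightarrow> snd \<omega> (tlin a u' b v') = tlin a (snd \<omega> u') b (snd \<omega> v')"
    "v \<in> pts (TM OE) \<Longrightarrow> g \<in> Ob G \<Longrightarrow> fst \<omega> (right_Ob g v) = AdO (inv\<^bsub>ogrp G\<^esub> g) (fst \<omega> v)"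
    "v' \<in> pts (TM ME) \<Longrightarrow> h \<in> Mor G \<Longrightarrow> snd \<omega> (right_Mor h v') = AdM (inv\<^bsub>mgrp G\<^esub> h) (snd \<omega> v')"
  using assms unfolding equivariant_1form_iff fibrewise_linear_iff by auto

lemma conn_mor_iff:
  "conn_mor G E r t \<longleftrightarrow> is_ntr TE L t \<and> smooth_map (TM OE) LM (ntr_map t) \<and> ntr_map t \<in> extensional (pts (TM OE)) \<and>
     fibrewise_linear OE (ntr_map t) \<and>
     (\<forall>v\<in>pts (TM OE). \<forall>g\<in>Ob G. ntr_map t (right_Ob g v) = AdM (inv\<^bsub>mgrp G\<^esub> (Idt G g)) (ntr_map t v))"
  by (auto simp: conn_mor_def smooth_nat_iso_def nat_iso_groupoid[OF groupoid_lie_2alg] is_ntr_def)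

lemma conn_morD:
  assumes "conn_mor G E r t"
  shows "is_ntr TE L t" "smooth_map (TM OE) LM (ntr_map t)" "ntr_map t \<in> extensional (pts (TM OE))"
    "u \<in> pts (TM OE) \<Longrightarrow> v \<in> pts (TM OE) \<Longrightarrow> fst u = fst v \<Longrightarrow> ntr_map t (tlin a u b v) = tlin a (ntr_map t u) b (ntr_map t v)"
    "v \<in> pts (TM OE) \<Longrightarrow> g \<in> Ob G \<Longrightarrow> ntr_map t (right_Ob g v) = AdM (inv\<^bsub>mgrp G\<^esub> (Idt G g)) (ntr_map t v)"
  using assms unfolding conn_mor_iff fibrewise_linear_iff by auto

lemma right_Ob_pts: "g \<in> Ob G \<Longrightarrow> v \<in> pts (TM OE) \<Longrightarrow> right_Ob g v \<in> pts (TM OE)"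
  by (rule tmap_map_pts[OF objM_E objM_E smooth_right_Ob])

lemma AdM_inv_Idt_Cmp:
  assumes "g \<in> Ob G" "B \<in> pts LM" "A \<in> pts LM" "S B = T A"
  shows "AdM (inv\<^bsub>mgrp G\<^esub> (Idt G g)) (Cmp (tangent_gpd G) B A)
    = Cmp (tangent_gpd G) (AdM (inv\<^bsub>mgrp G\<^esub> (Idt G g)) B) (AdM (inv\<^bsub>mgrp G\<^esub> (Idt G g)) A)"
  using AdM_Cmp[OF inv_Ob[OF assms(1)] assms(2-4)] by (simp add: inv_Idt[OF assms(1)])

lemma ntr_L:
  assumes "is_ntr C L t" "x \<in> Ob C"
  shows "ntr_map t x \<in> pts LM" "S (ntr_map t x) = fst (ntr_src t) x" "T (ntr_map t x) = fst (ntr_tgt t) x"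
  using ntr_Mor[OF assms] ntr_Src[OF assms] ntr_Tgt[OF assms] by simp_all

lemma conn_mor_id:
  assumes \<omega>: "equivariant_1form G E r \<omega>" shows "conn_mor G E r (ntr_id TE L \<omega>)"
proof -
  note w = equivariant_1formD[OF \<omega>]
  have wO: "fst \<omega> v \<in> pts LO" if "v \<in> pts (TM OE)" for v using smooth_map_pts[OF w(2) that] .
  have "smooth_map (TM OE) LM (ntr_map (ntr_id TE L \<omega>))"
    by (rule smooth_map_cong[OF pre_manifold_TM[OF objM_E] pre_manifold_LM
        smooth_map_compose[OF pre_manifold_TM[OF objM_E] pre_manifold_LO pre_manifold_LM w(2) smooth_map_U]]) simp
  moreover have "fibrewise_linear OE (ntr_map (ntr_id TE L \<omega>))"
    unfolding fibrewise_linear_iff using wO by (simp add: tlin_pts[OF objM_E] w(5) U_tlin)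
  moreover have "ntr_map (ntr_id TE L \<omega>) (right_Ob g v) = AdM (inv\<^bsub>mgrp G\<^esub> (Idt G g)) (ntr_map (ntr_id TE L \<omega>) v)"
    if "v \<in> pts (TM OE)" "g \<in> Ob G" for v g
    using that wO by (simp add: right_Ob_pts w(7) U_AdO inv_Ob inv_Idt)
  ultimately show ?thesis
    unfolding conn_mor_iff using is_ntr_id[OF precat_TE category_lie_2alg w(1)] by simp
qed

lemma conn_mor_vcomp:
  assumes s: "conn_mor G E r s" and t: "conn_mor G E r t" and st: "ntr_tgt s = ntr_src t"
  shows "conn_mor G E r (vcomp TE L t s)"
proof -
  note s' = conn_morD[OF s] and t' = conn_morD[OF t]
  have ts: "ntr_map t v \<in> pts LM" "ntr_map s v \<in> pts LM" "S (ntr_map t v) = T (ntr_map s v)" if "v \<in> pts (TM OE)" for v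
    using ntr_L[OF s'(1), of v] ntr_L[OF t'(1), of v] that st by simp_all
  have "smooth_map (TM OE) LM (ntr_map (vcomp TE L t s))"
    by (rule smooth_map_cong[OF pre_manifold_TM[OF objM_E] pre_manifold_LM
        smooth_map_Cmp_LM[OF pre_manifold_TM[OF objM_E] t'(2) s'(2) ts(3)]]) simp_all
  moreover have "fibrewise_linear OE (ntr_map (vcomp TE L t s))"
    unfolding fibrewise_linear_iff by (simp add: tlin_pts[OF objM_E] s'(4) t'(4) Cmp_tlin ts)
  moreover have "ntr_map (vcomp TE L t s) (right_Ob g v) = AdM (inv\<^bsub>mgrp G\<^esub> (Idt G g)) (ntr_map (vcomp TE L t s) v)"
    if "v \<in> pts (TM OE)" "g \<in> Ob G" for v g
    using that ts by (simp add: right_Ob_pts s'(5) t'(5) AdM_inv_Idt_Cmp)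
  ultimately show ?thesis
    unfolding conn_mor_iff using is_ntr_vcomp[OF precat_TE category_lie_2alg s'(1) t'(1) st] by simp
qed

lemma category_conn_cat:
  assumes Q: "\<And>\<omega>. \<omega> \<in> Q \<Longrightarrow> equivariant_1form G E r \<omega>"
  shows "category (conn_cat G E r Q)" (is "category ?D")
  unfolding category_def
proof (intro conjI ballI impI)
  fix f assume f: "f \<in> Mor ?D"
  then have f': "is_ntr TE L f" "ntr_map f \<in> extensional (Ob TE)" using conn_morD(1,3) by simp_all
  show "Cmp ?D f (Idt ?D (Src ?D f)) = f" "Cmp ?D (Idt ?D (Tgt ?D f)) f = f"
    using vcomp_id_right[OF category_lie_2alg f' refl] vcomp_id_left[OF category_lie_2alg f' refl] by simp_all
  fix g h assume "g \<in> Mor ?D" "h \<in> Mor ?D" "Src ?D g = Tgt ?D f" "Src ?D h = Tgt ?D g"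
  then show "Cmp ?D h (Cmp ?D g f) = Cmp ?D (Cmp ?D h g) f"
    using vcomp_assoc[OF category_lie_2alg f'(1), of g h] conn_morD(1) by simp
qed (use Q in \<open>simp_all add: conn_mor_id conn_mor_vcomp\<close>)

section \<open>Pulling back connection forms along gauge transformations\<close>

lemma gauge_ob_smooth: "F \<in> gauge_ob G E pr r \<Longrightarrow> smooth_map OE OE (fst F)" "F \<in> gauge_ob G E pr r \<Longrightarrow> smooth_map ME ME (snd F)"
  using gauge_obD(2) smooth_functor_objM smooth_functor_morM by blast+

lemma gauge_right_Ob:
  assumes F: "F \<in> gauge_ob G E pr r" and g: "g \<in> Ob G" and v: "v \<in> pts (TM OE)"
  shows "tmap OE OE (fst F) (right_Ob g v) = right_Ob g (tmap OE OE (fst F) v)"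
proof -
  note f = gauge_ob_smooth(1)[OF F] and rg = smooth_right_Ob[OF g]
  have "tmap OE OE (fst F) (right_Ob g v) = tmap OE OE (\<lambda>p. fst F (fst r (p, g))) v"
    by (rule tmap_compose_map[OF objM_E objM_E objM_E rg f v])
  also have "\<dots> = tmap OE OE (\<lambda>p. fst r (fst F p, g)) v"
    by (rule tmap_cong_pts[OF objM_E objM_E smooth_map_compose[OF objM_E objM_E objM_E rg f] v]) (simp add: gauge_obD(5)[OF F _ g])
  also have "\<dots> = right_Ob g (tmap OE OE (fst F) v)"
    by (rule tmap_compose_map[OF objM_E objM_E objM_E f rg v, symmetric])
  finally show ?thesis .
qed

lemma gauge_right_Mor:
  assumes F: "F \<in> gauge_ob G E pr r" and g: "g \<in> Mor G" and v: "v \<in> pts (TM ME)"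
  shows "tmap ME ME (snd F) (right_Mor g v) = right_Mor g (tmap ME ME (snd F) v)"
proof -
  note f = gauge_ob_smooth(2)[OF F] and rg = smooth_right_Mor[OF g]
  have "tmap ME ME (snd F) (right_Mor g v) = tmap ME ME (\<lambda>p. snd F (snd r (p, g))) v"
    by (rule tmap_compose_map[OF morM_E morM_E morM_E rg f v])
  also have "\<dots> = tmap ME ME (\<lambda>p. snd r (snd F p, g)) v"
    by (rule tmap_cong_pts[OF morM_E morM_E smooth_map_compose[OF morM_E morM_E morM_E rg f] v]) (simp add: gauge_obD(6)[OF F _ g])
  also have "\<dots> = right_Mor g (tmap ME ME (snd F) v)"
    by (rule tmap_compose_map[OF morM_E morM_E morM_E f rg v, symmetric])
  finally show ?thesis .
qed

text \<open>Differentiating \<open>\<Psi>(pg) = \<Psi>(p) 1\<^sub>g\<close>.\<close>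

lemma gauge_mor_right:
  assumes s: "s \<in> gauge_mor G E X pr r" and g: "g \<in> Ob G" and v: "v \<in> pts (TM OE)"
  shows "tmap OE ME (ntr_map s) (right_Ob g v) = right_Mor (Idt G g) (tmap OE ME (ntr_map s) v)"
proof -
  note f = smooth_ntrD(4)[OF gauge_morD(3)[OF s]] and rg = smooth_right_Ob[OF g]
  have h: "Idt G g \<in> Mor G" using g by (rule category_Idt[OF category_G])
  have "tmap OE ME (ntr_map s) (right_Ob g v) = tmap OE ME (\<lambda>p. ntr_map s (fst r (p, g))) v"
    by (rule tmap_compose_map[OF objM_E objM_E morM_E rg f v])
  also have "\<dots> = tmap OE ME (\<lambda>p. snd r (ntr_map s p, Idt G g)) v"
    by (rule tmap_cong_pts[OF objM_E morM_E smooth_map_compose[OF objM_E objM_E morM_E rg f] v]) (simp add: gauge_morD(6)[OF s _ g])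
  also have "\<dots> = right_Mor (Idt G g) (tmap OE ME (ntr_map s) v)"
    by (rule tmap_compose_map[OF objM_E morM_E morM_E f smooth_right_Mor[OF h] v, symmetric])
  finally show ?thesis .
qed

text \<open>The form \<open>\<omega> \<circ> F\<^sub>*\<close>; a gauge transformation acts by the pullback along its inverse.\<close>

definition pullback_form where "pullback_form F \<omega> = fcomp_on TE \<omega> (tangent_functor E E F)"

lemma pullback_form_simps [simp]:
  "v \<in> pts (TM OE) \<Longrightarrow> fst (pullback_form F \<omega>) v = fst \<omega> (tmap OE OE (fst F) v)"
  "w \<in> pts (TM ME) \<Longrightarrow> snd (pullback_form F \<omega>) w = snd \<omega> (tmap ME ME (snd F) w)"
  by (simp_all add: pullback_form_def)

lemma equivariant_pullback_form:
  assumes F: "F \<in> gauge_ob G E pr r" and \<omega>: "equivariant_1form G E r \<omega>"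
  shows "equivariant_1form G E r (pullback_form F \<omega>)"
proof -
  note w = equivariant_1formD[OF \<omega>] and f = gauge_ob_smooth[OF F]
  note TO = pre_manifold_TM[OF objM_E] and TM = pre_manifold_TM[OF morM_E]
  note fO = tmap_map_pts[OF objM_E objM_E f(1)] and fM = tmap_map_pts[OF morM_E morM_E f(2)]
  have "is_functor TE L (pullback_form F \<omega>)"
    unfolding pullback_form_def
    by (rule is_functor_fcomp_on[OF precat_TE is_functor_tangent_functor[OF lie_groupoid_E lie_groupoid_E gauge_obD(2)[OF F]] w(1)])
  moreover have "smooth_map (TM OE) LO (fst (pullback_form F \<omega>))"
    by (rule smooth_map_cong[OF TO pre_manifold_LO smooth_map_compose[OF TO TO pre_manifold_LO smooth_map_tmap[OF objM_E objM_E f(1)] w(2)]]) simp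
  moreover have "smooth_map (TM ME) LM (snd (pullback_form F \<omega>))"
    by (rule smooth_map_cong[OF TM pre_manifold_LM smooth_map_compose[OF TM TM pre_manifold_LM smooth_map_tmap[OF morM_E morM_E f(2)] w(3)]]) simp
  moreover have "fibrewise_linear OE (fst (pullback_form F \<omega>))" "fibrewise_linear ME (snd (pullback_form F \<omega>))"
  proof -
    have "smooth_at OE OE (fst F) (fst u)" if "u \<in> pts (TM OE)" for u
      using smooth_mapD[OF f(1), of "fst u"] that by (simp add: pts_TM)
    then show "fibrewise_linear OE (fst (pullback_form F \<omega>))"
      unfolding fibrewise_linear_iff by (simp add: tlin_pts[OF objM_E] tmap_tlin[OF objM_E objM_E] w(5) fO)
    have "smooth_at ME ME (snd F) (fst u)" if "u \<in> pts (TM ME)" for u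
      using smooth_mapD[OF f(2), of "fst u"] that by (simp add: pts_TM)
    then show "fibrewise_linear ME (snd (pullback_form F \<omega>))"
      unfolding fibrewise_linear_iff by (simp add: tlin_pts[OF morM_E] tmap_tlin[OF morM_E morM_E] w(6) fM)
  qed
  moreover have "fst (pullback_form F \<omega>) (right_Ob g v) = AdO (inv\<^bsub>ogrp G\<^esub> g) (fst (pullback_form F \<omega>) v)"
    if "v \<in> pts (TM OE)" "g \<in> Ob G" for v g
    using that by (simp add: right_Ob_pts gauge_right_Ob[OF F] w(7) fO)
  moreover have "snd (pullback_form F \<omega>) (right_Mor h v) = AdM (inv\<^bsub>mgrp G\<^esub> h) (snd (pullback_form F \<omega>) v)"
    if "v \<in> pts (TM ME)" "h \<in> Mor G" for v h
    using that by (simp add: tmap_map_pts[OF morM_E morM_E smooth_right_Mor] gauge_right_Mor[OF F] w(8) fM)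
  ultimately show ?thesis unfolding equivariant_1form_iff by (simp add: pullback_form_def)
qed

abbreviation "EL \<equiv> prod_gpd E L"
abbreviation "\<delta> \<equiv> fund_functor G E r"

lemma category_EL: "category EL"
  by (rule prod_gpd_category[OF category_E category_lie_2alg])

lemma fund_Ob_pts: "p \<in> Ob E \<Longrightarrow> B \<in> pts LO \<Longrightarrow> fst \<delta> (p, B) \<in> pts (TM OE)"
  and fund_Mor_pts: "a \<in> Mor E \<Longrightarrow> A \<in> pts LM \<Longrightarrow> snd \<delta> (a, A) \<in> pts (TM ME)"
  using tmap_map_pts[OF objM_G objM_E smooth_orbit_Ob, of p B] tmap_map_pts[OF morM_G morM_E smooth_orbit_Mor, of a A]
  by (simp_all add: fund_functor_def LO_TM LM_TM)

lemma gauge_fund_Ob: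
  assumes F: "F \<in> gauge_ob G E pr r" and p: "p \<in> Ob E" and B: "B \<in> pts LO"
  shows "tmap OE OE (fst F) (fst \<delta> (p, B)) = fst \<delta> (fst F p, B)"
proof -
  have B': "B \<in> pts (TM (objM G))" using B by (simp add: LO_TM)
  note rp = smooth_orbit_Ob[OF p] and f = gauge_ob_smooth(1)[OF F]
  have "tmap OE OE (fst F) (tmap (objM G) OE (\<lambda>g. fst r (p, g)) B) = tmap (objM G) OE (\<lambda>g. fst F (fst r (p, g))) B"
    by (rule tmap_compose_map[OF objM_G objM_E objM_E rp f B'])
  also have "\<dots> = tmap (objM G) OE (\<lambda>g. fst r (fst F p, g)) B"
    by (rule tmap_cong_pts[OF objM_G objM_E smooth_map_compose[OF objM_G objM_E objM_E rp f] B']) (simp add: gauge_obD(5)[OF F p])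
  finally show ?thesis by (simp add: fund_functor_def)
qed

lemma gauge_fund_Mor:
  assumes F: "F \<in> gauge_ob G E pr r" and a: "a \<in> Mor E" and A: "A \<in> pts LM"
  shows "tmap ME ME (snd F) (snd \<delta> (a, A)) = snd \<delta> (snd F a, A)"
proof -
  have A': "A \<in> pts (TM (morM G))" using A by (simp add: LM_TM)
  note ra = smooth_orbit_Mor[OF a] and f = gauge_ob_smooth(2)[OF F]
  have "tmap ME ME (snd F) (tmap (morM G) ME (\<lambda>g. snd r (a, g)) A) = tmap (morM G) ME (\<lambda>g. snd F (snd r (a, g))) A"
    by (rule tmap_compose_map[OF morM_G morM_E morM_E ra f A'])
  also have "\<dots> = tmap (morM G) ME (\<lambda>g. snd r (snd F a, g)) A"
    by (rule tmap_cong_pts[OF morM_G morM_E smooth_map_compose[OF morM_G morM_E morM_E ra f] A']) (simp add: gauge_obD(6)[OF F a])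
  finally show ?thesis by (simp add: fund_functor_def)
qed

text \<open>Equivariance of \<open>F\<close> gives \<open>F\<^sub>* \<delta>\<^sub>p(B) = \<delta>\<^bsub>F p\<^esub>(B)\<close>, so pulling back \<open>\<omega>\<close> along \<open>F\<close>
  pulls back \<open>\<omega> \<circ> \<delta>\<close> along \<open>F \<times> id\<close>.\<close>

lemma pullback_form_fund:
  assumes F: "F \<in> gauge_ob G E pr r"
  shows "fcomp_on EL (pullback_form F \<omega>) \<delta> = fcomp_on EL (fcomp_on EL \<omega> \<delta>) (\<lambda>(p, B). (fst F p, B), \<lambda>(a, A). (snd F a, A))"
proof (rule functor_eqI[of EL])
  note f = gauge_obD(3)[OF F]
  fix x assume "x \<in> Ob EL"
  then show "fst (fcomp_on EL (pullback_form F \<omega>) \<delta>) x = fst (fcomp_on EL (fcomp_on EL \<omega> \<delta>) (\<lambda>(p, B). (fst F p, B), \<lambda>(a, A). (snd F a, A))) x"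
    by (cases x) (simp add: fund_Ob_pts gauge_fund_Ob[OF F] functor_Ob[OF f])
next
  note f = gauge_obD(3)[OF F]
  fix x assume "x \<in> Mor EL"
  then show "snd (fcomp_on EL (pullback_form F \<omega>) \<delta>) x = snd (fcomp_on EL (fcomp_on EL \<omega> \<delta>) (\<lambda>(p, B). (fst F p, B), \<lambda>(a, A). (snd F a, A))) x"
    by (cases x) (simp add: fund_Mor_pts gauge_fund_Mor[OF F] functor_Mor[OF f])
qed simp_all

lemma strict_pullback_form:
  assumes F: "F \<in> gauge_ob G E pr r" and \<omega>: "strict_connection G E r \<omega>"
  shows "strict_connection G E r (pullback_form F \<omega>)"
proof -
  have e: "equivariant_1form G E r \<omega>" and
    s: "fcomp_on EL \<omega> \<delta> = (restrict snd (Ob EL), restrict snd (Mor EL))" using \<omega> by (auto simp: strict_connection_def)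
  note f = gauge_obD(3)[OF F]
  have ext: "functor_ext EL (restrict snd (Ob EL), restrict snd (Mor EL))" by (simp add: functor_ext_def)
  have "fcomp_on EL (pullback_form F \<omega>) \<delta> = (restrict snd (Ob EL), restrict snd (Mor EL))"
    unfolding pullback_form_fund[OF F] s
  proof (rule functor_eqI[of EL])
    fix x assume "x \<in> Ob EL"
    then show "fst (fcomp_on EL (restrict snd (Ob EL), restrict snd (Mor EL)) (\<lambda>(p, B). (fst F p, B), \<lambda>(a, A). (snd F a, A))) x
       = fst (restrict snd (Ob EL), restrict snd (Mor EL)) x"
      by (cases x) (simp add: functor_Ob[OF f])
  next
    fix x assume "x \<in> Mor EL"
    then show "snd (fcomp_on EL (restrict snd (Ob EL), restrict snd (Mor EL)) (\<lambda>(p, B). (fst F p, B), \<lambda>(a, A). (snd F a, A))) x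
       = snd (restrict snd (Ob EL), restrict snd (Mor EL)) x"
      by (cases x) (simp add: functor_Mor[OF f])
  qed (rule functor_ext_fcomp_on ext)+
  then show ?thesis using equivariant_pullback_form[OF F e] by (simp add: strict_connection_def)
qed

lemma is_functor_gauge_prod:
  assumes F: "F \<in> gauge_ob G E pr r"
  shows "is_functor EL EL (\<lambda>(p, B). (fst F p, B), \<lambda>(a, A). (snd F a, A))"
proof -
  note f = gauge_obD(3)[OF F]
  show ?thesis
    by (rule is_functorI)
      (auto simp: functor_Ob[OF f] functor_Mor[OF f] functor_Src[OF f] functor_Tgt[OF f] functor_Idt[OF f] functor_Cmp[OF f])
qed

lemma semi_strict_iff:
  "semi_strict_connection G E r \<omega> \<longleftrightarrow> equivariant_1form G E r \<omega> \<and>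
     (\<exists>\<kappa>. is_ntr EL L (fcomp_on EL \<omega> \<delta>, \<kappa>, (snd, snd)) \<and> smooth_map (prod_mfd OE LO) LM \<kappa> \<and>
        (\<forall>p\<in>Ob E. \<forall>A\<in>pts LO. \<forall>B\<in>pts LO. \<forall>a b. \<kappa> (p, tlin a A b B) = tlin a (\<kappa> (p, A)) b (\<kappa> (p, B))) \<and>
        (\<forall>p\<in>Ob E. \<forall>g\<in>Ob G. \<forall>B\<in>pts LO. \<kappa> (fst r (p, g), AdO (inv\<^bsub>ogrp G\<^esub> g) B) = AdM (inv\<^bsub>mgrp G\<^esub> (Idt G g)) (\<kappa> (p, B))))"
  by (simp add: semi_strict_connection_def smooth_nat_iso_def nat_iso_groupoid[OF groupoid_lie_2alg] is_ntr_def)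

text \<open>The isomorphism \<open>\<kappa>\<close> is pulled back along \<open>F \<times> id\<close>.\<close>

lemma semi_strict_pullback_form:
  assumes F: "F \<in> gauge_ob G E pr r" and \<omega>: "semi_strict_connection G E r \<omega>"
  shows "semi_strict_connection G E r (pullback_form F \<omega>)"
proof -
  obtain \<kappa> where e: "equivariant_1form G E r \<omega>" and k: "is_ntr EL L (fcomp_on EL \<omega> \<delta>, \<kappa>, (snd, snd))" "smooth_map (prod_mfd OE LO) LM \<kappa>"
    "\<And>p A B a b. p \<in> Ob E \<Longrightarrow> A \<in> pts LO \<Longrightarrow> B \<in> pts LO \<Longrightarrow> \<kappa> (p, tlin a A b B) = tlin a (\<kappa> (p, A)) b (\<kappa> (p, B))"
    "\<And>p g B. p \<in> Ob E \<Longrightarrow> g \<in> Ob G \<Longrightarrow> B \<in> pts LO \<Longrightarrow> \<kappa> (fst r (p, g), AdO (inv\<^bsub>ogrp G\<^esub> g) B) = AdM (inv\<^bsub>mgrp G\<^esub> (Idt G g)) (\<kappa> (p, B))"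
    using \<omega> unfolding semi_strict_iff by blast
  let ?\<kappa> = "\<lambda>(p, B). \<kappa> (fst F p, B)"
  let ?t = "(fcomp_on EL (fcomp_on EL \<omega> \<delta>) (\<lambda>(p, B). (fst F p, B), \<lambda>(a, A). (snd F a, A)), \<lambda>(p, B). \<kappa> (fst F p, B), (snd, snd))"
  note f = gauge_obD(3)[OF F] and EO = pre_manifold_prod[OF objM_E pre_manifold_LO]
  have "smooth_map (prod_mfd OE LO) LM (\<lambda>z. \<kappa> (fst F (fst z), snd z))"
    by (rule smooth_map_compose[OF EO EO pre_manifold_LM smooth_map_Pair[OF EO objM_E pre_manifold_LO
      smooth_map_compose[OF EO objM_E objM_E smooth_map_fst[OF objM_E pre_manifold_LO] gauge_ob_smooth(1)[OF F]]
      smooth_map_snd[OF objM_E pre_manifold_LO]] k(2)])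
  then have "smooth_map (prod_mfd OE LO) LM ?\<kappa>" by (simp add: case_prod_unfold)
  moreover have "is_ntr EL L (fcomp_on EL (pullback_form F \<omega>) \<delta>, ?\<kappa>, (snd, snd))"
    unfolding pullback_form_fund[OF F]
  proof (rule is_ntrI)
    show "is_functor EL L (ntr_src ?t)"
      using is_functor_fcomp_on[OF category_precategory[OF category_EL] is_functor_gauge_prod[OF F] ntr_functor_src[OF k(1)]] by simp
    show "is_functor EL L (ntr_tgt ?t)"
      using ntr_functor_tgt[OF k(1)] by simp
  next
    fix x assume x: "x \<in> Ob EL"
    then obtain p B where pB: "x = (p, B)" "(fst F p, B) \<in> Ob EL" by (cases x) (simp add: functor_Ob[OF f])
    note kk = ntr_Mor[OF k(1) pB(2)] ntr_Src[OF k(1) pB(2)] ntr_Tgt[OF k(1) pB(2)]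
    show "ntr_map ?t x \<in> Mor L"
      "Src L (ntr_map ?t x) =
        fst (ntr_src ?t) x"
      "Tgt L (ntr_map ?t x) =
        fst (ntr_tgt ?t) x"
      using kk x pB by simp_all
  next
    fix y assume y: "y \<in> Mor EL"
    then obtain a A where aA: "y = (a, A)" "a \<in> Mor E" "A \<in> pts LM" "(snd F a, A) \<in> Mor EL" by (cases y) (simp add: functor_Mor[OF f])
    from ntr_natural[OF k(1) aA(4)]
    show "Cmp L (ntr_map ?t (Tgt EL y))
         (snd (ntr_src ?t) y) =
        Cmp L (snd (ntr_tgt ?t) y)
         (ntr_map ?t (Src EL y))"
      using y aA by (simp add: functor_Src[OF f] functor_Tgt[OF f])
  qed
  moreover have "\<forall>p\<in>Ob E. \<forall>A\<in>pts LO. \<forall>B\<in>pts LO. \<forall>a b. ?\<kappa> (p, tlin a A b B) = tlin a (?\<kappa> (p, A)) b (?\<kappa> (p, B))"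
    using k(3) functor_Ob[OF f] by simp
  moreover have "\<forall>p\<in>Ob E. \<forall>g\<in>Ob G. \<forall>B\<in>pts LO. ?\<kappa> (fst r (p, g), AdO (inv\<^bsub>ogrp G\<^esub> g) B) = AdM (inv\<^bsub>mgrp G\<^esub> (Idt G g)) (?\<kappa> (p, B))"
    using k(4) functor_Ob[OF f] gauge_obD(5)[OF F] by simp
  ultimately show ?thesis unfolding semi_strict_iff using equivariant_pullback_form[OF F e] by blast
qed

text \<open>The isomorphism \<open>\<kappa>\<close> is the identity transformation.\<close>

lemma strict_imp_semi_strict:
  assumes \<omega>: "strict_connection G E r \<omega>" shows "semi_strict_connection G E r \<omega>"
proof -
  have e: "equivariant_1form G E r \<omega>" and
    s: "fcomp_on EL \<omega> \<delta> = (restrict snd (Ob EL), restrict snd (Mor EL))" using \<omega> by (auto simp: strict_connection_def)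
  let ?\<kappa> = "\<lambda>(p, B). U B"
  have f: "is_functor EL L (snd, snd)"
    by (rule is_functorI) auto
  have "is_functor EL L (restrict snd (Ob EL), restrict snd (Mor EL))"
    by (rule is_functor_cong[OF category_precategory[OF category_EL] f]) auto
  then have "is_ntr EL L (fcomp_on EL \<omega> \<delta>, ?\<kappa>, (snd, snd))"
    unfolding s using f
    by (intro is_ntrI) (auto simp: U_pts SU TU S_pts T_pts category_Idt_left[OF category_lie_2alg, simplified] category_Idt_right[OF category_lie_2alg, simplified])
  moreover have "smooth_map (prod_mfd OE LO) LM ?\<kappa>"
    using smooth_map_compose[OF pre_manifold_prod[OF objM_E pre_manifold_LO] pre_manifold_LO pre_manifold_LM smooth_map_snd[OF objM_E pre_manifold_LO] smooth_map_U]
    by (simp add: case_prod_unfold)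
  ultimately show ?thesis
    unfolding semi_strict_iff using e by (intro conjI exI[of _ ?\<kappa>]) (simp_all add: U_tlin U_AdO inv_Ob inv_Idt)
qed

text \<open>The component at \<open>v\<close> is the composite in \<open>L(G)\<close> of \<open>\<zeta>(F'\<^sub>* v)\<close> and \<open>\<omega>(\<Psi>\<^sub>* v)\<close>. Both are linear
  in \<open>v\<close> and equivariant, the second because \<open>\<omega>\<close> is equivariant under \<open>1\<^sub>g\<close>, and composition in \<open>L(G)\<close>
  is linear and compatible with the adjoint action of \<open>1\<^sub>g\<close>.\<close>

lemma conn_mor_pullback:
  assumes \<zeta>: "conn_mor G E r \<zeta>" and src: "equivariant_1form G E r (ntr_src \<zeta>)" and s: "s \<in> gauge_mor G E X pr r"
  shows "conn_mor G E r (hcomp TE L \<zeta> (tangent_ntr E E s))"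
proof -
  note z = conn_morD[OF \<zeta>] and w = equivariant_1formD[OF src] and s' = gauge_morD[OF s]
  note st = is_ntr_tangent_ntr[OF lie_groupoid_E lie_groupoid_E s'(3)]
  note f = gauge_ob_smooth(1)[OF s'(2)] and sm = smooth_ntrD(4)[OF s'(3)]
  let ?f = "tmap OE OE (fst (ntr_tgt s))" and ?s = "tmap OE ME (ntr_map s)"
  note TO = pre_manifold_TM[OF objM_E] and TM = pre_manifold_TM[OF morM_E]
  have fv: "?f v \<in> pts (TM OE)" and sv: "?s v \<in> pts (TM ME)" if "v \<in> pts (TM OE)" for v
    using tmap_map_pts[OF objM_E objM_E f that] tmap_map_pts[OF objM_E morM_E sm that] .
  note n = is_ntr_hcomp[OF precat_TE category_lie_2alg st z(1)]
  have map: "ntr_map (hcomp TE L \<zeta> (tangent_ntr E E s)) v = Cmp (tangent_gpd G) (ntr_map \<zeta> (?f v)) (snd (ntr_src \<zeta>) (?s v))"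
    if "v \<in> pts (TM OE)" for v using that by simp
  have mem: "ntr_map \<zeta> (?f v) \<in> pts LM" "snd (ntr_src \<zeta>) (?s v) \<in> pts LM" if "v \<in> pts (TM OE)" for v
    using smooth_map_pts[OF z(2) fv[OF that]] smooth_map_pts[OF w(3) sv[OF that]] .
  have comp: "S (ntr_map \<zeta> (?f v)) = T (snd (ntr_src \<zeta>) (?s v))" if "v \<in> pts (TM OE)" for v
    using ntr_L(2)[OF z(1), of "?f v"] functor_Tgt[OF w(1), of "?s v"] fv[OF that] sv[OF that] ntr_Tgt[OF st, of v] that by simp
  have "smooth_map (TM OE) LM (\<lambda>v. Cmp (tangent_gpd G) (ntr_map \<zeta> (?f v)) (snd (ntr_src \<zeta>) (?s v)))"
    by (rule smooth_map_Cmp_LM[OF TO smooth_map_compose[OF TO TO pre_manifold_LM smooth_map_tmap[OF objM_E objM_E f] z(2)]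
      smooth_map_compose[OF TO TM pre_manifold_LM smooth_map_tmap[OF objM_E morM_E sm] w(3)] comp])
  then have "smooth_map (TM OE) LM (ntr_map (hcomp TE L \<zeta> (tangent_ntr E E s)))"
    by (rule smooth_map_cong[OF TO pre_manifold_LM]) (simp only: map)
  moreover have "fibrewise_linear OE (ntr_map (hcomp TE L \<zeta> (tangent_ntr E E s)))"
    unfolding fibrewise_linear_iff
  proof (intro ballI impI allI)
    fix u v a b assume u: "u \<in> pts (TM OE)" and v: "v \<in> pts (TM OE)" and uv: "fst u = fst v"
    have b: "fst u \<in> pts OE" using u by (simp add: pts_TM)
    have "?f (tlin a u b v) = tlin a (?f u) b (?f v)" "?s (tlin a u b v) = tlin a (?s u) b (?s v)"
      using tmap_tlin[OF objM_E objM_E smooth_mapD[OF f b] u v uv] tmap_tlin[OF objM_E morM_E smooth_mapD[OF sm b] u v uv] by simp_all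
    then show "ntr_map (hcomp TE L \<zeta> (tangent_ntr E E s)) (tlin a u b v) =
       tlin a (ntr_map (hcomp TE L \<zeta> (tangent_ntr E E s)) u) b (ntr_map (hcomp TE L \<zeta> (tangent_ntr E E s)) v)"
      using uv by (simp only: map[OF u] map[OF v] map[OF tlin_pts[OF objM_E u v uv]])
        (simp add: z(4)[OF fv[OF u] fv[OF v]] w(6)[OF sv[OF u] sv[OF v]] Cmp_tlin[OF mem(1)[OF u] mem(1)[OF v] mem(2)[OF u] mem(2)[OF v] comp[OF u] comp[OF v]])
  qed
  moreover have "ntr_map (hcomp TE L \<zeta> (tangent_ntr E E s)) (right_Ob g v) = AdM (inv\<^bsub>mgrp G\<^esub> (Idt G g)) (ntr_map (hcomp TE L \<zeta> (tangent_ntr E E s)) v)"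
    if v: "v \<in> pts (TM OE)" and g: "g \<in> Ob G" for v g
    by (simp only: map[OF v] map[OF right_Ob_pts[OF g v]] gauge_right_Ob[OF s'(2) g v] gauge_mor_right[OF s g v]
      z(5)[OF fv[OF v] g] w(8)[OF sv[OF v] category_Idt[OF category_G g]] AdM_inv_Idt_Cmp[OF g mem[OF v] comp[OF v]])
  ultimately show ?thesis unfolding conn_mor_iff using n by simp
qed

section \<open>The action\<close>

lemma gauge_act_ob_eq: "F \<in> gauge_ob G E pr r \<Longrightarrow> gauge_act_ob E F \<omega> = pullback_form (finv_on E E F) \<omega>"
  by (simp add: gauge_act_ob_def pullback_form_def finv_on_tangent_functor[OF lie_groupoid_E gauge_obD(1)])

lemma gauge_act_mor_eq: "t \<in> gauge_mor G E X pr r \<Longrightarrow> gauge_act_mor G E t \<zeta> = hcomp TE L \<zeta> (tangent_ntr E E (hinverse E t))"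
  using hinv_tangent_ntr[OF lie_groupoid_E gauge_morD(3), of t] gauge_obD(1)[OF gauge_morD(1)] gauge_obD(1)[OF gauge_morD(2)]
  by (simp add: gauge_act_mor_def)

lemma pullback_form_fid: "functor_ext TE \<omega> \<Longrightarrow> pullback_form (fid E) \<omega> = \<omega>"
  by (simp add: pullback_form_def tangent_functor_fid[OF lie_groupoid_E] fcomp_on_fid_right)

lemma pullback_form_fcomp_on:
  assumes F: "F \<in> gauge_ob G E pr r" and H: "H \<in> gauge_ob G E pr r"
  shows "pullback_form (fcomp_on E H F) \<omega> = pullback_form F (pullback_form H \<omega>)"
  using fcomp_on_assoc[OF is_functor_tangent_functor[OF lie_groupoid_E lie_groupoid_E gauge_obD(2)[OF F]], of \<omega> "tangent_functor E E H"]
  by (simp add: pullback_form_def tangent_functor_fcomp_on[OF lie_groupoid_E lie_groupoid_E lie_groupoid_E gauge_obD(2)[OF F] gauge_obD(2)[OF H]])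

lemma gauge_inv_laws:
  shows "finv_on E E (fid E) = fid E"
    and "F \<in> gauge_ob G E pr r \<Longrightarrow> F' \<in> gauge_ob G E pr r \<Longrightarrow> finv_on E E (fcomp_on E F' F) = fcomp_on E (finv_on E E F) (finv_on E E F')"
    and "F \<in> gauge_ob G E pr r \<Longrightarrow> hinverse E (ntr_id E E F) = ntr_id E E (finv_on E E F)"
    and "t \<in> gauge_mor G E X pr r \<Longrightarrow> t' \<in> gauge_mor G E X pr r \<Longrightarrow> hinverse E (hcomp E E t' t) = hcomp E E (hinverse E t) (hinverse E t')"
    and "t \<in> gauge_mor G E X pr r \<Longrightarrow> t' \<in> gauge_mor G E X pr r \<Longrightarrow> ntr_tgt t = ntr_src t' \<Longrightarrow>
      hinverse E (vcomp E E t' t) = vcomp E E (hinverse E t') (hinverse E t)"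
proof -
  let ?H0 = "gauge_ogrp G E pr r" and ?H1 = "gauge_mgrp G E X pr r"
  have g: "group ?H0" "group ?H1" and c: "carrier ?H0 = gauge_ob G E pr r" "carrier ?H1 = gauge_mor G E X pr r"
    and i: "is_functor (gauge_cat G E X pr r) (gauge_cat G E X pr r) (m_inv ?H0, m_inv ?H1)"
    using gauge_strict_2group by (simp_all add: strict_2group_def)
  show "finv_on E E (fid E) = fid E"
    using group.is_monoid[OF g(1), THEN monoid.inv_one] gauge_inv(1)[OF fid_gauge_ob] by simp
  show "finv_on E E (fcomp_on E F' F) = fcomp_on E (finv_on E E F) (finv_on E E F')" if "F \<in> gauge_ob G E pr r" "F' \<in> gauge_ob G E pr r"
    using group.inv_mult_group[OF g(1), of F F'] that c gauge_inv(1) fcomp_on_gauge_ob by simp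
  show "hinverse E (hcomp E E t' t) = hcomp E E (hinverse E t) (hinverse E t')" if "t \<in> gauge_mor G E X pr r" "t' \<in> gauge_mor G E X pr r"
    using group.inv_mult_group[OF g(2), of t t'] that c gauge_inv(2) hcomp_gauge_mor by simp
  show "hinverse E (ntr_id E E F) = ntr_id E E (finv_on E E F)" if "F \<in> gauge_ob G E pr r"
    using functor_Idt[OF i, of F] that gauge_inv ntr_id_gauge_mor by simp
  show "hinverse E (vcomp E E t' t) = vcomp E E (hinverse E t') (hinverse E t)"
    if "t \<in> gauge_mor G E X pr r" "t' \<in> gauge_mor G E X pr r" "ntr_tgt t = ntr_src t'"
    using functor_Cmp[OF i, of t t'] that gauge_inv(2) vcomp_gauge_mor by simp
qed

text \<open>The action laws are the images of the group laws of the gauge 2-group: with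
  \<open>\<Psi>\<^sub>*\<inverse> = (\<Psi>\<inverse>)\<^sub>*\<close>, compatibility with products is associativity of horizontal composition, and
  functoriality is the interchange law. The set \<open>Q\<close> of forms is either that of the semi-strict or that of
  the strict connections.\<close>

lemma gauge_action:
  assumes Q: "\<And>\<omega>. \<omega> \<in> Q \<Longrightarrow> equivariant_1form G E r \<omega>"
    and pull: "\<And>F \<omega>. F \<in> gauge_ob G E pr r \<Longrightarrow> \<omega> \<in> Q \<Longrightarrow> pullback_form F \<omega> \<in> Q"
  shows "strict_2group_action (gauge_cat G E X pr r) (gauge_ogrp G E pr r) (gauge_mgrp G E X pr r) (conn_cat G E r Q)
     (\<lambda>(F, \<omega>). gauge_act_ob E F \<omega>, \<lambda>(\<Psi>, \<zeta>). gauge_act_mor G E \<Psi> \<zeta>)" (is "strict_2group_action ?C ?H0 ?H1 ?D ?act")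
proof -
  note E = lie_groupoid_E and catL = category_lie_2alg
  let ?T = "tangent_ntr E E"
  have tn: "is_ntr TE TE (?T t)" if "t \<in> gauge_mor G E X pr r" for t
    using is_ntr_tangent_ntr[OF E E gauge_morD(3)[OF that]] .
  have inv_ob: "finv_on E E F \<in> gauge_ob G E pr r" if "F \<in> gauge_ob G E pr r" for F using finv_on_gauge_ob[OF that] .
  have inv_mor: "hinverse E t \<in> gauge_mor G E X pr r" if "t \<in> gauge_mor G E X pr r" for t using hinverse_gauge_mor(1)[OF that] .
  have act_src: "ntr_src (hcomp TE L \<zeta> (?T (hinverse E t))) = pullback_form (finv_on E E (ntr_src t)) (ntr_src \<zeta>)"
    "ntr_tgt (hcomp TE L \<zeta> (?T (hinverse E t))) = pullback_form (finv_on E E (ntr_tgt t)) (ntr_tgt \<zeta>)" for \<zeta> t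
    by (simp_all add: pullback_form_def)
  have conn: "is_ntr TE L \<zeta>" "functor_ext TE (ntr_src \<zeta>)" "functor_ext TE (ntr_tgt \<zeta>)" "ntr_map \<zeta> \<in> extensional (Ob TE)" "equivariant_1form G E r (ntr_src \<zeta>)"
    if "\<zeta> \<in> Mor ?D" for \<zeta>
    using that Q equivariant_1formD(4) conn_morD(1,3) by auto
  have act_Mor: "hcomp TE L \<zeta> (?T (hinverse E t)) \<in> Mor ?D" if t: "t \<in> gauge_mor G E X pr r" and z: "\<zeta> \<in> Mor ?D" for t \<zeta>
    unfolding conn_cat_simps act_src
    using z conn_mor_pullback[OF _ conn(5)[OF z] inv_mor[OF t]] pull inv_ob gauge_morD(1,2)[OF t] by simp
  have act_functor: "is_functor (prod_cat ?C ?D) ?D ?act"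
  proof (rule is_functorI)
    fix x assume "x \<in> Ob (prod_cat ?C ?D)"
    then obtain F \<omega> where x: "x = (F, \<omega>)" "F \<in> gauge_ob G E pr r" "\<omega> \<in> Q" by (auto simp: prod_cat_def)
    show "fst ?act x \<in> Ob ?D" using x pull inv_ob by (simp add: gauge_act_ob_eq)
    have w: "is_functor TE L \<omega>" using equivariant_1formD(1)[OF Q[OF x(3)]] .
    note F' = gauge_obD(2)[OF inv_ob[OF x(2)]]
    have "hcomp TE L (ntr_id TE L \<omega>) (?T (hinverse E (ntr_id E E F))) = ntr_id TE L (pullback_form (finv_on E E F) \<omega>)"
      by (simp add: gauge_inv_laws(3)[OF x(2)] tangent_ntr_id[OF E E F'] hcomp_ntr_id[OF catL is_functor_tangent_functor[OF E E F'] w] pullback_form_def)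
    then show "snd ?act (Idt (prod_cat ?C ?D) x) = Idt ?D (fst ?act x)"
      using x by (simp add: prod_cat_def gauge_act_mor_eq[OF ntr_id_gauge_mor] gauge_act_ob_eq)
  next
    fix f assume "f \<in> Mor (prod_cat ?C ?D)"
    then obtain t \<zeta> where f: "f = (t, \<zeta>)" "t \<in> gauge_mor G E X pr r" "\<zeta> \<in> Mor ?D" by (auto simp: prod_cat_def)
    show "snd ?act f \<in> Mor ?D" using act_Mor[OF f(2,3)] f(1) by (simp add: gauge_act_mor_eq[OF f(2)] del: conn_cat_simps)
    show "Src ?D (snd ?act f) = fst ?act (Src (prod_cat ?C ?D) f)" "Tgt ?D (snd ?act f) = fst ?act (Tgt (prod_cat ?C ?D) f)"
      using f act_src[of \<zeta> t] gauge_morD(1,2)[OF f(2)]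
      by (simp_all add: prod_cat_def gauge_act_mor_eq gauge_act_ob_eq del: hcomp_simps)
    fix g assume "g \<in> Mor (prod_cat ?C ?D)" and gf: "Src (prod_cat ?C ?D) g = Tgt (prod_cat ?C ?D) f"
    then obtain t' \<zeta>' where g: "g = (t', \<zeta>')" "t' \<in> gauge_mor G E X pr r" "\<zeta>' \<in> Mor ?D" by (auto simp: prod_cat_def)
    have tt: "ntr_tgt t = ntr_src t'" and zz: "ntr_tgt \<zeta> = ntr_src \<zeta>'" using gf f(1) g(1) by (simp_all add: prod_cat_def)
    note it = inv_mor[OF f(2)] and it' = inv_mor[OF g(2)]
    have itt: "ntr_tgt (hinverse E t) = ntr_src (hinverse E t')" using tt by simp
    have Titt: "ntr_tgt (?T (hinverse E t)) = ntr_src (?T (hinverse E t'))" using itt by simp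
    have "hcomp TE L (vcomp TE L \<zeta>' \<zeta>) (?T (hinverse E (vcomp E E t' t)))
       = hcomp TE L (vcomp TE L \<zeta>' \<zeta>) (vcomp TE TE (?T (hinverse E t')) (?T (hinverse E t)))"
      using gauge_inv_laws(5)[OF f(2) g(2) tt] tangent_ntr_vcomp[OF E E gauge_morD(3)[OF it] gauge_morD(3)[OF it'] itt] by simp
    also have "\<dots> = vcomp TE L (hcomp TE L \<zeta>' (?T (hinverse E t'))) (hcomp TE L \<zeta> (?T (hinverse E t)))"
      by (rule hcomp_interchange[OF catL tn[OF it] tn[OF it'] conn(1)[OF f(3)] conn(1)[OF g(3)] Titt zz])
    finally show "snd ?act (Cmp (prod_cat ?C ?D) g f) = Cmp ?D (snd ?act g) (snd ?act f)"
      using f g tt by (simp add: prod_cat_def gauge_act_mor_eq vcomp_gauge_mor)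
  qed
  have unit_Ob: "fst ?act (\<one>\<^bsub>?H0\<^esub>, x) = x" if "x \<in> Ob ?D" for x
    using that equivariant_1formD(4)[OF Q, of x] by (simp add: gauge_act_ob_eq[OF fid_gauge_ob] gauge_inv_laws(1) pullback_form_fid)
  have unit_Mor: "snd ?act (\<one>\<^bsub>?H1\<^esub>, f) = f" if "f \<in> Mor ?D" for f
    using hcomp_id_right[OF precat_TE catL conn(1-4)[OF that]]
    by (simp add: gauge_act_mor_eq[OF ntr_id_gauge_mor[OF fid_gauge_ob]] gauge_inv_laws(1) gauge_inv_laws(3)[OF fid_gauge_ob]
        tangent_ntr_id[OF E E smooth_functor_fid[OF E]] tangent_functor_fid[OF E])
  have mult_Ob: "fst ?act (F', fst ?act (F, x)) = fst ?act (F \<otimes>\<^bsub>?H0\<^esub> F', x)"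
    if "F \<in> Ob ?C" "F' \<in> Ob ?C" "x \<in> Ob ?D" for F F' x
    using that by (simp add: gauge_act_ob_eq fcomp_on_gauge_ob gauge_inv_laws(2) pullback_form_fcomp_on inv_ob)
  have mult_Mor: "snd ?act (t', snd ?act (t, f)) = snd ?act (t \<otimes>\<^bsub>?H1\<^esub> t', f)"
    if "t \<in> Mor ?C" "t' \<in> Mor ?C" and f: "f \<in> Mor ?D" for t t' f
  proof -
    from that have t: "t \<in> gauge_mor G E X pr r" "t' \<in> gauge_mor G E X pr r" by simp_all
    note it = inv_mor[OF t(1)] and it' = inv_mor[OF t(2)]
    have "hcomp TE L (hcomp TE L f (?T (hinverse E t))) (?T (hinverse E t')) = hcomp TE L f (hcomp TE TE (?T (hinverse E t)) (?T (hinverse E t')))"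
      by (rule hcomp_assoc[OF catL tn[OF it'] tn[OF it] conn(1)[OF f]])
    also have "hcomp TE TE (?T (hinverse E t)) (?T (hinverse E t')) = ?T (hinverse E (hcomp E E t' t))"
      using gauge_inv_laws(4)[OF t] tangent_ntr_hcomp[OF E E E gauge_morD(3)[OF it'] gauge_morD(3)[OF it]] by simp
    finally show ?thesis using t by (simp add: gauge_act_mor_eq hcomp_gauge_mor)
  qed
  show ?thesis
    unfolding strict_2group_action_def
  proof (intro conjI ballI)
    show "category ?D" by (rule category_conn_cat[OF Q])
  qed (fact gauge_strict_2group act_functor | rule unit_Ob unit_Mor mult_Ob mult_Mor; assumption)+
qed

lemma subcategory_conn_cat:
  assumes Q: "\<And>\<omega>. \<omega> \<in> Q \<Longrightarrow> equivariant_1form G E r \<omega>" and "Q' \<subseteq> Q"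
  shows "subcategory (conn_cat G E r Q') (conn_cat G E r Q)"
  unfolding subcategory_def
  using category_conn_cat[OF Q] category_conn_cat[of Q'] assms by (auto simp: composable_def)

end

theorem proposition5p47:
  fixes G :: "('g0, 'g1, 'a::real_inner, 'b::real_inner) lie_2gp"
    and E :: "('e0, 'e1, 'c::real_inner, 'd::real_inner) lie_gpd"
    and X :: "('x0, 'x1, 'k::real_inner, 'l::real_inner) lie_gpd"
    and pr :: "('e0, 'e1, 'x0, 'x1) ftr"
    and r :: "('e0 \<times> 'g0, 'e1 \<times> 'g1, 'e0, 'e1) ftr"
  assumes "lie_2group G"
    and "lie_groupoid X"
    and "principal_2bundle G E X pr r"
  defines "act \<equiv> (\<lambda>(F, \<omega>). gauge_act_ob E F \<omega>, \<lambda>(\<Psi>, \<zeta>). gauge_act_mor G E \<Psi> \<zeta>)"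
  shows "strict_2group_action
           (gauge_cat G E X pr r) (gauge_ogrp G E pr r) (gauge_mgrp G E X pr r)
           (\<Omega>_semi G E r) act \<and>
         subcategory (\<Omega>_strict G E r) (\<Omega>_semi G E r) \<and>
         strict_2group_action
           (gauge_cat G E X pr r) (gauge_ogrp G E pr r) (gauge_mgrp G E X pr r)
           (\<Omega>_strict G E r) act"
proof -
  interpret principal_2bundle_setting G E X pr r
    by unfold_locales (rule assms(3))
  have semi: "equivariant_1form G E r \<omega>" if "\<omega> \<in> {\<omega>. semi_strict_connection G E r \<omega>}" for \<omega>
    using that by (simp add: semi_strict_connection_def)
  have strict: "equivariant_1form G E r \<omega>" if "\<omega> \<in> {\<omega>. strict_connection G E r \<omega>}" for \<omega>
    using that by (simp add: strict_connection_def)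
  have sub: "{\<omega>. strict_connection G E r \<omega>} \<subseteq> {\<omega>. semi_strict_connection G E r \<omega>}"
    using strict_imp_semi_strict by blast
  show ?thesis
    unfolding act_def \<Omega>_semi_def \<Omega>_strict_def
  proof (intro conjI)
    show "subcategory (conn_cat G E r {\<omega>. strict_connection G E r \<omega>}) (conn_cat G E r {\<omega>. semi_strict_connection G E r \<omega>})"
      by (rule subcategory_conn_cat[OF semi sub])
  qed (rule gauge_action, erule semi strict, simp add: semi_strict_pullback_form strict_pullback_form)+
qed

end
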